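(* Let $\alpha\in(\tfrac12,\infty)$. A convex compact ancient solution to the generalized curve shortening flow with power $\alpha$ in $\mathbf{R}^2$ which sweeps $\mathbf{R}^2$ must be a shrinking circle.
   Context: The generalized curve shortening flow with power $\alpha$ is the evolution of curves in $\mathbf{R}^2$ given by $\frac{\partial F}{\partial t}=-\kappa^{\alpha}\vec v$, where $\kappa$ is the curvature and $\vec v$ is the unit outward normal of the evolving curve. A convex compact ancient solution is a solution consisting of closed convex embedded curves $C_t$ whose existence time starts from $-\infty$ (after a time shift, $t\in(-\infty,0)$, with the curves shrinking to a point at the final time). The solution sweeps $\mathbf{R}^2$ if the regions enclosed by the curves $C_t$ exhaust $\mathbf{R}^2$ as $t\to-\infty$. A shrinking circle is a solution for which all $C_t$ are circles with a common center. *)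

theory Defs
  imports "HOL-Analysis.Analysis"
begin

fun higher_differentiable_on ::
  "'a::real_normed_vector set \<Rightarrow> ('a \<Rightarrow> 'b::real_normed_vector) \<Rightarrow> nat \<Rightarrow> bool" where
  "higher_differentiable_on S f 0 \<longleftrightarrow> continuous_on S f"
| "higher_differentiable_on S f (Suc n) \<longleftrightarrow>
     (\<forall>x\<in>S. f differentiable (at x)) \<and>
     (\<forall>v. higher_differentiable_on S (\<lambda>x. frechet_derivative f (at x) v) n)"

text \<open>Meant for open \<open>S\<close>, since derivatives are taken in the full space.\<close>

definition smooth_on :: "'a::real_normed_vector set \<Rightarrow> ('a \<Rightarrow> 'b::real_normed_vector) \<Rightarrow> bool" where
  "smooth_on S f \<longleftrightarrow> (\<forall>n. higher_differentiable_on S f n)"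

text \<open>Closed curves are 1-periodic maps on the line, i.e. maps on \<open>\<real>/\<int>\<close>, so that derivatives
  at the base point are two-sided; \<open>path_image\<close> is then the whole trace of the curve, and
  \<open>inside (path_image \<gamma>)\<close> is the region it encloses. Neither orientation is excluded.\<close>

definition closed_embedded_curve :: "(real \<Rightarrow> real^2) \<Rightarrow> bool" where
  "closed_embedded_curve \<gamma> \<longleftrightarrow>
     (\<forall>u. \<gamma> (u + 1) = \<gamma> u) \<and> simple_path \<gamma> \<and> (\<forall>u. vector_derivative \<gamma> (at u) \<noteq> 0)"

definition closed_convex_embedded_curve :: "(real \<Rightarrow> real^2) \<Rightarrow> bool" where
  "closed_convex_embedded_curve \<gamma> \<longleftrightarrow>
     closed_embedded_curve \<gamma> \<and> convex (inside (path_image \<gamma>))"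

definition outward_unit_normal :: "(real \<Rightarrow> real^2) \<Rightarrow> real \<Rightarrow> real^2 \<Rightarrow> bool" where
  "outward_unit_normal \<gamma> u \<nu> \<longleftrightarrow>
     norm \<nu> = 1 \<and> \<nu> \<bullet> vector_derivative \<gamma> (at u) = 0 \<and>
     (\<forall>\<^sub>F s in at_right 0. \<gamma> u + s *\<^sub>R \<nu> \<in> outside (path_image \<gamma>))"

text \<open>The curvature vector (second arc length derivative) is \<open>- \<kappa> \<nu>\<close>. Since \<open>\<nu>\<close> is orthogonal to
  the velocity, in an arbitrary regular parametrisation \<open>\<kappa> = - (\<gamma>'' \<bullet> \<nu>) / \<bar>\<gamma>'\<bar>\<^sup>2\<close>. With \<open>\<nu>\<close> the
  outward normal, a circle of radius \<open>r\<close> has curvature \<open>1 / r\<close> and convex curves have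
  \<open>\<kappa> \<ge> 0\<close>, whichever way they are traversed.\<close>

definition curvature :: "(real \<Rightarrow> real^2) \<Rightarrow> real \<Rightarrow> real^2 \<Rightarrow> real" where
  "curvature \<gamma> u \<nu> =
     - (vector_derivative (\<lambda>w. vector_derivative \<gamma> (at w)) (at u) \<bullet> \<nu>)
       / (norm (vector_derivative \<gamma> (at u)))\<^sup>2"

text \<open>The curve at time \<open>t\<close> is \<open>F t\<close>. Values at times \<open>t \<ge> 0\<close> play no role. The outward unit
  normal at a point of a regular embedded curve is unique. For \<open>\<alpha> > 0\<close>, \<open>0 powr \<alpha> = 0\<close> is the
  intended value at points of zero curvature.\<close>

definition generalized_curve_shortening_flow :: "real \<Rightarrow> (real \<Rightarrow> real \<Rightarrow> real^2) \<Rightarrow> bool" where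
  "generalized_curve_shortening_flow \<alpha> F \<longleftrightarrow>
     smooth_on ({..<0} \<times> UNIV) (\<lambda>(t, u). F t u) \<and>
     (\<forall>t<0. \<forall>u. \<exists>\<nu>. outward_unit_normal (F t) u \<nu> \<and>
        ((\<lambda>\<tau>. F \<tau> u) has_vector_derivative - (curvature (F t) u \<nu> powr \<alpha>) *\<^sub>R \<nu>) (at t))"

definition shrinks_to_point :: "(real \<Rightarrow> real \<Rightarrow> real^2) \<Rightarrow> bool" where
  "shrinks_to_point F \<longleftrightarrow>
     (\<exists>p. \<forall>e>0. \<forall>\<^sub>F t in at_left 0. path_image (F t) \<subseteq> ball p e)"

definition convex_compact_ancient_solution :: "real \<Rightarrow> (real \<Rightarrow> real \<Rightarrow> real^2) \<Rightarrow> bool" where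
  "convex_compact_ancient_solution \<alpha> F \<longleftrightarrow>
     (\<forall>t<0. closed_convex_embedded_curve (F t)) \<and>
     generalized_curve_shortening_flow \<alpha> F \<and>
     shrinks_to_point F"

text \<open>As the enclosed regions are convex, requiring this for points is the same as requiring it for
  compact sets: a compact set lies in a simplex, hence in a region containing its vertices.\<close>

definition sweeps_plane :: "(real \<Rightarrow> real \<Rightarrow> real^2) \<Rightarrow> bool" where
  "sweeps_plane F \<longleftrightarrow> (\<forall>x. \<forall>\<^sub>F t in at_bot. x \<in> inside (path_image (F t)))"

definition shrinking_circle :: "real \<Rightarrow> (real \<Rightarrow> real \<Rightarrow> real^2) \<Rightarrow> bool" where
  "shrinking_circle \<alpha> F \<longleftrightarrow>
     generalized_curve_shortening_flow \<alpha> F \<and>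
     (\<exists>p. \<forall>t<0. \<exists>r>0. path_image (F t) = sphere p r)"

end

theory Submission
  imports Defs "HOL-Complex_Analysis.Great_Picard"
begin

text \<open>
  Let \<open>\<kappa>\<close> be the curvature, \<open>L\<close> the length, \<open>A\<close> the enclosed area, and \<open>P = L\<^sup>2 - 4 pi A\<close>. Since \<open>P\<close> is nonincreasing in time and tends to 0
  at extinction, it is nonnegative. If it vanishes at all times, then \<open>P' = 0\<close> forces \<open>\<kappa>\<close> to be constant along each curve,
  and the flow equation keeps the centre fixed.

  A long thin curve cannot have come from curves sweeping the plane: discs in front of its tips, retreating more slowly
  than the curve, show that it was even longer in the past, and then, as \<open>\<alpha> > 1/2\<close>, a flat parabola inside the curve shows that the width changes only by a bounded factor.
  So the inradius is at least \<open>c L\<close> at all times.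

  For \<open>\<alpha> \<ge> 1\<close> this improves Gage's inequality by a constant factor, and makes \<open>P / A\<^sup>1\<^sup>+\<^sup>\<epsilon>\<close> nonincreasing for some \<open>\<epsilon> > 0\<close>. Backwards in time
  \<open>P / A\<close> is bounded and \<open>A\<close> tends to infinity, so \<open>P = 0\<close>.

  For \<open>\<alpha> < 1\<close> put \<open>p = 1 / \<alpha>\<close> and let \<open>h\<close> be the support function about a fixed interior point. The entropy
  \<open>- ln (\<integral> h\<^sup>1\<^sup>-\<^sup>p d\<theta>) / (p - 1) - ln A / 2\<close> is monotone and bounded, so its derivative with respect to \<open>ln A\<close> tends to 0 along times going to
  \<open>- \<infinity>\<close>. The rescaled support functions then converge to a \<open>2 pi\<close>-periodic solution of \<open>h'' + h = h\<^sup>-\<^sup>p\<close>, which is constant by Sturm comparison.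
  Hence \<open>P / L\<^sup>2\<close> tends to 0 along these times, and near circles it is nonincreasing, so that again \<open>P = 0\<close>.
\<close>

section \<open>Touching arguments\<close>

text \<open>Curvature may vanish on arcs, so the normal angle is not a coordinate. Quantities are
  therefore integrals in the parameter \<open>u\<close>, where \<open>g du\<close> is arc length and
  \<open>w du\<close> the angle measure. The bound \<alpha> > 1/2 comes from the parabola: its
  curvature is of order width / length^2, its speed the \<alpha>-th power of that, and the length
  grows at least linearly into the past. As 2 \<alpha> > 1, the total displacement is finite,
  uniformly in the starting time. Gage's inequality by itself only makes \<open>P / A\<close>
  monotone, and a bounded monotone quantity is no contradiction. Any fixed gain in the exponent is
  one, because the area is unbounded. For \<alpha> < 1 the Chebyshev inequality that brings in the
  squared curvature is reversed, so this route closes. Compactness yields nearly circular curves at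
  some early times only, and the monotonicity of \<open>P / L^2\<close> forward from there needs its
  own proof. It loses a factor \<open>1 / \<alpha>\<close>, up to 2, which is why the convolution
  kernel needs an L^1 norm below pi.\<close>

lemma deriv_nonpos_of_left_pos:
  fixes f :: "real \<Rightarrow> real"
  assumes "(f has_real_derivative d) (at s)" "f s = 0" "\<forall>\<^sub>F s' in at_left s. f s' > 0"
  shows "d \<le> 0"
proof (rule ccontr)
  assume "\<not> d \<le> 0"
  then obtain e where e: "e > 0" "\<And>h. 0 < h \<Longrightarrow> h < e \<Longrightarrow> f (s - h) < f s"
    using DERIV_pos_inc_left[OF assms(1)] by auto
  obtain b where b: "b < s" "\<And>y. b < y \<Longrightarrow> y < s \<Longrightarrow> f y > 0"
    using assms(3) unfolding eventually_at_left_field by auto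
  define h where "h = min (e/2) ((s - b)/2)"
  have "0 < h" "h < e" "b < s - h" "s - h < s"
    using e(1) b(1) unfolding h_def by (auto simp: min_def field_simps)
  then show False using e(2)[of h] b(2)[of "s - h"] assms(2) by auto
qed

lemma local_min_second_deriv:
  fixes f :: "real \<Rightarrow> real"
  assumes f: "\<And>x. (f has_real_derivative f' x) (at x)"
    and f': "(f' has_real_derivative f2) (at u)"
    and min: "\<forall>\<^sub>F x in nhds u. f u \<le> f x"
  shows "f' u = 0" "f2 \<ge> 0"
proof -
  obtain d where d: "d > 0" "\<And>x. dist x u < d \<Longrightarrow> f u \<le> f x"
    using min unfolding eventually_nhds_metric by auto
  show 0: "f' u = 0"
    by (rule DERIV_local_min[OF f d(1)]) (use d(2) in \<open>auto simp: dist_real_def abs_minus_commute\<close>)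
  show "f2 \<ge> 0"
  proof (rule ccontr)
    assume "\<not> f2 \<ge> 0"
    then obtain e where e: "e > 0" "\<And>h. 0 < h \<Longrightarrow> h < e \<Longrightarrow> f' (u + h) < f' u"
      using DERIV_neg_dec_right[OF f'] by auto
    define h where "h = min (d/2) (e/2)"
    have h: "0 < h" "h < d" "h < e" using d(1) e(1) by (auto simp: h_def min_def)
    obtain z where z: "z > u" "z < u + h" "f (u + h) - f u = (u + h - u) * f' z"
      using MVT2[of u "u + h" f f'] f h by auto
    have "f' z < 0" using e(2)[of "z - u"] z h 0 by auto
    then have "f (u + h) < f u" using z(3) h(1) mult_pos_neg[of h "f' z"] by auto
    then show False using d(2)[of "u + h"] h by (auto simp: dist_real_def)
  qed
qed

text \<open>The region \<open>c\<^sub>1 \<ge> 0, c\<^sub>2 \<ge> 0\<close> is the part of the curve on which a barrier is compared with it,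
  and \<open>\<phi>\<close> is positive as long as the two do not touch there.\<close>

lemma first_touch:
  fixes \<phi> c1 c2 :: "real \<Rightarrow> real \<Rightarrow> real"
  assumes cont: "continuous_on ({t1..t0} \<times> UNIV) (\<lambda>(s,u). \<phi> s u)"
      "continuous_on ({t1..t0} \<times> UNIV) (\<lambda>(s,u). c1 s u)"
      "continuous_on ({t1..t0} \<times> UNIV) (\<lambda>(s,u). c2 s u)"
    and per: "\<And>s u. s \<in> {t1..t0} \<Longrightarrow> \<phi> s (u + 1) = \<phi> s u"
      "\<And>s u. s \<in> {t1..t0} \<Longrightarrow> c1 s (u + 1) = c1 s u"
      "\<And>s u. s \<in> {t1..t0} \<Longrightarrow> c2 s (u + 1) = c2 s u"
    and strict: "\<And>s u. s \<in> {t1..t0} \<Longrightarrow> c1 s u \<ge> 0 \<Longrightarrow> c2 s u \<ge> 0 \<Longrightarrow> \<phi> s u \<le> 0 \<Longrightarrow>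
        t1 < s \<and> c1 s u > 0 \<and> c2 s u > 0"
    and bad: "s0 \<in> {t1..t0}" "c1 s0 u0 \<ge> 0" "c2 s0 u0 \<ge> 0" "\<phi> s0 u0 \<le> 0"
  obtains s u where "t1 < s" "s \<le> t0" "\<phi> s u = 0" "c1 s u > 0" "c2 s u > 0"
    "\<forall>\<^sub>F u' in nhds u. \<phi> s u' \<ge> \<phi> s u" "\<forall>\<^sub>F s' in at_left s. \<phi> s' u > 0"
    "\<And>s' u'. t1 \<le> s' \<Longrightarrow> s' < s \<Longrightarrow> c1 s' u' \<ge> 0 \<Longrightarrow> c2 s' u' \<ge> 0 \<Longrightarrow> \<phi> s' u' > 0"
proof -
  define S where "S = {t1..t0} \<times> (UNIV::real set)"
  \<comment> \<open>By periodicity \<open>u\<close> can be taken in a compact interval, so the set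
    of bad pairs is compact and has an earliest time. By \<open>strict\<close> that pair lies in the
    interior of the region, which persists for nearby times and parameters.\<close>
  define B where "B = {p \<in> {t1..t0} \<times> {0..1}. c1 (fst p) (snd p) \<ge> 0 \<and> c2 (fst p) (snd p) \<ge> 0
      \<and> \<phi> (fst p) (snd p) \<le> 0}"
  have c': "continuous_on S (\<lambda>p. \<phi> (fst p) (snd p))" "continuous_on S (\<lambda>p. c1 (fst p) (snd p))"
     "continuous_on S (\<lambda>p. c2 (fst p) (snd p))"
    using cont unfolding S_def by (simp_all add: case_prod_unfold)
  have frac: "f s (frac u) = f s u" if "\<And>u. f s (u + 1) = f s u" for f :: "real \<Rightarrow> real \<Rightarrow> real" and s u
  proof -
    have "f s (x + real n) = f s x" for x n
    proof (induction n)
      case (Suc n)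
      then show ?case using that[of "x + real n"] by (simp add: algebra_simps)
    qed simp
    note nn = this
    show ?thesis
    proof (cases "\<lfloor>u\<rfloor> \<ge> 0")
      case True
      then have "u = frac u + real (nat \<lfloor>u\<rfloor>)" by (simp add: frac_def)
      then show ?thesis using nn[of "frac u" "nat \<lfloor>u\<rfloor>"] by metis
    next
      case False
      then have "frac u = u + real (nat (- \<lfloor>u\<rfloor>))" by (simp add: frac_def)
      then show ?thesis using nn[of u "nat (- \<lfloor>u\<rfloor>)"] by metis
    qed
  qed
  have Bne: "(s, frac u) \<in> B" if "s \<in> {t1..t0}" "c1 s u \<ge> 0" "c2 s u \<ge> 0" "\<phi> s u \<le> 0" for s u
    using that frac[of \<phi> s u] frac[of c1 s u] frac[of c2 s u] per
    unfolding B_def by (auto simp: frac_lt_1 less_imp_le)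
  have sub: "{t1..t0} \<times> {0..1} \<subseteq> S" by (auto simp: S_def)
  have "closed B"
  proof -
    have "closed {p \<in> {t1..t0} \<times> {0..1}. 0 \<le> c1 (fst p) (snd p)}"
      by (intro continuous_on_closed_Collect_le closed_Times
          continuous_intros continuous_on_subset[OF c'(2) sub])
    moreover have "closed {p \<in> {t1..t0} \<times> {0..1}. 0 \<le> c2 (fst p) (snd p)}"
      by (intro continuous_on_closed_Collect_le closed_Times
          continuous_intros continuous_on_subset[OF c'(3) sub])
    moreover have "closed {p \<in> {t1..t0} \<times> {0..1}. \<phi> (fst p) (snd p) \<le> 0}"
      by (intro continuous_on_closed_Collect_le closed_Times
          continuous_intros continuous_on_subset[OF c'(1) sub])
    ultimately have "closed ({p \<in> {t1..t0} \<times> {0..1}. 0 \<le> c1 (fst p) (snd p)} \<inter>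
       {p \<in> {t1..t0} \<times> {0..1}. 0 \<le> c2 (fst p) (snd p)} \<inter> {p \<in> {t1..t0} \<times> {0..1}. \<phi> (fst p) (snd p) \<le> 0})"
      by auto
    also have "\<dots> = B" unfolding B_def by auto
    finally show ?thesis .
  qed
  moreover have "bounded B"
    by (rule bounded_subset[of "{t1..t0} \<times> {0..1}"]) (auto simp: B_def bounded_Times)
  ultimately have "compact B" by (simp add: compact_eq_bounded_closed)
  moreover have "B \<noteq> {}" using Bne[OF bad] by auto
  ultimately obtain p where p: "p \<in> B" "\<And>q. q \<in> B \<Longrightarrow> fst p \<le> fst q"
    using continuous_attains_inf[of B fst] continuous_on_fst[OF continuous_on_id] by blast
  define s u where "s = fst p" and "u = snd p"
  have s: "s \<in> {t1..t0}" "c1 s u \<ge> 0" "c2 s u \<ge> 0" "\<phi> s u \<le> 0"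
    using p(1) unfolding B_def s_def u_def by auto
  have str: "t1 < s" "c1 s u > 0" "c2 s u > 0" using strict[OF s] by auto
  have glob: "\<phi> s' u' > 0" if "t1 \<le> s'" "s' < s" "c1 s' u' \<ge> 0" "c2 s' u' \<ge> 0" for s' u'
  proof (rule ccontr)
    assume "\<not> \<phi> s' u' > 0"
    then have "(s', frac u') \<in> B" using Bne[of s' u'] that s by auto
    then show False using p(2)[of "(s', frac u')"] that(2) by (auto simp: s_def)
  qed
  have loc: "\<exists>e>0. \<forall>s' u'. s' \<in> {t1..t0} \<longrightarrow> \<bar>s' - s\<bar> < e \<longrightarrow> \<bar>u' - u\<bar> < e \<longrightarrow> f s' u' \<in> A"
    if f: "continuous_on S (\<lambda>p. f (fst p) (snd p))" and "open A" "f s u \<in> A" for f :: "real \<Rightarrow> real \<Rightarrow> real" and A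
  proof -
    have "(s,u) \<in> S" using s by (auto simp: S_def)
    then obtain e where e: "e > 0" "\<And>q. q \<in> S \<Longrightarrow> dist q (s,u) < e \<Longrightarrow> f (fst q) (snd q) \<in> A"
      using f \<open>open A\<close> \<open>f s u \<in> A\<close> unfolding continuous_on_topological
      by (metis (mono_tags, lifting) fst_conv snd_conv open_dist)
    show ?thesis
    proof (intro exI[of _ "e/2"] conjI allI impI)
      fix s' u' assume *: "s' \<in> {t1..t0}" "\<bar>s' - s\<bar> < e/2" "\<bar>u' - u\<bar> < e/2"
      have "dist (s',u') (s,u) \<le> dist s' s + dist u' u"
        unfolding dist_prod_def by (simp add: sqrt_sum_squares_le_sum)
      then have "dist (s',u') (s,u) < e" using * by (auto simp: dist_real_def)
      then show "f s' u' \<in> A" using e(2)[of "(s',u')"] *(1) by (auto simp: S_def)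
    qed (use e in auto)
  qed
  obtain e1 where e1: "e1 > 0" "\<And>s' u'. s' \<in> {t1..t0} \<Longrightarrow> \<bar>s' - s\<bar> < e1 \<Longrightarrow> \<bar>u' - u\<bar> < e1 \<Longrightarrow> c1 s' u' > 0"
    using loc[OF c'(2), of "{0<..}"] str(2) by auto
  obtain e2 where e2: "e2 > 0" "\<And>s' u'. s' \<in> {t1..t0} \<Longrightarrow> \<bar>s' - s\<bar> < e2 \<Longrightarrow> \<bar>u' - u\<bar> < e2 \<Longrightarrow> c2 s' u' > 0"
    using loc[OF c'(3), of "{0<..}"] str(3) by auto
  define e where "e = min e1 e2"
  have e: "e > 0" using e1 e2 by (auto simp: e_def)
  have pos: "\<phi> s' u' > 0" if "t1 \<le> s'" "s' < s" "\<bar>s' - s\<bar> < e" "\<bar>u' - u\<bar> < e" for s' u'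
    by (rule glob) (use that s(1) e1(2)[of s' u'] e2(2)[of s' u'] in \<open>auto simp: e_def less_imp_le\<close>)
  \<comment> \<open>Time \<open>s\<close> is a limit of earlier times, at which \<open>pos\<close>
    holds, so the sign survives weakly.\<close>
  have nonneg: "\<phi> s u' \<ge> 0" if u': "\<bar>u' - u\<bar> < e" for u'
  proof (rule ccontr)
    assume "\<not> \<phi> s u' \<ge> 0"
    have "continuous_on {t1..t0} (\<lambda>r. \<phi> (fst (r,u')) (snd (r,u')))"
      by (rule continuous_on_compose2[OF c'(1)]) (auto simp: S_def intro!: continuous_intros)
    then have "continuous_on {t1..t0} (\<lambda>r. \<phi> r u')" by simp
    then obtain d where d: "d > 0" "\<And>r. r \<in> {t1..t0} \<Longrightarrow> dist r s < d \<Longrightarrow> dist (\<phi> r u') (\<phi> s u') < - \<phi> s u'"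
      using s(1) \<open>\<not> \<phi> s u' \<ge> 0\<close> unfolding continuous_on_iff by (metis neg_0_less_iff_less not_le)
    define r where "r = max t1 (s - min d e / 2)"
    have "t1 \<le> r" "r < s" "\<bar>r - s\<bar> < e" "dist r s < d" using d(1) e str(1)
      by (auto simp: r_def dist_real_def max_def min_def)
    then show False using pos[of r u'] u' d(2)[of r] s(1) by (auto simp: dist_real_def)
  qed
  have z: "\<phi> s u = 0" using nonneg[of u] e s(4) by auto
  have ev1: "\<forall>\<^sub>F u' in nhds u. \<phi> s u' \<ge> \<phi> s u"
    unfolding eventually_nhds_metric z using nonneg e by (auto simp: dist_real_def)
  have ev2: "\<forall>\<^sub>F s' in at_left s. \<phi> s' u > 0"
    unfolding eventually_at_left_field
    by (rule exI[of _ "max t1 (s - e)"]) (use pos[of _ u] e str(1) in auto)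
  show thesis
    by (rule that[of s u]) (use z ev1 ev2 glob str s in auto)
qed

section \<open>The flow and its barriers\<close>

lemma has_real_derivative_inner:
  fixes f :: "real \<Rightarrow> complex"
  assumes "(f has_vector_derivative f') (at u)"
  shows "((\<lambda>u. f u \<bullet> a) has_real_derivative f' \<bullet> a) (at u)"
  using bounded_linear.has_vector_derivative[OF bounded_linear_inner_left assms]
  by (simp add: has_real_derivative_iff_has_vector_derivative)

definition frame :: "complex \<Rightarrow> complex \<Rightarrow> bool" where
  "frame a b \<longleftrightarrow> norm a = 1 \<and> norm b = 1 \<and> a \<bullet> b = 0"

lemma frame_inner:
  assumes "frame a b"
  shows "z \<bullet> w = (z \<bullet> a) * (w \<bullet> a) + (z \<bullet> b) * (w \<bullet> b)"
proof -
  define p q r s where "p = Re a" "q = Im a" "r = Re b" "s = Im b"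
  note d = this
  have n: "p\<^sup>2 + q\<^sup>2 = 1" "r\<^sup>2 + s\<^sup>2 = 1" "p * r + q * s = 0"
    using assms unfolding frame_def d by (auto simp: cmod_def inner_complex_def)
  define k where "k = p * s - q * r"
  have r: "r = - q * k" and s: "s = p * k" unfolding k_def using n by algebra+
  have "k\<^sup>2 = 1" using n(1,2) unfolding r s by algebra
  have "z \<bullet> w = Re z * Re w + Im z * Im w" by (simp add: inner_complex_def)
  also have "\<dots> = (Re z * p + Im z * q) * (Re w * p + Im w * q)
      + (Re z * r + Im z * s) * (Re w * r + Im w * s)"
    using n(1) \<open>k\<^sup>2 = 1\<close> unfolding r s by algebra
  finally show ?thesis by (simp add: inner_complex_def d)
qed

lemma frame_norm:
  assumes "frame a b"
  shows "(norm z)\<^sup>2 = (z \<bullet> a)\<^sup>2 + (z \<bullet> b)\<^sup>2"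
  using frame_inner[OF assms, of z z] unfolding power2_norm_eq_inner by (simp add: power2_eq_square)

lemma frame_neg: "frame a b \<Longrightarrow> frame (- a) b" "frame a b \<Longrightarrow> frame a (- b)"
  by (auto simp: frame_def)

lemma inner_i_mult: "(\<i> * z) \<bullet> z = 0" "z \<bullet> (\<i> * z) = 0"
  by (auto simp: inner_complex_def)

lemma periodic_integral:
  fixes f :: "real \<Rightarrow> real"
  assumes c: "continuous_on UNIV f" and p: "\<And>u. f (u + 1) = f u"
  shows "integral {a..a+1} f = integral {0..1} f"
proof -
  define l where "l = min a 0 - 1"
  define r where "r = max a 0 + 2"
  have cf: "continuous_on S f" for S using c continuous_on_subset by blast
  obtain F where F: "\<And>x. x \<in> {l..r} \<Longrightarrow> (F has_vector_derivative f x) (at x within {l..r})"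
    using antiderivative_continuous[OF cf] by blast
  have F': "(F has_real_derivative f x) (at x)" if "l < x" "x < r" for x
    using F[of x] that at_within_Icc_at[of l x r] by (simp add: has_real_derivative_iff_has_vector_derivative)
  have I: "integral {x..x+1} f = F (x + 1) - F x" if "l < x" "x + 1 < r" for x
    by (intro integral_unique fundamental_theorem_of_calculus)
      (use that in \<open>auto simp: has_real_derivative_iff_has_vector_derivative[symmetric]
        intro!: has_field_derivative_at_within[OF F']\<close>)
  have "F (a + 1) - F a = F (0 + 1) - F 0"
  proof (rule DERIV_isconst3[of l "r - 1" a 0 "\<lambda>x. F (x + 1) - F x"])
    show "((\<lambda>x. F (x + 1) - F x) has_real_derivative 0) (at x)" if "x \<in> {l<..<r - 1}" for x
    proof -
      have "((\<lambda>x. F (x + 1)) has_real_derivative f (x + 1) * 1) (at x)"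
        by (rule DERIV_chain2[OF F']) (use that in \<open>auto intro!: derivative_eq_intros\<close>)
      then show ?thesis using F'[of x] that p by (auto intro!: derivative_eq_intros)
    qed
  qed (auto simp: l_def r_def)
  then show ?thesis using I[of a] I[of 0] by (simp add: l_def r_def)
qed

lemma periodic_deriv_integral:
  fixes F f :: "real \<Rightarrow> real"
  assumes "\<And>u. (F has_real_derivative f u) (at u)" "F 1 = F 0"
  shows "integral {0..1} f = 0"
  using fundamental_theorem_of_calculus[of 0 1 F f] assms
  by (auto simp: has_real_derivative_iff_has_vector_derivative[symmetric]
    intro!: integral_unique intro: has_field_derivative_at_within)

section \<open>Closed convex curves described by their normal angle\<close>

locale closed_curve =
  fixes X N :: "real \<Rightarrow> complex" and g w \<theta> :: "real \<Rightarrow> real"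
  assumes X_u: "\<And>u. (X has_vector_derivative g u *\<^sub>R (\<i> * N u)) (at u)"
    and N_cis: "\<And>u. N u = cis (\<theta> u)"
    and theta_u: "\<And>u. (\<theta> has_real_derivative w u) (at u)"
    and theta_per: "\<And>u. \<theta> (u + 1) = \<theta> u + 2 * pi"
    and X_per: "\<And>u. X (u + 1) = X u" and g_per: "\<And>u. g (u + 1) = g u" and w_per: "\<And>u. w (u + 1) = w u"
    and g_pos: "\<And>u. g u > 0" and w_nonneg: "\<And>u. w u \<ge> 0"
    and g_cont: "continuous_on UNIV g" and w_cont: "continuous_on UNIV w"
begin

definition len :: real where "len = integral {0..1} g"
text \<open>The divergence theorem's formula for the enclosed area, taken as the definition.\<close>

definition area :: real where "area = (1/2) * integral {0..1} (\<lambda>u. (X u \<bullet> N u) * g u)"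

lemma norm_N: "norm (N u) = 1" by (simp add: N_cis)

lemma N_per: "N (u + 1) = N u"
  by (simp add: N_cis theta_per flip: cis_mult)

lemma N_u: "(N has_vector_derivative w u *\<^sub>R (\<i> * N u)) (at u)"
proof -
  have "((\<lambda>u. cis (\<theta> u)) has_vector_derivative w u *\<^sub>R (\<i> * cis (\<theta> u))) (at u)"
    using has_derivative_cis[OF has_vector_derivative_def[THEN iffD1, OF theta_u[unfolded has_real_derivative_iff_has_vector_derivative]]]
    unfolding has_vector_derivative_def by (simp add: scaleR_conv_of_real mult_ac)
  then show ?thesis by (simp add: N_cis[abs_def])
qed

lemma X_cont: "continuous_on S X"
  by (meson X_u continuous_at_imp_continuous_on has_vector_derivative_continuous)

lemma N_cont: "continuous_on S N"
  by (meson N_u continuous_at_imp_continuous_on has_vector_derivative_continuous)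

lemma g_cont': "continuous_on S g" and w_cont': "continuous_on S w"
  using g_cont w_cont continuous_on_subset by blast+

lemma theta_cont: "continuous_on S \<theta>"
  by (intro continuous_at_imp_continuous_on ballI DERIV_isCont[OF theta_u])

lemma theta_mono: "u \<le> u' \<Longrightarrow> \<theta> u \<le> \<theta> u'"
  by (rule DERIV_nonneg_imp_nondecreasing) (use theta_u w_nonneg in blast)+

lemma theta_surj: "\<exists>u. \<theta> u = x"
proof -
  have nn: "\<theta> (u + real n) = \<theta> u + 2 * pi * real n" for u n
  proof (induction n)
    case (Suc n)
    then show ?case using theta_per[of "u + real n"] by (simp add: algebra_simps)
  qed simp
  obtain n where n: "\<bar>x\<bar> + \<bar>\<theta> 0\<bar> < 2 * pi * real n"
    using reals_Archimedean2[of "(\<bar>x\<bar> + \<bar>\<theta> 0\<bar>) / (2 * pi)"] by (auto simp: field_simps)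
  have "\<theta> (- real n) = \<theta> 0 - 2 * pi * real n" "\<theta> (real n) = \<theta> 0 + 2 * pi * real n"
    using nn[of "- real n" n] nn[of 0 n] by auto
  then have "\<theta> (- real n) \<le> x" "x \<le> \<theta> (real n)" using n by auto
  then show ?thesis using IVT'[of \<theta> "- real n" x "real n"] theta_cont by auto
qed

lemma N_surj: "norm e = 1 \<Longrightarrow> \<exists>u. N u = e"
proof -
  assume e: "norm e = 1"
  obtain u where "\<theta> u = Arg e" using theta_surj by blast
  moreover have "cis (Arg e) = e"
    using e cis_Arg[of e] norm_eq_zero[of e] by (simp add: sgn_eq)
  ultimately show ?thesis by (metis N_cis)
qed

lemma inner_X_deriv: "((\<lambda>u. (X u - z) \<bullet> a) has_real_derivative g u * ((\<i> * N u) \<bullet> a)) (at u)"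
  using has_real_derivative_inner[OF X_u] by (auto intro!: derivative_eq_intros simp: inner_diff_left)

lemma inner_N_deriv: "((\<lambda>u. N u \<bullet> a) has_real_derivative w u * ((\<i> * N u) \<bullet> a)) (at u)"
  using has_real_derivative_inner[OF N_u] by simp

lemma T_u: "((\<lambda>u. \<i> * N u) has_vector_derivative - w u *\<^sub>R N u) (at u)"
  using bounded_linear.has_vector_derivative[OF bounded_linear_mult_right[of \<i>] N_u[of u]]
  by (simp add: scaleR_conv_of_real algebra_simps)

lemma X_has_derivative_prod:
  shows "((\<lambda>u. (X u - z) \<bullet> N u) has_real_derivative w u * ((X u - z) \<bullet> (\<i> * N u))) (at u)"
    "((\<lambda>u. (X u - z) \<bullet> (\<i> * N u)) has_real_derivative g u - w u * ((X u - z) \<bullet> N u)) (at u)"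
proof -
  have TT: "(\<i> * N u) \<bullet> (\<i> * N u) = 1" using norm_N[of u] by (simp add: dot_square_norm norm_mult)
  have X': "((\<lambda>u. X u - z) has_vector_derivative g u *\<^sub>R (\<i> * N u)) (at u)"
    using X_u by (auto intro!: derivative_eq_intros)
  show "((\<lambda>u. (X u - z) \<bullet> N u) has_real_derivative w u * ((X u - z) \<bullet> (\<i> * N u))) (at u)"
    using bounded_bilinear.has_vector_derivative[OF bounded_bilinear_inner X' N_u[of u]]
    by (simp add: has_real_derivative_iff_has_vector_derivative inner_i_mult)
  show "((\<lambda>u. (X u - z) \<bullet> (\<i> * N u)) has_real_derivative g u - w u * ((X u - z) \<bullet> N u)) (at u)"
    using bounded_bilinear.has_vector_derivative[OF bounded_bilinear_inner X' T_u[of u]]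
    by (simp add: has_real_derivative_iff_has_vector_derivative TT)
qed

lemma int_w: "integral {0..1} w = 2 * pi"
  using fundamental_theorem_of_calculus[of 0 1 \<theta> w] theta_u theta_per[of 0]
  by (auto simp: has_real_derivative_iff_has_vector_derivative[symmetric]
    intro!: integral_unique intro: has_field_derivative_at_within)

lemma int_N_g: "integral {0..1} (\<lambda>u. (N u \<bullet> a) * g u) = 0"
proof -
  have "integral {0..1} (\<lambda>u. g u * ((\<i> * N u) \<bullet> (\<i> * a))) = 0"
    by (rule periodic_deriv_integral[OF inner_X_deriv[where z = 0]]) (use X_per[of 0] in simp)
  then show ?thesis by (simp add: inner_complex_def algebra_simps)
qed

lemma int_N_w: "integral {0..1} (\<lambda>u. (N u \<bullet> a) * w u) = 0"
proof -
  have "integral {0..1} (\<lambda>u. w u * ((\<i> * N u) \<bullet> (\<i> * a))) = 0"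
    by (rule periodic_deriv_integral[OF inner_N_deriv]) (use N_per[of 0] in simp)
  then show ?thesis by (simp add: inner_complex_def algebra_simps)
qed

text \<open>Cauchy's formula for the length: the tangential component of \<open>X - z\<close> is
  periodic, and its derivative is \<open>g\<close> minus \<open>w\<close> times the support
  function.\<close>

lemma int_h_w: "integral {0..1} (\<lambda>u. ((X u - z) \<bullet> N u) * w u) = len"
proof -
  have "integral {0..1} (\<lambda>u. g u - w u * ((X u - z) \<bullet> N u)) = 0"
    by (rule periodic_deriv_integral[OF X_has_derivative_prod(2)]) (use X_per[of 0] N_per[of 0] in simp)
  moreover have "integral {0..1} (\<lambda>u. g u - w u * ((X u - z) \<bullet> N u))
     = integral {0..1} g - integral {0..1} (\<lambda>u. w u * ((X u - z) \<bullet> N u))"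
    by (intro integral_diff integrable_continuous_real continuous_intros g_cont' w_cont' X_cont N_cont)
  ultimately show ?thesis by (simp add: len_def mult.commute)
qed

lemma area_translate: "integral {0..1} (\<lambda>u. ((X u - z) \<bullet> N u) * g u) = 2 * area"
proof -
  have "integral {0..1} (\<lambda>u. ((X u - z) \<bullet> N u) * g u)
     = integral {0..1} (\<lambda>u. (X u \<bullet> N u) * g u - (N u \<bullet> z) * g u)"
    by (intro arg_cong[where f = "integral {0..1}"] ext) (simp add: inner_diff_left inner_commute algebra_simps)
  also have "\<dots> = integral {0..1} (\<lambda>u. (X u \<bullet> N u) * g u) - integral {0..1} (\<lambda>u. (N u \<bullet> z) * g u)"
    by (intro integral_diff integrable_continuous_real continuous_intros g_cont' X_cont N_cont)
  finally show ?thesis by (simp add: int_N_g area_def)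
qed

lemma len_pos: "len > 0"
proof -
  have "integral {0..1} (\<lambda>u. 0) < integral {0..1} g"
    using integral_less_real[of 0 1 "\<lambda>u. 0" g] g_cont' g_pos by auto
  then show ?thesis by (simp add: len_def)
qed

lemma len_le_of_dist:
  assumes "\<And>u. norm (X u - z) \<le> d"
  shows "len \<le> 2 * pi * d"
proof -
  have "len \<le> integral {0..1} (\<lambda>u. d * w u)"
    unfolding int_h_w[symmetric, of z]
  proof (intro integral_le integrable_continuous_real continuous_intros w_cont' X_cont N_cont mult_right_mono w_nonneg)
    show "(X u - z) \<bullet> N u \<le> d" for u
      using norm_cauchy_schwarz[of "X u - z" "N u"] assms[of u] by (simp add: norm_N)
  qed
  also have "\<dots> = 2 * pi * d" by (simp add: int_w)
  finally show ?thesis .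
qed

lemma area_ge:
  assumes "\<And>u. (X u - z) \<bullet> N u \<ge> r"
  shows "2 * area \<ge> r * len"
proof -
  have "r * len = integral {0..1} (\<lambda>u. r * g u)" by (simp add: len_def)
  also have "\<dots> \<le> integral {0..1} (\<lambda>u. ((X u - z) \<bullet> N u) * g u)"
    by (intro integral_le integrable_continuous_real continuous_intros g_cont' X_cont N_cont mult_right_mono assms less_imp_le[OF g_pos])
  finally show ?thesis by (simp add: area_translate)
qed

end

text \<open>\<open>N\<close> is the outward unit normal, \<open>T = \<i> N\<close> the unit tangent, \<open>g = \<bar>X\<^sub>u\<bar>\<close>, \<open>w = g \<kappa>\<close> the derivative of the tangent angle,
  \<open>v = \<kappa>\<^sup>\<alpha>\<close> the speed and \<open>\<psi>\<close> its arc length derivative.\<close>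

locale convex_flow =
  fixes \<alpha> :: real and X N :: "real \<Rightarrow> real \<Rightarrow> complex"
    and g gu w v \<psi> \<psi>u :: "real \<Rightarrow> real \<Rightarrow> real" and \<Omega> :: "real \<Rightarrow> complex set"
  assumes alpha: "\<alpha> > 1/2"
    and X_u: "\<And>t u. t < 0 \<Longrightarrow> (X t has_vector_derivative g t u *\<^sub>R (\<i> * N t u)) (at u)"
    and N_u: "\<And>t u. t < 0 \<Longrightarrow> (N t has_vector_derivative w t u *\<^sub>R (\<i> * N t u)) (at u)"
    and g_u: "\<And>t u. t < 0 \<Longrightarrow> (g t has_real_derivative gu t u) (at u)"
    and v_u: "\<And>t u. t < 0 \<Longrightarrow> (v t has_real_derivative g t u * \<psi> t u) (at u)"
    and psi_u: "\<And>t u. t < 0 \<Longrightarrow> (\<psi> t has_real_derivative \<psi>u t u) (at u)"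
    and X_t: "\<And>t u. t < 0 \<Longrightarrow> ((\<lambda>s. X s u) has_vector_derivative (- v t u) *\<^sub>R N t u) (at t)"
    and N_t: "\<And>t u. t < 0 \<Longrightarrow> ((\<lambda>s. N s u) has_vector_derivative \<psi> t u *\<^sub>R (\<i> * N t u)) (at t)"
    and g_t: "\<And>t u. t < 0 \<Longrightarrow> ((\<lambda>s. g s u) has_real_derivative - (v t u * w t u)) (at t)"
    and w_t: "\<And>t u. t < 0 \<Longrightarrow> ((\<lambda>s. w s u) has_real_derivative \<psi>u t u) (at t)"
    and norm_N: "\<And>t u. t < 0 \<Longrightarrow> norm (N t u) = 1"
    and g_pos: "\<And>t u. t < 0 \<Longrightarrow> g t u > 0"
    and w_nonneg: "\<And>t u. t < 0 \<Longrightarrow> w t u \<ge> 0"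
    and v_eq: "\<And>t u. t < 0 \<Longrightarrow> v t u = (w t u / g t u) powr \<alpha>"
    and X_per: "\<And>t u. t < 0 \<Longrightarrow> X t (u + 1) = X t u"
    and N_per: "\<And>t u. t < 0 \<Longrightarrow> N t (u + 1) = N t u"
    and g_per: "\<And>t u. t < 0 \<Longrightarrow> g t (u + 1) = g t u"
    and w_per: "\<And>t u. t < 0 \<Longrightarrow> w t (u + 1) = w t u"
    and psi_per: "\<And>t u. t < 0 \<Longrightarrow> \<psi> t (u + 1) = \<psi> t u"
    and X_cont: "continuous_on ({..<0} \<times> UNIV) (\<lambda>(t,u). X t u)"
    and N_cont: "continuous_on ({..<0} \<times> UNIV) (\<lambda>(t,u). N t u)"
    and g_cont: "continuous_on ({..<0} \<times> UNIV) (\<lambda>(t,u). g t u)"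
    and w_cont: "continuous_on ({..<0} \<times> UNIV) (\<lambda>(t,u). w t u)"
    and v_cont: "continuous_on ({..<0} \<times> UNIV) (\<lambda>(t,u). v t u)"
    and psi_cont: "continuous_on ({..<0} \<times> UNIV) (\<lambda>(t,u). \<psi> t u)"
    and psiu_cont: "continuous_on ({..<0} \<times> UNIV) (\<lambda>(t,u). \<psi>u t u)"
    and open_Omega: "\<And>t. t < 0 \<Longrightarrow> open (\<Omega> t)"
    and convex_Omega: "\<And>t. t < 0 \<Longrightarrow> convex (\<Omega> t)"
    and bounded_Omega: "\<And>t. t < 0 \<Longrightarrow> bounded (\<Omega> t)"
    and Omega_ne: "\<And>t. t < 0 \<Longrightarrow> \<Omega> t \<noteq> {}"
    and closure_Omega: "\<And>t. t < 0 \<Longrightarrow> closure (\<Omega> t) = \<Omega> t \<union> range (X t)"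
    and Omega_support: "\<And>t u z. t < 0 \<Longrightarrow> z \<in> \<Omega> t \<Longrightarrow> (z - X t u) \<bullet> N t u < 0"
    and turning: "\<And>t. t < 0 \<Longrightarrow> \<exists>\<theta>. (\<forall>u. N t u = cis (\<theta> u)) \<and>
        (\<forall>u. (\<theta> has_real_derivative w t u) (at u)) \<and> (\<forall>u. \<theta> (u + 1) = \<theta> u + 2 * pi)"
begin

definition K :: "real \<Rightarrow> complex set" where "K t = closure (\<Omega> t)"

lemma slab_cont:
  fixes f :: "real \<Rightarrow> real \<Rightarrow> 'b::topological_space"
  assumes "continuous_on ({..<0} \<times> UNIV) (\<lambda>(t,u). f t u)" "t0 < 0"
  shows "continuous_on ({t1..t0} \<times> (UNIV::real set)) (\<lambda>(t,u). f t u)"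
proof (rule continuous_on_subset[OF assms(1)])
  show "{t1..t0} \<times> UNIV \<subseteq> {..<0} \<times> (UNIV::real set)" using assms(2) by (intro Sigma_mono) auto
qed

lemma X_in_K: "t < 0 \<Longrightarrow> X t u \<in> K t"
  by (simp add: K_def closure_Omega)

lemma convex_K: "t < 0 \<Longrightarrow> convex (K t)"
  by (simp add: K_def convex_closure convex_Omega)

lemma compact_K: "t < 0 \<Longrightarrow> compact (K t)"
  by (simp add: K_def bounded_Omega compact_closure)

lemma Omega_subset_K: "\<Omega> t \<subseteq> K t"
  by (simp add: K_def closure_subset)

lemma K_support:
  assumes "t < 0" "z \<in> K t"
  shows "(z - X t u) \<bullet> N t u \<le> 0"
proof -
  have "K t \<subseteq> {z. (z - X t u) \<bullet> N t u \<le> 0}"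
    unfolding K_def
  proof (rule closure_minimal)
    show "closed {z. (z - X t u) \<bullet> N t u \<le> 0}"
      by (intro closed_Collect_le continuous_intros)
  qed (use Omega_support[OF assms(1)] in \<open>auto intro: less_imp_le\<close>)
  then show ?thesis using assms by auto
qed

definition \<Theta> :: "real \<Rightarrow> real \<Rightarrow> real" where
  "\<Theta> t = (SOME \<theta>. (\<forall>u. N t u = cis (\<theta> u)) \<and> (\<forall>u. (\<theta> has_real_derivative w t u) (at u)) \<and> (\<forall>u. \<theta> (u + 1) = \<theta> u + 2 * pi))"

lemma Theta: "t < 0 \<Longrightarrow> (\<forall>u. N t u = cis (\<Theta> t u)) \<and> (\<forall>u. (\<Theta> t has_real_derivative w t u) (at u)) \<and> (\<forall>u. \<Theta> t (u + 1) = \<Theta> t u + 2 * pi)"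
  unfolding \<Theta>_def by (rule someI_ex[OF turning])

lemma section_cont:
  fixes f :: "real \<Rightarrow> real \<Rightarrow> 'b::topological_space"
  assumes "continuous_on ({..<0} \<times> UNIV) (\<lambda>(t,u). f t u)" "t < 0"
  shows "continuous_on S (f t)"
proof -
  have "continuous_on S (\<lambda>u. (\<lambda>(t,u). f t u) (t, u))"
    by (rule continuous_on_compose2[OF assms(1)]) (use assms(2) in \<open>auto intro!: continuous_intros\<close>)
  then show ?thesis by simp
qed

lemma curve_at: "t < 0 \<Longrightarrow> closed_curve (X t) (N t) (g t) (w t) (\<Theta> t)"
  by unfold_locales (use Theta[of t] X_u X_per g_per w_per g_pos w_nonneg
      section_cont[OF g_cont] section_cont[OF w_cont] in blast)+

lemma N_surj:
  assumes "t < 0" "norm e = 1"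
  obtains u where "N t u = e"
  using closed_curve.N_surj[OF curve_at] assms by blast

lemma X_uu:
  assumes "t < 0"
  shows "((\<lambda>u. g t u *\<^sub>R (\<i> * N t u)) has_vector_derivative
     gu t u *\<^sub>R (\<i> * N t u) - (g t u * w t u) *\<^sub>R N t u) (at u)"
  by (rule has_vector_derivative_eq_rhs,
      (rule has_vector_derivative_scaleR[OF g_u[OF assms]
      bounded_linear.has_vector_derivative[OF bounded_linear_mult_right N_u[OF assms]]]))
    (simp add: scaleR_conv_of_real algebra_simps)

text \<open>A parabola moving faster than the flow stays on the inner side of the curve.\<close>

lemma parabola_barrier:
  assumes fr: "frame a b" and t: "t1 \<le> t0" "t0 < 0"
    and gg: "\<And>s. s \<in> {t1..t0} \<Longrightarrow> (gg has_real_derivative gg' s) (at s)"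
    and m: "\<And>s. s \<in> {t1..t0} \<Longrightarrow> (m has_real_derivative m' s) (at s)"
    and R: "continuous_on {t1..t0} R"
    and gg': "\<And>s. s \<in> {t1..t0} \<Longrightarrow> gg' s \<le> - 2 * m s powr \<alpha>"
    and m': "\<And>s. s \<in> {t1..t0} \<Longrightarrow> m' s \<ge> 0" "\<And>s. s \<in> {t1..t0} \<Longrightarrow> m s > 0"
    and slope: "\<And>s. s \<in> {t1..t0} \<Longrightarrow> \<bar>\<mu>\<bar> + m s * R s \<le> 1"
    and init: "\<And>u. \<bar>X t1 u \<bullet> a\<bar> \<le> R t1 \<Longrightarrow> N t1 u \<bullet> b \<ge> 0 \<Longrightarrow>
        X t1 u \<bullet> b > \<mu> * (X t1 u \<bullet> a) + gg t1 - m t1 * (X t1 u \<bullet> a)\<^sup>2 / 2"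
    and bdry: "\<And>s u. s \<in> {t1..t0} \<Longrightarrow> \<bar>X s u \<bullet> a\<bar> = R s \<Longrightarrow> N s u \<bullet> b > 0 \<Longrightarrow>
        X s u \<bullet> b > \<mu> * (X s u \<bullet> a) + gg s - m s * (X s u \<bullet> a)\<^sup>2 / 2"
    and ext: "\<And>s u. s \<in> {t1..t0} \<Longrightarrow> \<bar>X s u \<bullet> a\<bar> \<le> R s \<Longrightarrow> N s u \<bullet> b \<noteq> 0"
    and u0: "\<bar>X t0 u0 \<bullet> a\<bar> \<le> R t0" "N t0 u0 \<bullet> b \<ge> 0"
  shows "X t0 u0 \<bullet> b > \<mu> * (X t0 u0 \<bullet> a) + gg t0 - m t0 * (X t0 u0 \<bullet> a)\<^sup>2 / 2"
proof (rule ccontr)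
  assume neg: "\<not> ?thesis"
  define \<phi> where "\<phi> s u = X s u \<bullet> b - \<mu> * (X s u \<bullet> a) - gg s + m s * (X s u \<bullet> a)\<^sup>2 / 2" for s u
  define c1 where "c1 s u = R s - \<bar>X s u \<bullet> a\<bar>" for s u
  define c2 where "c2 s u = N s u \<bullet> b" for s u
  have Xc: "continuous_on ({t1..t0} \<times> UNIV) (\<lambda>p. X (fst p) (snd p))"
    using slab_cont[OF X_cont t(2)] by (simp add: case_prod_unfold)
  have Nc: "continuous_on ({t1..t0} \<times> UNIV) (\<lambda>p. N (fst p) (snd p))"
    using slab_cont[OF N_cont t(2)] by (simp add: case_prod_unfold)
  have fc: "continuous_on ({t1..t0} \<times> (UNIV::real set)) (\<lambda>p. f (fst p))" if "continuous_on {t1..t0} f" for f :: "real \<Rightarrow> real"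
    by (rule continuous_on_compose2[OF that]) (auto intro!: continuous_intros)
  have ggc: "continuous_on {t1..t0} gg" and mc: "continuous_on {t1..t0} m"
    by (intro continuous_at_imp_continuous_on ballI DERIV_isCont[OF gg] DERIV_isCont[OF m]; simp)+
  have P: "continuous_on ({t1..t0} \<times> UNIV) (\<lambda>(s,u). \<phi> s u)"
    unfolding \<phi>_def case_prod_unfold by (intro continuous_intros Xc fc ggc mc) auto
  have C1: "continuous_on ({t1..t0} \<times> UNIV) (\<lambda>(s,u). c1 s u)"
    unfolding c1_def case_prod_unfold by (intro continuous_intros Xc fc R)
  have C2: "continuous_on ({t1..t0} \<times> UNIV) (\<lambda>(s,u). c2 s u)"
    unfolding c2_def case_prod_unfold by (intro continuous_intros Nc)
  obtain s u where su: "t1 < s" "s \<le> t0" "\<phi> s u = 0" "c1 s u > 0" "c2 s u > 0"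
    "\<forall>\<^sub>F u' in nhds u. \<phi> s u' \<ge> \<phi> s u" "\<forall>\<^sub>F s' in at_left s. \<phi> s' u > 0"
  proof (rule first_touch[OF P C1 C2, where ?s0.0 = t0 and ?u0.0 = u0])
    show "\<phi> s (u + 1) = \<phi> s u" "c1 s (u + 1) = c1 s u" "c2 s (u + 1) = c2 s u" if "s \<in> {t1..t0}" for s u
      using that t X_per N_per by (auto simp: \<phi>_def c1_def c2_def)
    show "t1 < s \<and> 0 < c1 s u \<and> 0 < c2 s u" if s: "s \<in> {t1..t0}" "c1 s u \<ge> 0" "c2 s u \<ge> 0" "\<phi> s u \<le> 0" for s u
    proof -
      have x: "\<bar>X s u \<bullet> a\<bar> \<le> R s" using s by (simp add: c1_def)
      have 2: "c2 s u > 0" using ext[OF s(1) x] s(3) by (simp add: c2_def)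
      have "\<bar>X s u \<bullet> a\<bar> \<noteq> R s" using bdry[OF s(1), of u] 2 s(4) unfolding c2_def \<phi>_def by linarith
      moreover have "s \<noteq> t1"  using init[of u] x s(3,4) unfolding c2_def \<phi>_def by auto
      ultimately show ?thesis using 2 x s(1) by (auto simp: c1_def)
    qed
  qed (use neg u0 t in \<open>auto simp: \<phi>_def c1_def c2_def\<close>)
  have s0: "s < 0" "s \<in> {t1..t0}" using su t by auto
  define x where "x = X s u \<bullet> a"
  define \<beta> where "\<beta> = \<mu> - m s * x"
  define ta where "ta = (\<i> * N s u) \<bullet> a"
  define tb where "tb = (\<i> * N s u) \<bullet> b"
  define Na where "Na = N s u \<bullet> a"
  define Nb where "Nb = N s u \<bullet> b"
  have N1: "Na\<^sup>2 + Nb\<^sup>2 = 1" using frame_norm[OF fr, of "N s u"] norm_N[OF s0(1)] by (simp add: Na_def Nb_def)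
  have T1: "ta\<^sup>2 + tb\<^sup>2 = 1"
    using frame_norm[OF fr, of "\<i> * N s u"] norm_N[OF s0(1)] by (simp add: ta_def tb_def norm_mult)
  have TN: "ta * Na + tb * Nb = 0"
    using frame_inner[OF fr, of "\<i> * N s u" "N s u"] inner_i_mult by (simp add: ta_def tb_def Na_def Nb_def)
  have Xa: "((\<lambda>u. X s u \<bullet> c) has_real_derivative g s u * ((\<i> * N s u) \<bullet> c)) (at u)" for c u
    using has_real_derivative_inner[OF X_u[OF s0(1)]] by simp
  have Xaa: "((\<lambda>u. g s u * ((\<i> * N s u) \<bullet> c)) has_real_derivative
      gu s u * ((\<i> * N s u) \<bullet> c) - g s u * w s u * (N s u \<bullet> c)) (at u)" for c u
    using has_real_derivative_inner[OF X_uu[OF s0(1)], of c u] by (simp add: inner_diff_left)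
  define Y where "Y c u = g s u * ((\<i> * N s u) \<bullet> c)" for c u
  have Yd: "(Y c has_real_derivative
      gu s u * ((\<i> * N s u) \<bullet> c) - g s u * w s u * (N s u \<bullet> c)) (at u)" for c u
    unfolding Y_def[abs_def] by (rule Xaa)
  define D1 where "D1 u = Y b u - \<mu> * Y a u + m s * ((X s u \<bullet> a) * Y a u)" for u
  have d1: "(\<phi> s has_real_derivative D1 u) (at u)" for u
    unfolding \<phi>_def[abs_def] D1_def Y_def
    by (auto intro!: derivative_eq_intros Xa simp: power2_eq_square)
  define D2 where "D2 = (gu s u * tb - g s u * w s u * Nb) - \<mu> * (gu s u * ta - g s u * w s u * Na)
     + m s * (x * (gu s u * ta - g s u * w s u * Na) + (g s u * ta) * (g s u * ta))"
  have d2: "(D1 has_real_derivative D2) (at u)"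
    unfolding D1_def[abs_def] D2_def ta_def tb_def Na_def Nb_def x_def
    by (auto intro!: derivative_eq_intros Xa[folded Y_def] Yd) (simp add: Y_def algebra_simps)
  note lm = local_min_second_deriv[OF d1 d2 su(6)]
  have gp: "g s u > 0" using g_pos s0 by auto
  have "g s u * (tb - \<beta> * ta) = 0" using lm(1) unfolding D1_def Y_def \<beta>_def ta_def tb_def x_def by (simp add: algebra_simps)
  then have tb: "tb = \<beta> * ta" using gp by simp
  have "ta \<noteq> 0" using T1 tb by auto
  moreover have "ta * (Na + \<beta> * Nb) = 0" using TN tb by (simp add: algebra_simps)
  ultimately have Na: "Na = - \<beta> * Nb" by simp
  have Nbpos: "Nb > 0" using su(5) by (simp add: c2_def Nb_def)
  have Nb2: "Nb\<^sup>2 * (1 + \<beta>\<^sup>2) = 1" using N1 Na by (simp add: algebra_simps power_mult_distrib)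
  have ta2: "ta\<^sup>2 * (1 + \<beta>\<^sup>2) = 1" using T1 tb by (simp add: algebra_simps power_mult_distrib)
  have "ta\<^sup>2 = Nb\<^sup>2" using Nb2 ta2
    by (metis mult_cancel_right sum_power2_eq_zero_iff one_power2 zero_neq_one)
  \<comment> \<open>A slope of at most 1 puts the normal within 45 degrees of \<open>b\<close>. The
    speed \<open>v / Nb\<close> in direction \<open>b\<close> is then below \<open>2 * v\<close>,
    which is the origin of the factor 2 in the hypothesis on \<open>gg'\<close>.\<close>
  have bet: "\<bar>\<beta>\<bar> \<le> 1"
  proof -
    have "\<bar>\<beta>\<bar> \<le> \<bar>\<mu>\<bar> + \<bar>m s * x\<bar>" unfolding \<beta>_def by (rule abs_triangle_ineq4)
    also have "\<bar>m s * x\<bar> = m s * \<bar>x\<bar>" using m'(2)[OF s0(2)] by (simp add: abs_mult)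
    also have "\<bar>\<mu>\<bar> + m s * \<bar>x\<bar> \<le> \<bar>\<mu>\<bar> + m s * R s" using su(4) m'(2)[OF s0(2)] by (simp add: c1_def x_def)
    finally show ?thesis using slope[OF s0(2)] by simp
  qed
  have "\<beta>\<^sup>2 \<le> 1" using bet by (simp add: abs_square_le_1)
  have Nbhalf: "1/2 < Nb"
  proof (rule ccontr)
    assume "\<not> 1/2 < Nb"
    then have "Nb\<^sup>2 \<le> (1/2)\<^sup>2" using Nbpos by (intro power_mono) auto
    then have "Nb\<^sup>2 * (1 + \<beta>\<^sup>2) \<le> (1/4) * 2" using \<open>\<beta>\<^sup>2 \<le> 1\<close> by (intro mult_mono) (auto simp: power2_eq_square)
    then show False using Nb2 by simp
  qed
  have "Nb\<^sup>2 \<le> 1\<^sup>2" using N1 zero_le_power2[of Na] unfolding one_power2 by linarith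
  then have Nb1: "Nb \<le> 1" by (rule power2_le_imp_le) simp
  \<comment> \<open>Tangency removes the unknown \<open>gu\<close>; what remains of the second order
    condition says that the curvature at the contact is at most \<open>m\<close>.\<close>
  have D2eq: "D2 = - g s u * w s u * (Nb * (1 + \<beta>\<^sup>2)) + m s * (g s u)\<^sup>2 * ta\<^sup>2"
    unfolding D2_def tb Na \<beta>_def by (simp add: algebra_simps power2_eq_square)
  have ta1: "ta\<^sup>2 \<le> 1" using T1 zero_le_power2[of tb] by linarith
  have "Nb * (Nb * (1 + \<beta>\<^sup>2)) \<le> 1 * (Nb * (1 + \<beta>\<^sup>2))"
    using Nb1 Nbpos by (intro mult_right_mono) auto
  then have "Nb * (1 + \<beta>\<^sup>2) \<ge> 1" using Nb2 by (simp add: power2_eq_square mult.assoc)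
  then have "g s u * w s u * 1 \<le> g s u * w s u * (Nb * (1 + \<beta>\<^sup>2))"
    using gp w_nonneg[OF s0(1), of u] by (intro mult_left_mono) auto
  also have "\<dots> \<le> m s * (g s u)\<^sup>2 * ta\<^sup>2" using lm(2) D2eq by simp
  also have "\<dots> \<le> m s * (g s u)\<^sup>2 * 1"
    using ta1 m'(2)[OF s0(2)] by (intro mult_left_mono) auto
  finally have "w s u \<le> m s * g s u" using gp by (simp add: power2_eq_square)
  then have "w s u / g s u \<le> m s" using gp by (simp add: field_simps)
  then have vle: "v s u \<le> m s powr \<alpha>"
    unfolding v_eq[OF s0(1)] using w_nonneg[OF s0(1), of u] gp alpha by (intro powr_mono2) auto
  have Xt: "((\<lambda>s. X s u \<bullet> c) has_real_derivative - v s u * (N s u \<bullet> c)) (at s)" for c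
    using has_real_derivative_inner[OF X_t[OF s0(1)]] by simp
  define D3 where "D3 = - v s u * Nb + \<mu> * (v s u * Na) - gg' s + (m' s * x\<^sup>2 / 2 + m s * x * (- v s u * Na))"
  have \<phi>': "\<phi> s u = X s u \<bullet> b - \<mu> * (X s u \<bullet> a) - gg s + (1/2) * (m s * ((X s u \<bullet> a) * (X s u \<bullet> a)))" for s u
    by (simp add: \<phi>_def power2_eq_square)
  have "((\<lambda>s. \<phi> s u) has_real_derivative D3) (at s)"
    unfolding \<phi>' D3_def Na_def Nb_def x_def
    by (rule derivative_eq_intros Xt gg m s0 refl | simp add: field_simps power2_eq_square)+
  then have "D3 \<le> 0" using deriv_nonpos_of_left_pos su(3,7) by blast
  moreover have "D3 > 0"
  proof -
    have "D3 = - v s u * (Nb * (1 + \<beta>\<^sup>2)) - gg' s + m' s * x\<^sup>2 / 2"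
      unfolding D3_def Na \<beta>_def by (simp add: algebra_simps power2_eq_square)
    moreover have "Nb * (1 + \<beta>\<^sup>2) = 1 / Nb" using Nb2 Nbpos by (simp add: field_simps power2_eq_square)
    moreover have "1 / Nb < 2" using Nbhalf by (simp add: field_simps)
    moreover have "v s u \<ge> 0" unfolding v_eq[OF s0(1)] by simp
    ultimately have "D3 \<ge> - v s u * (1 / Nb) + 2 * m s powr \<alpha>"
      using gg'[OF s0(2)] mult_nonneg_nonneg[OF m'(1)[OF s0(2)] zero_le_power2[of x]] by simp
    moreover have "v s u * (1/Nb) \<le> m s powr \<alpha> * (1/Nb)" using vle Nbpos by (intro mult_right_mono) auto
    moreover have "m s powr \<alpha> * (1/Nb) < m s powr \<alpha> * 2"
      using \<open>1 / Nb < 2\<close> m'(2)[OF s0(2)] by (intro mult_strict_left_mono) auto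
    ultimately show ?thesis by linarith
  qed
  ultimately show False by simp
qed

text \<open>A disc moving slower than the tip of the curve inside it stays outside the curve.\<close>

lemma disc_barrier:
  assumes fr: "frame d f" and t: "t1 \<le> t0" "t0 < 0" and D: "D > 0" and k: "0 < k" "k < D powr (-\<alpha>)"
    and init: "\<And>u. \<zeta> \<le> X t1 u \<bullet> d"
    and strip: "\<And>s u. s \<in> {t1..t0} \<Longrightarrow> X s u \<bullet> d \<le> \<zeta> + k * (s - t1) \<Longrightarrow> \<bar>X s u \<bullet> f\<bar> < D"
    and u0: "X t0 u0 \<bullet> d \<le> \<zeta> + k * (t0 - t1)"
  shows "(X t0 u0 \<bullet> d - (\<zeta> + k * (t0 - t1)))\<^sup>2 + (X t0 u0 \<bullet> f)\<^sup>2 < D\<^sup>2"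
proof (rule ccontr)
  assume neg: "\<not> ?thesis"
  define z where "z s = \<zeta> + k * (s - t1)" for s
  define \<phi> where "\<phi> s u = D * D - ((X s u \<bullet> d - z s) * (X s u \<bullet> d - z s) + (X s u \<bullet> f) * (X s u \<bullet> f))" for s u
  define c1 where "c1 s u = z s - X s u \<bullet> d" for s u
  define c2 where "c2 s u = (1::real)" for s u :: real
  have Xc: "continuous_on ({t1..t0} \<times> UNIV) (\<lambda>p. X (fst p) (snd p))"
    using slab_cont[OF X_cont t(2)] by (simp add: case_prod_unfold)
  have P: "continuous_on ({t1..t0} \<times> UNIV) (\<lambda>(s,u). \<phi> s u)"
    unfolding \<phi>_def z_def case_prod_unfold by (intro continuous_intros Xc)
  have C1: "continuous_on ({t1..t0} \<times> UNIV) (\<lambda>(s,u). c1 s u)"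
    unfolding c1_def z_def case_prod_unfold by (intro continuous_intros Xc)
  have C2: "continuous_on ({t1..t0} \<times> UNIV) (\<lambda>(s,u). c2 s u)"
    unfolding c2_def by simp
  obtain s u where su: "t1 < s" "s \<le> t0" "\<phi> s u = 0" "c1 s u > 0"
    "\<forall>\<^sub>F u' in nhds u. \<phi> s u' \<ge> \<phi> s u" "\<forall>\<^sub>F s' in at_left s. \<phi> s' u > 0"
  proof (rule first_touch[OF P C1 C2, where ?s0.0 = t0 and ?u0.0 = u0])
    show "\<phi> s (u + 1) = \<phi> s u" "c1 s (u + 1) = c1 s u" "c2 s (u + 1) = c2 s u" if "s \<in> {t1..t0}" for s u
      using that t X_per by (auto simp: \<phi>_def c1_def c2_def)
    show "t1 < s \<and> 0 < c1 s u \<and> 0 < c2 s u" if s: "s \<in> {t1..t0}" "c1 s u \<ge> 0" "c2 s u \<ge> 0" "\<phi> s u \<le> 0" for s u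
    proof -
      have "\<bar>X s u \<bullet> f\<bar> < D" using strip[OF s(1), of u] s(2) by (simp add: c1_def z_def)
      then have "(X s u \<bullet> f) * (X s u \<bullet> f) < D * D"
        using abs_square_less_1 D by (metis abs_ge_zero abs_mult_self_eq mult_strict_mono' )
      then have "X s u \<bullet> d - z s \<noteq> 0" using s(4) by (auto simp: \<phi>_def)
      moreover have "s = t1 \<Longrightarrow> X s u \<bullet> d - z s = 0" using init[of u] s(2) by (auto simp: c1_def z_def)
      ultimately show ?thesis using s by (cases "s = t1") (auto simp: c1_def c2_def)
    qed
  qed (use neg u0 t in \<open>auto simp: \<phi>_def c1_def c2_def z_def power2_eq_square not_less\<close>)
  have s0: "s < 0" using su t by auto
  define p where "p = X s u \<bullet> d - z s"
  define q where "q = X s u \<bullet> f"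
  define nd where "nd = N s u \<bullet> d"
  define nf where "nf = N s u \<bullet> f"
  define td where "td = (\<i> * N s u) \<bullet> d"
  define tf where "tf = (\<i> * N s u) \<bullet> f"
  have N1: "nd\<^sup>2 + nf\<^sup>2 = 1" using frame_norm[OF fr, of "N s u"] norm_N[OF s0] by (simp add: nd_def nf_def)
  have T1: "td\<^sup>2 + tf\<^sup>2 = 1"
    using frame_norm[OF fr, of "\<i> * N s u"] norm_N[OF s0] by (simp add: td_def tf_def norm_mult)
  have TN: "td * nd + tf * nf = 0"
    using frame_inner[OF fr, of "\<i> * N s u" "N s u"] inner_i_mult by (simp add: td_def tf_def nd_def nf_def)
  have gp: "g s u > 0" using g_pos s0 by auto
  define Y where "Y c u = g s u * ((\<i> * N s u) \<bullet> c)" for c u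
  have Xa: "((\<lambda>u. X s u \<bullet> c) has_real_derivative Y c u) (at u)" for c u
    using has_real_derivative_inner[OF X_u[OF s0]] by (simp add: Y_def)
  have Yd: "(Y c has_real_derivative
      gu s u * ((\<i> * N s u) \<bullet> c) - g s u * w s u * (N s u \<bullet> c)) (at u)" for c u
    using has_real_derivative_inner[OF X_uu[OF s0], of c u] by (simp add: inner_diff_left Y_def[abs_def])
  define D1 where "D1 u = - 2 * ((X s u \<bullet> d - z s) * Y d u + (X s u \<bullet> f) * Y f u)" for u
  have d1: "(\<phi> s has_real_derivative D1 u) (at u)" for u
    unfolding \<phi>_def[abs_def] D1_def
    by (auto intro!: derivative_eq_intros Xa simp: algebra_simps)
  define D2 where "D2 = - 2 * (g s u * td * (g s u * td) + p * (gu s u * td - g s u * w s u * nd)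
      + g s u * tf * (g s u * tf) + q * (gu s u * tf - g s u * w s u * nf))"
  have d2: "(D1 has_real_derivative D2) (at u)"
    unfolding D1_def[abs_def] D2_def
    by (auto intro!: derivative_eq_intros Xa Yd) (simp add: Y_def p_def q_def nd_def nf_def td_def tf_def algebra_simps)
  note lm = local_min_second_deriv[OF d1 d2 su(5)]
  have "g s u * (p * td + q * tf) = 0" using lm(1) by (simp add: D1_def Y_def p_def q_def td_def tf_def algebra_simps)
  then have PT: "p * td + q * tf = 0" using gp by simp
  \<comment> \<open>The normal component of the radius vector. At the contact the tangential
    component is 0, so \<open>e\<close> is \<open>D\<close> up to sign; the second order condition
    \<open>ge\<close> excludes \<open>- D\<close> because \<open>w\<close> is nonnegative.\<close>
  define e where "e = p * nd + q * nf"
  have "e\<^sup>2 = p\<^sup>2 + q\<^sup>2" using N1 T1 TN PT unfolding e_def by algebra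
  also have "\<dots> = D\<^sup>2" using su(3) by (simp add: \<phi>_def p_def q_def power2_eq_square)
  finally have e2: "e\<^sup>2 = D\<^sup>2" .
  have "D2 = - 2 * ((g s u)\<^sup>2 * (td\<^sup>2 + tf\<^sup>2) + gu s u * (p * td + q * tf) - g s u * w s u * e)"
    unfolding D2_def e_def by (simp add: algebra_simps power2_eq_square)
  then have "g s u * g s u \<le> g s u * (w s u * e)" using lm(2) unfolding T1 PT by (simp add: power2_eq_square)
  then have ge: "g s u \<le> w s u * e" using gp by simp
  have "e > 0"
  proof (rule ccontr)
    assume "\<not> e > 0"
    then have "w s u * e \<le> 0" using w_nonneg[OF s0, of u] by (simp add: mult_nonneg_nonpos)
    then show False using ge gp by simp
  qed
  then have eD: "e = D" using e2 D by (simp add: power2_eq_iff_nonneg)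
  have "1 / D \<le> w s u / g s u" using ge gp D unfolding eD by (simp add: field_simps)
  then have "(1 / D) powr \<alpha> \<le> v s u" unfolding v_eq[OF s0] using D alpha by (intro powr_mono2) auto
  then have vk: "k < v s u" using k D by (simp add: powr_divide powr_minus_divide)
  have Xt: "((\<lambda>s. X s u \<bullet> c) has_real_derivative - v s u * (N s u \<bullet> c)) (at s)" for c
    using has_real_derivative_inner[OF X_t[OF s0]] by simp
  have zt: "(z has_real_derivative k) (at s)" unfolding z_def[abs_def] by (auto intro!: derivative_eq_intros)
  have "((\<lambda>s. \<phi> s u) has_real_derivative 2 * (v s u * e + k * p)) (at s)"
    unfolding \<phi>_def e_def nd_def nf_def p_def q_def
    by (auto intro!: derivative_eq_intros Xt zt simp: algebra_simps)
  then have "2 * (v s u * e + k * p) \<le> 0" using deriv_nonpos_of_left_pos su(3,6) by blast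
  moreover have "- D \<le> p"
  proof -
    have "p\<^sup>2 \<le> D\<^sup>2" using \<open>e\<^sup>2 = p\<^sup>2 + q\<^sup>2\<close> e2 zero_le_power2[of q] by linarith
    then have "\<bar>p\<bar> \<le> D" using D by (simp add: abs_le_square_iff[symmetric])
    then show ?thesis by simp
  qed
  then have "k * (- D) \<le> k * p" using k by (intro mult_left_mono) auto
  moreover have "k * D < v s u * D" using vk D by simp
  ultimately show False by (simp add: eD)
qed

section \<open>Monotonicity of the enclosed regions\<close>

lemma support_attained:
  assumes "t < 0" "norm e = 1"
  obtains u where "N t u = e" "\<And>z. z \<in> K t \<Longrightarrow> z \<bullet> e \<le> X t u \<bullet> e"
proof -
  obtain u where u: "N t u = e" using N_surj[OF assms] by blast
  then show thesis using K_support[OF assms(1), of _ u] that[of u] by (simp add: inner_diff_left)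
qed

lemma support_antimono:
  assumes t: "t1 \<le> t0" "t0 < 0" and e: "norm e = 1" and b: "\<And>u. X t1 u \<bullet> e \<le> c"
  shows "X t0 u0 \<bullet> e \<le> c"
proof (rule field_le_epsilon)
  fix \<epsilon> :: real assume ep: "\<epsilon> > 0"
  \<comment> \<open>The linear term gives the barrier a positive speed, since \<open>v\<close> may
    vanish; together with the initial gap \<open>\<epsilon> / 2\<close> the error stays within
    \<open>\<epsilon>\<close>.\<close>
  define r where "r = \<epsilon> / (2 * (t0 - t1 + 1))"
  have r: "r > 0" using t ep by (simp add: r_def)
  show "X t0 u0 \<bullet> e \<le> c + \<epsilon>"
  proof (rule ccontr)
    assume neg: "\<not> ?thesis"
    define \<phi> where "\<phi> s u = c + r * (s - t1) + \<epsilon> / 2 - X s u \<bullet> e" for s u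
    have Xc: "continuous_on ({t1..t0} \<times> UNIV) (\<lambda>p. X (fst p) (snd p))"
      using slab_cont[OF X_cont t(2)] by (simp add: case_prod_unfold)
    have P: "continuous_on ({t1..t0} \<times> UNIV) (\<lambda>(s,u). \<phi> s u)"
      unfolding \<phi>_def case_prod_unfold by (intro continuous_intros Xc)
    have C: "continuous_on ({t1..t0} \<times> UNIV) (\<lambda>(s::real,u::real). 1::real)" by simp
    have "r * (t0 - t1) \<le> \<epsilon> / 2" unfolding r_def using t ep by (simp add: field_simps)
    obtain s u where su: "t1 < s" "s \<le> t0" "\<phi> s u = 0"
      "\<forall>\<^sub>F u' in nhds u. \<phi> s u' \<ge> \<phi> s u" "\<forall>\<^sub>F s' in at_left s. \<phi> s' u > 0"
      "\<And>s' u'. t1 \<le> s' \<Longrightarrow> s' < s \<Longrightarrow> \<phi> s' u' > 0"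
    proof (rule first_touch[OF P C C, where ?s0.0 = t0 and ?u0.0 = u0])
      show "\<phi> s (u + 1) = \<phi> s u" if "s \<in> {t1..t0}" for s u
        using that t X_per by (auto simp: \<phi>_def)
      show "t1 < s \<and> (0::real) < 1 \<and> (0::real) < 1" if s: "s \<in> {t1..t0}" "\<phi> s u \<le> 0" for s u
        using s b[of u] ep by (cases "s = t1") (auto simp: \<phi>_def)
    qed (use neg t \<open>r * (t0 - t1) \<le> \<epsilon> / 2\<close> in \<open>auto simp: \<phi>_def\<close>)
    have s0: "s < 0" using su t by auto
    text \<open>A maximiser in direction \<open>e\<close> at the first touching time has normal \<open>e\<close>.\<close>
    obtain u1 where u1: "N s u1 = e" "\<And>z. z \<in> K s \<Longrightarrow> z \<bullet> e \<le> X s u1 \<bullet> e" using support_attained[OF s0 e] by blast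
    have "X s u \<bullet> e \<le> X s u1 \<bullet> e" using u1(2) X_in_K[OF s0] by blast
    then have le: "\<phi> s u1 \<le> 0" using su(3) by (simp add: \<phi>_def)
    have Xt: "((\<lambda>s. X s u1 \<bullet> e) has_real_derivative - v s u1) (at s)"
      using has_real_derivative_inner[OF X_t[OF s0], of u1 e] e by (simp add: u1(1) power2_norm_eq_inner[symmetric])
    have dp: "((\<lambda>s. \<phi> s u1) has_real_derivative r + v s u1) (at s)"
      unfolding \<phi>_def by (auto intro!: derivative_eq_intros Xt)
    have ev: "\<forall>\<^sub>F s' in at_left s. \<phi> s' u1 > 0"
      unfolding eventually_at_left_field using su(1,6) by (intro exI[of _ t1]) auto
    have "isCont (\<lambda>s. \<phi> s u1) s" using dp by (rule DERIV_isCont)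
    then have "((\<lambda>s. \<phi> s u1) \<longlongrightarrow> \<phi> s u1) (at_left s)"
      by (simp add: isCont_def filterlim_at_split)
    then have "\<phi> s u1 \<ge> 0"
      by (rule tendsto_lowerbound) (use ev in \<open>auto elim: eventually_mono simp: less_imp_le trivial_limit_at_left_real\<close>)
    then have "\<phi> s u1 = 0" using le by simp
    then have "r + v s u1 \<le> 0" using deriv_nonpos_of_left_pos[OF dp] ev by blast
    moreover have "v s u1 \<ge> 0" unfolding v_eq[OF s0] by simp
    ultimately show False using r by simp
  qed
qed

text \<open>A point outside the earlier set is cut off from it by a line, and the support value in
  the normal direction of that line cannot grow.\<close>

lemma K_antimono:
  assumes "t1 \<le> t0" "t0 < 0"
  shows "K t0 \<subseteq> K t1"
proof
  fix z assume z: "z \<in> K t0"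
  have t1: "t1 < 0" using assms by simp
  show "z \<in> K t1"
  proof (rule ccontr)
    assume "z \<notin> K t1"
    then obtain a b where ab: "a \<bullet> z < b" "\<And>x. x \<in> K t1 \<Longrightarrow> a \<bullet> x > b"
      using separating_hyperplane_closed_point[OF convex_K[OF t1] compact_imp_closed[OF compact_K[OF t1]]] by blast
    define e where "e = - sgn a"
    have "a \<noteq> 0" using ab(1) ab(2)[OF X_in_K[OF t1, of 0]] by auto
    then have e: "norm e = 1" by (simp add: e_def norm_sgn)
    have ee: "x \<bullet> e = - (a \<bullet> x) / norm a" for x by (simp add: e_def sgn_div_norm inner_commute field_simps)
    have "X t1 u \<bullet> e \<le> - b / norm a" for u
      unfolding ee using ab(2)[OF X_in_K[OF t1, of u]] by (intro divide_right_mono) auto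
    then have "X t0 u \<bullet> e \<le> - b / norm a" for u using support_antimono[OF assms e] by blast
    moreover obtain u where "z \<bullet> e \<le> X t0 u \<bullet> e" using support_attained[OF assms(2) e] z by blast
    ultimately have "z \<bullet> e \<le> - b / norm a" by (meson order_trans)
    then show False unfolding ee using ab(1) \<open>a \<noteq> 0\<close> by (simp add: divide_le_cancel)
  qed
qed

end

section \<open>Thin curves\<close>

lemma periodic_frac:
  fixes f :: "real \<Rightarrow> 'a"
  assumes "\<And>u. f (u + 1) = f u"
  shows "f (frac u) = f u"
proof -
  have nn: "f (x + real n) = f x" for x n
  proof (induction n)
    case (Suc n)
    then show ?case using assms[of "x + real n"] by (simp add: algebra_simps)
  qed simp
  show ?thesis
  proof (cases "\<lfloor>u\<rfloor> \<ge> 0")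
    case True
    then have "u = frac u + real (nat \<lfloor>u\<rfloor>)" by (simp add: frac_def)
    then show ?thesis using nn[of "frac u" "nat \<lfloor>u\<rfloor>"] by metis
  next
    case False
    then have "frac u = u + real (nat (- \<lfloor>u\<rfloor>))" by (simp add: frac_def)
    then show ?thesis using nn[of u "nat (- \<lfloor>u\<rfloor>)"] by metis
  qed
qed

lemma frame_expand:
  assumes "frame a b"
  shows "z = (z \<bullet> a) *\<^sub>R a + (z \<bullet> b) *\<^sub>R b"
proof -
  have "(z - ((z \<bullet> a) *\<^sub>R a + (z \<bullet> b) *\<^sub>R b)) \<bullet> w = 0" for w
    using frame_inner[OF assms, of z w] by (simp add: inner_diff_left inner_add_left inner_commute[of a w] inner_commute[of b w])
  from this[of "z - ((z \<bullet> a) *\<^sub>R a + (z \<bullet> b) *\<^sub>R b)"] show ?thesis by simp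
qed

lemma frame_inner_simps:
  assumes "frame a b"
  shows "a \<bullet> a = 1" "b \<bullet> b = 1" "a \<bullet> b = 0" "b \<bullet> a = 0"
  using assms by (auto simp: frame_def dot_square_norm inner_commute)

text \<open>The point over abscissa \<open>x\<close> on the segment from \<open>q\<close> to
  \<open>p\<close>. The estimates of sections of thin sets rest on it.\<close>

lemma convex_cross:
  assumes "frame a b" "convex C" "p \<in> C" "q \<in> C" "q \<bullet> a \<le> x" "x \<le> p \<bullet> a" "q \<bullet> a < p \<bullet> a"
  shows "x *\<^sub>R a + (((x - q \<bullet> a) * (p \<bullet> b) + (p \<bullet> a - x) * (q \<bullet> b)) / (p \<bullet> a - q \<bullet> a)) *\<^sub>R b \<in> C"
proof -
  define l where "l = (x - q \<bullet> a) / (p \<bullet> a - q \<bullet> a)"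
  have l: "0 \<le> l" "l \<le> 1" "1 - l = (p \<bullet> a - x) / (p \<bullet> a - q \<bullet> a)" using assms by (auto simp: l_def field_simps)
  have "l *\<^sub>R p + (1 - l) *\<^sub>R q \<in> C" using convexD[OF assms(2-4), of l "1 - l"] l by simp
  moreover have "(l *\<^sub>R p + (1 - l) *\<^sub>R q) \<bullet> a = x"
    unfolding l(3) using assms(7) by (simp add: inner_add_left l_def divide_simps) (simp add: algebra_simps)
  moreover have "(l *\<^sub>R p + (1 - l) *\<^sub>R q) \<bullet> b = ((x - q \<bullet> a) * (p \<bullet> b) + (p \<bullet> a - x) * (q \<bullet> b)) / (p \<bullet> a - q \<bullet> a)"
    unfolding l(3) by (simp add: inner_add_left l_def add_divide_distrib)
  ultimately show ?thesis using frame_expand[OF assms(1), of "l *\<^sub>R p + (1 - l) *\<^sub>R q"] by simp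
qed

section \<open>Retreat of the tips and loss of width\<close>

context convex_flow
begin

text \<open>Near its left end \<open>K s\<close> lies in a strip of half width \<open>3 * c\<close>,
  so a disc of radius \<open>4 * c\<close> centred on the axis of the strip reaches across it. The
  centre starts level with the extreme point at time \<open>s\<close> and follows more slowly than a
  circle of that radius shrinks. Since a point at distance \<open>\<xi>0\<close> is still present at
  time \<open>t0\<close>, the centre is still far out then, hence the extreme point was farther out
  at time \<open>s\<close>.\<close>

lemma tip_speed:
  assumes fr: "frame a b" and st: "s \<le> t0" "t0 < 0"
    and P0: "(- \<xi>0) *\<^sub>R a \<in> K t0"
    and strip: "\<And>p. p \<in> K s \<Longrightarrow> \<bar>p \<bullet> a\<bar> \<le> \<xi> \<Longrightarrow> \<bar>p \<bullet> b - \<mu> * (p \<bullet> a)\<bar> \<le> 3 * c"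
    and cone: "\<And>p. p \<in> K s \<Longrightarrow> \<bar>p \<bullet> b\<bar> \<le> c * (1 + \<bar>p \<bullet> a\<bar> / \<xi>0)"
    and left: "\<And>p. p \<in> K s \<Longrightarrow> p \<bullet> a \<ge> - \<xi>"
    and c: "0 < c" "100 * c \<le> \<xi>0" "\<xi>0 \<le> \<xi>" and mu: "\<bar>\<mu>\<bar> \<le> 2 * c / \<xi>0"
  shows "\<exists>p\<in>K s. p \<bullet> a \<le> - (\<xi>0 / 4 + (4 * c) powr (-\<alpha>) / 4 * (t0 - s))"
proof -
  have s0: "s < 0" using st by simp
  have xi0: "\<xi>0 > 0" using c by simp
  have mu2: "\<bar>\<mu>\<bar> \<le> 1/50"
  proof -
    have "2 * c / \<xi>0 \<le> 1/50" using c xi0 by (simp add: field_simps)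
    then show ?thesis using mu by linarith
  qed
  define \<sigma> where "\<sigma> = sqrt (1 + \<mu>\<^sup>2)"
  have mus: "\<mu>\<^sup>2 \<le> (1/50)\<^sup>2" using mu2 by (simp add: abs_le_square_iff[symmetric])
  have sig2: "\<sigma>\<^sup>2 = 1 + \<mu>\<^sup>2" unfolding \<sigma>_def by (rule real_sqrt_pow2) simp
  have sig1: "1 \<le> \<sigma>" unfolding \<sigma>_def by simp
  have "\<sigma>\<^sup>2 \<le> (11/10)\<^sup>2" unfolding sig2 using mus by (simp add: power2_eq_square)
  then have sig3: "\<sigma> \<le> 11/10" by (rule power2_le_imp_le) simp
  define d where "d = (1/\<sigma>) *\<^sub>R (a + \<mu> *\<^sub>R b)"
  define f where "f = (1/\<sigma>) *\<^sub>R (b - \<mu> *\<^sub>R a)"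
  note fi = frame_inner_simps[OF fr]
  have na: "norm (a + \<mu> *\<^sub>R b) = \<sigma>" "norm (b - \<mu> *\<^sub>R a) = \<sigma>"
    unfolding \<sigma>_def norm_eq_sqrt_inner
    by (simp_all add: inner_add_left inner_add_right inner_diff_left inner_diff_right fi power2_eq_square)
  have fr': "frame d f"
    unfolding frame_def d_def f_def using sig1 na
    by (simp add: inner_add_left inner_diff_right fi)
  have pd: "p \<bullet> d = (p \<bullet> a + \<mu> * (p \<bullet> b)) / \<sigma>" and pf: "p \<bullet> f = (p \<bullet> b - \<mu> * (p \<bullet> a)) / \<sigma>" for p
    unfolding d_def f_def by (simp_all add: inner_add_right inner_diff_right)
  have muy: "\<bar>\<mu> * (p \<bullet> b)\<bar> \<le> (c + \<bar>p \<bullet> a\<bar> / 100) / 50" if "p \<in> K s" for p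
  proof -
    have "\<bar>p \<bullet> b\<bar> \<le> c + c * \<bar>p \<bullet> a\<bar> / \<xi>0" using cone[OF that] by (simp add: algebra_simps)
    also have "c * \<bar>p \<bullet> a\<bar> / \<xi>0 \<le> \<bar>p \<bullet> a\<bar> / 100"
      using mult_right_mono[OF c(2), of "\<bar>p \<bullet> a\<bar>"] xi0 by (simp add: field_simps)
    finally have "\<bar>p \<bullet> b\<bar> \<le> c + \<bar>p \<bullet> a\<bar> / 100" by simp
    then have "\<bar>\<mu>\<bar> * \<bar>p \<bullet> b\<bar> \<le> (1/50) * (c + \<bar>p \<bullet> a\<bar> / 100)" using mu2 by (intro mult_mono) auto
    then show ?thesis by (simp add: abs_mult)
  qed
  have neg: "\<bar>p \<bullet> a\<bar> \<le> \<xi>" if "p \<in> K s" "p \<bullet> d \<le> 0" for p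
  proof (cases "p \<bullet> a > 0")
    case True
    have "p \<bullet> a + \<mu> * (p \<bullet> b) \<le> 0" using that(2) sig1 unfolding pd by (simp add: divide_le_0_iff)
    then have "p \<bullet> a \<le> (c + \<bar>p \<bullet> a\<bar> / 100) / 50" using muy[OF that(1)] by linarith
    then show ?thesis using True c by simp
  next
    case False
    then show ?thesis using left[OF that(1)] by simp
  qed
  have "K s \<noteq> {}" using X_in_K[OF s0] by blast
  moreover have "continuous_on (K s) (\<lambda>q. q \<bullet> d)" by (intro continuous_intros)
  ultimately obtain ps where ps: "ps \<in> K s" "\<And>q. q \<in> K s \<Longrightarrow> ps \<bullet> d \<le> q \<bullet> d"
    using continuous_attains_inf[OF compact_K[OF s0], of "\<lambda>q. q \<bullet> d"] by blast
  define z where "z = ps \<bullet> d"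
  \<comment> \<open>Half the shrinking speed of the disc, as \<open>disc_barrier\<close> needs a
    strict inequality. Passing from the tilted coordinate along \<open>d\<close> back to
    \<open>a\<close> uses up another factor 2.\<close>
  define k where "k = (4 * c) powr (-\<alpha>) / 2"
  have k: "0 < k" "k < (4 * c) powr (-\<alpha>)" using c by (auto simp: k_def)
  have Pd: "((- \<xi>0) *\<^sub>R a) \<bullet> d \<le> - (9/10) * \<xi>0"
  proof -
    have "((- \<xi>0) *\<^sub>R a) \<bullet> d = - \<xi>0 / \<sigma>" unfolding pd by (simp add: fi)
    also have "\<dots> \<le> - (9/10) * \<xi>0"
    proof -
      have "(9/10) * \<xi>0 * \<sigma> \<le> (9/10) * \<xi>0 * (11/10)" using sig3 xi0 by (intro mult_left_mono) auto
      also have "\<dots> \<le> \<xi>0" using xi0 by simp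
      finally show ?thesis using sig1 by (simp add: field_simps)
    qed
    finally show ?thesis .
  qed
  have z9: "z \<le> - (9/10) * \<xi>0"
    using ps(2)[of "(- \<xi>0) *\<^sub>R a"] P0 K_antimono[OF st] Pd unfolding z_def by force
  have zfin: "z + k * (t0 - s) \<le> - \<xi>0 / 2"
  proof (rule ccontr)
    assume A: "\<not> ?thesis"
    \<comment> \<open>The time at which the centre reaches \<open>- \<xi>0 / 2\<close>. The curve
      then still has a point at or beyond \<open>- (9/10) * \<xi>0\<close>, at distance at least
      \<open>(4/10) * \<xi>0 \<ge> 40 * c\<close> from the centre and so outside the disc.\<close>
    define \<tau> where "\<tau> = s + (- \<xi>0 / 2 - z) / k"
    have tau: "s \<le> \<tau>" "\<tau> \<le> t0" "z + k * (\<tau> - s) = - \<xi>0 / 2"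
      using A z9 k xi0 unfolding \<tau>_def by (auto simp: field_simps)
    have tau0: "\<tau> < 0" using tau st by simp
    have e: "norm (- d) = 1" using fr' by (simp add: frame_def)
    obtain u0 where u0: "((- \<xi>0) *\<^sub>R a) \<bullet> (- d) \<le> X \<tau> u0 \<bullet> (- d)"
      using support_attained[OF tau0 e] P0 K_antimono[OF tau(2) st(2)] by blast
    then have Xd: "X \<tau> u0 \<bullet> d \<le> - (9/10) * \<xi>0" using Pd by simp
    have "(X \<tau> u0 \<bullet> d - (z + k * (\<tau> - s)))\<^sup>2 + (X \<tau> u0 \<bullet> f)\<^sup>2 < (4 * c)\<^sup>2"
    proof (rule disc_barrier[OF fr' tau(1) tau0 _ k])
      show "z \<le> X s u \<bullet> d" for u using ps(2) X_in_K[OF s0] by (simp add: z_def)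
      show "\<bar>X r u \<bullet> f\<bar> < 4 * c" if r: "r \<in> {s..\<tau>}" "X r u \<bullet> d \<le> z + k * (r - s)" for r u
      proof -
        have "X r u \<in> K r" using r tau0 by (intro X_in_K) auto
        then have Ks: "X r u \<in> K s" using K_antimono[of s r] r tau0 by auto
        have "k * (r - s) \<le> k * (\<tau> - s)" using k r by (intro mult_left_mono) auto
        then have "X r u \<bullet> d \<le> 0" using r(2) tau(3) xi0 by linarith
        then have "\<bar>X r u \<bullet> b - \<mu> * (X r u \<bullet> a)\<bar> \<le> 3 * c" using strip[OF Ks neg[OF Ks]] by blast
        moreover have "\<bar>X r u \<bullet> f\<bar> \<le> \<bar>X r u \<bullet> b - \<mu> * (X r u \<bullet> a)\<bar>"
          unfolding pf using sig1 by (simp add: abs_divide divide_le_eq mult_le_cancel_left1)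
        ultimately show ?thesis using c by linarith
      qed
      show "X \<tau> u0 \<bullet> d \<le> z + k * (\<tau> - s)" using Xd tau(3) xi0 by simp
    qed (use c in auto)
    moreover have "(4 * c)\<^sup>2 \<le> (X \<tau> u0 \<bullet> d - (z + k * (\<tau> - s)))\<^sup>2"
      unfolding abs_le_square_iff[symmetric] tau(3) using Xd c xi0 by simp
    ultimately show False using zero_le_power2[of "X \<tau> u0 \<bullet> f"] by linarith
  qed
  have kk: "0 \<le> k * (t0 - s)" using k st by simp
  have "ps \<bullet> a + \<mu> * (ps \<bullet> b) = \<sigma> * z" unfolding z_def pd using sig1 by simp
  also have "\<dots> \<le> 1 * z" using sig1 z9 xi0 by (intro mult_right_mono_neg) auto
  finally have "ps \<bullet> a + \<mu> * (ps \<bullet> b) \<le> z" by simp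
  then have "ps \<bullet> a \<le> z + (c + \<bar>ps \<bullet> a\<bar> / 100) / 50" using muy[OF ps(1)] by linarith
  moreover have "x \<le> - (q / 4 + E / 2)"
    if "x \<le> z + (c + \<bar>x\<bar> / 100) / 50" "z + E \<le> - q / 2" "0 \<le> E" "100 * c \<le> q" "0 < c" for x E q :: real
    using that by (cases "x \<ge> 0") (simp_all add: field_simps)
  ultimately have "ps \<bullet> a \<le> - (\<xi>0 / 4 + (k * (t0 - s)) / 2)" using zfin kk c by blast
  then show ?thesis using ps(1) by (auto simp: k_def intro!: bexI[of _ ps])
qed

lemma axis_section:
  assumes fr: "frame a b" and t: "t < 0" and 0: "0 \<in> \<Omega> t"
  shows "\<exists>y>0. y *\<^sub>R b \<in> K t \<and> (\<forall>q. q *\<^sub>R b \<in> K t \<longrightarrow> q \<le> y) \<and> y *\<^sub>R b \<in> range (X t)"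
proof -
  note fi = frame_inner_simps[OF fr]
  have K0: "0 \<in> K t" using 0 Omega_subset_K by blast
  have "compact ((\<lambda>p. p \<bullet> b) ` (K t \<inter> {p. p \<bullet> a = 0}))"
    by (intro compact_continuous_image continuous_intros compact_Int_closed compact_K t closed_Collect_eq)
  then obtain r where r: "r \<in> (\<lambda>p. p \<bullet> b) ` (K t \<inter> {p. p \<bullet> a = 0})"
        "\<And>q. q \<in> (\<lambda>p. p \<bullet> b) ` (K t \<inter> {p. p \<bullet> a = 0}) \<Longrightarrow> q \<le> r"
      using compact_attains_sup[of "(\<lambda>p. p \<bullet> b) ` (K t \<inter> {p. p \<bullet> a = 0})"] K0 by force
  then obtain p where p: "p \<in> K t" "p \<bullet> a = 0" "p \<bullet> b = r" by auto
  have rK: "r *\<^sub>R b \<in> K t" using p frame_expand[OF fr, of p] by simp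
  have max: "q \<le> r" if "q *\<^sub>R b \<in> K t" for q
    by (rule r(2), rule image_eqI[of _ _ "q *\<^sub>R b"]) (use that fi in auto)
  have nO: "r *\<^sub>R b \<notin> \<Omega> t"
  proof
    assume "r *\<^sub>R b \<in> \<Omega> t"
    then obtain e where e: "e > 0" "ball (r *\<^sub>R b) e \<subseteq> \<Omega> t" using open_Omega[OF t] open_contains_ball by blast
    have "(r + e/2) *\<^sub>R b \<in> ball (r *\<^sub>R b) e" using e fr by (simp add: dist_norm frame_def scaleR_left_diff_distrib[symmetric] del: scaleR_left_diff_distrib)
    then have "(r + e/2) *\<^sub>R b \<in> K t" using e(2) Omega_subset_K[of t] by blast
    then have "r + e / 2 \<le> r" by (rule max)
    then show False using e(1) by simp
  qed
  have "r > 0"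
  proof -
    obtain e where e: "e > 0" "ball 0 e \<subseteq> \<Omega> t" using open_Omega[OF t] 0 open_contains_ball by blast
    have "(e/2) *\<^sub>R b \<in> ball 0 e" using e fr by (simp add: frame_def)
    then have "(e/2) *\<^sub>R b \<in> K t" using e(2) Omega_subset_K[of t] by blast
    then have "e / 2 \<le> r" by (rule max)
    then show ?thesis using e(1) by simp
  qed
  moreover have "r *\<^sub>R b \<in> range (X t)" using rK nO closure_Omega[OF t] by (auto simp: K_def)
  ultimately show ?thesis using rK max by blast
qed

text \<open>Thinness forces length: by \<open>tip_speed\<close> the curve at time \<open>s\<close>
  reaches \<open>E s\<close> on both sides. Over the window \<open>R s = E s / 2\<close> a parabola
  of curvature about \<open>10 * c / (R s)^2\<close> fits under the upper arc and falls at speed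
  \<open>2 * m powr \<alpha>\<close>. As \<open>R\<close> grows linearly into the past, its total
  fall is controlled by \<open>R t0 powr (1 - 2 * \<alpha>)\<close>, however early \<open>t\<close>
  is. Losing at most \<open>3 * c / 8\<close> at either end leaves a quarter of the section.\<close>

lemma chord_drop:
  assumes fr: "frame a b" and tt: "t \<le> t0" "t0 < 0"
    and ends: "\<xi>0 *\<^sub>R a \<in> K t0" "(- \<xi>0) *\<^sub>R a \<in> K t0" and int: "0 \<in> \<Omega> t0"
    and GB: "G *\<^sub>R b \<in> K t" "(- B) *\<^sub>R b \<in> K t" "\<And>y. y *\<^sub>R b \<in> K t \<Longrightarrow> - B \<le> y \<and> y \<le> G"
    and c: "c = G + B" "0 < c" "100 * c \<le> \<xi>0"
    and small: "16 * 40 powr \<alpha> * 8 powr (2 * \<alpha> - 1) / (2 * \<alpha> - 1) * (c / \<xi>0) powr (2 * \<alpha> - 1) \<le> 1/8"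
  shows "\<exists>y. y *\<^sub>R b \<in> K t0 \<and> y \<ge> G - 3 * c / 8"
proof -
  have t0: "t < 0" using tt by simp
  have xi0: "\<xi>0 > 0" using c by simp
  note fi = frame_inner_simps[OF fr]
  have sub: "K s \<subseteq> K t" if "t \<le> s" "s \<le> t0" for s using K_antimono[of t s] that tt by auto
  have endt: "\<xi>0 *\<^sub>R a \<in> K s" "(- \<xi>0) *\<^sub>R a \<in> K s" if "s \<le> t0" for s
    using ends K_antimono[OF that tt(2)] by auto
  have "0 \<in> K t"
    using convexD[OF convex_K[OF t0] endt(1)[OF tt(1)] endt(2)[OF tt(1)], of "1/2" "1/2"] by simp
  then have GBpos: "0 \<le> G" "0 \<le> B" using GB(3)[of 0] by auto
  have Kne: "K t \<noteq> {}" using X_in_K[OF t0] by blast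
  have conta: "continuous_on (K t) (\<lambda>q. q \<bullet> a)" by (intro continuous_intros)
  obtain P where P: "P \<in> K t" "\<And>q. q \<in> K t \<Longrightarrow> P \<bullet> a \<le> q \<bullet> a"
    using continuous_attains_inf[OF compact_K[OF t0] Kne conta] by blast
  obtain Q where Q: "Q \<in> K t" "\<And>q. q \<in> K t \<Longrightarrow> q \<bullet> a \<le> Q \<bullet> a"
    using continuous_attains_sup[OF compact_K[OF t0] Kne conta] by blast
  define \<xi>m where "\<xi>m = - (P \<bullet> a)"
  define \<xi>p where "\<xi>p = Q \<bullet> a"
  have ext: "\<xi>0 \<le> \<xi>m" "\<xi>0 \<le> \<xi>p"
    using P(2)[OF endt(2)[OF tt(1)]] Q(2)[OF endt(1)[OF tt(1)]] by (auto simp: \<xi>m_def \<xi>p_def fi)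
  have extpos: "0 < \<xi>m" "0 < \<xi>p" using ext xi0 by auto
  \<comment> \<open>Height over the origin and slope of the chord between the extreme points; the
    parabola is tilted by the same slope.\<close>
  define y0 where "y0 = (\<xi>m * (Q \<bullet> b) + \<xi>p * (P \<bullet> b)) / (\<xi>p + \<xi>m)"
  define \<mu> where "\<mu> = (Q \<bullet> b - P \<bullet> b) / (\<xi>p + \<xi>m)"
  have cross0: "- B \<le> ((- (q \<bullet> a)) * (p \<bullet> b) + (p \<bullet> a) * (q \<bullet> b)) / (p \<bullet> a - q \<bullet> a) \<and>
      ((- (q \<bullet> a)) * (p \<bullet> b) + (p \<bullet> a) * (q \<bullet> b)) / (p \<bullet> a - q \<bullet> a) \<le> G"
    if "p \<in> K t" "q \<in> K t" "q \<bullet> a \<le> 0" "0 \<le> p \<bullet> a" "q \<bullet> a < p \<bullet> a" for p q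
    using convex_cross[OF fr convex_K[OF t0] that(1,2), of 0] that by (intro GB(3)) simp
  have y0: "- B \<le> y0" "y0 \<le> G"
    using cross0[OF Q(1) P(1)] extpos unfolding y0_def \<xi>m_def \<xi>p_def by simp_all
  have Qb: "Q \<bullet> b = y0 + \<mu> * \<xi>p" and Pb: "P \<bullet> b = y0 - \<mu> * \<xi>m"
  proof -
    have S: "\<xi>p + \<xi>m \<noteq> 0" using extpos by simp
    have 1: "y0 * (\<xi>p + \<xi>m) = \<xi>m * (Q \<bullet> b) + \<xi>p * (P \<bullet> b)" "\<mu> * (\<xi>p + \<xi>m) = Q \<bullet> b - P \<bullet> b"
      using S by (simp_all add: y0_def \<mu>_def)
    have "(Q \<bullet> b) * (\<xi>p + \<xi>m) = (y0 + \<mu> * \<xi>p) * (\<xi>p + \<xi>m)"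
         "(P \<bullet> b) * (\<xi>p + \<xi>m) = (y0 - \<mu> * \<xi>m) * (\<xi>p + \<xi>m)"
      using 1 by algebra+
    then show "Q \<bullet> b = y0 + \<mu> * \<xi>p" "P \<bullet> b = y0 - \<mu> * \<xi>m" using S by simp_all
  qed
  have cone: "\<bar>p \<bullet> b\<bar> \<le> c * (1 + \<bar>p \<bullet> a\<bar> / \<xi>0)" if p: "p \<in> K t" for p
  proof -
    define x where "x = \<bar>p \<bullet> a\<bar>"
    have "- B \<le> \<xi>0 * (p \<bullet> b) / (\<xi>0 + x) \<and> \<xi>0 * (p \<bullet> b) / (\<xi>0 + x) \<le> G"
    proof (cases "p \<bullet> a \<ge> 0")
      case True
      then show ?thesis using cross0[OF p endt(2)[OF tt(1)]] xi0 by (simp add: fi x_def add.commute)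
    next
      case False
      then show ?thesis using cross0[OF endt(1)[OF tt(1)] p] xi0 by (simp add: fi x_def)
    qed
    then have "\<bar>\<xi>0 * (p \<bullet> b) / (\<xi>0 + x)\<bar> \<le> c"
      using c(1) GBpos unfolding abs_le_iff by linarith
    then have "\<xi>0 * \<bar>p \<bullet> b\<bar> / (\<xi>0 + x) \<le> c" using xi0 by (simp add: abs_mult x_def abs_divide)
    then have "\<xi>0 * \<bar>p \<bullet> b\<bar> \<le> c * (\<xi>0 + x)" using xi0 by (simp add: divide_le_eq x_def)
    then show ?thesis using xi0 unfolding x_def by (simp add: field_simps)
  qed
  have mu: "\<bar>\<mu>\<bar> \<le> 2 * c / \<xi>0"
  proof -
    have "\<bar>Q \<bullet> b - P \<bullet> b\<bar> \<le> \<bar>Q \<bullet> b\<bar> + \<bar>P \<bullet> b\<bar>" by (rule abs_triangle_ineq4)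
    also have "\<dots> \<le> c * (1 + \<xi>p / \<xi>0) + c * (1 + \<xi>m / \<xi>0)"
      using cone[OF Q(1)] cone[OF P(1)] extpos by (simp add: \<xi>m_def \<xi>p_def)
    also have "\<dots> = c * (2 + (\<xi>p + \<xi>m) / \<xi>0)" by (simp add: algebra_simps add_divide_distrib)
    also have "\<dots> \<le> c * ((\<xi>p + \<xi>m) / \<xi>0 + (\<xi>p + \<xi>m) / \<xi>0)"
      using ext xi0 c by (intro mult_left_mono add_right_mono) (auto simp: le_divide_eq)
    also have "\<dots> = 2 * c / \<xi>0 * (\<xi>p + \<xi>m)" by simp
    finally show ?thesis unfolding \<mu>_def using extpos by (simp add: abs_divide divide_le_eq)
  qed
  \<comment> \<open>For a point within this distance, the extreme point on the other side is at
    least as far from the axis, so interpolating to abscissa 0 loses at most a factor 2.\<close>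
  define \<xi> where "\<xi> = min \<xi>m \<xi>p"
  have xi: "\<xi>0 \<le> \<xi>" using ext by (simp add: \<xi>_def)
  have strip: "\<bar>p \<bullet> b - \<mu> * (p \<bullet> a)\<bar> \<le> 3 * c" if p: "p \<in> K t" "\<bar>p \<bullet> a\<bar> \<le> \<xi>" for p
  proof -
    define x where "x = p \<bullet> a"
    define h where "h = p \<bullet> b - \<mu> * x - y0"
    have "\<bar>h\<bar> \<le> 2 * c"
    proof (cases "x \<ge> 0")
      case True
      have x: "x \<le> \<xi>m" using p(2) True by (simp add: \<xi>_def x_def)
      have "(\<xi>m * (p \<bullet> b) + x * (P \<bullet> b)) / (x + \<xi>m) = y0 + h * (\<xi>m / (x + \<xi>m))"
        unfolding Pb h_def using True extpos by (simp add: field_simps)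
      then have "- B \<le> y0 + h * (\<xi>m / (x + \<xi>m)) \<and> y0 + h * (\<xi>m / (x + \<xi>m)) \<le> G"
        using cross0[OF p(1) P(1)] True extpos by (simp add: x_def \<xi>m_def)
      then have "\<bar>h * (\<xi>m / (x + \<xi>m))\<bar> \<le> c" using y0 c(1) unfolding abs_le_iff by linarith
      then have "\<bar>h\<bar> * (\<xi>m / (x + \<xi>m)) \<le> c" using True extpos by (simp add: abs_mult)
      moreover have "1/2 \<le> \<xi>m / (x + \<xi>m)" using x True extpos by (simp add: field_simps)
      then have "\<bar>h\<bar> * (1/2) \<le> \<bar>h\<bar> * (\<xi>m / (x + \<xi>m))" by (intro mult_left_mono) auto
      ultimately show ?thesis by linarith
    next
      case False
      have x: "- x \<le> \<xi>p" using p(2) False by (simp add: \<xi>_def x_def)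
      have "((- x) * (Q \<bullet> b) + \<xi>p * (p \<bullet> b)) / (\<xi>p - x) = y0 + h * (\<xi>p / (\<xi>p - x))"
        unfolding Qb h_def using False extpos by (simp add: field_simps)
      then have "- B \<le> y0 + h * (\<xi>p / (\<xi>p - x)) \<and> y0 + h * (\<xi>p / (\<xi>p - x)) \<le> G"
        using cross0[OF Q(1) p(1)] False extpos by (simp add: x_def \<xi>p_def)
      then have "\<bar>h * (\<xi>p / (\<xi>p - x))\<bar> \<le> c" using y0 c(1) unfolding abs_le_iff by linarith
      then have "\<bar>h\<bar> * (\<xi>p / (\<xi>p - x)) \<le> c" using False extpos by (simp add: abs_mult)
      moreover have "1/2 \<le> \<xi>p / (\<xi>p - x)" using x False extpos by (simp add: field_simps)
      then have "\<bar>h\<bar> * (1/2) \<le> \<bar>h\<bar> * (\<xi>p / (\<xi>p - x))" by (intro mult_left_mono) auto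
      ultimately show ?thesis by linarith
    qed
    moreover have "\<bar>y0\<bar> \<le> c" using y0 GBpos c(1) unfolding abs_le_iff by linarith
    moreover have "p \<bullet> b - \<mu> * (p \<bullet> a) = h + y0" by (simp add: h_def x_def)
    ultimately show ?thesis by linarith
  qed
  define kq where "kq = (4 * c) powr (-\<alpha>) / 4"
  have kq: "kq > 0" using c by (simp add: kq_def)
  define E where "E s = \<xi>0 / 4 + kq * (t0 - s)" for s
  have tipL: "\<exists>p\<in>K s. p \<bullet> a \<le> - E s" if s: "t \<le> s" "s \<le> t0" "\<And>p. p \<in> K s \<Longrightarrow> p \<bullet> a \<ge> - \<xi>" for s
    unfolding E_def kq_def
    by (rule tip_speed[OF fr s(2) tt(2) ends(2), of \<xi> \<mu> c])
      (use strip cone sub[OF s(1,2)] s c xi mu in auto)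
  have tipR: "\<exists>p\<in>K s. p \<bullet> a \<ge> E s" if s: "t \<le> s" "s \<le> t0" "\<And>p. p \<in> K s \<Longrightarrow> p \<bullet> a \<le> \<xi>" for s
  proof -
    have "\<exists>p\<in>K s. p \<bullet> (- a) \<le> - E s"
      unfolding E_def kq_def
      by (rule tip_speed[OF frame_neg(1)[OF fr] s(2) tt(2), of \<xi>0 \<xi> "- \<mu>" c])
        (use strip cone sub[OF s(1,2)] s c xi mu ends in auto)
    then show ?thesis by auto
  qed
  have Emono: "E s \<le> E t" "\<xi>0 / 4 \<le> E s" if "t \<le> s" "s \<le> t0" for s
    using that kq by (auto simp: E_def)
  \<comment> \<open>\<open>tip_speed\<close> is applied only at the nearer extreme point. A set
    reaching beyond \<open>\<xi>\<close> on some side is thereby already past \<open>E t\<close>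
    there.\<close>
  have xiE: "E t \<le> \<xi>"
  proof (cases "\<xi>m \<le> \<xi>p")
    case True
    then have "\<xi> = \<xi>m" by (simp add: \<xi>_def)
    then show ?thesis using tipL[of t] P(2) tt by (force simp: \<xi>m_def)
  next
    case False
    then have "\<xi> = \<xi>p" by (simp add: \<xi>_def)
    then show ?thesis using tipR[of t] Q(2) tt by (force simp: \<xi>p_def)
  qed
  have left: "\<exists>p\<in>K s. p \<bullet> a \<le> - E s" if s: "t \<le> s" "s \<le> t0" for s
  proof (cases "\<forall>p\<in>K s. p \<bullet> a \<ge> - \<xi>")
    case False
    then obtain p where "p \<in> K s" "p \<bullet> a < - \<xi>" by auto
    then show ?thesis using xiE Emono(1)[OF s] by (intro bexI[of _ p]) auto
  qed (use tipL[OF s] in auto)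
  have right: "\<exists>p\<in>K s. p \<bullet> a \<ge> E s" if s: "t \<le> s" "s \<le> t0" for s
  proof (cases "\<forall>p\<in>K s. p \<bullet> a \<le> \<xi>")
    case False
    then obtain p where "p \<in> K s" "p \<bullet> a > \<xi>" by auto
    then show ?thesis using xiE Emono(1)[OF s] by (intro bexI[of _ p]) auto
  qed (use tipR[OF s] in auto)
  define R where "R s = E s / 2" for s
  have Rpos: "\<xi>0 / 8 \<le> R s" "0 < R s" if "t \<le> s" "s \<le> t0" for s
    using Emono(2)[OF that] xi0 by (auto simp: R_def)
  have Rd: "(R has_real_derivative - kq / 2) (at s)" for s
    unfolding R_def[abs_def] E_def by (auto intro!: derivative_eq_intros)
  \<comment> \<open>At the ends of the window the parabola has dropped by \<open>5 * c\<close>. Its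
    top is at most \<open>G \<le> c\<close>, so there it is below the strip of half width
    \<open>3 * c\<close>.\<close>
  define m where "m s = 10 * c / (R s)\<^sup>2" for s
  \<comment> \<open>Chosen so that \<open>gg\<close> integrates the fall
    \<open>2 * m powr \<alpha>\<close>, the derivative of \<open>R\<close> being
    \<open>- kq / 2\<close>. Its sign requires \<alpha> > 1/2.\<close>
  define Z where "Z = 2 * (10 * c) powr \<alpha> / ((2 * \<alpha> - 1) * (kq / 2))"
  define gg where "gg s = G - c / 4 - Z * (R s powr (1 - 2 * \<alpha>) - R t powr (1 - 2 * \<alpha>))" for s
  have Zpos: "Z > 0" using c kq alpha by (simp add: Z_def)
  have md: "(m has_real_derivative 10 * c * kq / (R s)^3) (at s)" if s: "s \<in> {t..t0}" for s
    unfolding m_def[abs_def] using Rpos[of s] s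
    by (auto intro!: derivative_eq_intros Rd simp: field_simps power2_eq_square power3_eq_cube)
  have mpow: "m s powr \<alpha> = (10 * c) powr \<alpha> * R s powr (- 2 * \<alpha>)" if s: "s \<in> {t..t0}" for s
  proof -
    have "R s powr (- 2 * \<alpha>) = ((R s)\<^sup>2) powr (- \<alpha>)"
    proof -
      have "(R s)\<^sup>2 = R s powr 2" using Rpos[of s] s by simp
      then show ?thesis by (simp only: powr_powr) simp
    qed
    then show ?thesis unfolding m_def using c Rpos[of s] s
      by (simp add: powr_divide powr_minus_divide)
  qed
  have gd: "(gg has_real_derivative - 2 * m s powr \<alpha>) (at s)" if s: "s \<in> {t..t0}" for s
  proof -
    have Rp: "R s > 0" using Rpos[of s] s by auto
    have D: "((\<lambda>s. R s powr (1 - 2 * \<alpha>)) has_real_derivative (1 - 2 * \<alpha>) * R s powr ((1 - 2 * \<alpha>) - 1) * (- kq / 2)) (at s)"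
      by (rule DERIV_fun_powr[OF Rd Rp, THEN DERIV_cong]) simp
    have D': "(gg has_real_derivative - (Z * ((1 - 2 * \<alpha>) * R s powr ((1 - 2 * \<alpha>) - 1) * (- kq / 2)))) (at s)"
      unfolding gg_def[abs_def]
      by (rule DERIV_cong[OF DERIV_diff[OF DERIV_const DERIV_cmult[OF DERIV_diff[OF D DERIV_const]]]]) simp
    have "Z * ((2 * \<alpha> - 1) * (kq / 2)) = 2 * (10 * c) powr \<alpha>"
      unfolding Z_def using kq alpha by simp
    moreover have "- (Z * ((1 - 2 * \<alpha>) * r * (- kq / 2))) = - (Z * ((2 * \<alpha> - 1) * (kq / 2))) * r" for r
      by (simp add: algebra_simps)
    moreover have "(1 - 2 * \<alpha>) - 1 = - 2 * \<alpha>" by simp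
    ultimately have "- (Z * ((1 - 2 * \<alpha>) * R s powr ((1 - 2 * \<alpha>) - 1) * (- kq / 2))) = - 2 * m s powr \<alpha>"
      unfolding mpow[OF s] by simp
    with D' show ?thesis by simp
  qed
  have above: "p \<bullet> b \<le> X s u \<bullet> b" if "s < 0" "p \<in> K s" "p \<bullet> a = X s u \<bullet> a" "N s u \<bullet> b > 0" for p s u
  proof -
    have "(p - X s u) \<bullet> N s u \<le> 0" using K_support that by blast
    moreover have "(p - X s u) \<bullet> N s u = (p \<bullet> b - X s u \<bullet> b) * (N s u \<bullet> b)"
      by (subst frame_inner[OF fr]) (simp add: inner_diff_left that(3))
    ultimately have "(p \<bullet> b - X s u \<bullet> b) * (N s u \<bullet> b) \<le> 0" by simp
    then show ?thesis using that(4) by (simp add: mult_le_0_iff)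
  qed
  \<comment> \<open>A supporting line parallel to \<open>b\<close> inside the window would leave the
    curve on one side of it, but the curve reaches \<open>2 * R s\<close> on both.\<close>
  have Nb0: "N s u \<bullet> b \<noteq> 0" if s: "s \<in> {t..t0}" and x: "\<bar>X s u \<bullet> a\<bar> \<le> R s" for s u
  proof
    assume n0: "N s u \<bullet> b = 0"
    have s0: "s < 0" using s tt by auto
    have "(N s u \<bullet> a)\<^sup>2 = 1" using frame_norm[OF fr, of "N s u"] n0 norm_N[OF s0] by simp
    then have or: "N s u \<bullet> a = 1 \<or> N s u \<bullet> a = -1" by (simp add: power2_eq_1_iff)
    have sup: "(p \<bullet> a - X s u \<bullet> a) * (N s u \<bullet> a) \<le> 0" if "p \<in> K s" for p
    proof -
      have "(p - X s u) \<bullet> N s u = (p \<bullet> a - X s u \<bullet> a) * (N s u \<bullet> a)"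
        by (subst frame_inner[OF fr]) (simp add: inner_diff_left n0)
      then show ?thesis using K_support[OF s0 that, of u] by simp
    qed
    have Rp: "R s > 0" "E s = 2 * R s" using Rpos[of s] s by (auto simp: R_def)
    obtain p q where "p \<in> K s" "q \<in> K s" "p \<bullet> a \<ge> E s" "q \<bullet> a \<le> - E s"
      using left[of s] right[of s] s by auto
    then show False using or sup[of p] sup[of q] x Rp by (elim disjE) auto
  qed
  \<comment> \<open>At the initial time the upper arc lies above a roof that drops by at most
    \<open>c * \<bar>x\<bar> / R t\<close>. The gap \<open>c / 4\<close> keeps the parabola under
    this roof because \<open>5 * z^2 - z + 1/4\<close> has no real zero.\<close>
  have par0: "\<mu> * x + gg t - m t * x\<^sup>2 / 2 < p" if "\<bar>x\<bar> \<le> R t" "\<mu> * x + G - c * \<bar>x\<bar> / R t \<le> p" for x p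
  proof -
    have Rp: "R t > 0" using Rpos[of t] tt by auto
    define z where "z = \<bar>x\<bar> / R t"
    have "m t * x\<^sup>2 / 2 = 5 * c * z\<^sup>2" using Rp by (simp add: m_def z_def power_divide)
    moreover have "gg t = G - c / 4" by (simp add: gg_def)
    moreover have "0 < c * (1/4 - z + 5 * z\<^sup>2)"
    proof -
      have "1/4 - z + 5 * z\<^sup>2 = 5 * (z - 1/10)\<^sup>2 + 1/5" by (simp add: power2_eq_square algebra_simps)
      then have "0 < 1/4 - z + 5 * z\<^sup>2" using zero_le_power2[of "z - 1/10"] by linarith
      then show ?thesis using c(2) by (rule mult_pos_pos[rotated])
    qed
    ultimately show ?thesis using that(2) by (simp add: z_def algebra_simps)
  qed
  obtain y where y: "y > 0" "y *\<^sub>R b \<in> K t0" "\<forall>q. q *\<^sub>R b \<in> K t0 \<longrightarrow> q \<le> y" "y *\<^sub>R b \<in> range (X t0)"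
    using axis_section[OF fr tt(2) int] by auto
  obtain u1 where u1: "X t0 u1 = y *\<^sub>R b" using y(4) by auto
  have ua: "X t0 u1 \<bullet> a = 0" "X t0 u1 \<bullet> b = y" by (simp_all add: u1 fi)
  have Nn: "N t0 u1 \<bullet> b > 0"
  proof -
    have n0: "N t0 u1 \<bullet> b \<noteq> 0" using Nb0[of t0 u1] ua Rpos[of t0] tt by auto
    have "(0 - X t0 u1) \<bullet> N t0 u1 \<le> 0" using K_support[OF tt(2)] int Omega_subset_K by blast
    then have "y * (N t0 u1 \<bullet> b) \<ge> 0" by (simp add: u1 inner_commute)
    then have "N t0 u1 \<bullet> b \<ge> 0" using y(1) by (simp add: zero_le_mult_iff)
    then show ?thesis using n0 by simp
  qed
  have main: "X t0 u1 \<bullet> b > \<mu> * (X t0 u1 \<bullet> a) + gg t0 - m t0 * (X t0 u1 \<bullet> a)\<^sup>2 / 2"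
  proof (rule parabola_barrier[OF fr tt gd md])
    show "continuous_on {t..t0} R" by (intro continuous_at_imp_continuous_on ballI DERIV_isCont[OF Rd])
    show "- 2 * m s powr \<alpha> \<le> - 2 * m s powr \<alpha>" for s by simp
    show "0 \<le> 10 * c * kq / R s ^ 3" "0 < m s" if "s \<in> {t..t0}" for s
      using that c kq Rpos[of s] by (auto simp: m_def)
    show "\<bar>\<mu>\<bar> + m s * R s \<le> 1" if s: "s \<in> {t..t0}" for s
    proof -
      have Rs: "\<xi>0 / 8 \<le> R s" "0 < R s" using Rpos[of s] s by auto
      have "m s * R s = 10 * c / R s" using Rs by (simp add: m_def power2_eq_square)
      also have "\<dots> \<le> 10 * c / (\<xi>0 / 8)" using Rs xi0 c by (intro divide_left_mono) auto
      also have "10 * c / (\<xi>0 / 8) = 80 * (c / \<xi>0)" by simp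
      finally have "\<bar>\<mu>\<bar> + m s * R s \<le> 80 * (c / \<xi>0) + 2 * (c / \<xi>0)" using mu by simp
      also have "\<dots> = 82 * c / \<xi>0" by simp
      also have "\<dots> \<le> 1" using c xi0 by (simp add: field_simps)
      finally show ?thesis .
    qed
    show "X t u \<bullet> b > \<mu> * (X t u \<bullet> a) + gg t - m t * (X t u \<bullet> a)\<^sup>2 / 2"
      if x: "\<bar>X t u \<bullet> a\<bar> \<le> R t" and n: "N t u \<bullet> b \<ge> 0" for u
    proof (rule par0[OF x])
      define x where "x = X t u \<bullet> a"
      have Rp: "R t > 0" "E t = 2 * R t" using Rpos[of t] tt by (auto simp: R_def)
      have n': "N t u \<bullet> b > 0" using n Nb0[of t u] x tt by auto
      have GG: "(G *\<^sub>R b) \<bullet> a = 0" "(G *\<^sub>R b) \<bullet> b = G" by (simp_all add: fi)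
      have xR: "\<bar>x\<bar> \<le> R t" using x by (simp add: x_def)
      show "\<mu> * (X t u \<bullet> a) + G - c * \<bar>X t u \<bullet> a\<bar> / R t \<le> X t u \<bullet> b"
      proof (cases "x \<ge> 0")
        case True
        define h where "h = (x * (Q \<bullet> b) + (\<xi>p - x) * G) / \<xi>p"
        have "x *\<^sub>R a + h *\<^sub>R b \<in> K t"
          using convex_cross[OF fr convex_K[OF t0] Q(1) GB(1), of x] True xR xiE Rp extpos
          unfolding h_def GG by (simp add: \<xi>p_def \<xi>_def)
        then have "h \<le> X t u \<bullet> b" using above[OF t0 _ _ n', of "x *\<^sub>R a + h *\<^sub>R b"] by (simp add: x_def inner_add_left fi)
        moreover have "h = \<mu> * x + G - (G - y0) * (x / \<xi>p)"
          unfolding h_def Qb using extpos by (simp add: field_simps)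
        moreover have "(G - y0) * (x / \<xi>p) \<le> c * (x / R t)"
          using True y0 c Rp xiE extpos by (intro mult_mono divide_left_mono) (auto simp: \<xi>_def)
        ultimately show ?thesis using True by (simp add: x_def)
      next
        case False
        define h where "h = ((x + \<xi>m) * G + (- x) * (P \<bullet> b)) / \<xi>m"
        have "x *\<^sub>R a + h *\<^sub>R b \<in> K t"
          using convex_cross[OF fr convex_K[OF t0] GB(1) P(1), of x] False xR xiE Rp extpos
          unfolding h_def GG by (simp add: \<xi>m_def \<xi>_def)
        then have "h \<le> X t u \<bullet> b" using above[OF t0 _ _ n', of "x *\<^sub>R a + h *\<^sub>R b"] by (simp add: x_def inner_add_left fi)
        moreover have "h = \<mu> * x + G - (G - y0) * (- x / \<xi>m)"
          unfolding h_def Pb using extpos by (simp add: field_simps)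
        moreover have "(G - y0) * (- x / \<xi>m) \<le> c * (- x / R t)"
        proof (rule mult_mono)
          show "- x / \<xi>m \<le> - x / R t" using False Rp xiE extpos by (intro divide_left_mono) (auto simp: \<xi>_def)
          show "0 \<le> - x / \<xi>m" using False extpos by (intro divide_nonneg_pos) auto
        qed (use y0 c in auto)
        ultimately show ?thesis using False by (simp add: x_def)
      qed
    qed
    show "X s u \<bullet> b > \<mu> * (X s u \<bullet> a) + gg s - m s * (X s u \<bullet> a)\<^sup>2 / 2"
      if s: "s \<in> {t..t0}" and x: "\<bar>X s u \<bullet> a\<bar> = R s" and n: "N s u \<bullet> b > 0" for s u
    proof -
      have s0: "s < 0" using s tt by auto
      have Rp: "R s > 0" "E s = 2 * R s" using Rpos[of s] s by (auto simp: R_def)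
      obtain p q where pq: "p \<in> K s" "q \<in> K s" "p \<bullet> a \<ge> 2 * R s" "q \<bullet> a \<le> - 2 * R s"
        using left[of s] right[of s] s unfolding Rp(2) by force
      define x where "x = X s u \<bullet> a"
      have xa: "\<bar>x\<bar> = R s" using x by (simp add: x_def)
      define h where "h = ((x - q \<bullet> a) * (p \<bullet> b) + (p \<bullet> a - x) * (q \<bullet> b)) / (p \<bullet> a - q \<bullet> a)"
      have hK: "x *\<^sub>R a + h *\<^sub>R b \<in> K s"
        unfolding h_def by (rule convex_cross[OF fr convex_K[OF s0] pq(1,2)]) (use pq xa Rp in auto)
      have "h \<le> X s u \<bullet> b" using above[OF s0 hK _ n] by (simp add: x_def inner_add_left fi)
      moreover have "\<bar>h - \<mu> * x\<bar> \<le> 3 * c"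
        using strip[of "x *\<^sub>R a + h *\<^sub>R b"] hK sub[of s] s xa xiE Emono(1)[of s] Rp by (auto simp: inner_add_left fi)
      moreover have "m s * x\<^sup>2 / 2 = 5 * c"
        using Rp xa by (simp add: m_def power2_abs[of x, symmetric])
      moreover have "gg s \<le> G"
      proof -
        have "R s \<le> R t" using Emono(1)[of s] s by (simp add: R_def)
        then have "R t powr (1 - 2 * \<alpha>) \<le> R s powr (1 - 2 * \<alpha>)" using alpha Rp by (intro powr_mono2') auto
        then have "0 \<le> Z * (R s powr (1 - 2 * \<alpha>) - R t powr (1 - 2 * \<alpha>))" using Zpos by simp
        then show ?thesis unfolding gg_def using c(2) by linarith
      qed
      ultimately show ?thesis using c GBpos unfolding x_def by linarith
    qed
    show "\<bar>X t0 u1 \<bullet> a\<bar> \<le> R t0" using Rpos[of t0] tt by (simp add: ua)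
  qed (use Nb0 Nn in auto)
  \<comment> \<open>This is the hypothesis \<open>small\<close> with \<open>kq\<close> and
    \<open>R t0 = \<xi>0 / 8\<close> written out. Together with the initial gap \<open>c / 4\<close>
    it makes up the loss \<open>3 * c / 8\<close>.\<close>
  have "Z * R t0 powr (1 - 2 * \<alpha>) \<le> c / 8"
  proof -
    have R0: "R t0 = \<xi>0 / 8" by (simp add: R_def E_def)
    have "R t0 powr (1 - 2 * \<alpha>) = 8 powr (2 * \<alpha> - 1) * \<xi>0 powr (1 - 2 * \<alpha>)"
      unfolding R0 using xi0 by (simp add: powr_divide powr_minus_divide[symmetric] minus_diff_eq divide_powr_uminus)
    moreover have "Z = 16 * 40 powr \<alpha> / (2 * \<alpha> - 1) * (c * c powr (2 * \<alpha> - 1))"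
    proof -
      have "c powr \<alpha> * c powr \<alpha> = c * c powr (2 * \<alpha> - 1)"
        using c by (simp add: powr_add[symmetric] powr_mult_base)
      moreover have "(10 * c) powr \<alpha> * (4 * c) powr \<alpha> = 40 powr \<alpha> * (c powr \<alpha> * c powr \<alpha>)"
      proof -
        have "(10 * c) powr \<alpha> * (4 * c) powr \<alpha> = (10 powr \<alpha> * 4 powr \<alpha>) * (c powr \<alpha> * c powr \<alpha>)"
          using c(2) by (simp add: powr_mult)
        also have "10 powr \<alpha> * 4 powr \<alpha> = (10 * 4) powr \<alpha>" by (simp only: powr_mult)
        finally show ?thesis by simp
      qed
      moreover have "Z = 16 * ((10 * c) powr \<alpha> * (4 * c) powr \<alpha>) / (2 * \<alpha> - 1)"
        unfolding Z_def kq_def using c alpha by (simp add: powr_minus field_simps)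
      ultimately show ?thesis by simp
    qed
    ultimately have "Z * R t0 powr (1 - 2 * \<alpha>) =
       c * (16 * 40 powr \<alpha> * 8 powr (2 * \<alpha> - 1) / (2 * \<alpha> - 1) * (c powr (2 * \<alpha> - 1) * \<xi>0 powr (1 - 2 * \<alpha>)))"
      by simp
    also have "c powr (2 * \<alpha> - 1) * \<xi>0 powr (1 - 2 * \<alpha>) = (c / \<xi>0) powr (2 * \<alpha> - 1)"
      using c xi0 by (simp add: powr_divide divide_powr_uminus minus_diff_eq)
    also have "c * (16 * 40 powr \<alpha> * 8 powr (2 * \<alpha> - 1) / (2 * \<alpha> - 1) * (c / \<xi>0) powr (2 * \<alpha> - 1)) \<le> c * (1/8)"
      using small c by (intro mult_left_mono) auto
    finally show ?thesis by simp
  qed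
  moreover have "0 \<le> Z * R t powr (1 - 2 * \<alpha>)" using Zpos by simp
  ultimately have "gg t0 \<ge> G - 3 * c / 8" unfolding gg_def by (simp add: algebra_simps)
  then show ?thesis using main y(2) unfolding ua by (intro exI[of _ y]) simp
qed

end

section \<open>Non-collapsing\<close>

context convex_flow
begin

lemma Omega_antimono:
  assumes "t1 \<le> t0" "t0 < 0"
  shows "\<Omega> t0 \<subseteq> \<Omega> t1"
proof -
  have t1: "t1 < 0" using assms by simp
  have "\<Omega> t0 \<subseteq> interior (K t1)"
    using K_antimono[OF assms] Omega_subset_K[of t0] open_Omega[OF assms(2)] interior_maximal by blast
  also have "interior (K t1) = \<Omega> t1"
    unfolding K_def using convex_interior_closure[OF convex_Omega[OF t1]] interior_open[OF open_Omega[OF t1]] by simp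
  finally show ?thesis .
qed

lemma speed_bound:
  assumes "t1 \<le> t0" "t0 < 0"
  shows "\<exists>V>0. \<forall>s t u. s \<in> {t1..t0} \<longrightarrow> t \<in> {t1..t0} \<longrightarrow> norm (X t u - X s u) \<le> V * \<bar>t - s\<bar>"
proof -
  have "continuous_on ({t1..t0} \<times> {0..1}) (\<lambda>(t,u). v t u)"
    by (rule continuous_on_subset[OF v_cont]) (use assms in auto)
  then have "bounded ((\<lambda>(t,u). v t u) ` ({t1..t0} \<times> {0..1}))"
    by (intro compact_imp_bounded compact_continuous_image compact_Times compact_Icc)
  then obtain V where V: "V > 0" "\<And>p. p \<in> {t1..t0} \<times> {0..1} \<Longrightarrow> norm ((\<lambda>(t,u). v t u) p) \<le> V"
    unfolding bounded_pos by (metis (no_types, lifting) imageI)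
  have vV: "\<bar>v t u\<bar> \<le> V" if "t \<in> {t1..t0}" for t u
  proof -
    have t: "t < 0" using that assms by auto
    have "v t (frac u) = v t u"
      by (rule periodic_frac[of "v t"]) (use v_eq[OF t] w_per[OF t] g_per[OF t] in simp)
    moreover have "\<bar>v t (frac u)\<bar> \<le> V"
      using V(2)[of "(t, frac u)"] that frac_lt_1[of u] by (auto simp: less_imp_le)
    ultimately show ?thesis by simp
  qed
  have "norm (X t u - X s u) \<le> V * norm (t - s)" if s: "s \<in> {t1..t0}" and t: "t \<in> {t1..t0}" for s t u
  proof (rule differentiable_bound[of "{t1..t0}" "\<lambda>r. X r u" "\<lambda>r h. h *\<^sub>R ((- v r u) *\<^sub>R N r u)"])
    fix r assume r: "r \<in> {t1..t0}"
    then have r0: "r < 0" using assms by auto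
    show "((\<lambda>r. X r u) has_derivative (\<lambda>h. h *\<^sub>R ((- v r u) *\<^sub>R N r u))) (at r within {t1..t0})"
      using X_t[OF r0, of u] unfolding has_vector_derivative_def by (rule has_derivative_at_withinI)
    show "onorm (\<lambda>h. h *\<^sub>R ((- v r u) *\<^sub>R N r u)) \<le> V"
      by (rule onorm_bound) (use vV[OF r, of u] V(1) norm_N[OF r0, of u] in \<open>simp_all add: abs_mult mult.commute[of _ "\<bar>v r u\<bar>"] mult_right_mono\<close>)
  qed (use s t in auto)
  then show ?thesis using V(1) by (auto intro!: exI[of _ V])
qed

text \<open>Sweeping makes the section longer than \<open>5 * c0\<close> in the far past. If it were
  at most \<open>c0\<close> at time \<open>t0\<close>, it would have a length between
  \<open>4 * c0\<close> and \<open>5 * c0\<close> at some time, and from there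
  \<open>chord_drop\<close> at both ends leaves more than \<open>c0\<close>. The 500 is the 100 of
  \<open>chord_drop\<close> for length \<open>5 * c0\<close>.\<close>

lemma noncollapse_axis:
  assumes sweep: "\<And>z. \<forall>\<^sub>F t in at_bot. z \<in> \<Omega> t"
    and fr: "frame a b" and t0: "t0 < 0"
    and ends: "\<xi>0 *\<^sub>R a \<in> K t0" "(- \<xi>0) *\<^sub>R a \<in> K t0" and int: "0 \<in> \<Omega> t0"
    and c0: "0 < c0" "500 * c0 \<le> \<xi>0"
    and small: "16 * 40 powr \<alpha> * 8 powr (2 * \<alpha> - 1) / (2 * \<alpha> - 1) * (5 * c0 / \<xi>0) powr (2 * \<alpha> - 1) \<le> 1/8"
  shows "\<exists>y1 y2. y1 *\<^sub>R b \<in> K t0 \<and> y2 *\<^sub>R b \<in> K t0 \<and> y1 - y2 > c0"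
proof (rule ccontr)
  assume neg: "\<not> ?thesis"
  have int': "0 \<in> \<Omega> s" if "s \<le> t0" for s using Omega_antimono[OF that t0] int by blast
  define PG where "PG e s y \<longleftrightarrow> y > 0 \<and> y *\<^sub>R e \<in> K s \<and> (\<forall>q. q *\<^sub>R e \<in> K s \<longrightarrow> q \<le> y) \<and> y *\<^sub>R e \<in> range (X s)" for e s y
  define top where "top e s = (SOME y. PG e s y)" for e s
  define G where "G = top b"
  define B where "B = top (- b)"
  have "PG e s (top e s)" if "s \<le> t0" "frame a e" for e s
    unfolding top_def using axis_section[OF that(2) _ int'[OF that(1)]] that t0 by (intro someI_ex[of "PG e s"]) (auto simp: PG_def)
  then have tp: "top e s > 0 \<and> top e s *\<^sub>R e \<in> K s \<and> (\<forall>q. q *\<^sub>R e \<in> K s \<longrightarrow> q \<le> top e s) \<and> top e s *\<^sub>R e \<in> range (X s)"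
    if "s \<le> t0" "frame a e" for e s
    using that unfolding PG_def by blast
  note G = tp[OF _ fr, folded G_def] and B = tp[OF _ frame_neg(2)[OF fr], folded B_def]
  define c where "c s = G s + B s" for s
  have "G t0 *\<^sub>R b \<in> K t0" "(- B t0) *\<^sub>R b \<in> K t0" using G[of t0] B[of t0] by auto
  then have "\<not> G t0 - (- B t0) > c0" using neg by blast
  then have ct0: "c t0 \<le> c0" by (simp add: c_def)
  define S where "S = {s. s \<le> t0 \<and> c s \<le> 5 * c0}"
  have t0S: "t0 \<in> S" using ct0 c0 by (simp add: S_def)
  have "\<forall>\<^sub>F t in at_bot. (3 * c0) *\<^sub>R b \<in> \<Omega> t \<and> (3 * c0) *\<^sub>R (- b) \<in> \<Omega> t"
    using eventually_conj[OF sweep sweep] by blast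
  then obtain T where T: "\<And>t. t \<le> T \<Longrightarrow> (3 * c0) *\<^sub>R b \<in> \<Omega> t \<and> (3 * c0) *\<^sub>R (- b) \<in> \<Omega> t"
    unfolding eventually_at_bot_linorder by blast
  have lower: "T \<le> s" if "s \<in> S" for s
  proof (rule ccontr)
    assume "\<not> T \<le> s"
    then have "(3 * c0) *\<^sub>R b \<in> K s" "(3 * c0) *\<^sub>R (- b) \<in> K s" using T[of s] Omega_subset_K[of s] by auto
    then have "3 * c0 \<le> G s" "3 * c0 \<le> B s" using G[of s] B[of s] that by (auto simp: S_def)
    then show False using that c0 by (simp add: S_def c_def)
  qed
  have "\<exists>t\<in>S. c t > 4 * c0"
  proof (rule ccontr)
    assume A: "\<not> ?thesis"
    \<comment> \<open>A comparison across the infimum replaces continuity of the section length.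
      From just before \<open>ts\<close> to a time of \<open>S\<close> just after it the section
      shrinks at most by the factor 4/5: the curve moves little, and the disc of radius
      \<open>r\<close> about 0 absorbs the displacement.\<close>
    define ts where "ts = Inf S"
    have bdd: "bdd_below S" using lower by (rule bdd_belowI)
    have tst0: "ts \<le> t0" unfolding ts_def using t0S bdd by (rule cInf_lower)
    obtain r where r: "r > 0" "ball 0 r \<subseteq> \<Omega> t0" using open_Omega[OF t0] int open_contains_ball by blast
    obtain V where V: "V > 0" "\<And>s t u. s \<in> {ts-1..t0} \<Longrightarrow> t \<in> {ts-1..t0} \<Longrightarrow> norm (X t u - X s u) \<le> V * \<bar>t - s\<bar>"
      using speed_bound[of "ts - 1" t0] tst0 t0 by auto
    define \<delta> where "\<delta> = min 1 (r / (16 * V))"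
    have d: "\<delta> > 0" "\<delta> \<le> 1" "V * (2 * \<delta>) \<le> r / 8"
    proof -
      show "\<delta> > 0" "\<delta> \<le> 1" using r V by (auto simp: \<delta>_def)
      have "V * (2 * \<delta>) \<le> V * (2 * (r / (16 * V)))" using V by (intro mult_left_mono) (auto simp: \<delta>_def)
      also have "\<dots> = r / 8" using V by simp
      finally show "V * (2 * \<delta>) \<le> r / 8" .
    qed
    define s where "s = ts - \<delta>"
    have s: "s \<le> t0" "s < ts" "s \<in> {ts-1..t0}" "s < 0" using d tst0 t0 by (auto simp: s_def)
    have "s \<notin> S" using s(2) cInf_lower[OF _ bdd, of s] by (auto simp: ts_def)
    then have cs: "c s > 5 * c0" using s by (simp add: S_def)
    obtain t' where t': "t' \<in> S" "t' < ts + \<delta>" using cInf_lessD[of S "ts + \<delta>"] t0S d by (auto simp: ts_def)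
    have ts': "ts \<le> t'" unfolding ts_def using t'(1) bdd by (rule cInf_lower)
    have t't0: "t' \<le> t0" "t' < 0" "t' \<in> {ts-1..t0}" using t' ts' t0 by (auto simp: S_def)
    have step: "(4/5 * y) *\<^sub>R e \<in> K t'" if "y *\<^sub>R e \<in> range (X s)" for y e
    proof -
      from that obtain u where u: "y *\<^sub>R e = X s u" by (rule rangeE)
      have "norm (X t' u - X s u) \<le> V * \<bar>t' - s\<bar>" using V(2) s t't0 by blast
      also have "\<dots> \<le> V * (2 * \<delta>)" using V(1) t' ts' by (intro mult_left_mono) (auto simp: s_def)
      finally have "norm (X t' u - X s u) \<le> r / 8" using d by simp
      then have "norm (4 *\<^sub>R (X s u - X t' u)) < r" using r by (simp add: norm_minus_commute)
      then have "4 *\<^sub>R (X s u - X t' u) \<in> ball 0 r" by simp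
      then have "4 *\<^sub>R (X s u - X t' u) \<in> K t'"
        using r(2) Omega_antimono[OF t't0(1) t0] Omega_subset_K[of t'] by blast
      from convexD[OF convex_K[OF t't0(2)] X_in_K[OF t't0(2), of u] this, of "4/5" "1/5"]
      show ?thesis unfolding scaleR_scaleR[symmetric] u by (simp add: algebra_simps)
    qed
    have "4/5 * G s \<le> G t'" "4/5 * B s \<le> B t'"
      using step[of "G s" b] step[of "B s" "- b"] G[OF s(1)] B[OF s(1)] G[OF t't0(1)] B[OF t't0(1)] by blast+
    then have "c t' > 4 * c0" using cs by (simp add: c_def)
    then show False using A t'(1) by auto
  qed
  then obtain t where t: "t \<le> t0" "c t \<le> 5 * c0" "4 * c0 < c t" by (auto simp: S_def)
  have xi0: "\<xi>0 > 0" using c0 by simp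
  have cp: "c t > 0" using t c0 by simp
  have sm: "16 * 40 powr \<alpha> * 8 powr (2 * \<alpha> - 1) / (2 * \<alpha> - 1) * (c t / \<xi>0) powr (2 * \<alpha> - 1) \<le> 1/8"
  proof -
    have "(c t / \<xi>0) powr (2 * \<alpha> - 1) \<le> (5 * c0 / \<xi>0) powr (2 * \<alpha> - 1)"
      using t cp xi0 alpha by (intro powr_mono2) (auto intro: divide_right_mono)
    then have "16 * 40 powr \<alpha> * 8 powr (2 * \<alpha> - 1) / (2 * \<alpha> - 1) * (c t / \<xi>0) powr (2 * \<alpha> - 1)
        \<le> 16 * 40 powr \<alpha> * 8 powr (2 * \<alpha> - 1) / (2 * \<alpha> - 1) * (5 * c0 / \<xi>0) powr (2 * \<alpha> - 1)"
      using alpha by (intro mult_left_mono) auto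
    then show ?thesis using small by linarith
  qed
  have c100: "100 * c t \<le> \<xi>0" using t c0 by simp
  have GBt: "- B t \<le> y \<and> y \<le> G t" if "y *\<^sub>R b \<in> K t" for y
  proof -
    have "(- y) *\<^sub>R (- b) \<in> K t" using that by simp
    then have "- y \<le> B t" using B[OF t(1)] by blast
    then show ?thesis using G[OF t(1)] that by auto
  qed
  have GBt2: "- G t \<le> y \<and> y \<le> B t" if "y *\<^sub>R - b \<in> K t" for y
    using GBt[of "- y"] that by simp
  have "\<exists>y. y *\<^sub>R b \<in> K t0 \<and> y \<ge> G t - 3 * c t / 8"
    by (rule chord_drop[OF fr t(1) t0 ends int _ _ GBt _ cp c100 sm])
      (use G[OF t(1)] B[OF t(1)] in \<open>auto simp: c_def\<close>)
  moreover have "\<exists>y. y *\<^sub>R (- b) \<in> K t0 \<and> y \<ge> B t - 3 * c t / 8"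
    by (rule chord_drop[OF frame_neg(2)[OF fr] t(1) t0 ends int _ _ _ _ cp c100 sm, where B = "G t"])
      (use G[OF t(1)] B[OF t(1)] GBt2 in \<open>auto simp: c_def\<close>)
  ultimately obtain y y' where yy: "y *\<^sub>R b \<in> K t0" "y \<ge> G t - 3 * c t / 8" "(- y') *\<^sub>R b \<in> K t0" "y' \<ge> B t - 3 * c t / 8"
    by auto
  then have "y - (- y') \<le> c0" using neg by (meson not_le)
  moreover have "c t = G t + B t" by (rule c_def)
  ultimately show False using yy(2,4) t(2,3) by linarith
qed

lemma translate:
  "convex_flow \<alpha> (\<lambda>t u. X t u - z) N g gu w v \<psi> \<psi>u (\<lambda>t. (\<lambda>x. x - z) ` \<Omega> t)"
proof
  show "continuous_on ({..<0} \<times> UNIV) (\<lambda>(t,u). X t u - z)"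
    using continuous_on_diff[OF X_cont continuous_on_const[of _ z]] by (simp add: case_prod_unfold)
  fix t u :: real assume t: "t < 0"
  show "((\<lambda>u. X t u - z) has_vector_derivative g t u *\<^sub>R (\<i> * N t u)) (at u)"
    using X_u[OF t] by (auto intro!: derivative_eq_intros)
  show "((\<lambda>s. X s u - z) has_vector_derivative (- v t u) *\<^sub>R N t u) (at t)"
    using X_t[OF t] by (auto intro!: derivative_eq_intros)
  show "open ((\<lambda>x. x - z) ` \<Omega> t)" using open_translation_subtract[OF open_Omega[OF t]] .
  show "convex ((\<lambda>x. x - z) ` \<Omega> t)" using convex_translation_subtract[OF convex_Omega[OF t]] .
  show "bounded ((\<lambda>x. x - z) ` \<Omega> t)" using bounded_translation_minus[OF bounded_Omega[OF t]] .
  show "closure ((\<lambda>x. x - z) ` \<Omega> t) = (\<lambda>x. x - z) ` \<Omega> t \<union> range (\<lambda>u. X t u - z)"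
    unfolding closure_translation_subtract closure_Omega[OF t] by auto
  show "(x - (X t u - z)) \<bullet> N t u < 0" if "x \<in> (\<lambda>x. x - z) ` \<Omega> t" for x
    using that Omega_support[OF t, of _ u] by auto
qed (use alpha N_u g_u v_u psi_u N_t g_t w_t norm_N g_pos w_nonneg v_eq X_per N_per g_per w_per psi_per
   N_cont g_cont w_cont v_cont psi_cont psiu_cont Omega_ne turning in \<open>simp_all add: has_real_derivative_iff_has_vector_derivative\<close>)

end

section \<open>From chords to the inradius\<close>

context convex_flow
begin

text \<open>The smallness condition involves only the ratio of width to length, so one
  \<open>\<epsilon>\<close> serves all times and scales; translating the flow moves \<open>z\<close>
  to the origin.\<close>

lemma K_section:
  assumes sweep: "\<And>z. \<forall>\<^sub>F t in at_bot. z \<in> \<Omega> t"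
  shows "\<exists>\<epsilon>>0. \<epsilon> \<le> 1 \<and> (\<forall>t<0. \<forall>a b z \<xi>. frame a b \<longrightarrow> \<xi> > 0 \<longrightarrow> z \<in> \<Omega> t \<longrightarrow> z + \<xi> *\<^sub>R a \<in> K t \<longrightarrow> z - \<xi> *\<^sub>R a \<in> K t \<longrightarrow>
      (\<exists>y1 y2. z + y1 *\<^sub>R b \<in> K t \<and> z + y2 *\<^sub>R b \<in> K t \<and> y1 - y2 > \<epsilon> * \<xi>))"
proof -
  define C where "C = 16 * 40 powr \<alpha> * 8 powr (2 * \<alpha> - 1) / (2 * \<alpha> - 1)"
  have C: "C > 0" unfolding C_def using alpha by simp
  define \<epsilon> where "\<epsilon> = min (1/500) ((1 / (8 * C)) powr (1 / (2 * \<alpha> - 1)) / 5)"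
  have e: "\<epsilon> > 0" "\<epsilon> \<le> 1/500" using C by (auto simp: \<epsilon>_def)
  have small: "C * (5 * \<epsilon>) powr (2 * \<alpha> - 1) \<le> 1/8"
  proof -
    have "(5 * \<epsilon>) powr (2 * \<alpha> - 1) \<le> ((1 / (8 * C)) powr (1 / (2 * \<alpha> - 1))) powr (2 * \<alpha> - 1)"
      using e alpha by (intro powr_mono2) (auto simp: \<epsilon>_def)
    also have "\<dots> = 1 / (8 * C)" using C alpha by (simp add: powr_powr)
    finally have "C * (5 * \<epsilon>) powr (2 * \<alpha> - 1) \<le> C * (1 / (8 * C))" using C by (intro mult_left_mono) auto
    then show ?thesis using C by simp
  qed
  have "\<exists>y1 y2. z + y1 *\<^sub>R b \<in> K t \<and> z + y2 *\<^sub>R b \<in> K t \<and> y1 - y2 > \<epsilon> * \<xi>"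
    if t: "t < 0" and fr: "frame a b" and xi: "\<xi> > 0" and z: "z \<in> \<Omega> t"
      and ends: "z + \<xi> *\<^sub>R a \<in> K t" "z - \<xi> *\<^sub>R a \<in> K t" for t a b z \<xi>
  proof -
    interpret tr: convex_flow \<alpha> "\<lambda>t u. X t u - z" N g gu w v \<psi> \<psi>u "\<lambda>t. (\<lambda>x. x - z) ` \<Omega> t"
      by (rule translate)
    have trK: "tr.K s = (\<lambda>x. x - z) ` K s" for s
      unfolding tr.K_def K_def by (rule closure_translation_subtract)
    have mem: "x \<in> tr.K s \<longleftrightarrow> z + x \<in> K s" for x s
      unfolding trK by (auto intro: image_eqI[of _ _ "z + x"])
    have mem': "x \<in> (\<lambda>x. x - z) ` \<Omega> s \<longleftrightarrow> z + x \<in> \<Omega> s" for x s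
      by (auto intro: image_eqI[of _ _ "z + x"])
    have "\<exists>y1 y2. y1 *\<^sub>R b \<in> tr.K t \<and> y2 *\<^sub>R b \<in> tr.K t \<and> y1 - y2 > \<epsilon> * \<xi>"
    proof (rule tr.noncollapse_axis[OF _ fr t])
      show "\<forall>\<^sub>F t in at_bot. x \<in> (\<lambda>x. x - z) ` \<Omega> t" for x unfolding mem' by (rule sweep)
      show "\<xi> *\<^sub>R a \<in> tr.K t" "(- \<xi>) *\<^sub>R a \<in> tr.K t" "0 \<in> (\<lambda>x. x - z) ` \<Omega> t"
        unfolding mem mem' using ends z by simp_all
      show "0 < \<epsilon> * \<xi>" "500 * (\<epsilon> * \<xi>) \<le> \<xi>" using e xi by auto
      show "16 * 40 powr \<alpha> * 8 powr (2 * \<alpha> - 1) / (2 * \<alpha> - 1) * (5 * (\<epsilon> * \<xi>) / \<xi>) powr (2 * \<alpha> - 1) \<le> 1 / 8"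
        using small xi unfolding C_def by simp
    qed
    then show ?thesis unfolding mem .
  qed
  then show ?thesis using e by (intro exI[of _ \<epsilon>]) auto
qed

text \<open>The region contains a triangle whose base is parallel to a diameter and half as long,
  and whose height \<open>s = \<epsilon> * dm / 8\<close> comes from \<open>K_section\<close>. It
  contains a disc of radius \<open>s / 8\<close>, while the length is at most
  \<open>2 * pi * dm\<close>; this is the ratio \<open>\<epsilon> / (128 * pi)\<close>.\<close>

theorem inradius:
  assumes sweep: "\<And>z. \<forall>\<^sub>F t in at_bot. z \<in> \<Omega> t"
  shows "\<exists>c>0. \<forall>t<0. \<exists>z. \<forall>u. (X t u - z) \<bullet> N t u \<ge> c * integral {0..1} (g t)"
proof -
  obtain \<epsilon> where e: "\<epsilon> > 0" "\<epsilon> \<le> 1" and sec: "\<And>t a b z \<xi>. t < 0 \<Longrightarrow> frame a b \<Longrightarrow> \<xi> > 0 \<Longrightarrow> z \<in> \<Omega> t \<Longrightarrow>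
     z + \<xi> *\<^sub>R a \<in> K t \<Longrightarrow> z - \<xi> *\<^sub>R a \<in> K t \<Longrightarrow>
      \<exists>y1 y2. z + y1 *\<^sub>R b \<in> K t \<and> z + y2 *\<^sub>R b \<in> K t \<and> y1 - y2 > \<epsilon> * \<xi>"
    using K_section[OF sweep] by metis
  have "\<exists>z. \<forall>u. (X t u - z) \<bullet> N t u \<ge> \<epsilon> / (128 * pi) * integral {0..1} (g t)" if t: "t < 0" for t
  proof -
    interpret c: closed_curve "X t" "N t" "g t" "w t" "\<Theta> t" by (rule curve_at[OF t])
    have Kne: "K t \<noteq> {}" using X_in_K[OF t] by blast
    obtain P Q where PQ: "P \<in> K t" "Q \<in> K t" "\<And>x y. x \<in> K t \<Longrightarrow> y \<in> K t \<Longrightarrow> dist x y \<le> dist P Q"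
      using diameter_compact_attained[OF compact_K[OF t] Kne] diameter_bounded_bound[OF compact_imp_bounded[OF compact_K[OF t]]]
      by metis
    define dm where "dm = dist P Q"
    obtain z0 where z0: "z0 \<in> \<Omega> t" using Omega_ne[OF t] by blast
    have z0K: "z0 \<in> K t" using z0 Omega_subset_K by blast
    have "c.len \<le> 2 * pi * dm"
      by (rule c.len_le_of_dist[of z0]) (use PQ(3)[OF X_in_K[OF t] z0K] in \<open>simp add: dist_norm dm_def\<close>)
    moreover from this have "0 < (2 * pi) * dm" using c.len_pos by linarith
    then have "0 < dm" by (rule zero_less_mult_pos) simp
    ultimately have len: "integral {0..1} (g t) \<le> 2 * pi * dm" "0 < dm" by (simp_all add: c.len_def)
    \<comment> \<open>Contracting the diameter halfway towards an interior point makes its midpoint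
      interior and keeps its ends in \<open>K t\<close>.\<close>
    define z where "z = (1/2) *\<^sub>R z0 + (1/4) *\<^sub>R P + (1/4) *\<^sub>R Q"
    define a where "a = (1/dm) *\<^sub>R (Q - P)"
    define \<xi> where "\<xi> = dm / 4"
    have xi: "\<xi> > 0" using len by (simp add: \<xi>_def)
    have na: "norm a = 1" unfolding a_def using len by (simp add: dm_def dist_norm norm_minus_commute)
    have fr: "frame a (\<i> * a)" using na by (simp add: frame_def norm_mult inner_i_mult)
    have xa: "\<xi> *\<^sub>R a = (1/4) *\<^sub>R (Q - P)" using len by (simp add: \<xi>_def a_def)
    have zp: "z + \<xi> *\<^sub>R a = (1/2) *\<^sub>R z0 + (1/2) *\<^sub>R Q" "z - \<xi> *\<^sub>R a = (1/2) *\<^sub>R z0 + (1/2) *\<^sub>R P"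
      unfolding xa z_def by (simp_all add: scaleR_diff_right scaleR_left.add[symmetric])
    have mid: "z \<in> \<Omega> t"
    proof -
      have "(1/2) *\<^sub>R P + (1/2) *\<^sub>R Q \<in> K t" using convexD[OF convex_K[OF t] PQ(1,2), of "1/2" "1/2"] by simp
      then have "((1/2) *\<^sub>R P + (1/2) *\<^sub>R Q) - (1/2) *\<^sub>R (((1/2) *\<^sub>R P + (1/2) *\<^sub>R Q) - z0) \<in> interior (\<Omega> t)"
        by (intro mem_interior_closure_convex_shrink[OF convex_Omega[OF t]])
          (use z0 interior_open[OF open_Omega[OF t]] in \<open>auto simp: K_def\<close>)
      moreover have "((1/2) *\<^sub>R P + (1/2) *\<^sub>R Q) - (1/2) *\<^sub>R (((1/2) *\<^sub>R P + (1/2) *\<^sub>R Q) - z0) = z"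
        unfolding z_def by (simp add: algebra_simps complex_eq_iff)
      ultimately show ?thesis using interior_open[OF open_Omega[OF t]] by simp
    qed
    have ends: "z + \<xi> *\<^sub>R a \<in> K t" "z - \<xi> *\<^sub>R a \<in> K t"
      unfolding zp using convexD[OF convex_K[OF t] z0K PQ(2), of "1/2" "1/2"] convexD[OF convex_K[OF t] z0K PQ(1), of "1/2" "1/2"] by simp_all
    obtain y1 y2 where y: "z + y1 *\<^sub>R (\<i> * a) \<in> K t" "z + y2 *\<^sub>R (\<i> * a) \<in> K t" "y1 - y2 > \<epsilon> * \<xi>"
      using sec[OF t fr xi mid ends] by blast
    obtain b y where b: "frame a b" "y \<ge> \<epsilon> * \<xi> / 2" "z + y *\<^sub>R b \<in> K t"
    proof (cases "y1 \<ge> \<epsilon> * \<xi> / 2")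
      case True
      then show thesis using that[OF fr _ y(1)] by blast
    next
      case False
      then show thesis using that[OF frame_neg(2)[OF fr], of "- y2"] y(2,3) by simp
    qed
    define s where "s = \<epsilon> * \<xi> / 2"
    have s: "0 < s" "s \<le> \<xi>" "s \<le> y" using e xi b mult_right_mono[OF e(2), of \<xi>] by (auto simp: s_def)
    have zb: "z + s *\<^sub>R b \<in> K t"
    proof -
      have "(s / y) *\<^sub>R (z + y *\<^sub>R b) + (1 - s / y) *\<^sub>R z \<in> K t"
        using s b(3) mid Omega_subset_K by (intro convexD[OF convex_K[OF t]]) auto
      moreover have "(s / y) *\<^sub>R (z + y *\<^sub>R b) + (1 - s / y) *\<^sub>R z = z + s *\<^sub>R b"
        using s by (simp add: scaleR_add_right scaleR_diff_left)
      ultimately show ?thesis by simp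
    qed
    \<comment> \<open>Shifting the centre by \<open>s / 4\<close> towards the apex helps for normals
      with \<open>q < 0\<close>. For the others it costs at most \<open>s / 8\<close> if
      \<open>q < 1/2\<close>, and a quarter of the apex bound \<open>s * q\<close>
      otherwise.\<close>
    have "(X t u - (z + (s/4) *\<^sub>R b)) \<bullet> N t u \<ge> s / 8" for u
    proof -
      define p where "p = N t u \<bullet> a"
      define q where "q = N t u \<bullet> b"
      have pq: "p\<^sup>2 + q\<^sup>2 = 1" using frame_norm[OF b(1), of "N t u"] norm_N[OF t] by (simp add: p_def q_def)
      define H where "H = (X t u - z) \<bullet> N t u"
      have H: "\<xi> * p \<le> H" "- \<xi> * p \<le> H" "s * q \<le> H"
        using K_support[OF t ends(1), of u] K_support[OF t ends(2), of u] K_support[OF t zb, of u]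
        by (auto simp: H_def p_def q_def inner_diff_left inner_add_left inner_commute[of "N t u" a] inner_commute[of "N t u" b])
      have goal: "(X t u - (z + (s/4) *\<^sub>R b)) \<bullet> N t u = H - s / 4 * q"
        by (simp add: H_def q_def inner_diff_left inner_add_left inner_commute[of "N t u" b])
      have Hp: "s * \<bar>p\<bar> \<le> H"
      proof -
        have "s * \<bar>p\<bar> \<le> \<xi> * \<bar>p\<bar>" using s by (intro mult_right_mono) auto
        also have "\<xi> * \<bar>p\<bar> \<le> H" using H(1,2) by (cases "p \<ge> 0") auto
        finally show ?thesis .
      qed
      show ?thesis
      proof (cases "q \<ge> 1/2")
        case True
        then have "s * (1/2) \<le> s * q" using s by (intro mult_left_mono) auto
        moreover have "s / 4 * q = s * q / 4" by simp
        ultimately show ?thesis unfolding goal using H(3) s(1) by linarith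
      next
        case False
        have "p\<^sup>2 \<ge> (1 - \<bar>q\<bar>)\<^sup>2" 
        proof -
          have "q\<^sup>2 \<le> 1" using pq zero_le_power2[of p] by linarith
          then have "\<bar>q\<bar> \<le> 1" using abs_square_le_1 by auto
          then have "\<bar>q\<bar> * \<bar>q\<bar> \<le> \<bar>q\<bar> * 1" by (intro mult_left_mono) auto
          then show ?thesis using pq by (simp add: power2_eq_square algebra_simps)
        qed
        then have "1 - \<bar>q\<bar> \<le> \<bar>p\<bar>" unfolding abs_le_square_iff[symmetric] by linarith
        then have "s * (1 - \<bar>q\<bar>) \<le> s * \<bar>p\<bar>" using s by (intro mult_left_mono) auto
        then have 1: "s * (1 - \<bar>q\<bar>) \<le> H" using Hp by linarith
        have 2: "s * q \<le> s * (1/2)" using False s by (intro mult_left_mono) auto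
        have 3: "0 \<le> H" using s by (intro order_trans[OF mult_nonneg_nonneg[of s "\<bar>p\<bar>"] Hp]) auto
        have "s / 8 \<le> H - r / 4" if "r \<le> s / 2" "s - r \<le> H \<or> s + r \<le> H \<and> r \<le> 0" for r
          using that 3 s(1) by (elim disjE conjE) linarith+
        note main = this
        have "s - s * q \<le> H \<or> s + s * q \<le> H \<and> s * q \<le> 0"
        proof (cases "q \<ge> 0")
          case False
          then show ?thesis using 1 s(1) mult_nonneg_nonpos[of s q] by (simp add: algebra_simps)
        qed (use 1 in \<open>simp add: algebra_simps\<close>)
        with 2 have "s / 8 \<le> H - s * q / 4" by (intro main) simp_all
        then show ?thesis unfolding goal by simp
      qed
    qed
    moreover have "\<epsilon> / (128 * pi) * integral {0..1} (g t) \<le> s / 8"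
    proof -
      have "\<epsilon> / (128 * pi) * integral {0..1} (g t) \<le> \<epsilon> / (128 * pi) * (2 * pi * dm)"
        using len e by (intro mult_left_mono) auto
      also have "\<dots> = s / 8" by (simp add: s_def \<xi>_def)
      finally show ?thesis .
    qed
    ultimately show ?thesis by (meson order_trans)
  qed
  then show ?thesis using e by (intro exI[of _ "\<epsilon> / (128 * pi)"]) auto
qed

end

section \<open>Gage's inequality\<close>

lemma nonneg_of_deriv_nonneg:
  fixes f :: "real \<Rightarrow> real"
  assumes "\<And>x. 0 \<le> x \<Longrightarrow> (f has_real_derivative f' x) (at x)" "\<And>x. 0 \<le> x \<Longrightarrow> 0 \<le> f' x" "0 \<le> f 0" "0 \<le> x"
  shows "0 \<le> f x"
  using DERIV_nonneg_imp_nondecreasing[of 0 x f] assms by (meson order_trans)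

lemma cos_ge_taylor2: "1 - x\<^sup>2 / 2 \<le> cos x" if "0 \<le> x" for x :: real
proof -
  have "0 \<le> (\<lambda>x. cos x - 1 + x\<^sup>2 / 2) x"
  proof (rule nonneg_of_deriv_nonneg[OF _ _ _ that])
    show "((\<lambda>x. cos x - 1 + x\<^sup>2 / 2) has_real_derivative - sin x + x) (at x)" for x :: real
      by (auto intro!: derivative_eq_intros)
    show "0 \<le> - sin x + x" if "0 \<le> x" for x :: real using sin_x_le_x[OF that] by simp
  qed simp
  then show ?thesis by simp
qed

lemma sin_ge_taylor3: "x - x^3 / 6 \<le> sin x" if "0 \<le> x" for x :: real
proof -
  have "0 \<le> (\<lambda>x. sin x - x + x^3 / 6) x"
  proof (rule nonneg_of_deriv_nonneg[OF _ _ _ that])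
    show "((\<lambda>x. sin x - x + x^3 / 6) has_real_derivative cos x - 1 + x\<^sup>2 / 2) (at x)" for x :: real
      by (auto intro!: derivative_eq_intros)
    show "0 \<le> cos x - 1 + x\<^sup>2 / 2" if "0 \<le> x" for x :: real using cos_ge_taylor2[OF that] by simp
  qed simp
  then show ?thesis by simp
qed

lemma cos_le_taylor4: "cos x \<le> 1 - x\<^sup>2 / 2 + x^4 / 24" if "0 \<le> x" for x :: real
proof -
  have "0 \<le> (\<lambda>x. 1 - x\<^sup>2 / 2 + x^4 / 24 - cos x) x"
  proof (rule nonneg_of_deriv_nonneg[OF _ _ _ that])
    show "((\<lambda>x. 1 - x\<^sup>2 / 2 + x^4 / 24 - cos x) has_real_derivative - x + x^3 / 6 + sin x) (at x)" for x :: real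
      by (auto intro!: derivative_eq_intros)
    show "0 \<le> - x + x^3 / 6 + sin x" if "0 \<le> x" for x :: real using sin_ge_taylor3[OF that] by simp
  qed simp
  then show ?thesis by simp
qed

text \<open>The maximum of \<open>y * sin y\<close> on [0, pi] is about 1.82. What matters is a
  bound away from 2, so that \<open>1 - y * sin y\<close> has absolute value below 1 except at zeros
  of \<open>sin\<close>. The gap 1/1000 returns in \<open>kern_0_sq_le\<close>.\<close>

lemma mult_sin_bounds:
  assumes "\<bar>y\<bar> \<le> pi"
  shows "(sin y)\<^sup>2 \<le> y * sin y" "y * sin y \<le> 1999/1000"
proof -
  have pi: "pi \<le> 16/5" using pi_approx by simp
  have main: "(sin y)\<^sup>2 \<le> y * sin y \<and> y * sin y \<le> 1999/1000" if y: "0 \<le> y" "y \<le> pi" for y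
  proof
    have s0: "0 \<le> sin y" using sin_ge_zero y by blast
    show "(sin y)\<^sup>2 \<le> y * sin y" unfolding power2_eq_square
      using s0 sin_x_le_x y by (intro mult_right_mono) auto
    show "y * sin y \<le> 1999/1000"
    \<comment> \<open>\<open>8/5\<close> is an upper bound of \<open>pi / 2\<close>; beyond it
      \<open>sin y\<close> is the cosine of the small number \<open>s\<close> and is bounded by a
      Taylor polynomial.\<close>
    proof (cases "y \<le> 8/5")
      case True
      then have "y * sin y \<le> (8/5) * 1" using y s0 by (intro mult_mono) auto
      then show ?thesis by simp
    next
      case False
      define s where "s = y - pi / 2"
      have s: "0 \<le> s" "s \<le> 8/5" "sin y = cos s"
        using False y pi by (auto simp: s_def cos_diff)
      have "s * s \<le> (8/5) * (8/5)" using s by (intro mult_mono) auto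
      then have "(s * s) * (s * s) \<le> ((8/5) * (8/5)) * (s * s)" by (intro mult_right_mono) auto
      then have cs: "cos s \<le> 1 - (59/150) * (s * s)"
        using cos_le_taylor4[OF s(1)] by (simp add: power2_eq_square power4_eq_xxxx)
      then have "y * sin y \<le> y * (1 - (59/150) * (s * s))" using y s(3) by (intro mult_left_mono) auto
      moreover have "y \<le> 8/5 + s" using pi by (simp add: s_def)
      moreover have "0 \<le> 1 - (59/150) * (s * s)" using cs s(3) s0 by linarith
      ultimately have "y * sin y \<le> (8/5 + s) * (1 - (59/150) * (s * s))"
        by (meson mult_right_mono order_trans)
      also have "\<dots> = 8/5 + s - (472/750) * (s * s) - (59/150) * (s * s * s)" by (simp add: algebra_simps)
      also have "\<dots> \<le> 8/5 + s - (472/750) * (s * s)" using s by simp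
      also have "\<dots> \<le> 1999/1000"
      proof -
        \<comment> \<open>The concave quadratic is maximal at \<open>750/944\<close>, which
          \<open>1589/2000\<close> approximates.\<close>
        have "0 \<le> (s - 1589/2000)\<^sup>2" by simp
        then have "(1589/1000) * s - (1589/2000)*(1589/2000) \<le> s * s" by (simp add: power2_eq_square algebra_simps)
        then show ?thesis using s by simp
      qed
      finally show ?thesis .
    qed
  qed
  show "(sin y)\<^sup>2 \<le> y * sin y" "y * sin y \<le> 1999/1000"
    using main[of y] main[of "- y"] assms by (cases "y \<ge> 0"; simp)+
qed

lemma has_integral_cont: "continuous_on {a..b} f \<Longrightarrow> (f has_integral integral {a..b} f) {a..b}" for f :: "real \<Rightarrow> real"
  by (intro integrable_integral integrable_continuous_real)

lemmas lin_integral = integral_unique has_integral_add has_integral_diff has_integral_mult_right has_integral_cont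
lemmas integral_mono_intros = integral_le integrable_continuous_real
lemmas integral_nonneg_intros = integral_nonneg integrable_continuous_real

lemma integral_ext: "(\<And>u. f u = g u) \<Longrightarrow> integral S f = integral S g"
  by presburger

lemma integral_cauchy_schwarz:
  fixes f g :: "real \<Rightarrow> real"
  assumes "continuous_on {a..b} f" "continuous_on {a..b} g"
  shows "(integral {a..b} (\<lambda>x. f x * g x))\<^sup>2 \<le> integral {a..b} (\<lambda>x. (f x)\<^sup>2) * integral {a..b} (\<lambda>x. (g x)\<^sup>2)"
proof -
  define A where "A = integral {a..b} (\<lambda>x. (f x)\<^sup>2)"
  define B where "B = integral {a..b} (\<lambda>x. f x * g x)"
  define C where "C = integral {a..b} (\<lambda>x. (g x)\<^sup>2)"
  have quad: "0 \<le> A - 2 * s * B + s\<^sup>2 * C" for s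
  proof -
    have "0 \<le> integral {a..b} (\<lambda>x. (f x - s * g x)\<^sup>2)"
      by (intro integral_nonneg_intros continuous_intros assms) auto
    also have "(\<lambda>x. (f x - s * g x)\<^sup>2) = (\<lambda>x. (f x)\<^sup>2 - 2 * s * (f x * g x) + s\<^sup>2 * (g x)\<^sup>2)"
      by (auto simp: power2_eq_square algebra_simps)
    also have "integral {a..b} \<dots> = A - 2 * s * B + s\<^sup>2 * C"
      unfolding A_def B_def C_def
      by (intro lin_integral
        continuous_intros assms)
    finally show ?thesis .
  qed
  have C: "0 \<le> C" unfolding C_def by (intro integral_nonneg_intros continuous_intros assms) auto
  have "B\<^sup>2 \<le> A * C"
  proof (cases "C = 0")
    case True
    have "B = 0"
    proof (rule ccontr)
      assume "B \<noteq> 0"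
      then show False using quad[of "(A + 1) / (2 * B)"] True by simp
    qed
    then show ?thesis using True by simp
  next
    case False
    then have "0 \<le> (A - 2 * (B / C) * B + (B / C)\<^sup>2 * C) * C" using quad[of "B / C"] C by simp
    also have "\<dots> = A * C - B\<^sup>2" using False by (simp add: field_simps power2_eq_square)
    finally show ?thesis by simp
  qed
  then show ?thesis by (simp add: A_def B_def C_def)
qed

lemma int_diff: "continuous_on {a..b} f \<Longrightarrow> continuous_on {a..b} g \<Longrightarrow>
   integral {a..b} (\<lambda>x. f x - g x) = integral {a..b} f - integral {a..b} g" for f g :: "real \<Rightarrow> real"
  by (intro integral_diff integrable_continuous_real)

lemma int_add: "continuous_on {a..b} f \<Longrightarrow> continuous_on {a..b} g \<Longrightarrow>
   integral {a..b} (\<lambda>x. f x + g x) = integral {a..b} f + integral {a..b} g" for f g :: "real \<Rightarrow> real"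
  by (intro integral_add integrable_continuous_real)

text \<open>On functions of mean 0 orthogonal to \<open>cos\<close> and \<open>sin\<close>, convolution with \<open>kern\<close> is a multiple of the inverse of \<open>1 + d\<^sup>2/d\<theta>\<^sup>2\<close>;
  this makes \<open>c\<close> a free parameter, and turns the isoperimetric deficit into a quadratic form in \<open>g - m w\<close>.\<close>

definition kern :: "real \<Rightarrow> real \<Rightarrow> real" where
  "kern c x = 1 - (pi - x) * sin x + c * cos x"

section \<open>The isoperimetric deficit as a quadratic form\<close>

context closed_curve
begin

lemma inner_N_N: "N u' \<bullet> N u = cos (\<theta> u' - \<theta> u)" "(\<i> * N u') \<bullet> N u = - sin (\<theta> u' - \<theta> u)"
  by (simp_all add: N_cis inner_complex_def cos_diff sin_diff algebra_simps)

text \<open>This is \<open>2 * pi\<close> times the difference between the mean radius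
  \<open>len / (2 * pi)\<close> and the support function about the Steiner point, the mean of
  \<open>X\<close> in the angle measure \<open>w du\<close>.\<close>

definition \<Phi> :: "real \<Rightarrow> real" where
  "\<Phi> u = len - 2 * pi * (X u \<bullet> N u) + integral {0..1} (\<lambda>u'. (X u' \<bullet> N u) * w u')"

lemma X_w_integral: "integral {0..1} (\<lambda>u'. (X u' \<bullet> a) * w u') = integral {0..1} (\<lambda>u'. w u' *\<^sub>R X u') \<bullet> a"
proof -
  have "(\<lambda>u'. w u' *\<^sub>R X u') integrable_on {0..1}"
    by (intro integrable_continuous_real continuous_intros w_cont' X_cont)
  from integral_linear[OF this bounded_linear_inner_left[of a]] show ?thesis
    by (simp add: o_def mult.commute)
qed

lemma Phi_cont: "continuous_on S \<Phi>"
  unfolding \<Phi>_def X_w_integral by (intro continuous_intros X_cont N_cont)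

lemma per_int: "continuous_on UNIV f \<Longrightarrow> (\<And>u. f (u + 1) = f u) \<Longrightarrow> integral {a..a+1} f = integral {0..1} f" for f :: "real \<Rightarrow> real"
  by (rule periodic_integral)

text \<open>Integration by parts turns the integral of \<open>(pi - x) * sin x\<close> against
  \<open>g du\<close> into support values. Both parameters drop out: \<open>cos\<close> integrates
  to 0 against \<open>g du\<close> and \<open>w du\<close>, and against \<open>w du\<close> the
  terms \<open>1\<close> and \<open>(pi - x) * sin x\<close> both give
  \<open>2 * pi\<close>.\<close>

lemma Phi_kernel: "\<Phi> u = integral {u..u+1} (\<lambda>u'. kern c (\<theta> u' - \<theta> u) * (g u' - m * w u'))"
proof -
  define x where "x u' = \<theta> u' - \<theta> u" for u'
  have x0: "x u = 0" "x (u + 1) = 2 * pi" by (simp_all add: x_def theta_per)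
  have xd: "(x has_real_derivative w u') (at u')" for u'
    unfolding x_def[abs_def] by (auto intro!: derivative_eq_intros theta_u)
  have xc: "continuous_on S x" for S unfolding x_def[abs_def] by (intro continuous_intros theta_cont)
  have ftc: "integral {u..u+1} f' = f (u + 1) - f u" if "\<And>u'. (f has_real_derivative f' u') (at u')" for f f' :: "real \<Rightarrow> real"
    by (intro integral_unique fundamental_theorem_of_calculus)
      (auto simp: has_real_derivative_iff_has_vector_derivative[symmetric] intro!: has_field_derivative_at_within that)
  have cX: "continuous_on UNIV (\<lambda>u'. (X u' \<bullet> N u) * w u')" by (intro continuous_intros X_cont w_cont)
  define IX where "IX = integral {0..1} (\<lambda>u'. (X u' \<bullet> N u) * w u')"
  have IX: "integral {u..u+1} (\<lambda>u'. (X u' \<bullet> N u) * w u') = IX"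
    unfolding IX_def by (rule per_int[OF cX]) (simp add: X_per w_per)
  have w1: "integral {u..u+1} w = 2 * pi" using per_int[OF w_cont w_per] int_w by simp
  have g1: "integral {u..u+1} g = len" using per_int[OF g_cont g_per] by (simp add: len_def)
  have cg: "integral {u..u+1} (\<lambda>u'. cos (x u') * g u') = 0"
  proof -
    have "integral {u..u+1} (\<lambda>u'. (N u' \<bullet> N u) * g u') = integral {0..1} (\<lambda>u'. (N u' \<bullet> N u) * g u')"
      by (rule per_int) (auto intro!: continuous_intros N_cont g_cont simp: N_per g_per)
    then show ?thesis using int_N_g[of "N u"] by (simp add: inner_N_N(1) x_def)
  qed
  have cw: "integral {u..u+1} (\<lambda>u'. cos (x u') * w u') = 0"
  proof -
    have "integral {u..u+1} (\<lambda>u'. (N u' \<bullet> N u) * w u') = integral {0..1} (\<lambda>u'. (N u' \<bullet> N u) * w u')"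
      by (rule per_int) (auto intro!: continuous_intros N_cont w_cont simp: N_per w_per)
    then show ?thesis using int_N_w[of "N u"] by (simp add: inner_N_N(1) x_def)
  qed
  have sg: "integral {u..u+1} (\<lambda>u'. (pi - x u') * sin (x u') * g u') = 2 * pi * (X u \<bullet> N u) - IX"
  proof -
    have "integral {u..u+1} (\<lambda>u'. - w u' * ((X u' - X u) \<bullet> N u) - (pi - x u') * sin (x u') * g u')
       = (pi - x (u + 1)) * ((X (u + 1) - X u) \<bullet> N u) - (pi - x u) * ((X u - X u) \<bullet> N u)"
    proof (rule ftc)
      show "((\<lambda>u'. (pi - x u') * ((X u' - X u) \<bullet> N u)) has_real_derivative
         - w u' * ((X u' - X u) \<bullet> N u) - (pi - x u') * sin (x u') * g u') (at u')" for u'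
        by (rule derivative_eq_intros xd inner_X_deriv refl)+ (simp add: inner_N_N(2) x_def algebra_simps)
    qed
    then have 1: "integral {u..u+1} (\<lambda>u'. - w u' * ((X u' - X u) \<bullet> N u) - (pi - x u') * sin (x u') * g u') = 0"
      by (simp add: X_per)
    have "integral {u..u+1} (\<lambda>u'. - w u' * ((X u' - X u) \<bullet> N u) - (pi - x u') * sin (x u') * g u')
      = integral {u..u+1} (\<lambda>u'. - w u' * ((X u' - X u) \<bullet> N u)) - integral {u..u+1} (\<lambda>u'. (pi - x u') * sin (x u') * g u')"
      by (intro int_diff continuous_intros w_cont' g_cont' X_cont xc)
    moreover have "integral {u..u+1} (\<lambda>u'. - w u' * ((X u' - X u) \<bullet> N u))
      = integral {u..u+1} (\<lambda>u'. (X u \<bullet> N u) * w u' - (X u' \<bullet> N u) * w u')"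
      by (intro integral_ext) (simp add: inner_diff_left algebra_simps)
    moreover have "\<dots> = integral {u..u+1} (\<lambda>u'. (X u \<bullet> N u) * w u') - integral {u..u+1} (\<lambda>u'. (X u' \<bullet> N u) * w u')"
      by (intro int_diff continuous_intros w_cont' X_cont)
    ultimately show ?thesis using 1 w1 IX by (simp add: algebra_simps)
  qed
  have sw: "integral {u..u+1} (\<lambda>u'. (pi - x u') * sin (x u') * w u') = 2 * pi"
  proof -
    have "integral {u..u+1} (\<lambda>u'. (pi - x u') * sin (x u') * w u')
       = (- (pi - x (u + 1)) * cos (x (u + 1)) - sin (x (u + 1))) - (- (pi - x u) * cos (x u) - sin (x u))"
    proof (rule ftc)
      show "((\<lambda>u'. - (pi - x u') * cos (x u') - sin (x u')) has_real_derivative (pi - x u') * sin (x u') * w u') (at u')" for u'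
        by (rule derivative_eq_intros xd refl)+ (simp add: algebra_simps)
    qed
    then show ?thesis by (simp add: x0)
  qed
  have "integral {u..u+1} (\<lambda>u'. kern c (\<theta> u' - \<theta> u) * (g u' - m * w u'))
     = integral {u..u+1} (\<lambda>u'. (g u' - m * w u') + (c * (cos (x u') * g u') - (c * m) * (cos (x u') * w u'))
         - ((pi - x u') * sin (x u') * g u' - m * ((pi - x u') * sin (x u') * w u')))"
    by (intro integral_ext) (simp add: kern_def x_def algebra_simps)
  also have "\<dots> = (integral {u..u+1} g - m * integral {u..u+1} w) + (c * integral {u..u+1} (\<lambda>u'. cos (x u') * g u')
       - (c * m) * integral {u..u+1} (\<lambda>u'. cos (x u') * w u'))
       - (integral {u..u+1} (\<lambda>u'. (pi - x u') * sin (x u') * g u') - m * integral {u..u+1} (\<lambda>u'. (pi - x u') * sin (x u') * w u'))"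
    by (intro lin_integral
        continuous_intros w_cont' g_cont' xc)
  also have "\<dots> = len - 2 * pi * (X u \<bullet> N u) + IX"
    unfolding cg cw sg sw g1 w1 by (simp add: algebra_simps)
  finally show ?thesis unfolding \<Phi>_def IX_def by simp
qed

text \<open>By Cauchy's formula \<open>\<Phi>\<close> integrates to 0 against \<open>w du\<close>,
  which makes \<open>m\<close> free; against \<open>g du\<close> it gives the deficit.\<close>

lemma Phi_integral: "integral {0..1} (\<lambda>u. \<Phi> u * (g u - m * w u)) = len\<^sup>2 - 4 * pi * area"
proof -
  define C where "C = integral {0..1} (\<lambda>u'. w u' *\<^sub>R X u')"
  have P: "\<Phi> u = len - 2 * pi * (X u \<bullet> N u) + N u \<bullet> C" for u
    unfolding \<Phi>_def X_w_integral C_def by (simp add: inner_commute)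
  have "integral {0..1} (\<lambda>u. \<Phi> u * (g u - m * w u))
    = integral {0..1} (\<lambda>u. (len * g u - (len * m) * w u) - ((2 * pi) * ((X u \<bullet> N u) * g u) - (2 * pi * m) * (((X u - 0) \<bullet> N u) * w u))
        + ((N u \<bullet> C) * g u - m * ((N u \<bullet> C) * w u)))"
    by (intro integral_ext) (simp add: P algebra_simps)
  also have "\<dots> = (len * integral {0..1} g - (len * m) * integral {0..1} w)
     - ((2 * pi) * integral {0..1} (\<lambda>u. (X u \<bullet> N u) * g u) - (2 * pi * m) * integral {0..1} (\<lambda>u. ((X u - 0) \<bullet> N u) * w u))
     + (integral {0..1} (\<lambda>u. (N u \<bullet> C) * g u) - m * integral {0..1} (\<lambda>u. (N u \<bullet> C) * w u))"
    by (intro lin_integral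
        continuous_intros w_cont' g_cont' X_cont N_cont)
  also have "\<dots> = len\<^sup>2 - 4 * pi * area"
    using area_translate[of 0] unfolding int_h_w int_w int_N_g int_N_w len_def[symmetric] by (simp add: power2_eq_square)
  finally show ?thesis .
qed

end

lemma kern_0_sq_le:
  assumes "0 \<le> x" "x \<le> 2 * pi"
  shows "(kern 0 x)\<^sup>2 \<le> 1 - (sin x)\<^sup>2 / 1000"
proof -
  define y where "y = pi - x"
  have y: "\<bar>y\<bar> \<le> pi" "sin x = sin y" using assms by (auto simp: y_def)
  note b = mult_sin_bounds[OF y(1)]
  have "(sin y)\<^sup>2 * (1/1000) \<le> (y * sin y) * (2 - y * sin y)"
    using b order_trans[OF zero_le_power2 b(1)] by (intro mult_mono) auto
  moreover have "(kern 0 x)\<^sup>2 = 1 - (y * sin y) * (2 - y * sin y)"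
    unfolding kern_def y(2)[symmetric] by (simp add: y_def power2_eq_square algebra_simps)
  ultimately show ?thesis using y(2) by simp
qed

section \<open>Gage's inequality for curves with large inradius\<close>

context closed_curve
begin

text \<open>The integral of the squared curvature over arc length.\<close>

definition V1 :: real where "V1 = integral {0..1} (\<lambda>u. (w u)\<^sup>2 / g u)"

lemma g_ne: "g u \<noteq> 0" using g_pos[of u] by simp

lemma cont_div: "continuous_on S f \<Longrightarrow> continuous_on S (\<lambda>u. f u / g u)" for f :: "real \<Rightarrow> real"
  by (intro continuous_on_divide g_cont' ballI g_ne)

lemma V1_ge: "4 * pi\<^sup>2 \<le> V1 * len"
proof -
  have "(integral {0..1} (\<lambda>u. (w u / sqrt (g u)) * sqrt (g u)))\<^sup>2
     \<le> integral {0..1} (\<lambda>u. (w u / sqrt (g u))\<^sup>2) * integral {0..1} (\<lambda>u. (sqrt (g u))\<^sup>2)"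
    by (intro integral_cauchy_schwarz continuous_intros w_cont' g_cont') (use g_ne in auto)
  moreover have "(\<lambda>u. (w u / sqrt (g u)) * sqrt (g u)) = w" "(\<lambda>u. (w u / sqrt (g u))\<^sup>2) = (\<lambda>u. (w u)\<^sup>2 / g u)"
     "(\<lambda>u. (sqrt (g u))\<^sup>2) = g"
    using g_pos g_ne by (auto simp: power_divide less_imp_le)
  ultimately show ?thesis by (simp add: V1_def len_def int_w power_mult_distrib)
qed

lemma V1_pos: "V1 > 0"
proof -
  have "0 < V1 * len" using V1_ge pi_gt_zero by (meson less_le_trans mult_pos_pos zero_less_numeral zero_less_power)
  then show ?thesis using len_pos by (simp add: zero_less_mult_iff)
qed

lemma weighted_square: "integral {0..1} (\<lambda>u. (g u - m * w u)\<^sup>2 / g u) = len - 4 * pi * m + m\<^sup>2 * V1"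
proof -
  have "integral {0..1} (\<lambda>u. (g u - m * w u)\<^sup>2 / g u) = integral {0..1} (\<lambda>u. g u - (2 * m) * w u + m\<^sup>2 * ((w u)\<^sup>2 / g u))"
    using g_ne by (intro integral_ext) (simp add: power2_eq_square field_simps)
  also have "\<dots> = len - (2 * m) * integral {0..1} w + m\<^sup>2 * V1"
    unfolding len_def V1_def
    by (intro lin_integral
        continuous_intros w_cont' g_cont' cont_div) (simp add: g_ne)
  finally show ?thesis by (simp add: int_w)
qed

text \<open>Gage's inequality \<open>4 pi area V1 \<ge> 4 pi\<^sup>2 len\<close>, improved by the factor \<open>sqrt (1 - a\<^sup>2 / 250)\<close> that non-collapsed curves allow.\<close>

lemma gage_strict:
  assumes a: "a > 0" and z: "\<And>u. (X u - z) \<bullet> N u \<ge> a * len"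
  shows "len\<^sup>2 - 4 * pi * area \<le> sqrt (1 - a\<^sup>2 / 250) * (len * (len - 4 * pi\<^sup>2 / V1))" "a\<^sup>2 \<le> 250"
proof -
  \<comment> \<open>The minimiser of the right-hand side of \<open>weighted_square\<close>.\<close>
  define m where "m = 2 * pi / V1"
  define f where "f u = g u - m * w u" for u
  define S where "S = integral {0..1} (\<lambda>u. (f u)\<^sup>2 / g u)"
  have fc: "continuous_on A f" for A unfolding f_def[abs_def] by (intro continuous_intros g_cont' w_cont')
  have fper: "f (u + 1) = f u" for u by (simp add: f_def g_per w_per)
  have S: "S = len - 4 * pi\<^sup>2 / V1"
    unfolding S_def f_def weighted_square m_def using V1_pos by (simp add: power2_eq_square field_simps)
  have S0: "S \<ge> 0" unfolding S_def
    by (intro integral_nonneg_intros cont_div continuous_intros fc) (simp add: less_imp_le[OF g_pos])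
  have Sper: "integral {u..u+1} (\<lambda>u. (f u)\<^sup>2 / g u) = S" for u
    unfolding S_def by (rule per_int) (auto intro!: cont_div continuous_intros fc simp: fper g_per)
  have gper: "integral {u..u+1} g = len" for u using per_int[OF g_cont g_per] by (simp add: len_def)
  \<comment> \<open>The width in direction \<open>N u\<close> is at least
    \<open>2 * a * len\<close>, and it is an integral of \<open>sin\<close> against arc length over
    half a turn. So the angles cannot concentrate at multiples of pi, where the kernel has absolute
    value 1.\<close>
  have sq: "4 * a\<^sup>2 * len \<le> integral {u..u+1} (\<lambda>u'. (sin (\<theta> u' - \<theta> u))\<^sup>2 * g u')" for u
  proof -
    define F where "F u' = (X u' - X u) \<bullet> N u" for u'
    have Fd: "(F has_real_derivative - (g u' * sin (\<theta> u' - \<theta> u))) (at u')" for u'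
      unfolding F_def[abs_def] using inner_X_deriv[of "X u" "N u" u'] by (simp add: inner_N_N(2))
    obtain u1 where u1: "u \<le> u1" "u1 \<le> u + 1" "\<theta> u1 = \<theta> u + pi"
      using IVT'[of \<theta> u "\<theta> u + pi" "u + 1"] theta_cont theta_per[of u] by auto
    have "N u1 = - N u" by (simp add: N_cis u1(3) cis_mult[symmetric])
    then have "2 * a * len \<le> F u - F u1" using z[of u] z[of u1] by (simp add: F_def inner_diff_left)
    also have "\<dots> = integral {u..u1} (\<lambda>u'. g u' * sin (\<theta> u' - \<theta> u))"
    proof -
      have "((\<lambda>u'. - (g u' * sin (\<theta> u' - \<theta> u))) has_integral F u1 - F u) {u..u1}"
        by (rule fundamental_theorem_of_calculus[OF u1(1)])
          (auto simp: has_real_derivative_iff_has_vector_derivative[symmetric] intro!: has_field_derivative_at_within Fd)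
      from has_integral_neg[OF this] show ?thesis by (simp add: integral_unique)
    qed
    also have "\<dots> \<le> integral {u..u1} (\<lambda>u'. \<bar>sin (\<theta> u' - \<theta> u)\<bar> * g u')"
      by (intro integral_mono_intros continuous_intros g_cont' theta_cont)
        (use g_pos in \<open>auto simp: mult.commute intro!: mult_right_mono less_imp_le[OF g_pos]\<close>)
    also have "\<dots> \<le> integral {u..u+1} (\<lambda>u'. \<bar>sin (\<theta> u' - \<theta> u)\<bar> * g u')"
      using u1 by (intro integral_subset_le integrable_continuous_real continuous_intros g_cont' theta_cont)
        (auto intro!: mult_nonneg_nonneg less_imp_le[OF g_pos])
    finally have "(2 * a * len)\<^sup>2 \<le> (integral {u..u+1} (\<lambda>u'. (\<bar>sin (\<theta> u' - \<theta> u)\<bar> * sqrt (g u')) * sqrt (g u')))\<^sup>2"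
      using a len_pos g_pos by (intro power_mono) (auto simp: mult.assoc less_imp_le)
    also have "\<dots> \<le> integral {u..u+1} (\<lambda>u'. (\<bar>sin (\<theta> u' - \<theta> u)\<bar> * sqrt (g u'))\<^sup>2) * integral {u..u+1} (\<lambda>u'. (sqrt (g u'))\<^sup>2)"
      by (intro integral_cauchy_schwarz continuous_intros g_cont' theta_cont)
    also have "\<dots> = integral {u..u+1} (\<lambda>u'. (sin (\<theta> u' - \<theta> u))\<^sup>2 * g u') * len"
      using g_pos by (simp add: power_mult_distrib less_imp_le gper)
    finally have "(4 * a\<^sup>2 * len) * len \<le> integral {u..u+1} (\<lambda>u'. (sin (\<theta> u' - \<theta> u))\<^sup>2 * g u') * len"
      by (simp add: power2_eq_square algebra_simps)
    then show ?thesis using len_pos by simp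
  qed
  have kc: "continuous_on A (\<lambda>u'. kern 0 (\<theta> u' - \<theta> u))" for A u
    unfolding kern_def by (intro continuous_intros theta_cont)
  have k2: "integral {u..u+1} (\<lambda>u'. (kern 0 (\<theta> u' - \<theta> u))\<^sup>2 * g u') \<le> (1 - a\<^sup>2 / 250) * len" for u
  proof -
    have "integral {u..u+1} (\<lambda>u'. (kern 0 (\<theta> u' - \<theta> u))\<^sup>2 * g u')
       \<le> integral {u..u+1} (\<lambda>u'. g u' - (1/1000) * ((sin (\<theta> u' - \<theta> u))\<^sup>2 * g u'))"
    proof (intro integral_mono_intros continuous_intros g_cont' theta_cont kc)
      fix u' assume u': "u' \<in> {u..u+1}"
      then have "0 \<le> \<theta> u' - \<theta> u" "\<theta> u' - \<theta> u \<le> 2 * pi"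
        using theta_mono[of u u'] theta_mono[of u' "u + 1"] theta_per[of u] by auto
      from mult_right_mono[OF kern_0_sq_le[OF this] less_imp_le[OF g_pos[of u']]]
      show "(kern 0 (\<theta> u' - \<theta> u))\<^sup>2 * g u' \<le> g u' - (1/1000) * ((sin (\<theta> u' - \<theta> u))\<^sup>2 * g u')"
        by (simp add: algebra_simps)
    qed
    also have "\<dots> = integral {u..u+1} g - (1/1000) * integral {u..u+1} (\<lambda>u'. (sin (\<theta> u' - \<theta> u))\<^sup>2 * g u')"
      by (intro lin_integral continuous_intros g_cont' theta_cont)
    also have "\<dots> \<le> (1 - a\<^sup>2 / 250) * len" using sq[of u] gper[of u] by (simp add: algebra_simps)
    finally show ?thesis .
  qed
  define lam where "lam = 1 - a\<^sup>2 / 250"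
  have lam: "0 \<le> lam"
  proof -
    have "0 \<le> integral {0..0+1} (\<lambda>u'. (kern 0 (\<theta> u' - \<theta> 0))\<^sup>2 * g u')"
      by (intro integral_nonneg_intros continuous_intros kc g_cont') (auto simp: less_imp_le[OF g_pos])
    then have "0 \<le> lam * len" using k2[of 0] by (simp add: lam_def)
    then show ?thesis using len_pos by (simp add: zero_le_mult_iff)
  qed
  then show "a\<^sup>2 \<le> 250" by (simp add: lam_def)
  have Phi_le: "\<bar>\<Phi> u\<bar> \<le> sqrt (lam * len * S)" for u
  proof -
    have "(\<Phi> u)\<^sup>2 = (integral {u..u+1} (\<lambda>u'. (kern 0 (\<theta> u' - \<theta> u) * sqrt (g u')) * (f u' / sqrt (g u'))))\<^sup>2"
      unfolding Phi_kernel[of u 0 m] f_def using g_ne by simp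
    also have "\<dots> \<le> integral {u..u+1} (\<lambda>u'. (kern 0 (\<theta> u' - \<theta> u) * sqrt (g u'))\<^sup>2) * integral {u..u+1} (\<lambda>u'. (f u' / sqrt (g u'))\<^sup>2)"
      by (intro integral_cauchy_schwarz continuous_intros kc g_cont' fc) (use g_ne in auto)
    also have "\<dots> = integral {u..u+1} (\<lambda>u'. (kern 0 (\<theta> u' - \<theta> u))\<^sup>2 * g u') * S"
      using g_pos Sper[of u] by (simp add: power_mult_distrib power_divide less_imp_le)
    also have "\<dots> \<le> (lam * len) * S" unfolding lam_def by (rule mult_right_mono[OF k2 S0])
    finally show ?thesis by (simp add: real_le_rsqrt power2_abs abs_le_square_iff)
  qed
  \<comment> \<open>The improved factor is available for the supremum of \<open>\<Phi>\<close> but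
    not for this L^1 norm; hence it enters the product only once, as a square root.\<close>
  have fabs: "integral {0..1} (\<lambda>u. \<bar>f u\<bar>) \<le> sqrt (len * S)"
  proof -
    have "(integral {0..1} (\<lambda>u. \<bar>f u\<bar>))\<^sup>2 = (integral {0..1} (\<lambda>u. sqrt (g u) * (\<bar>f u\<bar> / sqrt (g u))))\<^sup>2"
      using g_ne by simp
    also have "\<dots> \<le> integral {0..1} (\<lambda>u. (sqrt (g u))\<^sup>2) * integral {0..1} (\<lambda>u. (\<bar>f u\<bar> / sqrt (g u))\<^sup>2)"
      by (intro integral_cauchy_schwarz continuous_intros g_cont' fc) (use g_ne in auto)
    also have "\<dots> = len * S" unfolding S_def len_def using g_pos by (simp add: power_divide less_imp_le)
    finally show ?thesis by (rule real_le_rsqrt)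
  qed
  have "len\<^sup>2 - 4 * pi * area = integral {0..1} (\<lambda>u. \<Phi> u * f u)" unfolding f_def Phi_integral ..
  also have "\<dots> \<le> integral {0..1} (\<lambda>u. sqrt (lam * len * S) * \<bar>f u\<bar>)"
  proof (intro integral_mono_intros continuous_intros fc Phi_cont)
    show "\<Phi> u * f u \<le> sqrt (lam * len * S) * \<bar>f u\<bar>" for u
      using mult_right_mono[OF Phi_le[of u], of "\<bar>f u\<bar>"] abs_ge_self[of "\<Phi> u * f u"] by (simp add: abs_mult)
  qed
  also have "\<dots> = sqrt (lam * len * S) * integral {0..1} (\<lambda>u. \<bar>f u\<bar>)" by simp
  also have "\<dots> \<le> sqrt (lam * len * S) * sqrt (len * S)"
    using fabs lam len_pos S0 by (intro mult_left_mono) auto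
  also have "\<dots> = sqrt lam * (len * S)"
    using len_pos S0 by (simp add: real_sqrt_mult mult_ac)
  finally show "len\<^sup>2 - 4 * pi * area \<le> sqrt (1 - a\<^sup>2 / 250) * (len * (len - 4 * pi\<^sup>2 / V1))"
    by (simp add: S lam_def)
qed

end

section \<open>Length, area and isoperimetric deficit\<close>

lemma pow_cheb:
  fixes \<alpha> :: real
  assumes "\<alpha> \<ge> 0" "k \<ge> 0" "m \<ge> 0"
  shows "0 \<le> (k - m) * (k powr \<alpha> - m powr \<alpha>)"
proof (cases "k \<ge> m")
  case True
  then have "m powr \<alpha> \<le> k powr \<alpha>" using assms by (intro powr_mono2) auto
  then show ?thesis using True by simp
next
  case False
  then have "k powr \<alpha> \<le> m powr \<alpha>" using assms by (intro powr_mono2) auto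
  then show ?thesis using False by (intro mult_nonpos_nonpos) auto
qed

context convex_flow
begin

definition L :: "real \<Rightarrow> real" where "L t = integral {0..1} (g t)"
definition A :: "real \<Rightarrow> real" where "A t = (1/2) * integral {0..1} (\<lambda>u. (X t u \<bullet> N t u) * g t u)"

lemma len_area: "closed_curve.len (g t) = L t" "closed_curve.area (X t) (N t) (g t) = A t" if "t < 0"
  using closed_curve.len_def[OF curve_at[OF that]] closed_curve.area_def[OF curve_at[OF that]]
  by (simp_all add: L_def A_def)

lemma v_nonneg: "t < 0 \<Longrightarrow> v t u \<ge> 0"
  by (simp add: v_eq)

lemma v_per: "t < 0 \<Longrightarrow> v t (u + 1) = v t u"
  by (simp add: v_eq w_per g_per)

lemma leibniz:
  fixes f f' :: "real \<Rightarrow> real \<Rightarrow> real"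
  assumes d: "\<And>t u. t < T \<Longrightarrow> ((\<lambda>t. f t u) has_real_derivative f' t u) (at t)"
    and c: "continuous_on ({..<T} \<times> UNIV) (\<lambda>(t,u). f t u)" "continuous_on ({..<T} \<times> UNIV) (\<lambda>(t,u). f' t u)"
    and t: "t < (T::real)"
  shows "((\<lambda>t. integral {0..1} (f t)) has_real_derivative integral {0..1} (f' t)) (at t)"
proof -
  have "((\<lambda>t. integral (cbox 0 1) (f t)) has_real_derivative integral (cbox 0 1) (f' t)) (at t within {..<T})"
  proof (rule leibniz_rule_field_derivative)
    show "((\<lambda>t. f t u) has_real_derivative f' t u) (at t within {..<T})" if "t \<in> {..<T}" for t u
      using d that by (auto intro: has_field_derivative_at_within)
    show "continuous_on ({..<T} \<times> cbox 0 1) (\<lambda>(t,u). f' t u)"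
      by (rule continuous_on_subset[OF c(2)]) auto
    show "f s integrable_on cbox 0 1" if "s \<in> {..<T}" for s
    proof (rule integrable_continuous)
      have "continuous_on (cbox 0 1) (\<lambda>u. (\<lambda>(t,u). f t u) (s, u))"
        by (rule continuous_on_compose2[OF c(1)]) (use that in \<open>auto intro!: continuous_intros\<close>)
      then show "continuous_on (cbox 0 1) (f s)" by simp
    qed
  qed (use t in auto)
  then show ?thesis using at_within_open[of t "{..<T}"] t by simp
qed

lemma conts:
  "continuous_on ({..<0} \<times> UNIV) (\<lambda>p. X (fst p) (snd p))" "continuous_on ({..<0} \<times> UNIV) (\<lambda>p. N (fst p) (snd p))"
  "continuous_on ({..<0} \<times> UNIV) (\<lambda>p. g (fst p) (snd p))" "continuous_on ({..<0} \<times> UNIV) (\<lambda>p. w (fst p) (snd p))"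
  "continuous_on ({..<0} \<times> UNIV) (\<lambda>p. v (fst p) (snd p))" "continuous_on ({..<0} \<times> UNIV) (\<lambda>p. \<psi> (fst p) (snd p))"
  "continuous_on ({..<0} \<times> UNIV) (\<lambda>p. \<psi>u (fst p) (snd p))"
  using X_cont N_cont g_cont w_cont v_cont psi_cont psiu_cont by (simp_all add: case_prod_unfold)

lemmas csec = section_cont[OF X_cont] section_cont[OF N_cont] section_cont[OF g_cont] section_cont[OF w_cont]
  section_cont[OF v_cont] section_cont[OF psi_cont] section_cont[OF psiu_cont]

lemma L_deriv: "t < 0 \<Longrightarrow> (L has_real_derivative - integral {0..1} (\<lambda>u. v t u * w t u)) (at t)"
proof -
  assume t: "t < 0"
  have "((\<lambda>t. integral {0..1} (g t)) has_real_derivative integral {0..1} (\<lambda>u. - (v t u * w t u))) (at t)"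
    by (rule leibniz[OF g_t g_cont _ t]) (simp_all add: case_prod_unfold continuous_intros conts)
  then show ?thesis by (simp add: L_def[abs_def])
qed

lemma A_deriv: "t < 0 \<Longrightarrow> (A has_real_derivative - integral {0..1} (\<lambda>u. v t u * g t u)) (at t)"
proof -
  assume t: "t < 0"
  interpret c: closed_curve "X t" "N t" "g t" "w t" "\<Theta> t" by (rule curve_at[OF t])
  define f' where "f' t u = (- v t u + \<psi> t u * (X t u \<bullet> (\<i> * N t u))) * g t u - (X t u \<bullet> N t u) * (v t u * w t u)" for t u
  have d: "((\<lambda>t. (X t u \<bullet> N t u) * g t u) has_real_derivative f' t u) (at t)" if "t < 0" for t u
  proof -
    have "((\<lambda>t. X t u \<bullet> N t u) has_real_derivative X t u \<bullet> (\<psi> t u *\<^sub>R (\<i> * N t u)) + ((- v t u) *\<^sub>R N t u) \<bullet> N t u) (at t)"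
      using bounded_bilinear.has_vector_derivative[OF bounded_bilinear_inner X_t[OF that] N_t[OF that]]
      by (simp add: has_real_derivative_iff_has_vector_derivative)
    moreover have "N t u \<bullet> N t u = 1" using norm_N[OF that, of u] by (simp add: dot_square_norm)
    ultimately have "((\<lambda>t. X t u \<bullet> N t u) has_real_derivative - v t u + \<psi> t u * (X t u \<bullet> (\<i> * N t u))) (at t)" by simp
    from DERIV_mult[OF this g_t[OF that, of u]] show ?thesis
      unfolding f'_def by (rule DERIV_cong) (simp add: algebra_simps)
  qed
  have i: "((\<lambda>t. integral {0..1} (\<lambda>u. (X t u \<bullet> N t u) * g t u)) has_real_derivative integral {0..1} (f' t)) (at t)"
    by (rule leibniz[OF d _ _ t]) (auto simp: case_prod_unfold f'_def intro!: continuous_intros conts)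
  \<comment> \<open>Apart from \<open>- 2 * v * g\<close>, the integrand \<open>f'\<close> is the
    derivative along the curve of the periodic function \<open>v\<close> times the tangential
    component of \<open>X\<close>.\<close>
  have "integral {0..1} (\<lambda>u. g t u * \<psi> t u * ((X t u - 0) \<bullet> (\<i> * N t u)) + (g t u - w t u * ((X t u - 0) \<bullet> N t u)) * v t u) = 0"
    by (rule periodic_deriv_integral[OF DERIV_mult[OF v_u[OF t] c.X_has_derivative_prod(2)[where z = 0]]])
      (use v_per[OF t, of 0] X_per[OF t, of 0] N_per[OF t, of 0] in simp)
  moreover have "integral {0..1} (f' t) = integral {0..1} (\<lambda>u. (g t u * \<psi> t u * ((X t u - 0) \<bullet> (\<i> * N t u)) + (g t u - w t u * ((X t u - 0) \<bullet> N t u)) * v t u)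
      - 2 * (v t u * g t u))"
    by (intro integral_ext) (simp add: f'_def algebra_simps)
  moreover have "\<dots> = integral {0..1} (\<lambda>u. g t u * \<psi> t u * ((X t u - 0) \<bullet> (\<i> * N t u)) + (g t u - w t u * ((X t u - 0) \<bullet> N t u)) * v t u)
      - 2 * integral {0..1} (\<lambda>u. v t u * g t u)"
    by (intro lin_integral continuous_intros csec t)
  ultimately have "integral {0..1} (f' t) = - 2 * integral {0..1} (\<lambda>u. v t u * g t u)" by simp
  then show ?thesis unfolding A_def[abs_def] using DERIV_cmult[OF i, of "1/2"] by simp
qed

lemma L_pos: "t < 0 \<Longrightarrow> L t > 0"
  using closed_curve.len_pos[OF curve_at] len_area by simp

definition P :: "real \<Rightarrow> real" where "P t = (L t)\<^sup>2 - 4 * pi * A t"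

lemma int_w: "t < 0 \<Longrightarrow> integral {0..1} (w t) = 2 * pi"
  using closed_curve.int_w[OF curve_at] by simp

text \<open>Both factors have the sign of the curvature minus \<open>m\<close>, as in Chebyshev's
  integral inequality.\<close>

lemma weighted_cheb:
  assumes t: "t < 0" and m: "m \<ge> 0"
  shows "integral {0..1} (\<lambda>u. (w t u - m * g t u) * (v t u - m powr \<alpha>))
     = integral {0..1} (\<lambda>u. v t u * w t u) - m * integral {0..1} (\<lambda>u. v t u * g t u) - m powr \<alpha> * (2 * pi - m * L t)"
   "\<And>u. 0 \<le> (w t u - m * g t u) * (v t u - m powr \<alpha>)"
proof -
  have "integral {0..1} (\<lambda>u. (w t u - m * g t u) * (v t u - m powr \<alpha>))
    = integral {0..1} (\<lambda>u. v t u * w t u - m * (v t u * g t u) - m powr \<alpha> * (w t u - m * g t u))"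
    by (intro integral_ext) (simp add: algebra_simps)
  also have "\<dots> = integral {0..1} (\<lambda>u. v t u * w t u) - m * integral {0..1} (\<lambda>u. v t u * g t u)
     - m powr \<alpha> * (integral {0..1} (w t) - m * integral {0..1} (g t))"
    by (intro lin_integral continuous_intros csec t)
  finally show "integral {0..1} (\<lambda>u. (w t u - m * g t u) * (v t u - m powr \<alpha>))
     = integral {0..1} (\<lambda>u. v t u * w t u) - m * integral {0..1} (\<lambda>u. v t u * g t u) - m powr \<alpha> * (2 * pi - m * L t)"
    using int_w[OF t] by (simp add: L_def)
  show "0 \<le> (w t u - m * g t u) * (v t u - m powr \<alpha>)" for u
  proof -
    have gp: "g t u > 0" using g_pos[OF t] .
    have "w t u - m * g t u = g t u * (w t u / g t u - m)" using gp by (simp add: field_simps)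
    moreover have "0 \<le> (w t u / g t u - m) * ((w t u / g t u) powr \<alpha> - m powr \<alpha>)"
      using w_nonneg[OF t, of u] gp alpha m by (intro pow_cheb) auto
    ultimately show ?thesis using gp v_eq[OF t, of u] by (simp add: mult.assoc)
  qed
qed

text \<open>For the mean curvature \<open>m = 2 * pi / L t\<close> the last term of
  \<open>weighted_cheb\<close> vanishes, and what is left is the derivative of the deficit.\<close>

lemma P_deriv: "t < 0 \<Longrightarrow> (P has_real_derivative
     - 2 * L t * integral {0..1} (\<lambda>u. (w t u - (2 * pi / L t) * g t u) * (v t u - (2 * pi / L t) powr \<alpha>))) (at t)"
proof -
  assume t: "t < 0"
  have m: "2 * pi / L t \<ge> 0" using L_pos[OF t] by simp
  have "(P has_real_derivative 2 * L t * (- integral {0..1} (\<lambda>u. v t u * w t u)) - 4 * pi * (- integral {0..1} (\<lambda>u. v t u * g t u))) (at t)"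
    unfolding P_def[abs_def] by (auto intro!: derivative_eq_intros L_deriv[OF t] A_deriv[OF t])
  then show ?thesis
    by (rule DERIV_cong) (unfold weighted_cheb(1)[OF t m], use L_pos[OF t] in \<open>simp add: field_simps\<close>)
qed

lemma P_antimono:
  assumes "s \<le> t" "t < 0"
  shows "P t \<le> P s"
proof (rule DERIV_nonpos_imp_nonincreasing[OF assms(1)])
  fix x assume x: "s \<le> x" "x \<le> t"
  then have x0: "x < 0" using assms by simp
  have m: "2 * pi / L x \<ge> 0" using L_pos[OF x0] by simp
  let ?I = "integral {0..1} (\<lambda>u. (w x u - (2 * pi / L x) * g x u) * (v x u - (2 * pi / L x) powr \<alpha>))"
  have "0 \<le> ?I"
    by (intro integral_nonneg_intros continuous_intros csec x0 weighted_cheb(2)[OF x0 m])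
  then show "\<exists>y. (P has_real_derivative y) (at x) \<and> y \<le> 0"
    using L_pos[OF x0] P_deriv[OF x0] by (intro exI[of _ "- 2 * L x * ?I"] conjI) (assumption, simp add: mult_nonneg_nonneg less_imp_le)
qed

lemma P_nonneg:
  assumes shrink: "\<exists>p. \<forall>e>0. \<forall>\<^sub>F t in at_left 0. \<forall>u. norm (X t u - p) < e" and t: "t < 0"
  shows "P t \<ge> 0"
proof (rule ccontr)
  assume neg: "\<not> P t \<ge> 0"
  obtain p where p: "\<And>e. e > 0 \<Longrightarrow> \<forall>\<^sub>F t in at_left 0. \<forall>u. norm (X t u - p) < e" using shrink by blast
  \<comment> \<open>Close to extinction \<open>4 * pi * A s\<close> is at most
    \<open>4 * pi * (pi * e)\<close>, hence at most half of \<open>- P t\<close>; the bound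
    \<open>e \<le> 1\<close> replaces \<open>e * e\<close> by \<open>e\<close>.\<close>
  define e where "e = min 1 (- P t / (8 * pi * pi))"
  have e: "e > 0" using neg by (simp add: e_def divide_neg_pos)
  obtain b where b: "b < 0" "\<And>s u. b < s \<Longrightarrow> s < 0 \<Longrightarrow> norm (X s u - p) < e"
    using p[OF e] unfolding eventually_at_left_field by auto
  define s where "s = max t (b / 2)"
  have s: "t \<le> s" "s < 0" "b < s" using b t by (auto simp: s_def)
  interpret c: closed_curve "X s" "N s" "g s" "w s" "\<Theta> s" by (rule curve_at[OF s(2)])
  have ne: "norm (X s u - p) \<le> e" for u using b(2)[OF s(3,2)] less_imp_le by blast
  have Ls: "L s \<le> 2 * pi * e" using c.len_le_of_dist[OF ne] len_area[OF s(2)] by simp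
  have "2 * A s \<le> e * L s"
  proof -
    have "2 * A s = integral {0..1} (\<lambda>u. ((X s u - p) \<bullet> N s u) * g s u)"
      using c.area_translate[of p] len_area[OF s(2)] by simp
    also have "\<dots> \<le> integral {0..1} (\<lambda>u. e * g s u)"
    proof (intro integral_mono_intros continuous_intros csec s(2) mult_right_mono less_imp_le[OF g_pos[OF s(2)]])
      show "(X s u - p) \<bullet> N s u \<le> e" for u
        using norm_cauchy_schwarz[of "X s u - p" "N s u"] ne[of u] norm_N[OF s(2), of u] by simp
    qed
    finally show ?thesis by (simp add: L_def)
  qed
  also have "\<dots> \<le> e * (2 * pi * e)" using Ls e by (intro mult_left_mono) auto
  also have "\<dots> \<le> 1 * (2 * pi * e)" using e by (intro mult_right_mono) (auto simp: e_def)
  finally have "4 * pi * A s \<le> 4 * pi * (pi * e)" by simp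
  also have "\<dots> \<le> 4 * pi * (pi * (- P t / (8 * pi * pi)))" by (intro mult_left_mono) (auto simp: e_def)
  also have "\<dots> = - P t / 2" by (simp add: field_simps)
  finally have "4 * pi * A s \<le> - P t / 2" .
  then have "P s \<ge> P t / 2" using zero_le_power2[of "L s"] unfolding P_def[of s] by linarith
  then show False using P_antimono[OF s(1,2)] neg by simp
qed

end

section \<open>Flows that sweep the plane and shrink to a point\<close>

locale sweeping_flow = convex_flow +
  assumes sweep: "\<And>z. \<forall>\<^sub>F t in at_bot. z \<in> \<Omega> t"
    and shrink: "\<exists>p. \<forall>e>0. \<forall>\<^sub>F t in at_left 0. \<forall>u. norm (X t u - p) < e"
begin

lemma P_ge_0: "t < 0 \<Longrightarrow> P t \<ge> 0"
  by (rule P_nonneg[OF shrink])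

lemma inner_radius:
  obtains a where "a > 0" "\<And>t. t < 0 \<Longrightarrow> \<exists>z. \<forall>u. (X t u - z) \<bullet> N t u \<ge> a * L t"
  using inradius[OF sweep] by (auto simp: L_def)

lemma area_ge_length: 
  obtains a where "a > 0" "\<And>t. t < 0 \<Longrightarrow> 2 * A t \<ge> a * (L t)\<^sup>2"
proof -
  obtain a where a: "a > 0" "\<And>t. t < 0 \<Longrightarrow> \<exists>z. \<forall>u. (X t u - z) \<bullet> N t u \<ge> a * L t"
    using inner_radius by blast
  have "2 * A t \<ge> a * (L t)\<^sup>2" if t: "t < 0" for t
  proof -
    interpret c: closed_curve "X t" "N t" "g t" "w t" "\<Theta> t" by (rule curve_at[OF t])
    obtain z where "\<And>u. (X t u - z) \<bullet> N t u \<ge> a * L t" using a(2)[OF t] by blast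
    from c.area_ge[OF this] show ?thesis by (simp add: len_area[OF t] power2_eq_square)
  qed
  with a(1) that show thesis by blast
qed

lemma A_pos: "t < 0 \<Longrightarrow> A t > 0"
proof -
  assume t: "t < 0"
  obtain a where "a > 0" "2 * A t \<ge> a * (L t)\<^sup>2" using area_ge_length t by metis
  moreover have "a * (L t)\<^sup>2 > 0" using \<open>a > 0\<close> L_pos[OF t] by simp
  ultimately show ?thesis by linarith
qed

lemma A_at_bot: "filterlim A at_top at_bot"
  unfolding filterlim_at_top
proof
  fix Z :: real
  define R where "R = max 1 Z * 4"
  have R: "R > 0" "R \<ge> 4" "R \<ge> 4 * Z" by (auto simp: R_def)
  have "\<forall>\<^sub>F t in at_bot. t < (0::real)" by (rule eventually_gt_at_bot)
  with sweep[of "of_real R"] sweep[of "- of_real R"] sweep[of "\<i> * of_real R"] sweep[of "- (\<i> * of_real R)"]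
  show "\<forall>\<^sub>F t in at_bot. Z \<le> A t"
  proof eventually_elim
    fix t assume m: "of_real R \<in> \<Omega> t" "- of_real R \<in> \<Omega> t" "\<i> * of_real R \<in> \<Omega> t" "- (\<i> * of_real R) \<in> \<Omega> t" and t: "t < 0"
    interpret c: closed_curve "X t" "N t" "g t" "w t" "\<Theta> t" by (rule curve_at[OF t])
    \<comment> \<open>One of the two coordinates of a unit vector has absolute value at least 1/2,
      so four points on the axes already bound the support function from below.\<close>
    have h: "(X t u - 0) \<bullet> N t u \<ge> R / 2" for u
    proof -
      note s = Omega_support[OF t m(1), of u] Omega_support[OF t m(2), of u] Omega_support[OF t m(3), of u] Omega_support[OF t m(4), of u]
      have "X t u \<bullet> N t u \<ge> R * \<bar>Re (N t u)\<bar>" "X t u \<bullet> N t u \<ge> R * \<bar>Im (N t u)\<bar>"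
        using s by (auto simp: inner_complex_def abs_if algebra_simps)
      moreover have "\<bar>Re (N t u)\<bar> + \<bar>Im (N t u)\<bar> \<ge> 1"
        using cmod_le[of "N t u"] norm_N[OF t, of u] by simp
      then have "R * \<bar>Re (N t u)\<bar> + R * \<bar>Im (N t u)\<bar> \<ge> R"
        using R mult_left_mono[of 1 "\<bar>Re (N t u)\<bar> + \<bar>Im (N t u)\<bar>" R] by (simp add: algebra_simps)
      ultimately show ?thesis by simp
    qed
    have "integral {0..1} (\<lambda>u. (R/2) * w t u) \<le> integral {0..1} (\<lambda>u. ((X t u - 0) \<bullet> N t u) * w t u)"
      by (intro integral_mono_intros continuous_intros csec t mult_right_mono h w_nonneg[OF t])
    then have "R * pi \<le> L t" using c.int_h_w[of 0] int_w[OF t] len_area(1)[OF t] by simp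
    moreover have "R * 3 \<le> R * pi" using R pi_gt3 by (intro mult_left_mono) auto
    ultimately have "L t \<ge> 3" "L t \<ge> 1" using R by linarith+
    then have "R / 2 * 1 \<le> R / 2 * L t" using R by (intro mult_left_mono) auto
    also have "\<dots> \<le> 2 * A t" using c.area_ge[OF h] by (simp add: len_area[OF t])
    finally show "Z \<le> A t" using R by simp
  qed
qed

text \<open>Chebyshev's inequality in the measure \<open>w du\<close> for the curvature and its
  power \<alpha> - 1, which is nondecreasing because \<alpha> \<ge> 1; \<open>m\<close> is the mean
  curvature in this measure.\<close>

lemma int_v_w_ge:
  assumes t: "t < 0" and al: "\<alpha> \<ge> 1"
  shows "2 * pi * integral {0..1} (\<lambda>u. v t u * w t u) \<ge> integral {0..1} (\<lambda>u. v t u * g t u) * closed_curve.V1 (g t) (w t)"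
proof -
  interpret c: closed_curve "X t" "N t" "g t" "w t" "\<Theta> t" by (rule curve_at[OF t])
  define m where "m = c.V1 / (2 * pi)"
  have m: "m > 0" using c.V1_pos by (simp add: m_def)
  have nn: "0 \<le> (w t u - m * g t u) * (v t u - m powr (\<alpha> - 1) * (w t u / g t u))" for u
  proof -
    define k where "k = w t u / g t u"
    have gp: "g t u > 0" using g_pos[OF t] .
    have k0: "k \<ge> 0" using w_nonneg[OF t, of u] gp by (simp add: k_def)
    have ve: "v t u = k powr \<alpha>" unfolding k_def by (rule v_eq[OF t])
    have vk: "v t u = k powr (\<alpha> - 1) * k"
      unfolding ve using k0 powr_add[of k "\<alpha> - 1" 1] by (cases "k = 0") auto
    have "w t u - m * g t u = g t u * (k - m)" using gp by (simp add: k_def field_simps)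
    then have "(w t u - m * g t u) * (v t u - m powr (\<alpha> - 1) * (w t u / g t u))
        = g t u * k * ((k - m) * (k powr (\<alpha> - 1) - m powr (\<alpha> - 1)))"
      using vk by (simp add: k_def[symmetric] algebra_simps)
    moreover have "0 \<le> (k - m) * (k powr (\<alpha> - 1) - m powr (\<alpha> - 1))" using al k0 m by (intro pow_cheb) auto
    ultimately show ?thesis using gp k0 by simp
  qed
  have "0 \<le> integral {0..1} (\<lambda>u. (w t u - m * g t u) * (v t u - m powr (\<alpha> - 1) * (w t u / g t u)))"
    by (intro integral_nonneg_intros continuous_intros csec t c.cont_div nn)
  also have "\<dots> = integral {0..1} (\<lambda>u. v t u * w t u - m * (v t u * g t u) - m powr (\<alpha> - 1) * ((w t u)\<^sup>2 / g t u - m * w t u))"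
    by (intro integral_ext) (use c.g_ne in \<open>simp add: field_simps power2_eq_square\<close>)
  also have "\<dots> = integral {0..1} (\<lambda>u. v t u * w t u) - m * integral {0..1} (\<lambda>u. v t u * g t u)
     - m powr (\<alpha> - 1) * (c.V1 - m * integral {0..1} (w t))"
    unfolding c.V1_def
    by (intro lin_integral continuous_intros c.cont_div csec t)
  also have "c.V1 - m * integral {0..1} (w t) = 0" using int_w[OF t] by (simp add: m_def)
  finally show ?thesis by (simp add: m_def field_simps)
qed

lemma deficit_zero_ge1:
  assumes al: "\<alpha> \<ge> 1" and t: "t < 0"
  shows "P t = 0"
proof -
  obtain a where a: "a > 0" and za: "\<And>t. t < 0 \<Longrightarrow> \<exists>z. \<forall>u. (X t u - z) \<bullet> N t u \<ge> a * L t"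
    using inner_radius by blast
  obtain b where b: "b > 0" "\<And>t. t < 0 \<Longrightarrow> 2 * A t \<ge> b * (L t)\<^sup>2" using area_ge_length by blast
  define l where "l = sqrt (1 - a\<^sup>2 / 250)"
  have "a\<^sup>2 \<le> 250"
  proof -
    interpret c: closed_curve "X t" "N t" "g t" "w t" "\<Theta> t" by (rule curve_at[OF t])
    obtain z where "\<And>u. (X t u - z) \<bullet> N t u \<ge> a * c.len" using za[OF t] len_area(1)[OF t] by auto
    then show ?thesis by (rule c.gage_strict(2)[OF a])
  qed
  then have l: "0 \<le> l" "l < 1" using a unfolding l_def by (auto simp: real_sqrt_lt_1_iff)
  \<comment> \<open>The factor \<open>l < 1\<close> is traded for an exponent: a fraction
    \<open>1 - l\<close> of the slack in Gage's inequality pays for \<open>c' * P\<close>.\<close>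
  define c' where "c' = 1 - l"
  have c': "c' > 0" using l by (simp add: c'_def)
  define G where "G t = P t * A t powr (- 1 - c')" for t
  have mono: "G t \<le> G s" if st: "s \<le> t" for s
  proof (rule DERIV_nonpos_imp_nonincreasing[OF st])
    fix x assume "s \<le> x" "x \<le> t"
    then have x: "x < 0" using t by simp
    interpret c: closed_curve "X x" "N x" "g x" "w x" "\<Theta> x" by (rule curve_at[OF x])
    define V where "V = integral {0..1} (\<lambda>u. v x u * w x u)"
    define Y where "Y = integral {0..1} (\<lambda>u. v x u * g x u)"
    have Ax: "A x > 0" and Lx: "L x > 0" and P0: "P x \<ge> 0" using A_pos L_pos P_ge_0 x by auto
    have Y0: "Y \<ge> 0" unfolding Y_def
      by (intro integral_nonneg_intros continuous_intros csec x) (use v_nonneg[OF x] g_pos[OF x] in \<open>simp add: less_imp_le\<close>)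
    have dP: "(P has_real_derivative 2 * L x * (- V) - 4 * pi * (- Y)) (at x)"
      unfolding P_def[abs_def] V_def Y_def by (auto intro!: derivative_eq_intros L_deriv[OF x] A_deriv[OF x])
    have dA: "(A has_real_derivative - Y) (at x)" unfolding Y_def by (rule A_deriv[OF x])
    have dpow: "((\<lambda>x. A x powr (- 1 - c')) has_real_derivative (- 1 - c') * A x powr (- 1 - c' - 1) * (- Y)) (at x)"
      using DERIV_fun_powr[OF dA Ax, of "- 1 - c'"] by simp
    have pw: "A x powr (- 1 - c') = A x powr (- 1 - c' - 1) * A x"
      using Ax powr_add[of "A x" "- 1 - c' - 1" 1] by simp
    have d: "(G has_real_derivative A x powr (- 1 - c' - 1) * ((4 * pi * Y - 2 * L x * V) * A x + (1 + c') * P x * Y)) (at x)"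
      unfolding G_def[abs_def] by (rule DERIV_cong[OF DERIV_mult[OF dP dpow]]) (simp add: pw algebra_simps)
    obtain z where z: "\<And>u. (X x u - z) \<bullet> N x u \<ge> a * c.len" using za[OF x] len_area(1)[OF x] by auto
    have g1: "P x \<le> l * (L x * (L x - 4 * pi\<^sup>2 / c.V1))"
      using c.gage_strict(1)[OF a z] by (simp add: len_area[OF x] P_def l_def)
    define Q where "Q = L x * c.V1 - 4 * pi\<^sup>2"
    have Q0: "Q \<ge> 0" using c.V1_ge len_area(1)[OF x] by (simp add: Q_def mult.commute)
    have V1p: "c.V1 > 0" by (rule c.V1_pos)
    have "P x * c.V1 \<le> l * (L x * (L x - 4 * pi\<^sup>2 / c.V1)) * c.V1" using g1 V1p by (intro mult_right_mono) auto
    also have "\<dots> = l * (L x * Q)" unfolding Q_def using V1p by (simp add: field_simps)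
    finally have g2: "P x * c.V1 \<le> l * (L x * Q)" .
    have "c' * P x * (4 * pi\<^sup>2) \<le> c' * P x * (L x * c.V1)" using Q0 c' P0 by (intro mult_left_mono) (auto simp: Q_def)
    also have "\<dots> = (c' * L x) * (P x * c.V1)" by simp
    also have "\<dots> \<le> (c' * L x) * (l * (L x * Q))" using g2 c' Lx by (intro mult_left_mono) auto
    also have "\<dots> \<le> (c' * L x) * (1 * (L x * Q))" using l c' Lx Q0 by (intro mult_left_mono mult_right_mono) auto
    also have "\<dots> = L x * (L x * Q - l * (L x * Q))" by (simp add: c'_def algebra_simps)
    also have "\<dots> \<le> L x * (L x * Q - P x * c.V1)" using g2 Lx by (intro mult_left_mono) auto
    also have "\<dots> = L x * c.V1 * (4 * pi * A x) - 4 * pi\<^sup>2 * (L x)\<^sup>2"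
      by (simp add: Q_def P_def algebra_simps power2_eq_square)
    finally have "4 * pi * (pi * (c' * P x)) \<le> 4 * pi * (L x * c.V1 * A x - pi * (L x)\<^sup>2)"
      by (simp add: algebra_simps power2_eq_square)
    \<comment> \<open>Gage's inequality \<open>pi * L^2 \<le> L * V1 * A\<close> with a multiple of
      the deficit to spare.\<close>
    then have key: "pi * (c' * P x) \<le> L x * c.V1 * A x - pi * (L x)\<^sup>2"
      by (rule mult_left_le_imp_le) simp
    have "L x * A x * (Y * c.V1) \<le> L x * A x * (2 * pi * V)" 
      using int_v_w_ge[OF x al] Lx Ax unfolding V_def Y_def by (intro mult_left_mono) auto
    moreover have "Y * (pi * (c' * P x)) \<le> Y * (L x * c.V1 * A x - pi * (L x)\<^sup>2)" using key Y0 by (rule mult_left_mono)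
    ultimately have "pi * (Y * (c' * P x)) \<le> pi * (L x * A x * (2 * V) - Y * (L x)\<^sup>2)"
      by (simp add: algebra_simps)
    then have "Y * (c' * P x) \<le> L x * A x * (2 * V) - Y * (L x)\<^sup>2"
      by (rule mult_left_le_imp_le) simp
    then have "(4 * pi * Y - 2 * L x * V) * A x + (1 + c') * P x * Y \<le> 0"
      by (simp add: P_def algebra_simps)
    then show "\<exists>y. (G has_real_derivative y) (at x) \<and> y \<le> 0"
      using d by (intro exI[of _ "A x powr (- 1 - c' - 1) * ((4 * pi * Y - 2 * L x * V) * A x + (1 + c') * P x * Y)"] conjI mult_nonneg_nonpos) auto
  qed
  have lim: "((\<lambda>s. (2 / b) * A s powr (- c')) \<longlongrightarrow> (2 / b) * 0) at_bot"
    by (intro tendsto_mult_left tendsto_neg_powr[OF _ A_at_bot]) (use c' in auto)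
  have "G t \<le> (2 / b) * 0"
  proof (rule tendsto_lowerbound[OF lim])
    show "\<forall>\<^sub>F s in at_bot. G t \<le> 2 / b * A s powr - c'"
    proof (rule eventually_mono[OF eventually_le_at_bot[of t]])
      fix s assume st: "s \<le> t"
      then have s: "s < 0" using t by simp
      have As: "A s > 0" using A_pos[OF s] .
      have "P s \<le> (L s)\<^sup>2" using As by (simp add: P_def)
      also have "\<dots> \<le> 2 / b * A s" using b(1) b(2)[OF s] by (simp add: field_simps)
      finally have "P s \<le> 2 / b * A s" .
      then have "G s \<le> (2 / b * A s) * A s powr (- 1 - c')" unfolding G_def by (intro mult_right_mono) auto
      also have "\<dots> = 2 / b * A s powr (- c')" using As powr_add[of "A s" 1 "- 1 - c'"] by simp
      finally show "G t \<le> 2 / b * A s powr - c'" using mono[OF st] by simp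
    qed
  qed auto
  then have "P t * A t powr (- 1 - c') \<le> 0" by (simp add: G_def)
  then have "P t \<le> 0" using A_pos[OF t] by (simp add: mult_le_0_iff)
  then show ?thesis using P_ge_0[OF t] by simp
qed

end

section \<open>Curves near a circle\<close>

text \<open>The zeros of this kernel on \<open>[0, pi]\<close> are \<open>pi / 4\<close> and \<open>3 pi / 4\<close>. As \<open>sgn (cos (2 y))\<close> is orthogonal to \<open>1\<close> and \<open>cos\<close>,
  this choice of the constant and of the \<open>cos\<close> coefficient minimises the \<open>L\<^sup>1\<close> norm; it has to be below \<open>pi\<close>.\<close>

definition skern :: "real \<Rightarrow> real" where
  "skern y = pi * sqrt 2 / 4 - y * sin y - pi / 4 * cos y"

lemma skern_minus: "skern (- y) = skern y"
  by (simp add: skern_def)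

lemma skern_cont: "continuous_on S skern"
  unfolding skern_def[abs_def] by (intro continuous_intros) auto

lemma sin_cos_3pi4: "sin (3 * pi / 4) = sqrt 2 / 2" "cos (3 * pi / 4) = - (sqrt 2 / 2)"
proof -
  have e: "3 * pi / 4 = pi - pi / 4" by simp
  show "sin (3 * pi / 4) = sqrt 2 / 2" "cos (3 * pi / 4) = - (sqrt 2 / 2)"
    unfolding e sin_pi_minus cos_pi_minus by (simp_all add: sin_45 cos_45)
qed

lemma skern_deriv: "(skern has_real_derivative - (1 - pi / 4) * sin y - y * cos y) (at y)"
  unfolding skern_def[abs_def] by (auto intro!: derivative_eq_intros simp: algebra_simps)

text \<open>The function decreases up to pi / 2 and increases after 3 pi / 4. Between these points
  it is convex with nonpositive end values.\<close>

lemma skern_sign: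
  assumes "0 \<le> y"
  shows "y \<le> pi / 4 \<Longrightarrow> skern y \<ge> 0" "pi / 4 \<le> y \<Longrightarrow> y \<le> 3 * pi / 4 \<Longrightarrow> skern y \<le> 0"
    "3 * pi / 4 \<le> y \<Longrightarrow> y \<le> pi \<Longrightarrow> skern y \<ge> 0"
proof -
  have z: "skern (pi / 4) = 0" "skern (3 * pi / 4) = 0"
    unfolding skern_def sin_cos_3pi4 by (simp_all add: sin_45 cos_45 field_simps)
  have pi4: "pi / 4 \<le> 1" using pi_less_4 by simp
  have dec: "skern b \<le> skern a" if "0 \<le> a" "a \<le> b" "b \<le> pi / 2" for a b
  proof (rule DERIV_nonpos_imp_nonincreasing[OF that(2)])
    fix x assume "a \<le> x" "x \<le> b"
    then have "0 \<le> sin x" "0 \<le> cos x" "0 \<le> x" using that by (auto intro!: sin_ge_zero cos_ge_zero)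
    then have "0 \<le> (1 - pi / 4) * sin x" "0 \<le> x * cos x" using pi4 by simp_all
    then have "- (1 - pi / 4) * sin x - x * cos x \<le> 0" by linarith
    then show "\<exists>d. (skern has_real_derivative d) (at x) \<and> d \<le> 0" using skern_deriv by blast
  qed
  show "skern y \<ge> 0" if "y \<le> pi / 4"
    using dec[OF assms that] z by simp
  have conv: "convex_on {pi / 2..3 * pi / 4} skern"
  proof (rule f''_ge0_imp_convex)
    fix x assume x: "x \<in> {pi / 2..3 * pi / 4}"
    show "(skern has_real_derivative - (1 - pi / 4) * sin x - x * cos x) (at x)" by (rule skern_deriv)
    show "((\<lambda>x. - (1 - pi / 4) * sin x - x * cos x) has_real_derivative - (1 - pi / 4) * cos x - (cos x - x * sin x)) (at x)"
      by (auto intro!: derivative_eq_intros simp: algebra_simps)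
    have s: "sin x \<ge> 0" using x by (intro sin_ge_zero) auto
    have c: "cos x \<le> 0" using cos_ge_zero[of "pi - x"] x by simp
    have "0 \<le> x * sin x" "0 \<le> (2 - pi / 4) * (- cos x)" using s c x pi4 by (auto intro!: mult_nonneg_nonneg mult_nonneg_nonpos)
    then show "- (1 - pi / 4) * cos x - (cos x - x * sin x) \<ge> 0" by (simp add: algebra_simps)
  qed simp
  show "skern y \<le> 0" if y: "pi / 4 \<le> y" "y \<le> 3 * pi / 4"
  proof (cases "y \<le> pi / 2")
    case True
    then show ?thesis using dec[of "pi / 4" y] z y by simp
  next
    case False
    have h: "skern (pi / 2) \<le> 0" using dec[of "pi / 4" "pi / 2"] z by simp
    define q where "q = (y - pi / 2) / (pi / 4)"
    have q: "0 \<le> q" "q \<le> 1" using False y by (auto simp: q_def field_simps)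
    have e: "y = (1 - q) *\<^sub>R (pi / 2) + q *\<^sub>R (3 * pi / 4)" by (simp add: q_def field_simps)
    have "skern y \<le> (1 - q) * skern (pi / 2) + q * skern (3 * pi / 4)"
      by (subst e, rule convex_onD[OF conv]) (use q in auto)
    also have "\<dots> \<le> 0" using q h z by (simp add: mult_nonneg_nonpos)
    finally show ?thesis .
  qed
  show "skern y \<ge> 0" if y: "3 * pi / 4 \<le> y" "y \<le> pi"
  proof -
    have "skern (3 * pi / 4) \<le> skern y"
    proof (rule DERIV_nonneg_imp_nondecreasing[OF y(1)])
      fix x assume x: "3 * pi / 4 \<le> x" "x \<le> y"
      define r where "r = pi - x"
      have r: "0 \<le> r" "r \<le> pi / 4" using x y by (auto simp: r_def)
      have "sin r \<le> sin (pi / 4)" "cos r \<ge> cos (pi / 4)" using r by (auto intro!: sin_monotone_2pi_le cos_monotone_0_pi_le)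
      then have sc: "sin x \<le> sqrt 2 / 2" "- cos x \<ge> sqrt 2 / 2" by (simp_all add: r_def sin_45 cos_45)
      have "1 \<le> x" using x(1) pi_gt3 by simp
      then have "1 * (sqrt 2 / 2) \<le> x * (- cos x)" using sc by (intro mult_mono) auto
      moreover have "(1 - pi / 4) * sin x \<le> (1 - pi / 4) * (sqrt 2 / 2)" using sc pi4 by (intro mult_left_mono) auto
      moreover have "(1 - pi / 4) * (sqrt 2 / 2) \<le> 1 * (sqrt 2 / 2)" by (intro mult_right_mono) auto
      ultimately have "(1 - pi / 4) * sin x \<le> x * (- cos x)" by linarith
      then have "- (1 - pi / 4) * sin x - x * cos x \<ge> 0" by (simp add: algebra_simps)
      then show "\<exists>d. (skern has_real_derivative d) (at x) \<and> 0 \<le> d" using skern_deriv by blast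
    qed
    then show ?thesis using z by simp
  qed
qed

text \<open>The value is about 2.6, below pi. Its double is still below the \<open>2 * pi\<close>
  that \<open>near_circle\<close> can afford.\<close>

lemma skern_abs_integral: "((\<lambda>y. \<bar>skern y\<bar>) has_integral 2 * pi * (sqrt 2 - 1)) {- pi..pi}"
proof -
  define H where "H y = pi * sqrt 2 / 4 * y + y * cos y - (1 + pi / 4) * sin y" for y
  have Hd: "(H has_real_derivative skern y) (at y within S)" for y S
    unfolding H_def[abs_def] skern_def by (auto intro!: derivative_eq_intros simp: algebra_simps)
  have pos: "((\<lambda>y. \<bar>skern y\<bar>) has_integral H b - H a) {a..b}" if "a \<le> b" "\<And>y. y \<in> {a..b} \<Longrightarrow> skern y \<ge> 0" for a b
    by (rule has_integral_eq[of _ skern], use that in simp)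
      (intro fundamental_theorem_of_calculus that(1) Hd[unfolded has_real_derivative_iff_has_vector_derivative])
  have neg: "((\<lambda>y. \<bar>skern y\<bar>) has_integral - (H b - H a)) {a..b}" if "a \<le> b" "\<And>y. y \<in> {a..b} \<Longrightarrow> skern y \<le> 0" for a b
    by (rule has_integral_eq[of _ "\<lambda>y. - skern y"], use that in simp)
      (intro has_integral_neg fundamental_theorem_of_calculus that(1) Hd[unfolded has_real_derivative_iff_has_vector_derivative])
  have le: "- pi \<le> - (3 * pi / 4)" "- (3 * pi / 4) \<le> - (pi / 4)" "- (pi / 4) \<le> pi / 4" "pi / 4 \<le> 3 * pi / 4" "3 * pi / 4 \<le> pi" by simp_all
  have 1: "((\<lambda>y. \<bar>skern y\<bar>) has_integral H (- (3 * pi / 4)) - H (- pi)) {- pi..- (3 * pi / 4)}"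
  proof (rule pos[OF le(1)])
    show "skern y \<ge> 0" if "y \<in> {- pi..- (3 * pi / 4)}" for y
      using skern_sign(3)[of "- y"] that pi_gt_zero by (simp add: skern_minus)
  qed
  have 2: "((\<lambda>y. \<bar>skern y\<bar>) has_integral - (H (- (pi / 4)) - H (- (3 * pi / 4)))) {- (3 * pi / 4)..- (pi / 4)}"
  proof (rule neg[OF le(2)])
    show "skern y \<le> 0" if "y \<in> {- (3 * pi / 4)..- (pi / 4)}" for y
      using skern_sign(2)[of "- y"] that pi_gt_zero by (simp add: skern_minus)
  qed
  have 3: "((\<lambda>y. \<bar>skern y\<bar>) has_integral H (pi / 4) - H (- (pi / 4))) {- (pi / 4)..pi / 4}"
  proof (rule pos[OF le(3)])
    show "skern y \<ge> 0" if "y \<in> {- (pi / 4)..pi / 4}" for y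
      using skern_sign(1)[of "y"] skern_sign(1)[of "- y"] that by (cases "y \<ge> 0") (auto simp: skern_minus)
  qed
  have 4: "((\<lambda>y. \<bar>skern y\<bar>) has_integral - (H (3 * pi / 4) - H (pi / 4))) {pi / 4..3 * pi / 4}"
  proof (rule neg[OF le(4)])
    show "skern y \<le> 0" if "y \<in> {pi / 4..3 * pi / 4}" for y
      using skern_sign(2)[of y] that pi_gt_zero by simp
  qed
  have 5: "((\<lambda>y. \<bar>skern y\<bar>) has_integral H pi - H (3 * pi / 4)) {3 * pi / 4..pi}"
  proof (rule pos[OF le(5)])
    show "skern y \<ge> 0" if "y \<in> {3 * pi / 4..pi}" for y
      using skern_sign(3)[of y] that pi_gt_zero by simp
  qed
  have Hm: "H (- y) = - H y" for y by (simp add: H_def)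
  have Hv: "H (pi / 4) = pi\<^sup>2 * sqrt 2 / 16 - sqrt 2 / 2" "H (3 * pi / 4) = 3 * pi\<^sup>2 * sqrt 2 / 16 - pi * sqrt 2 / 2 - sqrt 2 / 2"
    "H pi = pi\<^sup>2 * sqrt 2 / 4 - pi"
    unfolding H_def sin_cos_3pi4 by (simp_all add: sin_45 cos_45 power2_eq_square algebra_simps)
  have "((\<lambda>y. \<bar>skern y\<bar>) has_integral (H (- (3 * pi / 4)) - H (- pi)) + (- (H (- (pi / 4)) - H (- (3 * pi / 4))))
      + (H (pi / 4) - H (- (pi / 4))) + (- (H (3 * pi / 4) - H (pi / 4))) + (H pi - H (3 * pi / 4))) {- pi..pi}"
    by (rule has_integral_combine[OF _ _ has_integral_combine[OF _ _ has_integral_combine[OF _ _ has_integral_combine[OF _ _ 1 2] 3] 4] 5]) auto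
  then show ?thesis unfolding Hm Hv by (simp add: algebra_simps)
qed

lemma skern_bound: "\<bar>y\<bar> \<le> pi \<Longrightarrow> \<bar>skern y\<bar> \<le> 6"
proof -
  assume y: "\<bar>y\<bar> \<le> pi"
  have "\<bar>y * sin y\<bar> \<le> pi * 1" unfolding abs_mult using y by (intro mult_mono) auto
  moreover have "\<bar>pi / 4 * cos y\<bar> \<le> pi / 4 * 1" unfolding abs_mult by (intro mult_mono) auto
  moreover have "sqrt 2 \<le> 1.5" by (rule real_le_lsqrt) (auto simp: power2_eq_square)
  then have "pi * sqrt 2 / 4 \<le> pi * 1.5 / 4" by simp
  moreover have "pi * sqrt 2 / 4 \<ge> 0" by simp
  moreover have "pi \<le> 16/5" using pi_approx by simp
  ultimately show ?thesis unfolding skern_def abs_le_iff by linarith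
qed

section \<open>A Schur test for convolution in the normal angle\<close>

lemma cont_param_integral:
  fixes h :: "real \<Rightarrow> real \<Rightarrow> real"
  assumes "continuous_on UNIV (\<lambda>p. h (fst p) (snd p))"
  shows "continuous_on S (\<lambda>u. integral {a..b} (h u))"
proof -
  have "continuous_on (S \<times> cbox a b) (\<lambda>(u, r). h u r)"
    using continuous_on_subset[OF assms] by (simp add: case_prod_unfold)
  from integral_continuous_on_param[OF this] show ?thesis by simp
qed

lemma integral_swap_real:
  fixes h :: "real \<Rightarrow> real \<Rightarrow> real"
  assumes "continuous_on UNIV (\<lambda>p. h (fst p) (snd p))"
  shows "integral {a..b} (\<lambda>u. integral {c..d} (h u)) = integral {c..d} (\<lambda>r. integral {a..b} (\<lambda>u. h u r))"
  using integral_swap_continuous[of a c b d h] continuous_on_subset[OF assms]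
  by (simp add: case_prod_unfold)

lemma integral_reflect_unit:
  fixes f :: "real \<Rightarrow> real"
  shows "integral {0..1} (\<lambda>s. f (1 - s)) = integral {0..1} f"
proof -
  have "integral {0..1} (\<lambda>s. f (1 - s)) = integral {0 - 1..1 - 1} (\<lambda>s. f (s + 1))"
    using Henstock_Kurzweil_Integration.integral_reflect_real[where f = "\<lambda>s. f (1 - s)" and a = 0 and b = 1] by (simp add: add.commute)
  also have "\<dots> = integral {0..1} f" using integral_shift_real_ivl[of 0 1 1 f] by simp
  finally show ?thesis .
qed

lemma section_continuous:
  "continuous_on UNIV (\<lambda>p. h (fst p) (snd p)) \<Longrightarrow> continuous_on S (h u)"
  "continuous_on UNIV (\<lambda>p. h (fst p) (snd p)) \<Longrightarrow> continuous_on S (\<lambda>u. h u r)"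
  for h :: "real \<Rightarrow> real \<Rightarrow> real"
  by (drule continuous_on_compose2[where f = "\<lambda>r. (u, r)" and s = S], auto intro!: continuous_intros)
    (drule continuous_on_compose2[where f = "\<lambda>u. (u, r)" and s = S], auto intro!: continuous_intros)

context closed_curve
begin

text \<open>A Schur test with weight \<open>\<omega>\<close> that ends in \<open>G\<close> instead
  of the square of \<open>f\<close>. By \<open>fG\<close> and the inequality of arithmetic and
  geometric means, the product of two values of \<open>f\<close> is at most half of the sum of the
  two mixed products of \<open>G\<close> and \<open>\<omega>\<close>. These contribute equally
  because the kernel is symmetric.\<close>

lemma schur:
  fixes K f \<omega> G :: "real \<Rightarrow> real"
  assumes K: "continuous_on UNIV K" "\<And>x. K (2 * pi - x) = K x"
    and c: "continuous_on UNIV f" "continuous_on UNIV \<omega>" "continuous_on UNIV G"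
    and per: "\<And>u. f (u + 1) = f u" "\<And>u. \<omega> (u + 1) = \<omega> u" "\<And>u. G (u + 1) = G u"
    and nn: "\<And>u. \<omega> u \<ge> 0" "\<And>u. G u \<ge> 0" and fG: "\<And>u. (f u)\<^sup>2 \<le> \<omega> u * G u"
    and B: "\<And>u. integral {u..u+1} (\<lambda>u'. \<bar>K (\<theta> u' - \<theta> u)\<bar> * \<omega> u') \<le> B"
  shows "integral {0..1} (\<lambda>u. f u * integral {u..u+1} (\<lambda>u'. K (\<theta> u' - \<theta> u) * f u')) \<le> B * integral {0..1} G"
proof -
  have cc: "continuous_on UNIV (\<lambda>p::real\<times>real. h (k p))" if "continuous_on UNIV h" "continuous_on UNIV k" for h :: "real \<Rightarrow> real" and k
    by (rule continuous_on_compose2[OF that]) auto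
  note ci = continuous_intros cc[OF c(1)] cc[OF c(2)] cc[OF c(3)] cc[OF K(1)] cc[OF theta_cont]
  have shift: "integral {u..u+1} F = integral {0..1} (\<lambda>r. F (u + r))" for u and F :: "real \<Rightarrow> real"
    using integral_shift_real_ivl[of u u "u + 1" F] by (simp add: add.commute)
  define k where "k u r = \<bar>K (\<theta> (u + r) - \<theta> u)\<bar>" for u r
  have k0: "k u r \<ge> 0" for u r by (simp add: k_def)
  define D1 where "D1 u r = G u * (k u r * \<omega> (u + r))" for u r
  define D2 where "D2 u r = k u r * G (u + r) * \<omega> u" for u r
  define E where "E u r = f u * (K (\<theta> (u + r) - \<theta> u) * f (u + r))" for u r
  have cD1: "continuous_on UNIV (\<lambda>p. D1 (fst p) (snd p))" unfolding D1_def k_def by (intro ci)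
  have cD2: "continuous_on UNIV (\<lambda>p. D2 (fst p) (snd p))" unfolding D2_def k_def by (intro ci)
  have cE: "continuous_on UNIV (\<lambda>p. E (fst p) (snd p))" unfolding E_def by (intro ci)
  have pt: "E u r \<le> 1/2 * (D1 u r + D2 u r)" for u r
  proof -
    have "(f u * f (u + r))\<^sup>2 \<le> (\<omega> u * G u) * (\<omega> (u + r) * G (u + r))"
      unfolding power_mult_distrib using fG nn by (intro mult_mono) auto
    also have "\<dots> \<le> ((G u * \<omega> (u + r) + G (u + r) * \<omega> u) / 2)\<^sup>2"
    proof -
      have "0 \<le> (G u * \<omega> (u + r) - G (u + r) * \<omega> u)\<^sup>2" by simp
      then show ?thesis by (simp add: power2_eq_square field_simps)
    qed
    finally have "\<bar>f u * f (u + r)\<bar>\<^sup>2 \<le> ((G u * \<omega> (u + r) + G (u + r) * \<omega> u) / 2)\<^sup>2" by simp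
    then have "\<bar>f u * f (u + r)\<bar> \<le> (G u * \<omega> (u + r) + G (u + r) * \<omega> u) / 2"
      by (rule power2_le_imp_le) (use nn in simp)
    then have "k u r * \<bar>f u * f (u + r)\<bar> \<le> k u r * ((G u * \<omega> (u + r) + G (u + r) * \<omega> u) / 2)"
      using k0 by (intro mult_left_mono)
    moreover have "E u r \<le> k u r * \<bar>f u * f (u + r)\<bar>"
      unfolding E_def k_def abs_mult[symmetric] by (simp add: mult_ac)
    ultimately show ?thesis unfolding D1_def D2_def by (simp add: algebra_simps)
  qed
  have per_th: "\<theta> (u - 1) = \<theta> u - 2 * pi" for u using theta_per[of "u - 1"] by simp
  \<comment> \<open>The two points are exchanged: shift \<open>u\<close> by \<open>- r\<close>,
    using periodicity, and then reflect \<open>r\<close> to \<open>1 - r\<close>. One turn adds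
    \<open>2 * pi\<close> to the angle, whence the form \<open>K (2 * pi - x) = K x\<close> of
    symmetry.\<close>
  have "integral {0..1} (\<lambda>u. integral {0..1} (D2 u)) = integral {0..1} (\<lambda>r. integral {0..1} (\<lambda>u. D2 u r))"
    by (rule integral_swap_real[OF cD2])
  also have "\<dots> = integral {0..1} (\<lambda>r. integral {0..1} (\<lambda>u. D2 (u - r) r))"
  proof (rule arg_cong[where f = "integral _"], rule ext)
    fix r
    have "integral {0..1} (\<lambda>u. D2 (u - r) r) = integral {- r..- r + 1} (\<lambda>u. D2 u r)"
      using integral_shift_real_ivl[of "-r" "- r" "- r + 1" "\<lambda>u. D2 u r"] by simp
    also have "\<dots> = integral {0..1} (\<lambda>u. D2 u r)"
    proof (rule periodic_integral[OF section_continuous(2)[OF cD2]])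
      fix u
      have "u + 1 + r = (u + r) + 1" by simp
      then show "D2 (u + 1) r = D2 u r" unfolding D2_def k_def by (simp only: per theta_per) simp
    qed
    finally show "integral {0..1} (\<lambda>u. D2 u r) = integral {0..1} (\<lambda>u. D2 (u - r) r)" by simp
  qed
  also have "\<dots> = integral {0..1} (\<lambda>u. integral {0..1} (\<lambda>r. D2 (u - r) r))"
    by (rule integral_swap_real[symmetric]) (unfold D2_def k_def, intro ci)
  also have "\<dots> = integral {0..1} (\<lambda>u. integral {0..1} (D1 u))"
  proof (rule arg_cong[where f = "integral _"], rule ext)
    fix u
    have "integral {0..1} (\<lambda>r. D2 (u - r) r) = integral {0..1} (\<lambda>s. D2 (u - (1 - s)) (1 - s))"
      by (rule integral_reflect_unit[symmetric])
    also have "(\<lambda>s. D2 (u - (1 - s)) (1 - s)) = D1 u"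
    proof
      fix s
      have "\<omega> (u - (1 - s)) = \<omega> (u + s)" using per(2)[of "u - (1 - s)"] by simp
      moreover have "\<theta> (u - (1 - s)) = \<theta> (u + s) - 2 * pi" using per_th[of "u + s"] by (simp add: algebra_simps)
      moreover have "K (\<theta> u - (\<theta> (u + s) - 2 * pi)) = K (\<theta> (u + s) - \<theta> u)" using K(2)[of "\<theta> (u + s) - \<theta> u"] by (simp add: algebra_simps)
      ultimately show "D2 (u - (1 - s)) (1 - s) = D1 u s" by (simp add: D1_def D2_def k_def)
    qed
    finally show "integral {0..1} (\<lambda>r. D2 (u - r) r) = integral {0..1} (D1 u)" .
  qed
  finally have D12: "integral {0..1} (\<lambda>u. integral {0..1} (D2 u)) = integral {0..1} (\<lambda>u. integral {0..1} (D1 u))" .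
  have "integral {0..1} (\<lambda>u. f u * integral {u..u+1} (\<lambda>u'. K (\<theta> u' - \<theta> u) * f u')) = integral {0..1} (\<lambda>u. integral {0..1} (E u))"
    unfolding shift E_def by simp
  also have "\<dots> \<le> integral {0..1} (\<lambda>u. 1/2 * (integral {0..1} (D1 u) + integral {0..1} (D2 u)))"
  proof (intro integral_mono_intros continuous_intros cont_param_integral cE cD1 cD2)
    fix u
    have "integral {0..1} (E u) \<le> integral {0..1} (\<lambda>r. 1/2 * (D1 u r + D2 u r))"
      by (intro integral_mono_intros continuous_intros section_continuous cE cD1 cD2 pt)
    also have "\<dots> = 1/2 * (integral {0..1} (D1 u) + integral {0..1} (D2 u))"
      by (intro lin_integral section_continuous cD1 cD2)
    finally show "integral {0..1} (E u) \<le> 1/2 * (integral {0..1} (D1 u) + integral {0..1} (D2 u))" .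
  qed
  also have "\<dots> = 1/2 * (integral {0..1} (\<lambda>u. integral {0..1} (D1 u)) + integral {0..1} (\<lambda>u. integral {0..1} (D2 u)))"
    by (intro lin_integral cont_param_integral cD1 cD2)
  also have "\<dots> = integral {0..1} (\<lambda>u. integral {0..1} (D1 u))" by (simp add: D12)
  also have "\<dots> \<le> integral {0..1} (\<lambda>u. G u * B)"
  proof (intro integral_mono_intros continuous_intros cont_param_integral cD1 continuous_on_subset[OF c(3)])
    fix u
    have "integral {0..1} (D1 u) = G u * integral {u..u+1} (\<lambda>u'. \<bar>K (\<theta> u' - \<theta> u)\<bar> * \<omega> u')"
      unfolding shift D1_def k_def by simp
    also have "\<dots> \<le> G u * B" using B nn by (intro mult_left_mono)
    finally show "integral {0..1} (D1 u) \<le> G u * B" .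
  qed simp
  also have "\<dots> = B * integral {0..1} G" by simp
  finally show ?thesis .
qed

text \<open>Against the angle measure, substitution gives the exact L^1 norm of the kernel. The
  perturbation \<open>q\<close> will be small, so the crude bound 6 is enough for it.\<close>

lemma skern_weight:
  assumes fp: "continuous_on UNIV q" "\<And>u. q (u + 1) = q u" "\<And>u. q u \<ge> 0"
  shows "integral {u..u+1} (\<lambda>u'. \<bar>skern (pi - (\<theta> u' - \<theta> u))\<bar> * (w u' + q u')) \<le> 2 * pi * (sqrt 2 - 1) + 6 * integral {0..1} q"
proof -
  have sc: "continuous_on UNIV (\<lambda>u'. skern (pi - (\<theta> u' - \<theta> u)))"
    by (rule continuous_on_compose2[OF skern_cont]) (auto intro!: continuous_intros theta_cont)
  note s = continuous_on_subset[OF sc subset_UNIV]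
  have "((\<lambda>x. w x *\<^sub>R \<bar>skern (\<theta> x - \<theta> u - pi)\<bar>) has_integral
      integral {\<theta> u - \<theta> u - pi..\<theta> (u + 1) - \<theta> u - pi} (\<lambda>y. \<bar>skern y\<bar>)) {u..u+1}"
  proof (rule has_integral_substitution[where c = "- pi" and d = pi])
    show "(\<lambda>x. \<theta> x - \<theta> u - pi) ` {u..u + 1} \<subseteq> {- pi..pi}"
      using theta_mono[of u] theta_mono[of _ "u + 1"] theta_per[of u] by fastforce
    show "continuous_on {- pi..pi} (\<lambda>y. \<bar>skern y\<bar>)" by (intro continuous_intros skern_cont)
    show "((\<lambda>x. \<theta> x - \<theta> u - pi) has_real_derivative w x) (at x within {u..u + 1})" for x
      by (rule has_field_derivative_at_within) (auto intro!: derivative_eq_intros theta_u)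
  qed (use theta_per in auto)
  then have "((\<lambda>x. w x *\<^sub>R \<bar>skern (\<theta> x - \<theta> u - pi)\<bar>) has_integral 2 * pi * (sqrt 2 - 1)) {u..u+1}"
    using integral_unique[OF skern_abs_integral] theta_per[of u] by simp
  moreover have "skern (\<theta> x - \<theta> u - pi) = skern (pi - (\<theta> x - \<theta> u))" for x
    using skern_minus[of "pi - (\<theta> x - \<theta> u)"] by (simp add: algebra_simps)
  ultimately have 1: "integral {u..u+1} (\<lambda>x. \<bar>skern (pi - (\<theta> x - \<theta> u))\<bar> * w x) = 2 * pi * (sqrt 2 - 1)"
    by (intro integral_unique) (simp add: mult.commute)
  have "integral {u..u+1} (\<lambda>x. \<bar>skern (pi - (\<theta> x - \<theta> u))\<bar> * q x) \<le> integral {u..u+1} (\<lambda>x. 6 * q x)"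
  proof (intro integral_mono_intros continuous_intros s continuous_on_subset[OF fp(1)] mult_right_mono fp(3))
    fix x assume "x \<in> {u..u+1}"
    then have "\<theta> u \<le> \<theta> x" "\<theta> x \<le> \<theta> u + 2 * pi" using theta_mono[of u x] theta_mono[of x "u + 1"] theta_per[of u] by auto
    then show "\<bar>skern (pi - (\<theta> x - \<theta> u))\<bar> \<le> 6" by (intro skern_bound) (simp add: abs_le_iff)
  qed auto
  also have "\<dots> = 6 * integral {0..1} q" using per_int[OF fp(1,2), of u] by simp
  finally have 2: "integral {u..u+1} (\<lambda>x. \<bar>skern (pi - (\<theta> x - \<theta> u))\<bar> * q x) \<le> 6 * integral {0..1} q" .
  have "integral {u..u+1} (\<lambda>u'. \<bar>skern (pi - (\<theta> u' - \<theta> u))\<bar> * (w u' + q u')) =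
    integral {u..u+1} (\<lambda>x. \<bar>skern (pi - (\<theta> x - \<theta> u))\<bar> * w x) + integral {u..u+1} (\<lambda>x. \<bar>skern (pi - (\<theta> x - \<theta> u))\<bar> * q x)"
    unfolding distrib_left by (intro int_add continuous_intros s w_cont' continuous_on_subset[OF fp(1)]) auto
  then show ?thesis using 1 2 by simp
qed

text \<open>For the mean radius \<open>r\<close> the function \<open>g - r * w\<close> has integral
  0, so a constant may be added to the kernel. With the free coefficient of \<open>cos\<close> in
  \<open>kern\<close> this produces \<open>skern\<close>.\<close>

lemma Phi_skern:
  assumes r: "len = 2 * pi * r"
  shows "len\<^sup>2 - 4 * pi * area = integral {0..1} (\<lambda>u. (g u - r * w u) * integral {u..u+1} (\<lambda>u'. skern (pi - (\<theta> u' - \<theta> u)) * (g u' - r * w u')))"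
proof -
  have "\<Phi> u = integral {u..u+1} (\<lambda>u'. skern (pi - (\<theta> u' - \<theta> u)) * (g u' - r * w u'))" for u
  proof -
    have e: "skern (pi - x) = kern (pi / 4) x + (pi * sqrt 2 / 4 - 1)" for x
      by (simp add: skern_def kern_def)
    have f0: "integral {u..u+1} (\<lambda>u'. g u' - r * w u') = 0"
    proof -
      have "integral {u..u+1} (\<lambda>u'. g u' - r * w u') = integral {0..1} (\<lambda>u'. g u' - r * w u')"
        by (rule per_int) (auto intro!: continuous_intros g_cont w_cont simp: g_per w_per)
      also have "\<dots> = integral {0..1} g - r * integral {0..1} w"
        by (intro lin_integral g_cont' w_cont')
      finally show ?thesis using r by (simp add: int_w len_def)
    qed
    have kc: "continuous_on S (\<lambda>u'. kern (pi / 4) (\<theta> u' - \<theta> u))" for S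
      unfolding kern_def by (intro continuous_intros theta_cont)
    have "integral {u..u+1} (\<lambda>u'. skern (pi - (\<theta> u' - \<theta> u)) * (g u' - r * w u'))
      = integral {u..u+1} (\<lambda>u'. kern (pi / 4) (\<theta> u' - \<theta> u) * (g u' - r * w u') + (pi * sqrt 2 / 4 - 1) * (g u' - r * w u'))"
      unfolding e by (simp add: distrib_right)
    also have "\<dots> = integral {u..u+1} (\<lambda>u'. kern (pi / 4) (\<theta> u' - \<theta> u) * (g u' - r * w u'))
       + (pi * sqrt 2 / 4 - 1) * integral {u..u+1} (\<lambda>u'. g u' - r * w u')"
      by (intro lin_integral continuous_intros kc g_cont' w_cont')
    finally show ?thesis using Phi_kernel[of u "pi / 4" r] f0 by simp
  qed
  then show ?thesis using Phi_integral[of r] by (simp add: mult.commute)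
qed

end

lemma powr_le_linear: "0 < a \<Longrightarrow> a \<le> 1 \<Longrightarrow> 0 \<le> k \<Longrightarrow> k powr a \<le> 1 + a * (k - 1)" for a k :: real
proof -
  assume a: "0 < a" "a \<le> 1" "0 \<le> k"
  show ?thesis
  proof (cases "k = 0")
    case False
    then show ?thesis using Youngs_inequality_0[of a "1 - a" k 1] a by (simp add: algebra_simps)
  qed (use a in simp)
qed

text \<open>Below 1 this is concavity of the power at 1. Above 1 the same inequality is applied to
  \<open>1 / k\<close>, which brings in the factor \<open>k\<close>.\<close>

lemma square_le_powr_diff:
  fixes a k :: real
  assumes a: "0 < a" "a \<le> 1" and k: "0 \<le> k"
  shows "(1 - k)\<^sup>2 \<le> max 1 k / a * ((1 - k) * (1 - k powr a))"
proof (cases "k \<le> 1")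
  case True
  have "a * (1 - k) \<le> 1 - k powr a" using powr_le_linear[OF a k] by (simp add: algebra_simps)
  then have "(1 - k) * (a * (1 - k)) \<le> (1 - k) * (1 - k powr a)" using True by (intro mult_left_mono) auto
  then show ?thesis using True a by (simp add: max_def field_simps power2_eq_square)
next
  case False
  then have k1: "k > 1" by simp
  have "(1 / k) powr a \<le> 1 + a * (1 / k - 1)" using a k1 by (intro powr_le_linear) auto
  then have "k powr a * (1 / k) powr a \<le> k powr a * (1 - a * (1 - 1 / k))" by (intro mult_left_mono) (auto simp: algebra_simps)
  moreover have "k powr a * (1 / k) powr a = 1" using k1 by (simp add: powr_mult[symmetric])
  moreover have "1 * (a * (1 - 1 / k)) \<le> k powr a * (a * (1 - 1 / k))"
    using k1 a ge_one_powr_ge_zero[of k a] by (intro mult_right_mono) auto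
  ultimately have "a * (1 - 1 / k) \<le> k powr a - 1" by (simp add: algebra_simps)
  then have "k * (a * (1 - 1 / k)) \<le> k * (k powr a - 1)" using k1 by (intro mult_left_mono) auto
  moreover have "k * (a * (1 - 1 / k)) = a * (k - 1)" using k1 by (simp add: field_simps)
  ultimately have "(k - 1) * (a * (k - 1)) \<le> (k - 1) * (k * (k powr a - 1))" using k1 by (intro mult_left_mono) auto
  then show ?thesis using k1 a by (simp add: max_def field_simps power2_eq_square)
qed

section \<open>Monotonicity of the isoperimetric ratio near circles\<close>

context sweeping_flow
begin

text \<open>The conclusion is the sign of the derivative of \<open>P / L^2\<close>. With the mean
  radius scaled to 1 it reads \<open>Q * V \<le> 4 * pi^2 * (V - Y)\<close>, where
  \<open>GG = V - Y\<close> is the dissipation and \<open>V\<close> is at most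
  \<open>2 * pi + GG\<close>. So a bound \<open>Q \<le> C * GG\<close> with \<open>C\<close> a
  little below \<open>2 * pi\<close> suffices. The Schur test gives \<open>C\<close> near
  \<open>4 * pi * (sqrt 2 - 1)\<close>, about 5.2, which includes the factor 2 as a bound of
  \<open>1 / \<alpha>\<close>.\<close>

lemma near_circle:
  assumes t: "t < 0" and al: "\<alpha> \<le> 1" and near: "P t \<le> (L t / (2 * pi))\<^sup>2 / 10000"
  shows "L t * integral {0..1} (\<lambda>u. v t u * g t u) \<le> 2 * A t * integral {0..1} (\<lambda>u. v t u * w t u)"
proof -
  interpret c: closed_curve "X t" "N t" "g t" "w t" "\<Theta> t" by (rule curve_at[OF t])
  have a: "0 < \<alpha>" "\<alpha> > 1/2" using alpha by auto
  define r where "r = L t / (2 * pi)"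
  have r: "r > 0" using L_pos[OF t] by (simp add: r_def)
  have Lr: "L t = 2 * pi * r" by (simp add: r_def)
  define gh where "gh u = g t u / r" for u
  define f where "f u = gh u - w t u" for u
  define k where "k u = w t u / gh u" for u
  define s where "s u = v t u * r powr \<alpha>" for u
  define G where "G u = f u * (1 - s u)" for u
  define q where "q u = max 0 (f u)" for u
  define Q where "Q = integral {0..1} (\<lambda>u. f u * integral {u..u+1} (\<lambda>u'. skern (pi - (\<Theta> t u' - \<Theta> t u)) * f u'))"
  define GG where "GG = integral {0..1} G"
  define qq where "qq = integral {0..1} q"
  define V where "V = integral {0..1} (\<lambda>u. s u * w t u)"
  define Y where "Y = integral {0..1} (\<lambda>u. s u * gh u)"
  have gh0: "gh u > 0" for u using g_pos[OF t] r by (simp add: gh_def)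
  have k0: "k u \<ge> 0" for u using w_nonneg[OF t, of u] gh0[of u] by (simp add: k_def)
  have sk: "s u = k u powr \<alpha>" for u
  proof -
    have e: "k u = (w t u / g t u) * r" using r g_pos[OF t, of u] by (simp add: k_def gh_def)
    have "w t u / g t u \<ge> 0" using w_nonneg[OF t, of u] g_pos[OF t, of u] by simp
    then show ?thesis using r unfolding e s_def v_eq[OF t] by (subst powr_mult) auto
  qed
  have s0: "s u \<ge> 0" for u by (simp add: sk)
  have wk: "w t u = gh u * k u" for u using gh0[of u] by (simp add: k_def)
  have ghc: "continuous_on S gh" for S unfolding gh_def[abs_def] using r by (intro continuous_intros csec t) auto
  have fc: "continuous_on S f" for S unfolding f_def[abs_def] by (intro continuous_intros csec t ghc)
  have sc: "continuous_on S s" for S unfolding s_def[abs_def] by (intro continuous_intros csec t)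
  have Gc: "continuous_on S G" for S unfolding G_def[abs_def] by (intro continuous_intros fc sc)
  have qc: "continuous_on S q" for S unfolding q_def[abs_def] by (intro continuous_intros fc)
  have fper: "f (u + 1) = f u" for u by (simp add: f_def gh_def g_per[OF t] w_per[OF t])
  have Gper: "G (u + 1) = G u" for u by (simp add: G_def fper s_def v_per[OF t])
  have qper: "q (u + 1) = q u" for u by (simp add: q_def fper)
  have q0: "q u \<ge> 0" for u by (simp add: q_def)
  have f1k: "f u = gh u * (1 - k u)" for u unfolding f_def using wk[of u] by (simp add: algebra_simps)
  have G0: "G u \<ge> 0" for u
  proof -
    have "0 \<le> (k u - 1) * (k u powr \<alpha> - 1 powr \<alpha>)" using k0 a by (intro pow_cheb) auto
    then have "0 \<le> gh u * ((k u - 1) * (k u powr \<alpha> - 1))" using gh0[of u] by simp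
    then show ?thesis unfolding G_def f1k sk by (simp add: algebra_simps)
  qed
  have fG: "(f u)\<^sup>2 \<le> 2 * (w t u + q u) * G u" for u
  proof -
    \<comment> \<open>Both sides are the larger of \<open>gh u\<close> and
      \<open>w t u\<close>.\<close>
    have mx: "gh u * max 1 (k u) = w t u + q u" 
      using gh0[of u] wk[of u] unfolding q_def f1k by (cases "k u \<le> 1") (auto simp: max_def algebra_simps mult_le_0_iff zero_le_mult_iff)
    have "(f u)\<^sup>2 = (gh u)\<^sup>2 * (1 - k u)\<^sup>2" by (simp add: f1k power_mult_distrib)
    also have "\<dots> \<le> (gh u)\<^sup>2 * (max 1 (k u) / \<alpha> * ((1 - k u) * (1 - k u powr \<alpha>)))"
      by (intro mult_left_mono square_le_powr_diff a al k0) auto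
    also have "\<dots> = (1 / \<alpha>) * ((gh u * max 1 (k u)) * G u)" unfolding G_def f1k sk by (simp add: power2_eq_square algebra_simps)
    also have "\<dots> \<le> 2 * ((gh u * max 1 (k u)) * G u)"
      unfolding mx using a G0[of u] q0[of u] w_nonneg[OF t, of u] by (intro mult_right_mono) (auto simp: field_simps)
    finally show ?thesis unfolding mx mult.assoc .
  qed
  have iw: "integral {0..1} (w t) = 2 * pi" using int_w[OF t] .
  have igh: "integral {0..1} gh = 2 * pi"
  proof -
    have "integral {0..1} gh = integral {0..1} (\<lambda>u. (1 / r) * g t u)" by (simp add: gh_def[abs_def])
    also have "\<dots> = (1 / r) * L t" unfolding L_def by (rule integral_mult_right)
    finally show ?thesis using r by (simp add: Lr)
  qed
  have GGV: "GG = V - Y"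
  proof -
    have "GG = integral {0..1} (\<lambda>u. (gh u - w t u) + (s u * w t u - s u * gh u))"
      unfolding GG_def by (intro integral_ext) (simp add: G_def f_def algebra_simps)
    also have "\<dots> = (2 * pi - 2 * pi) + (V - Y)"
      unfolding V_def Y_def igh[symmetric] by (subst (2) igh, subst iw[symmetric],
        intro lin_integral continuous_intros csec t sc ghc)
    finally show ?thesis by simp
  qed
  have Y2: "Y \<le> 2 * pi"
  proof -
    have "Y \<le> integral {0..1} (\<lambda>u. gh u + \<alpha> * (w t u - gh u))"
      unfolding Y_def
    proof (intro integral_mono_intros continuous_intros csec t sc ghc)
      show "s u * gh u \<le> gh u + \<alpha> * (w t u - gh u)" for u
      proof -
        have "s u * gh u \<le> (1 + \<alpha> * (k u - 1)) * gh u"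
          unfolding sk using gh0[of u] by (intro mult_right_mono powr_le_linear a al k0) auto
        then show ?thesis using wk[of u] by (simp add: algebra_simps)
      qed
    qed
    also have "\<dots> = integral {0..1} gh + \<alpha> * (integral {0..1} (w t) - integral {0..1} gh)"
      by (intro lin_integral continuous_intros csec t ghc)
    finally show ?thesis by (simp add: igh iw)
  qed
  have GG0: "GG \<ge> 0" unfolding GG_def by (intro integral_nonneg_intros Gc G0)
  have PQ: "P t = r\<^sup>2 * Q"
  proof -
    have e: "g t u - r * w t u = r * f u" for u using r by (simp add: f_def gh_def field_simps)
    have "c.len = 2 * pi * r" using Lr len_area(1)[OF t] by simp
    from c.Phi_skern[OF this] have "P t = integral {0..1} (\<lambda>u. (r * f u) * integral {u..u+1} (\<lambda>u'. skern (pi - (\<Theta> t u' - \<Theta> t u)) * (r * f u')))"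
      unfolding e by (simp add: P_def len_area[OF t])
    also have "\<dots> = r\<^sup>2 * Q"
      unfolding mult.left_commute[of "skern _" r] integral_mult_right Q_def
      by (subst integral_mult_right[symmetric], intro integral_ext) (simp add: power2_eq_square)
    finally show ?thesis .
  qed
  have Q0: "Q \<ge> 0" using P_ge_0[OF t] r unfolding PQ by (simp add: zero_le_mult_iff)
  have Qs: "Q \<le> 1 / 10000" using near r unfolding PQ r_def[symmetric] by (simp add: field_simps)
  have QG: "Q \<le> 2 * (2 * pi * (sqrt 2 - 1) + 6 * qq) * GG"
    unfolding Q_def GG_def
  proof (rule c.schur[where K = "\<lambda>x. skern (pi - x)" and \<omega> = "\<lambda>u. 2 * (w t u + q u)"])
    show "continuous_on UNIV (\<lambda>x. skern (pi - x))"
      by (rule continuous_on_compose2[OF skern_cont]) (auto intro!: continuous_intros)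
    show "skern (pi - (2 * pi - x)) = skern (pi - x)" for x using skern_minus[of "pi - x"] by simp
    show "continuous_on UNIV (\<lambda>u. 2 * (w t u + q u))" by (intro continuous_intros csec t qc)
    show "integral {u..u + 1} (\<lambda>u'. \<bar>skern (pi - (\<Theta> t u' - \<Theta> t u))\<bar> * (2 * (w t u' + q u'))) \<le> 2 * (2 * pi * (sqrt 2 - 1) + 6 * qq)" for u
      using c.skern_weight[OF qc qper q0, of u] unfolding mult.left_commute[of _ 2] integral_mult_right qq_def by simp
  qed (use fG G0 q0 w_nonneg[OF t] fc Gc fper Gper qper w_per[OF t] in \<open>auto simp: mult.assoc\<close>)
  \<comment> \<open>The excess \<open>q\<close> in the Schur weight has to be small. It is
    controlled by \<open>fG\<close> itself, splitting the product with weights 1/100 and 50: the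
    term with \<open>qq\<close> on the right is absorbed, and the rest is small when
    \<open>GG\<close> is.\<close>
  have qb: "qq \<le> 1/100 * (2 * pi + qq) + 50 * GG"
  proof -
    have "qq \<le> integral {0..1} (\<lambda>u. 1/100 * (w t u + q u) + 50 * G u)"
      unfolding qq_def
    proof (intro integral_mono_intros continuous_intros csec t qc Gc)
      show "q u \<le> 1/100 * (w t u + q u) + 50 * G u" for u
      proof -
        have nn: "w t u + q u \<ge> 0" using w_nonneg[OF t, of u] q0[of u] by simp
        have "(q u)\<^sup>2 \<le> (f u)\<^sup>2" unfolding q_def by (simp add: max_def)
        also have "\<dots> \<le> 2 * (w t u + q u) * G u" by (rule fG)
        also have "\<dots> \<le> (1/100 * (w t u + q u) + 50 * G u)\<^sup>2"
        proof -
          have "0 \<le> (1/100 * (w t u + q u) - 50 * G u)\<^sup>2" by simp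
          then show ?thesis by (simp add: power2_eq_square algebra_simps)
        qed
        finally show ?thesis by (rule power2_le_imp_le) (use nn G0[of u] in simp)
      qed
    qed
    also have "\<dots> = 1/100 * (integral {0..1} (w t) + qq) + 50 * GG"
      unfolding qq_def GG_def by (intro lin_integral csec t qc Gc)
    finally show ?thesis by (simp add: iw)
  qed
  have pi3: "pi > 157/50" "pi < 16/5" using pi_approx by simp_all
  \<comment> \<open>If the dissipation is not small, the assumption on the deficit alone is enough.
    Otherwise \<open>qq\<close> is small and the Schur constant is at most
    \<open>193/100 * pi\<close>, which leaves room for the factor
    \<open>2 * pi + GG\<close>.\<close>
  have key: "Q * (2 * pi + GG) \<le> 4 * pi\<^sup>2 * GG"
  proof (cases "GG \<ge> 1 / 10000")
    case True
    have "Q * (2 * pi + GG) \<le> GG * (2 * pi) + 1 * GG"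
      unfolding distrib_left by (intro add_mono mult_right_mono) (use Qs True GG0 in auto)
    also have "\<dots> \<le> 4 * pi\<^sup>2 * GG"
    proof -
      have "4 * pi * 1 \<le> 4 * pi * pi" using pi3 by (intro mult_left_mono) auto
      then have "2 * pi + 1 \<le> 4 * pi * pi" using pi3 by linarith
      then have "(2 * pi + 1) * GG \<le> 4 * pi * pi * GG" using GG0 by (intro mult_right_mono)
      then show ?thesis by (simp add: power2_eq_square algebra_simps)
    qed
    finally show ?thesis .
  next
    case False
    have "100 * qq \<le> 2 * pi + qq + 5000 * GG" using qb by (simp add: field_simps)
    moreover have "5000 * GG \<le> 1/2" using False by simp
    ultimately have q7: "qq \<le> 7/100" using pi3(2) by linarith
    have "sqrt 2 \<le> 14143/10000" by (rule real_le_lsqrt) (auto simp: power2_eq_square)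
    then have "2 * pi * (sqrt 2 - 1) \<le> 2 * pi * (4143/10000)" by (intro mult_left_mono) auto
    moreover have "2 * (z + 6 * qq) \<le> 193/100 * pi" if "z \<le> 2 * pi * (4143/10000)" for z
      using that q7 pi3 by simp
    ultimately have b: "2 * (2 * pi * (sqrt 2 - 1) + 6 * qq) \<le> 193/100 * pi" by blast
    have "Q \<le> 193/100 * pi * GG" using QG mult_right_mono[OF b GG0] by simp
    then have "Q * (2 * pi + GG) \<le> 193/100 * pi * GG * (2 * pi + GG)" using GG0 by (intro mult_right_mono) auto
    also have "\<dots> = pi * GG * (193/100 * (2 * pi + GG))" by simp
    also have "\<dots> \<le> pi * GG * (4 * pi)" using GG0 False pi3 by (intro mult_left_mono) auto
    finally show ?thesis by (simp add: power2_eq_square algebra_simps)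
  qed
  have VG: "V \<le> 2 * pi + GG" using GGV Y2 by simp
  have "Q * V \<le> Q * (2 * pi + GG)" using VG Q0 by (intro mult_left_mono)
  then have QV: "Q * V \<le> 4 * pi\<^sup>2 * (V - Y)" using key GGV by simp
  have vs: "v t u = r powr (- \<alpha>) * s u" for u
    using r by (simp add: s_def powr_minus)
  have e1: "integral {0..1} (\<lambda>u. v t u * w t u) = r powr (- \<alpha>) * V"
    unfolding V_def vs mult.assoc by (rule integral_mult_right)
  have e2: "integral {0..1} (\<lambda>u. v t u * g t u) = r powr (- \<alpha>) * (r * Y)"
  proof -
    have "integral {0..1} (\<lambda>u. v t u * g t u) = integral {0..1} (\<lambda>u. (r powr (- \<alpha>) * r) * (s u * gh u))"
      unfolding vs gh_def using r by (intro integral_ext) simp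
    then show ?thesis unfolding Y_def integral_mult_right by simp
  qed
  have At: "4 * pi * A t = r\<^sup>2 * (4 * pi\<^sup>2 - Q)" using PQ by (simp add: P_def Lr power_mult_distrib algebra_simps)
  have "4 * pi * (L t * (r * Y)) = 2 * r\<^sup>2 * (4 * pi\<^sup>2 * Y)" by (simp add: Lr power2_eq_square algebra_simps)
  also have "\<dots> \<le> 2 * r\<^sup>2 * (4 * pi\<^sup>2 * V - Q * V)" using QV by (intro mult_left_mono) (auto simp: algebra_simps)
  also have "\<dots> = 2 * (4 * pi * A t) * V" unfolding At by (simp add: algebra_simps)
  finally have "(4 * pi) * (L t * (r * Y)) \<le> (4 * pi) * (2 * A t * V)" by (simp add: algebra_simps)
  then have "L t * (r * Y) \<le> 2 * A t * V" by (rule mult_left_le_imp_le) simp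
  then have "r powr (- \<alpha>) * (L t * (r * Y)) \<le> r powr (- \<alpha>) * (2 * A t * V)" by (intro mult_left_mono) auto
  then show ?thesis unfolding e1 e2 by (simp add: algebra_simps)
qed

end

text \<open>Up to the first time at which the level \<open>min (E b) \<epsilon>\<close> is reached
  the derivative is nonpositive, so the level, which is above \<open>E a\<close>, is never
  reached.\<close>

lemma nonincreasing_while_small:
  fixes E :: "real \<Rightarrow> real"
  assumes ab: "a \<le> b" and d: "\<And>x. a \<le> x \<Longrightarrow> x \<le> b \<Longrightarrow> (E has_real_derivative E' x) (at x)"
    and n: "\<And>x. a \<le> x \<Longrightarrow> x \<le> b \<Longrightarrow> E x \<le> \<epsilon> \<Longrightarrow> E' x \<le> 0" and a: "E a < \<epsilon>"
  shows "E b \<le> E a"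
proof (rule ccontr)
  assume "\<not> E b \<le> E a"
  define r where "r = min (E b) \<epsilon>"
  have r: "E a < r" "r \<le> \<epsilon>" "r \<le> E b" using a \<open>\<not> E b \<le> E a\<close> by (auto simp: r_def)
  have c: "continuous_on {a..b} E" by (intro continuous_at_imp_continuous_on ballI DERIV_isCont[OF d]) auto
  define S where "S = {x \<in> {a..b}. r \<le> E x}"
  have "closed ({a..b} \<inter> E -` {r..})" by (intro continuous_closed_preimage c) auto
  moreover have "{a..b} \<inter> E -` {r..} = S" by (auto simp: S_def)
  ultimately have "closed S" by simp
  then have "compact S" unfolding S_def by (metis (no_types, lifting) bounded_closed_interval bounded_subset compact_eq_bounded_closed mem_Collect_eq subsetI)
  moreover have "S \<noteq> {}" using ab r by (auto simp: S_def)
  ultimately have "\<exists>m\<in>S. \<forall>x\<in>S. m \<le> x" by (rule compact_attains_inf)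
  then obtain m where m: "m \<in> S" "\<And>x. x \<in> S \<Longrightarrow> m \<le> x" by auto
  have m': "a \<le> m" "m \<le> b" "r \<le> E m" using m(1) by (auto simp: S_def)
  have lt: "E x < r" if "a \<le> x" "x < m" for x
    using m(2)[of x] that m' by (force simp: S_def)
  have "E m \<le> E a"
  proof (rule DERIV_nonpos_imp_decreasing_open[OF m'(1)])
    fix x assume x: "a < x" "x < m"
    then have "E' x \<le> 0" using lt[of x] r m' by (intro n) auto
    then show "\<exists>y. (E has_real_derivative y) (at x) \<and> y \<le> 0" using d[of x] x m' by auto
  qed (use continuous_on_subset[OF c] m' in auto)
  then show False using m' r by simp
qed

context sweeping_flow
begin

text \<open>A small value of \<open>P / L^2\<close> at one early time persists until
  \<open>t\<close>, and arbitrarily small values are available. The threshold \<open>e0\<close> is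
  the assumption of \<open>near_circle\<close> expressed for \<open>P / L^2\<close>.\<close>

lemma deficit_zero_of_near:
  assumes al: "\<alpha> \<le> 1" and near: "\<And>e T. e > 0 \<Longrightarrow> T < 0 \<Longrightarrow> \<exists>t\<le>T. P t \<le> e * (L t)\<^sup>2" and t: "t < 0"
  shows "P t = 0"
proof -
  define E where "E t = P t / (L t)\<^sup>2" for t
  define e0 where "e0 = 1 / (40000 * pi\<^sup>2)"
  define E' where "E' x = (- 4 * pi) * (2 * A x * integral {0..1} (\<lambda>u. v x u * w x u) - L x * integral {0..1} (\<lambda>u. v x u * g x u)) / (L x)^3" for x
  have e0: "e0 > 0" by (simp add: e0_def)
  have "E t \<le> e" if e: "e > 0" for e
  proof -
    obtain s where s: "s \<le> t" "P s \<le> min e (e0 / 2) * (L s)\<^sup>2" using near[of "min e (e0/2)" t] e e0 t by auto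
    then have Es: "E s \<le> min e (e0 / 2)" unfolding E_def using L_pos[of s] t by (subst pos_divide_le_eq) auto
    have "E t \<le> E s"
    proof (rule nonincreasing_while_small[where E = E and a = s and b = t and E' = E' and \<epsilon> = e0])
      fix x assume x: "s \<le> x" "x \<le> t"
      then have x0: "x < 0" using t by simp
      have Lx: "L x > 0" using L_pos[OF x0] .
      show "(E has_real_derivative E' x) (at x)"
      proof -
        define V where "V = integral {0..1} (\<lambda>u. v x u * w x u)"
        define Y where "Y = integral {0..1} (\<lambda>u. v x u * g x u)"
        have dL: "(L has_real_derivative - V) (at x)" and dA: "(A has_real_derivative - Y) (at x)"
          unfolding V_def Y_def by (rule L_deriv[OF x0] A_deriv[OF x0])+
        have "(E has_real_derivative ((2 * L x * (- V) - 4 * pi * (- Y)) * (L x)\<^sup>2 - ((L x)\<^sup>2 - 4 * pi * A x) * (2 * L x * (- V))) / ((L x)\<^sup>2 * (L x)\<^sup>2)) (at x)"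
          unfolding E_def[abs_def] P_def using Lx by (auto intro!: derivative_eq_intros dL dA)
        then show ?thesis
          unfolding E'_def V_def[symmetric] Y_def[symmetric]
          by (rule DERIV_cong) (use Lx in \<open>simp add: field_simps power2_eq_square power3_eq_cube\<close>)
      qed
      assume "E x \<le> e0"
      then have "P x \<le> (L x / (2 * pi))\<^sup>2 / 10000" using Lx by (simp add: E_def e0_def field_simps power2_eq_square)
      from near_circle[OF x0 al this] show "E' x \<le> 0" unfolding E'_def using Lx
        by (intro divide_nonpos_pos mult_nonpos_nonneg) auto
    qed (use s Es e0 in auto)
    then show ?thesis using Es by simp
  qed
  then have "E t \<le> 0" by (rule field_le_epsilon[of "E t" 0, simplified])
  then have "P t \<le> 0" using L_pos[OF t] by (simp add: E_def divide_le_0_iff)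
  then show ?thesis using P_ge_0[OF t] by simp
qed

end

section \<open>Solitons\<close>

text \<open>The support function of a self-similarly shrinking curve, where the speed equals
  \<open>h\<close>, satisfies this equation with \<open>p = 1 / \<alpha>\<close>; the range of
  \<open>p\<close> is 1/2 < \<alpha> < 1. The bound \<open>\<mu>\<close> makes the power
  Lipschitz.\<close>

locale soliton_ode =
  fixes p \<mu> :: real and h h' :: "real \<Rightarrow> real"
  assumes p: "1 < p" "p < 2" and mu: "\<mu> > 0" "\<And>x. h x \<ge> \<mu>"
    and h: "\<And>x. (h has_real_derivative h' x) (at x)"
    and h': "\<And>x. (h' has_real_derivative h x powr (- p) - h x) (at x)"

lemma periodic_attains_inf:
  fixes f :: "real \<Rightarrow> real"
  assumes c: "continuous_on UNIV f" and per: "\<And>x. f (x + 2 * pi) = f x"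
  obtains m where "\<And>y. f m \<le> f y"
proof -
  have "\<exists>m\<in>{0..2*pi}. \<forall>y\<in>{0..2*pi}. f m \<le> f y"
    by (rule continuous_attains_inf) (use continuous_on_subset[OF c] in auto)
  then obtain m where m: "\<And>y. y \<in> {0..2*pi} \<Longrightarrow> f m \<le> f y" by blast
  have "f m \<le> f y" for y
  proof -
    have "f (2 * pi * frac (y / (2 * pi))) = f (2 * pi * (y / (2 * pi)))"
      by (rule periodic_frac[of "\<lambda>s. f (2 * pi * s)"]) (simp add: distrib_left per)
    moreover have "f m \<le> f (2 * pi * frac (y / (2 * pi)))"
      using frac_ge_0[of "y / (2 * pi)"] frac_lt_1[of "y / (2 * pi)"] by (intro m) (auto simp: mult_le_cancel_left1 intro: less_imp_le)
    ultimately show ?thesis by simp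
  qed
  with that show thesis by blast
qed

lemma powr_neg_lipschitz:
  fixes a b \<mu> p :: real
  assumes "\<mu> > 0" "a \<ge> \<mu>" "b \<ge> \<mu>" "p > 0"
  shows "\<bar>a powr (- p) - b powr (- p)\<bar> \<le> p * \<mu> powr (- p - 1) * \<bar>a - b\<bar>"
proof -
  have "norm (a powr (- p) - b powr (- p)) \<le> (p * \<mu> powr (- p - 1)) * norm (a - b)"
  proof (rule field_differentiable_bound[where S = "{\<mu>..}" and f' = "\<lambda>x. (- p) * x powr (- p - 1)"])
    fix x assume x: "x \<in> {\<mu>..}"
    then have x0: "x > 0" using assms by simp
    show "((\<lambda>x. x powr (- p)) has_real_derivative - p * x powr (- p - 1)) (at x within {\<mu>..})"
      using DERIV_fun_powr[OF DERIV_ident x0, of "- p"] by (simp add: has_field_derivative_at_within)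
    have "x powr (- p - 1) \<le> \<mu> powr (- p - 1)" using x assms by (intro powr_mono2') auto
    then show "norm (- p * x powr (- p - 1)) \<le> p * \<mu> powr (- p - 1)" using assms by (simp add: abs_mult)
  qed (use assms in auto)
  then show ?thesis by simp
qed

text \<open>Gronwall's argument for the squared distance in the phase plane. Reflection will take
  care of negative \<open>x\<close>.\<close>

lemma soliton_unique:
  assumes "soliton_ode p \<mu> a a'" "soliton_ode p \<mu> b b'" and 0: "a 0 = b 0" "a' 0 = b' 0" and x: "x \<ge> 0"
  shows "a x = b x"
proof -
  interpret a: soliton_ode p \<mu> a a' by fact
  interpret b: soliton_ode p \<mu> b b' by fact
  define d where "d x = a x - b x" for x
  define d' where "d' x = a' x - b' x" for x
  define d2 where "d2 x = (a x powr (- p) - a x) - (b x powr (- p) - b x)" for x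
  define C where "C = p * \<mu> powr (- p - 1) + 1"
  define \<rho> where "\<rho> x = ((d x)\<^sup>2 + (d' x)\<^sup>2) * exp (- (1 + C) * x)" for x
  have C: "C \<ge> 0" using a.p by (simp add: C_def)
  have d2: "\<bar>d2 x\<bar> \<le> C * \<bar>d x\<bar>" for x
    using powr_neg_lipschitz[OF a.mu(1) a.mu(2)[of x] b.mu(2)[of x], of p] a.p unfolding d2_def d_def C_def
    by (simp add: distrib_right)
  have "\<rho> x \<le> \<rho> 0"
  proof (rule DERIV_nonpos_imp_nonincreasing[OF x])
    fix y
    have dd: "(d has_real_derivative d' y) (at y)" "(d' has_real_derivative d2 y) (at y)"
      unfolding d_def[abs_def] d'_def[abs_def] d2_def by (auto intro!: derivative_eq_intros a.h b.h a.h' b.h')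
    have D: "(\<rho> has_real_derivative (2 * d y * d' y + 2 * d' y * d2 y - (1 + C) * ((d y)\<^sup>2 + (d' y)\<^sup>2)) * exp (- (1 + C) * y)) (at y)"
      unfolding \<rho>_def[abs_def] by (auto intro!: derivative_eq_intros dd simp: algebra_simps)
    have "2 * d' y * d2 y \<le> 2 * \<bar>d' y\<bar> * \<bar>d2 y\<bar>" using abs_ge_self[of "d' y * d2 y"] by (simp add: abs_mult)
    also have "\<dots> \<le> 2 * \<bar>d' y\<bar> * (C * \<bar>d y\<bar>)" using d2 by (intro mult_left_mono) auto
    also have "\<dots> = C * (2 * \<bar>d y\<bar> * \<bar>d' y\<bar>)" by simp
    also have "\<dots> \<le> C * ((d y)\<^sup>2 + (d' y)\<^sup>2)"
      using sum_squares_bound[of "\<bar>d y\<bar>" "\<bar>d' y\<bar>"] C by (intro mult_left_mono) auto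
    finally have "2 * d' y * d2 y \<le> C * ((d y)\<^sup>2 + (d' y)\<^sup>2)" .
    moreover have "2 * d y * d' y \<le> (d y)\<^sup>2 + (d' y)\<^sup>2" by (rule sum_squares_bound)
    ultimately have "2 * d y * d' y + 2 * d' y * d2 y - (1 + C) * ((d y)\<^sup>2 + (d' y)\<^sup>2) \<le> 0" by (simp add: algebra_simps)
    then show "\<exists>z. (\<rho> has_real_derivative z) (at y) \<and> z \<le> 0" using D mult_nonpos_nonneg[OF _ exp_ge_zero] by blast
  qed
  then have "((d x)\<^sup>2 + (d' x)\<^sup>2) * exp (- (1 + C) * x) \<le> 0" using 0 by (simp add: \<rho>_def d_def d'_def)
  then have "(d x)\<^sup>2 + (d' x)\<^sup>2 \<le> 0" by (simp add: mult_le_0_iff not_le)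
  then have "d x = 0" by (simp add: sum_power2_le_zero_iff)
  then show ?thesis by (simp add: d_def)
qed

context soliton_ode
begin

lemma pos: "h x > 0" using mu(1) mu(2)[of x] by linarith

lemma shift: "soliton_ode p \<mu> (\<lambda>x. h (m + x)) (\<lambda>x. h' (m + x))"
proof
  fix x
  have s: "((\<lambda>x. m + x) has_real_derivative 1) (at x)" by (auto intro!: derivative_eq_intros)
  show "((\<lambda>x. h (m + x)) has_real_derivative h' (m + x)) (at x)" using DERIV_chain2[OF h s] by simp
  show "((\<lambda>x. h' (m + x)) has_real_derivative h (m + x) powr (- p) - h (m + x)) (at x)" using DERIV_chain2[OF h' s] by simp
qed (use p mu in auto)

lemma reflect: "soliton_ode p \<mu> (\<lambda>x. h (m - x)) (\<lambda>x. - h' (m - x))"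
proof
  fix x
  have s: "((\<lambda>x. m - x) has_real_derivative - 1) (at x)" by (auto intro!: derivative_eq_intros)
  show "((\<lambda>x. h (m - x)) has_real_derivative - h' (m - x)) (at x)" using DERIV_chain2[OF h s] by simp
  show "((\<lambda>x. - h' (m - x)) has_real_derivative h (m - x) powr (- p) - h (m - x)) (at x)"
    using DERIV_minus[OF DERIV_chain2[OF h' s]] by simp
qed (use p mu in auto)

lemma symmetric: "h' m = 0 \<Longrightarrow> h (m + x) = h (m - x)"
  using soliton_unique[OF shift reflect, of m m "\<bar>x\<bar>"] by (cases "x \<ge> 0") auto

lemma antisymmetric: "h' m = 0 \<Longrightarrow> h' (m + x) = - h' (m - x)"
proof -
  assume m: "h' m = 0"
  have "((\<lambda>x. h (m + x)) has_real_derivative h' (m + x)) (at x)" using soliton_ode.h[OF shift] .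
  moreover have "((\<lambda>x. h (m + x)) has_real_derivative - h' (m - x)) (at x)" 
    unfolding symmetric[OF m] using soliton_ode.h[OF reflect] .
  ultimately show ?thesis by (rule DERIV_unique)
qed

lemma eq_one_of_crit:
  assumes "h' m = 0" "h m = 1"
  shows "h x = 1"
proof -
  have "soliton_ode p (min \<mu> 1) (\<lambda>_. 1) (\<lambda>_. 0)" by unfold_locales (use p mu in auto)
  moreover have "soliton_ode p (min \<mu> 1) (\<lambda>x. h (m + x)) (\<lambda>x. h' (m + x))"
    using shift[of m] mu p by (auto simp: soliton_ode_def intro: min.coboundedI1)
  ultimately have "h (m + \<bar>x - m\<bar>) = 1" using soliton_unique[of p "min \<mu> 1" "\<lambda>x. h (m + x)" _ "\<lambda>_. 1"] assms by fastforce
  then show ?thesis using symmetric[OF assms(1), of "x - m"] by (cases "x \<ge> m") auto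
qed

text \<open>Sturm comparison for the derivative \<open>f\<close> seen from a minimum
  \<open>m\<close>. Evenness about \<open>m\<close> and the period make \<open>f\<close> vanish at 0
  and at pi. Comparison places the first zero \<open>t\<close> after 0 strictly between pi / 2 and
  pi, and reflection in the critical point \<open>m + t\<close> sends the zero pi to
  \<open>2 * t - pi\<close>, a positive zero before \<open>t\<close>.\<close>

lemma periodic_eq_one:
  assumes per: "\<And>x. h (x + 2 * pi) = h x"
  shows "h x = 1"
proof (rule ccontr)
  assume ne: "h x \<noteq> 1"
  have hc: "continuous_on S h" for S by (intro continuous_at_imp_continuous_on ballI DERIV_isCont[OF h])
  obtain m where mm: "\<And>y. h m \<le> h y" using periodic_attains_inf[OF hc per] by blast
  have pern: "h' (x + 2 * pi) = h' x" for x
  proof -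
    have "((\<lambda>x. h (x + 2 * pi)) has_real_derivative h' (x + 2 * pi) * 1) (at x)"
      by (rule DERIV_chain2[OF h]) (auto intro!: derivative_eq_intros)
    then have "(h has_real_derivative h' (x + 2 * pi)) (at x)" by (simp add: per)
    from DERIV_unique[OF this h] show ?thesis .
  qed
  have m0: "h' m = 0" by (rule DERIV_local_min[OF h, of 1]) (use mm in auto)
  define f where "f x = h' (m + x)" for x
  define k where "k x = h (m + x)" for x
  have kd: "(k has_real_derivative f x) (at x)" for x unfolding k_def[abs_def] f_def by (rule soliton_ode.h[OF shift])
  have fd: "(f has_real_derivative k x powr (- p) - k x) (at x)" for x unfolding k_def f_def[abs_def] by (rule soliton_ode.h'[OF shift])
  have kp: "k x > 0" for x by (simp add: k_def pos)
  have fcc: "continuous_on S f" for S by (intro continuous_at_imp_continuous_on ballI DERIV_isCont[OF fd])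
  have f0: "f 0 = 0" using m0 by (simp add: f_def)
  have fpi: "f pi = 0"
    using antisymmetric[OF m0, of pi] pern[of "m - pi"] by (simp add: f_def algebra_simps)
  \<comment> \<open>At the minimum the value is below 1: it is not 1 by uniqueness, and above 1 the
    second derivative would be negative.\<close>
  have "k 0 powr (- p) - k 0 > 0"
  proof (rule ccontr)
    assume c: "\<not> k 0 powr (- p) - k 0 > 0"
    have "k 0 \<noteq> 1" using eq_one_of_crit[OF m0] ne by (auto simp: k_def)
    moreover have "k 0 \<ge> 1"
    proof (rule ccontr)
      assume "\<not> k 0 \<ge> 1"
      then have "1 powr (- p) \<le> k 0 powr (- p)" using kp[of 0] p by (intro powr_mono2') auto
      then show False using c \<open>\<not> k 0 \<ge> 1\<close> by simp
    qed
    ultimately have "k 0 > 1" by simp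
    then have "k 0 powr (- p) < 1 powr (- p)" using p by (intro powr_less_mono2_neg) auto
    then have "k 0 powr (- p) - k 0 < 0" using \<open>k 0 > 1\<close> by simp
    from DERIV_neg_dec_right[OF fd this] obtain d where d: "d > 0" "\<And>x. 0 < x \<Longrightarrow> x < d \<Longrightarrow> f x < 0" using f0 by auto
    have "k (d/2) < k 0"
      by (rule DERIV_neg_imp_decreasing_open) (use d kd in \<open>auto intro!: exI continuous_at_imp_continuous_on DERIV_isCont\<close>)
    then show False using mm[of "m + d/2"] by (simp add: k_def)
  qed
  from DERIV_pos_inc_right[OF fd this] obtain d where d: "d > 0" "\<And>x. 0 < x \<Longrightarrow> x < d \<Longrightarrow> f x > 0" using f0 by auto
  have dpi: "d \<le> pi" using d(2)[of pi] fpi by force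
  have "\<exists>t\<in>{d..pi} \<inter> f -` {0}. \<forall>y\<in>{d..pi} \<inter> f -` {0}. t \<le> y"
  proof (rule compact_attains_inf)
    have "closed ({d..pi} \<inter> f -` {0})" by (intro continuous_closed_preimage fcc) auto
    then show "compact ({d..pi} \<inter> f -` {0})"
      by (simp add: compact_eq_bounded_closed bounded_Int)
    show "{d..pi} \<inter> f -` {0} \<noteq> {}" using fpi dpi by auto
  qed
  then obtain t where t: "d \<le> t" "t \<le> pi" "f t = 0" "\<And>y. d \<le> y \<Longrightarrow> y \<le> pi \<Longrightarrow> f y = 0 \<Longrightarrow> t \<le> y" by auto
  have fp: "f y > 0" if y: "0 < y" "y < t" for y
  proof (rule ccontr)
    assume n: "\<not> f y > 0"
    then have yd: "d \<le> y" using d(2)[of y] y by force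
    have "\<exists>z\<ge>d/2. z \<le> y \<and> f z = 0"
      by (rule IVT2'[of f y 0 "d/2"]) (use n d(2)[of "d/2"] d(1) yd fcc in auto)
    then obtain z where z: "d/2 \<le> z" "z \<le> y" "f z = 0" by blast
    then have "d \<le> z" using d(2)[of z] d(1) by force
    moreover have "z \<le> pi" using z y t by simp
    ultimately show False using t(4)[of z] z y by simp
  qed
  have fdd: "((\<lambda>x. k x powr (- p) - k x) has_real_derivative - p * k x powr (- p - 1) * f x - f x) (at x)" for x
    using DERIV_diff[OF DERIV_fun_powr[OF kd kp, of "- p"] kd] by simp
  \<comment> \<open>\<open>sin\<close> solves the equation of \<open>f\<close> with its potential
    \<open>1 + p * k powr (- p - 1)\<close> lowered to 1, so \<open>f\<close> has to vanish before
    pi.\<close>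
  have tpi: "t < pi"
  proof (rule ccontr)
    assume "\<not> t < pi"
    then have tp: "t = pi" using t by simp
    define W where "W x = (k x powr (- p) - k x) * sin x - f x * cos x" for x
    have Wd: "(W has_real_derivative (- p * k x powr (- p - 1) * f x) * sin x) (at x)" for x
      unfolding W_def[abs_def]
      by (rule DERIV_cong[OF DERIV_diff[OF DERIV_mult[OF fdd DERIV_sin] DERIV_mult[OF fd DERIV_cos]]]) (simp add: algebra_simps)
    have "W pi < W 0"
    proof (rule DERIV_neg_imp_decreasing_open[where f = W])
      fix x assume x: "0 < x" "x < pi"
      have "0 < p * k x powr (- p - 1) * f x * sin x" using p kp[of x] fp[of x] x tp sin_gt_zero[of x] by simp
      then show "\<exists>y. (W has_real_derivative y) (at x) \<and> y < 0" using Wd[of x]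
        by (intro exI[of _ "- p * k x powr (- p - 1) * f x * sin x"]) simp
    qed (auto intro!: continuous_at_imp_continuous_on DERIV_isCont[OF Wd])
    then show False using fpi f0 by (simp add: W_def)
  qed
  \<comment> \<open>The product \<open>s = k * f\<close> satisfies
    \<open>s'' + 4 * s = (3 - p) * k powr (- p) * f\<close>, whose right-hand side is positive up to
    \<open>t\<close>. Comparison with \<open>sin (2 * x)\<close> excludes a zero up to pi /
    2.\<close>
  have t2: "t > pi / 2"
  proof (rule ccontr)
    assume "\<not> t > pi / 2"
    then have tp: "t \<le> pi / 2" by simp
    define s where "s x = k x * f x" for x
    define s' where "s' x = (f x)\<^sup>2 + k x powr (1 - p) - (k x)\<^sup>2" for x
    have kk: "k x * k x powr (- p) = k x powr (1 - p)" for x using kp[of x] powr_add[of "k x" 1 "- p"] by simp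
    have sd: "(s has_real_derivative s' x) (at x)" for x
      unfolding s_def[abs_def] s'_def kk[symmetric] by (auto intro!: derivative_eq_intros fd kd simp: algebra_simps power2_eq_square)
    have sd': "(s' has_real_derivative (3 - p) * k x powr (- p) * f x - 4 * s x) (at x)" for x
      unfolding s'_def[abs_def]
      by (rule DERIV_cong[OF DERIV_diff[OF DERIV_add[OF DERIV_power[OF fd, where n = 2] DERIV_fun_powr[OF kd kp, of "1 - p"]] DERIV_power[OF kd, where n = 2]]])
        (simp add: s_def algebra_simps)
    define W where "W x = s' x * sin (2 * x) - 2 * s x * cos (2 * x)" for x
    have Wd: "(W has_real_derivative ((3 - p) * k x powr (- p) * f x) * sin (2 * x)) (at x)" for x
      unfolding W_def[abs_def] by (auto intro!: derivative_eq_intros sd sd' simp: algebra_simps)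
    have "W 0 < W t"
    proof (rule DERIV_pos_imp_increasing_open[where f = W])
      fix x assume x: "0 < x" "x < t"
      have "0 < (3 - p) * k x powr (- p) * f x * sin (2 * x)" using p kp[of x] fp[of x] x tp sin_gt_zero[of "2 * x"] by simp
      then show "\<exists>y. (W has_real_derivative y) (at x) \<and> 0 < y" using Wd[of x] by blast
    qed (use d t in \<open>auto intro!: continuous_at_imp_continuous_on DERIV_isCont[OF Wd]\<close>)
    then have pos: "0 < k t * (k t powr (- p) - k t) * sin (2 * t)"
      using f0 t(3) by (simp add: W_def s_def s'_def kk[symmetric] power2_eq_square algebra_simps)
    have "k t powr (- p) - k t \<le> 0"
    proof (rule ccontr)
      assume "\<not> k t powr (- p) - k t \<le> 0"
      then obtain e where e: "e > 0" "\<And>h. 0 < h \<Longrightarrow> h < e \<Longrightarrow> f (t - h) < f t" using DERIV_pos_inc_left[OF fd[of t]] by auto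
      define q where "q = min (e/2) (t/2)"
      have "f (t - q) < 0" using e(2)[of q] e(1) d t by (auto simp: q_def)
      moreover have "f (t - q) > 0" using e(1) d t by (intro fp) (auto simp: q_def)
      ultimately show False by simp
    qed
    moreover have "sin (2 * t) \<ge> 0" using tp d t by (intro sin_ge_zero) auto
    ultimately have "k t * (k t powr (- p) - k t) * sin (2 * t) \<le> 0" using kp[of t] by (intro mult_nonpos_nonneg mult_nonneg_nonpos) auto
    then show False using pos by simp
  qed
  have "h' (m + t) = 0" using t(3) by (simp add: f_def)
  from antisymmetric[OF this, of "pi - t"] have "f (2 * t - pi) = 0" using fpi by (simp add: f_def algebra_simps)
  moreover have "f (2 * t - pi) > 0" using t2 tpi by (intro fp) auto
  ultimately show False by simp
qed

end

section \<open>Support functions\<close>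

lemma inner_sgn: "z \<bullet> sgn z = norm z" for z :: complex
  by (cases "z = 0") (simp_all add: sgn_div_norm dot_square_norm power2_eq_square)

text \<open>Variation of constants for \<open>H'' + H = H powr (- p)\<close>, up to an error that is controlled where \<open>H\<close> is bounded below.\<close>

definition almost_soliton :: "real \<Rightarrow> real \<Rightarrow> (real \<Rightarrow> real) \<Rightarrow> real \<Rightarrow> bool" where
  "almost_soliton p C H e \<longleftrightarrow> (\<forall>a. \<exists>B. \<bar>B\<bar> \<le> C \<and> (\<forall>b \<eta>. a < b \<longrightarrow> b < a + 2 * pi \<longrightarrow> \<eta> > 0 \<longrightarrow> (\<forall>s\<in>{a..b}. H s \<ge> \<eta>) \<longrightarrow>
     \<bar>H b - (H a * cos (b - a) + B * sin (b - a) + integral {a..b} (\<lambda>s. sin (b - s) * H s powr (- p)))\<bar> \<le> e / \<eta>))"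

lemma almost_soliton_mono:
  assumes "almost_soliton p C H e" "C \<le> C'" "e \<le> e'"
  shows "almost_soliton p C' H e'"
  unfolding almost_soliton_def
proof
  fix a
  obtain B where B: "\<bar>B\<bar> \<le> C" "\<forall>b \<eta>. a < b \<longrightarrow> b < a + 2 * pi \<longrightarrow> \<eta> > 0 \<longrightarrow> (\<forall>s\<in>{a..b}. H s \<ge> \<eta>) \<longrightarrow>
     \<bar>H b - (H a * cos (b - a) + B * sin (b - a) + integral {a..b} (\<lambda>s. sin (b - s) * H s powr (- p)))\<bar> \<le> e / \<eta>"
    using assms(1) unfolding almost_soliton_def by blast
  show "\<exists>B. \<bar>B\<bar> \<le> C' \<and> (\<forall>b \<eta>. a < b \<longrightarrow> b < a + 2 * pi \<longrightarrow> \<eta> > 0 \<longrightarrow> (\<forall>s\<in>{a..b}. H s \<ge> \<eta>) \<longrightarrow>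
     \<bar>H b - (H a * cos (b - a) + B * sin (b - a) + integral {a..b} (\<lambda>s. sin (b - s) * H s powr (- p)))\<bar> \<le> e' / \<eta>)"
    using B assms(2,3) by (intro exI[of _ B] conjI allI impI)
      (linarith, meson divide_right_mono less_imp_le order_trans)
qed

context closed_curve
begin

lemma X_diff:
  assumes "u1 \<le> u2"
  shows "((\<lambda>u. g u * ((\<i> * N u) \<bullet> e)) has_integral (X u2 - X u1) \<bullet> e) {u1..u2}"
  using fundamental_theorem_of_calculus[OF assms, of "\<lambda>u. (X u - 0) \<bullet> e"] inner_X_deriv[of 0 e]
  by (simp add: has_real_derivative_iff_has_vector_derivative[symmetric] has_field_derivative_at_within inner_diff_left)

lemma dist_le_len: "norm (X u - X u') \<le> len"
proof -
  define s where "s = u + frac (u' - u)"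
  have "X u' = X (u + (u' - u))" by simp
  also have "\<dots> = X s" unfolding s_def
    by (rule periodic_frac[of "\<lambda>s. X (u + s)", symmetric]) (simp add: X_per flip: add.assoc)
  finally have Xs: "X u' = X s" .
  have s: "u \<le> s" "s \<le> u + 1" using frac_ge_0[of "u' - u"] frac_lt_1[of "u' - u"] by (auto simp: s_def)
  have "(X s - X u) \<bullet> e \<le> len" if e: "norm e = 1" for e
  proof -
    have "(X s - X u) \<bullet> e = integral {u..s} (\<lambda>u. g u * ((\<i> * N u) \<bullet> e))"
      by (rule integral_unique[OF X_diff[OF s(1)], symmetric])
    also have "\<dots> \<le> integral {u..s} g"
    proof (intro integral_mono_intros continuous_intros g_cont' N_cont)
      fix x
      have "(\<i> * N x) \<bullet> e \<le> norm (\<i> * N x) * norm e" by (rule norm_cauchy_schwarz)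
      then have "(\<i> * N x) \<bullet> e \<le> 1" using e norm_N by (simp add: norm_mult)
      then show "g x * ((\<i> * N x) \<bullet> e) \<le> g x" using g_pos[of x] mult_left_mono[of _ 1 "g x"] by fastforce
    qed
    also have "\<dots> \<le> integral {u..u+1} g"
      by (intro integral_subset_le integrable_continuous_real g_cont') (use s g_pos less_imp_le in auto)
    also have "\<dots> = len" unfolding len_def by (rule per_int[OF g_cont g_per])
    finally show ?thesis .
  qed
  from this[of "sgn (X s - X u)"] have "norm (X s - X u) \<le> len"
    using len_pos by (cases "X s = X u") (auto simp: norm_sgn inner_sgn)
  then show ?thesis by (simp add: Xs norm_minus_commute)
qed

text \<open>As the origin is inside, some point of the curve has a negative component along
  \<open>X u\<close>, so \<open>X u\<close> is farther from it than from the origin.\<close>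

lemma norm_X_le:
  assumes h: "\<And>u. X u \<bullet> N u > 0"
  shows "norm (X u) \<le> len"
proof -
  define e where "e = sgn (X u)"
  have "X u \<noteq> 0" using h[of u] by auto
  then have "norm (- e) = 1" by (simp add: e_def norm_sgn)
  then obtain u' where u': "N u' = - e" using N_surj by blast
  have "X u \<bullet> e = norm (X u)" by (simp add: e_def inner_sgn)
  moreover have "X u' \<bullet> e < 0" using h[of u'] u' by simp
  moreover have "(X u - X u') \<bullet> e \<le> norm (X u - X u') * norm e" by (rule norm_cauchy_schwarz)
  ultimately show ?thesis using dist_le_len[of u u'] \<open>norm (- e) = 1\<close> by (simp add: inner_diff_left)
qed

text \<open>The support function of the normal angle. Where \<open>w\<close> vanishes on an arc
  several \<open>u\<close> have the same angle; for the origin inside, \<open>supp_theta\<close>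
  shows that the choice is immaterial.\<close>

definition supp :: "real \<Rightarrow> real" where
  "supp \<phi> = X (SOME u. \<theta> u = \<phi>) \<bullet> N (SOME u. \<theta> u = \<phi>)"

text \<open>The support value changes at rate \<open>w\<close> times the tangential component of
  \<open>X\<close>, which \<open>len\<close> bounds. Comparing with \<open>len * \<theta>\<close>
  avoids a division by \<open>w\<close>.\<close>

lemma h_lip:
  assumes h: "\<And>u. X u \<bullet> N u > 0" and u: "u \<le> u'"
  shows "\<bar>X u' \<bullet> N u' - X u \<bullet> N u\<bar> \<le> len * (\<theta> u' - \<theta> u)"
proof -
  have d: "((\<lambda>u. X u \<bullet> N u) has_real_derivative w u * (X u \<bullet> (\<i> * N u))) (at u)" for u
    using X_has_derivative_prod(1)[of 0] by simp
  have b: "\<bar>w u * (X u \<bullet> (\<i> * N u))\<bar> \<le> len * w u" for u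
    using Cauchy_Schwarz_ineq2[of "X u" "\<i> * N u"] norm_X_le[OF h, of u] norm_N[of u] w_nonneg[of u]
      mult_right_mono[of "\<bar>X u \<bullet> (\<i> * N u)\<bar>" len "w u"]
    by (simp add: abs_mult norm_mult mult.commute)
  have "X u' \<bullet> N u' - len * \<theta> u' \<le> X u \<bullet> N u - len * \<theta> u"
  proof (rule DERIV_nonpos_imp_nonincreasing[where f = "\<lambda>u. X u \<bullet> N u - len * \<theta> u", OF u])
    fix x
    have "((\<lambda>u. X u \<bullet> N u - len * \<theta> u) has_real_derivative w x * (X x \<bullet> (\<i> * N x)) - len * w x) (at x)"
      by (auto intro!: derivative_eq_intros d theta_u)
    then show "\<exists>y. ((\<lambda>u. X u \<bullet> N u - len * \<theta> u) has_real_derivative y) (at x) \<and> y \<le> 0" using b[of x] by force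
  qed
  moreover have "X u \<bullet> N u + len * \<theta> u \<le> X u' \<bullet> N u' + len * \<theta> u'"
  proof (rule DERIV_nonneg_imp_nondecreasing[where f = "\<lambda>u. X u \<bullet> N u + len * \<theta> u", OF u])
    fix x
    have "((\<lambda>u. X u \<bullet> N u + len * \<theta> u) has_real_derivative w x * (X x \<bullet> (\<i> * N x)) + len * w x) (at x)"
      by (auto intro!: derivative_eq_intros d theta_u)
    then show "\<exists>y. ((\<lambda>u. X u \<bullet> N u + len * \<theta> u) has_real_derivative y) (at x) \<and> 0 \<le> y" using b[of x] by force
  qed
  ultimately show ?thesis by (simp add: abs_le_iff algebra_simps)
qed

lemma supp_theta:
  assumes h: "\<And>u. X u \<bullet> N u > 0"
  shows "supp (\<theta> u) = X u \<bullet> N u"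
proof -
  define u' where "u' = (SOME u'. \<theta> u' = \<theta> u)"
  have "\<theta> u' = \<theta> u" unfolding u'_def by (rule someI[of _ u]) simp
  then have "X u' \<bullet> N u' = X u \<bullet> N u" using h_lip[OF h, of u u'] h_lip[OF h, of u' u] by (cases "u \<le> u'") auto
  then show ?thesis by (simp add: supp_def u'_def)
qed

lemma supp_lip:
  assumes h: "\<And>u. X u \<bullet> N u > 0"
  shows "\<bar>supp a - supp b\<bar> \<le> len * \<bar>a - b\<bar>"
proof -
  have *: "\<bar>supp a - supp b\<bar> \<le> len * (b - a)" if "a < b" for a b
  proof -
    obtain u u' where u: "\<theta> u = a" "\<theta> u' = b" using theta_surj by metis
    then have "u \<le> u'" using that theta_mono[of u' u] by force
    from h_lip[OF h this] show ?thesis using supp_theta[OF h, of u] supp_theta[OF h, of u'] u by (simp add: abs_minus_commute)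
  qed
  show ?thesis using *[of a b] *[of b a] by (cases a b rule: linorder_cases) (auto simp: abs_minus_commute)
qed

lemma supp_cont: "(\<And>u. X u \<bullet> N u > 0) \<Longrightarrow> continuous_on S supp"
  by (rule lipschitz_on_continuous_on[of len], rule lipschitz_onI) (use supp_lip len_pos in \<open>auto simp: dist_real_def\<close>)

lemma supp_per: "(\<And>u. X u \<bullet> N u > 0) \<Longrightarrow> supp (x + 2 * pi) = supp x"
proof -
  assume h: "\<And>u. X u \<bullet> N u > 0"
  obtain u where "\<theta> u = x" using theta_surj by blast
  then show ?thesis using supp_theta[OF h, of u] supp_theta[OF h, of "u + 1"] by (simp add: theta_per X_per N_per)
qed

lemma supp_bounds:
  assumes h: "\<And>u. X u \<bullet> N u > 0"
  shows "0 < supp x" "supp x \<le> len"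
proof -
  obtain u where "\<theta> u = x" using theta_surj by blast
  then have e: "supp x = X u \<bullet> N u" using supp_theta[OF h, of u] by simp
  show "0 < supp x" using h e by simp
  show "supp x \<le> len" using norm_cauchy_schwarz[of "X u" "N u"] norm_X_le[OF h, of u] norm_N[of u] e by simp
qed

lemma rotate_inner: "X u1 \<bullet> N u2 = (X u1 \<bullet> N u1) * cos (\<theta> u2 - \<theta> u1) + (X u1 \<bullet> (\<i> * N u1)) * sin (\<theta> u2 - \<theta> u1)"
proof -
  have "N u2 = N u1 * cis (\<theta> u2 - \<theta> u1)" by (simp add: N_cis cis_mult)
  then show ?thesis by (simp add: inner_complex_def algebra_simps)
qed

text \<open>The vector \<open>X u1\<close> contributes a combination of \<open>cos\<close> and
  \<open>sin\<close> to the support value at \<open>u2\<close>, and the arc from \<open>u1\<close>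
  to \<open>u2\<close> contributes the integral of \<open>g * sin (b - \<theta>)\<close>. This is
  variation of constants for \<open>H'' + H\<close> equal to the radius of curvature, in a form that
  survives zeros of \<open>w\<close>. Replacing \<open>g\<close> by \<open>w\<close> times the power
  \<open>- p\<close> of the support value costs the stated integral, divided by a lower bound of the
  support function.\<close>

lemma supp_formula:
  assumes h: "\<And>u. X u \<bullet> N u > 0"
  shows "almost_soliton p len supp (integral {0..1} (\<lambda>u. \<bar>(X u \<bullet> N u) * g u - (X u \<bullet> N u) powr (1 - p) * w u\<bar>))"
  unfolding almost_soliton_def
proof
  fix a
  define er where "er u = \<bar>(X u \<bullet> N u) * g u - (X u \<bullet> N u) powr (1 - p) * w u\<bar>" for u
  have hc: "continuous_on S (\<lambda>u. X u \<bullet> N u)" for S by (intro continuous_intros X_cont N_cont)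
  have hn: "X u \<bullet> N u \<noteq> 0" for u using h[of u] by simp
  have hpc: "continuous_on S (\<lambda>u. (X u \<bullet> N u) powr q)" for S q by (intro continuous_intros hc) (use h in \<open>auto simp: less_imp_neq[symmetric]\<close>)
  have erc: "continuous_on S er" for S unfolding er_def[abs_def] by (intro continuous_intros hc hpc g_cont' w_cont')
  have erp: "er (u + 1) = er u" for u by (simp add: er_def X_per N_per g_per w_per)
  obtain u1 where u1: "\<theta> u1 = a" using theta_surj by blast
  define B where "B = X u1 \<bullet> (\<i> * N u1)"
  have "\<bar>B\<bar> \<le> len" using Cauchy_Schwarz_ineq2[of "X u1" "\<i> * N u1"] norm_X_le[OF h, of u1] norm_N[of u1]
    by (simp add: B_def norm_mult)
  moreover have "\<bar>supp b - (supp a * cos (b - a) + B * sin (b - a) + integral {a..b} (\<lambda>s. sin (b - s) * supp s powr (- p)))\<bar>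
       \<le> integral {0..1} er / \<eta>" if b: "a < b" "b < a + 2 * pi" and eta: "\<eta> > 0" "\<forall>s\<in>{a..b}. supp s \<ge> \<eta>" for b \<eta>
  proof -
    obtain u2 where u2: "\<theta> u2 = b" using theta_surj by blast
    have u12: "u1 \<le> u2" using theta_mono[of u2 u1] u1 u2 b by force
    have u2': "u2 \<le> u1 + 1" using theta_mono[of "u1 + 1" u2] theta_per[of u1] u1 u2 b by force
    have "((\<lambda>u. g u * ((\<i> * N u) \<bullet> N u2)) has_integral (X u2 - X u1) \<bullet> N u2) {u1..u2}" by (rule X_diff[OF u12])
    then have i1: "integral {u1..u2} (\<lambda>u. g u * sin (b - \<theta> u)) = (X u2 - X u1) \<bullet> N u2"
      unfolding inner_N_N u2 sin_minus[symmetric] by (simp add: integral_unique)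
    have "((\<lambda>x. w x *\<^sub>R (sin (b - \<theta> x) * supp (\<theta> x) powr (- p))) has_integral integral {\<theta> u1..\<theta> u2} (\<lambda>s. sin (b - s) * supp s powr (- p))) {u1..u2}"
    proof (rule has_integral_substitution[where c = a and d = b])
      show "\<theta> ` {u1..u2} \<subseteq> {a..b}" using theta_mono u1 u2 by auto
      show "continuous_on {a..b} (\<lambda>s. sin (b - s) * supp s powr - p)"
        by (intro continuous_intros supp_cont[OF h]) (use supp_bounds[OF h] in \<open>auto simp: less_imp_neq[symmetric]\<close>)
      show "(\<theta> has_real_derivative w x) (at x within {u1..u2})" for x using theta_u by (rule has_field_derivative_at_within)
    qed (use u12 theta_mono in auto)
    then have i2: "integral {u1..u2} (\<lambda>x. w x * (sin (b - \<theta> x) * (X x \<bullet> N x) powr (- p))) = integral {a..b} (\<lambda>s. sin (b - s) * supp s powr (- p))"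
      unfolding u1 u2 supp_theta[OF h] by (simp add: integral_unique)
    have "supp b = X u2 \<bullet> N u2" "supp a = X u1 \<bullet> N u1" using supp_theta[OF h] u1 u2 by auto
    moreover have "X u2 \<bullet> N u2 = X u1 \<bullet> N u2 + (X u2 - X u1) \<bullet> N u2" by (simp add: inner_diff_left)
    ultimately have "supp b = supp a * cos (b - a) + B * sin (b - a) + integral {u1..u2} (\<lambda>u. g u * sin (b - \<theta> u))"
      using rotate_inner[of u1 u2] i1 u1 u2 by (simp add: B_def)
    then have "supp b - (supp a * cos (b - a) + B * sin (b - a) + integral {a..b} (\<lambda>s. sin (b - s) * supp s powr (- p)))
       = integral {u1..u2} (\<lambda>u. g u * sin (b - \<theta> u)) - integral {u1..u2} (\<lambda>x. w x * (sin (b - \<theta> x) * (X x \<bullet> N x) powr (- p)))"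
      unfolding i2 by simp
    also have "\<dots> = integral {u1..u2} (\<lambda>u. g u * sin (b - \<theta> u) - w u * (sin (b - \<theta> u) * (X u \<bullet> N u) powr (- p)))"
      by (intro int_diff[symmetric] continuous_intros g_cont' w_cont' theta_cont hpc)
    finally have e: "supp b - (supp a * cos (b - a) + B * sin (b - a) + integral {a..b} (\<lambda>s. sin (b - s) * supp s powr (- p))) = \<dots>" .
    have "\<bar>integral {u1..u2} (\<lambda>u. g u * sin (b - \<theta> u) - w u * (sin (b - \<theta> u) * (X u \<bullet> N u) powr (- p)))\<bar>
       \<le> integral {u1..u2} (\<lambda>u. er u / \<eta>)"
      unfolding real_norm_def[symmetric]
    proof (intro integral_norm_bound_integral integrable_continuous_real continuous_intros g_cont' w_cont' theta_cont hpc erc)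
      fix u assume "u \<in> {u1..u2}"
      then have "\<theta> u \<in> {a..b}" using theta_mono u1 u2 by auto
      then have he: "X u \<bullet> N u \<ge> \<eta>" using bspec[OF eta(2), of "\<theta> u"] supp_theta[OF h, of u] by simp
      have hp: "X u \<bullet> N u > 0" by (rule h)
      have pw: "(X u \<bullet> N u) powr (1 - p) = (X u \<bullet> N u) * (X u \<bullet> N u) powr (- p)" using powr_add[of "X u \<bullet> N u" 1 "- p"] hp by simp
      have "er u = \<bar>(X u \<bullet> N u) * (g u - w u * (X u \<bullet> N u) powr (- p))\<bar>" unfolding er_def pw by (simp add: algebra_simps)
      also have "\<dots> = (X u \<bullet> N u) * \<bar>g u - w u * (X u \<bullet> N u) powr (- p)\<bar>" using hp by (simp add: abs_mult)
      finally have er: "er u = (X u \<bullet> N u) * \<bar>g u - w u * (X u \<bullet> N u) powr (- p)\<bar>" .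
      have "norm (g u * sin (b - \<theta> u) - w u * (sin (b - \<theta> u) * (X u \<bullet> N u) powr (- p)))
         = \<bar>sin (b - \<theta> u) * (g u - w u * (X u \<bullet> N u) powr (- p))\<bar>" by (simp add: algebra_simps)
      also have "\<dots> \<le> 1 * \<bar>g u - w u * (X u \<bullet> N u) powr (- p)\<bar>" unfolding abs_mult by (intro mult_right_mono) auto
      also have "\<dots> \<le> er u / \<eta>" using mult_right_mono[OF he, of "\<bar>g u - w u * (X u \<bullet> N u) powr (- p)\<bar>"] eta(1) unfolding er by (simp add: field_simps)
      finally show "norm (g u * sin (b - \<theta> u) - w u * (sin (b - \<theta> u) * (X u \<bullet> N u) powr (- p))) \<le> er u / \<eta>" .
    qed (use eta(1) hn in \<open>auto intro: X_cont N_cont\<close>)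
    also have "\<dots> \<le> integral {u1..u1+1} (\<lambda>u. er u / \<eta>)"
      by (intro integral_subset_le integrable_continuous_real continuous_intros erc) (use u2' eta in \<open>auto simp: er_def\<close>)
    also have "\<dots> = integral {0..1} (\<lambda>u. er u / \<eta>)"
      by (rule per_int) (use eta in \<open>auto intro!: continuous_intros erc simp: erp\<close>)
    also have "\<dots> = integral {0..1} er / \<eta>" by simp
    finally show ?thesis unfolding e .
  qed
  ultimately show "\<exists>B. \<bar>B\<bar> \<le> len \<and> (\<forall>b \<eta>. a < b \<longrightarrow> b < a + 2 * pi \<longrightarrow> \<eta> > 0 \<longrightarrow> (\<forall>s\<in>{a..b}. supp s \<ge> \<eta>) \<longrightarrow>
     \<bar>supp b - (supp a * cos (b - a) + B * sin (b - a) + integral {a..b} (\<lambda>s. sin (b - s) * supp s powr (- p)))\<bar>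
       \<le> integral {0..1} (\<lambda>u. \<bar>(X u \<bullet> N u) * g u - (X u \<bullet> N u) powr (1 - p) * w u\<bar>) / \<eta>)"
    unfolding er_def by blast
qed

end

section \<open>Limits of almost solitons\<close>

locale soliton_limit =
  fixes p C :: real and H :: "nat \<Rightarrow> real \<Rightarrow> real" and Z :: "real \<Rightarrow> real" and e :: "nat \<Rightarrow> real"
  assumes p: "1 < p" "p < 2"
    and Hpos: "\<And>n x. H n x > 0" and Hcont: "\<And>n S. continuous_on S (H n)"
    and lim: "uniform_limit UNIV H Z sequentially" and e: "e \<longlonglongrightarrow> 0"
    and Zcont: "\<And>S. continuous_on S Z" and Zper: "\<And>x. Z (x + 2 * pi) = Z x" and Znz: "\<exists>x. Z x \<noteq> 0"
    and form: "\<And>n. almost_soliton p C (H n) (e n)"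
begin

lemma Hlim: "(\<lambda>n. H n x) \<longlonglongrightarrow> Z x"
  using tendsto_uniform_limitI[OF lim] by simp

lemma Z_nonneg: "Z x \<ge> 0"
  by (rule LIMSEQ_le_const[OF Hlim]) (use Hpos in \<open>auto intro: less_imp_le\<close>)

lemma Zpow_cont: "(\<And>x. x \<in> S \<Longrightarrow> Z x > 0) \<Longrightarrow> continuous_on S (\<lambda>s. Z s powr q)"
  by (intro continuous_intros Zcont) force

lemma Hpow_cont: "continuous_on S (\<lambda>s. H n s powr q)"
  by (intro continuous_intros Hcont) (use Hpos in \<open>auto simp: less_imp_neq[symmetric]\<close>)

lemma limit_formula:
  assumes ab: "a < b" "b < a + 2 * pi" and pos: "\<And>x. x \<in> {a..b} \<Longrightarrow> Z x > 0"
  shows "\<exists>B. \<forall>x\<in>{a<..b}. Z x = Z a * cos (x - a) + B * sin (x - a) + integral {a..x} (\<lambda>s. sin (x - s) * Z s powr (- p))"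
proof -
  have "\<exists>m\<in>{a..b}. \<forall>y\<in>{a..b}. Z m \<le> Z y" by (rule continuous_attains_inf) (use ab Zcont in auto)
  then obtain m where m: "m \<in> {a..b}" "\<And>y. y \<in> {a..b} \<Longrightarrow> Z m \<le> Z y" by blast
  define \<eta> where "\<eta> = Z m / 2"
  have eta: "\<eta> > 0" using pos[OF m(1)] by (simp add: \<eta>_def)
  define R where "R n B b = \<bar>H n b - (H n a * cos (b - a) + B * sin (b - a) + integral {a..b} (\<lambda>s. sin (b - s) * H n s powr (- p)))\<bar>" for n B b
  have "\<forall>n. \<exists>B. \<bar>B\<bar> \<le> C \<and> (\<forall>b \<eta>. a < b \<longrightarrow> b < a + 2 * pi \<longrightarrow> \<eta> > 0 \<longrightarrow> (\<forall>s\<in>{a..b}. H n s \<ge> \<eta>) \<longrightarrow> R n B b \<le> e n / \<eta>)"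
    using form unfolding almost_soliton_def R_def by blast
  from choice[OF this] obtain B where B0: "\<forall>n. \<bar>B n\<bar> \<le> C \<and> (\<forall>b \<eta>. a < b \<longrightarrow> b < a + 2 * pi \<longrightarrow> \<eta> > 0 \<longrightarrow> (\<forall>s\<in>{a..b}. H n s \<ge> \<eta>) \<longrightarrow> R n (B n) b \<le> e n / \<eta>)"
    by (rule exE)
  have B: "\<bar>B n\<bar> \<le> C" "a < b \<Longrightarrow> b < a + 2 * pi \<Longrightarrow> \<eta> > 0 \<Longrightarrow> \<forall>s\<in>{a..b}. H n s \<ge> \<eta> \<Longrightarrow>
     \<bar>H n b - (H n a * cos (b - a) + B n * sin (b - a) + integral {a..b} (\<lambda>s. sin (b - s) * H n s powr (- p)))\<bar> \<le> e n / \<eta>" for n b \<eta>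
    using B0[rule_format, of n] unfolding R_def by (blast, auto)
  \<comment> \<open>The coefficients need not converge, but they are bounded and depend on
    \<open>a\<close> only, so one subsequence serves all \<open>x\<close>. Its limit determines the
    coefficient in the limit formula.\<close>
  have "bounded (range B)" using B(1) by (auto simp: bounded_iff)
  then obtain l r where r: "strict_mono r" "(B \<circ> r) \<longlonglongrightarrow> l" using bounded_imp_convergent_subsequence by blast
  have near: "\<forall>\<^sub>F n in sequentially. \<forall>s. \<bar>H n s - Z s\<bar> < d" if "d > 0" for d
    using uniform_limitD[OF lim that] by (simp add: dist_real_def)
  have big: "\<forall>\<^sub>F n in sequentially. \<forall>s\<in>{a..b}. H n s \<ge> \<eta>"
    using near[OF eta]
  proof eventually_elim
    fix n assume n: "\<forall>s. \<bar>H n s - Z s\<bar> < \<eta>"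
    show "\<forall>s\<in>{a..b}. H n s \<ge> \<eta>"
    proof
      fix s assume "s \<in> {a..b}"
      then show "H n s \<ge> \<eta>" using m(2)[of s] n[rule_format, of s] unfolding \<eta>_def abs_less_iff by linarith
    qed
  qed
  define K where "K = p * \<eta> powr (- p - 1)"
  have K: "K \<ge> 0" using p by (simp add: K_def)
  have "Z x = Z a * cos (x - a) + l * sin (x - a) + integral {a..x} (\<lambda>s. sin (x - s) * Z s powr (- p))" if x: "x \<in> {a<..b}" for x
  proof -
    define I where "I n = integral {a..x} (\<lambda>s. sin (x - s) * H n s powr (- p))" for n
    define J where "J = integral {a..x} (\<lambda>s. sin (x - s) * Z s powr (- p))"
    have ne: "H n y \<noteq> 0" "y \<in> {a..x} \<Longrightarrow> Z y \<noteq> 0" for n y using Hpos[of n y] pos[of y] x by auto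
    have Zc: "continuous_on {a..x} (\<lambda>s. Z s powr q)" for q by (rule Zpow_cont) (use x pos in auto)
    have IJ: "I \<longlonglongrightarrow> J"
    proof (rule LIMSEQ_I)
      fix d :: real assume d: "d > 0"
      define d' where "d' = d / (2 * ((x - a) * (K + 1)))"
      have xK: "(x - a) * (K + 1) > 0" using x K by simp
      then have d': "d' > 0" using d by (simp add: d'_def)
      have "\<forall>\<^sub>F n in sequentially. norm (I n - J) < d"
        using big near[OF d']
      proof eventually_elim
        fix n assume n: "\<forall>s\<in>{a..b}. \<eta> \<le> H n s" "\<forall>s. \<bar>H n s - Z s\<bar> < d'"
        have "I n - J = integral {a..x} (\<lambda>s. sin (x - s) * H n s powr (- p) - sin (x - s) * Z s powr (- p))"
          unfolding I_def J_def by (intro int_diff[symmetric] continuous_intros Hpow_cont Zc)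
        also have "norm \<dots> \<le> integral {a..x} (\<lambda>s. K * d')"
        proof (intro integral_norm_bound_integral integrable_continuous_real continuous_intros Hpow_cont Zc)
          fix s assume s: "s \<in> {a..x}"
          then have s': "s \<in> {a..b}" using x by simp
          have "\<bar>H n s powr (- p) - Z s powr (- p)\<bar> \<le> K * \<bar>H n s - Z s\<bar>"
            unfolding K_def using n(1) s' m(2)[OF s'] eta p by (intro powr_neg_lipschitz) (auto simp: \<eta>_def)
          also have "\<dots> \<le> K * d'" using n(2) K by (intro mult_left_mono) (auto intro: less_imp_le)
          finally have "1 * \<bar>H n s powr (- p) - Z s powr (- p)\<bar> \<le> K * d'" by simp
          moreover have "norm (sin (x - s) * H n s powr (- p) - sin (x - s) * Z s powr (- p)) = \<bar>sin (x - s)\<bar> * \<bar>H n s powr (- p) - Z s powr (- p)\<bar>"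
            by (simp add: abs_mult[symmetric] algebra_simps)
          moreover have "\<bar>sin (x - s)\<bar> * \<bar>H n s powr (- p) - Z s powr (- p)\<bar> \<le> 1 * \<bar>H n s powr (- p) - Z s powr (- p)\<bar>"
            by (intro mult_right_mono) auto
          ultimately show "norm (sin (x - s) * H n s powr (- p) - sin (x - s) * Z s powr (- p)) \<le> K * d'" by linarith
        qed (use ne Hcont Zcont in blast)+
        also have "\<dots> = (x - a) * (K * d')" using x by simp
        also have "\<dots> \<le> (x - a) * ((K + 1) * d')" using x d' by (intro mult_left_mono mult_right_mono) auto
        also have "\<dots> = d / 2" unfolding d'_def using xK by (simp add: field_simps)
        also have "\<dots> < d" using d by simp
        finally show "norm (I n - J) < d" .
      qed
      then show "\<exists>no. \<forall>n\<ge>no. norm (I n - J) < d" by (simp add: eventually_sequentially)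
    qed
    define R where "R n = H n x - (H n a * cos (x - a) + B n * sin (x - a) + I n)" for n
    have "R \<longlonglongrightarrow> 0"
    proof (rule Lim_null_comparison)
      show "\<forall>\<^sub>F n in sequentially. norm (R n) \<le> e n / \<eta>"
        using big
      proof eventually_elim
        fix n assume "\<forall>s\<in>{a..b}. \<eta> \<le> H n s"
        then show "norm (R n) \<le> e n / \<eta>" unfolding R_def I_def real_norm_def
          using x ab eta by (intro B(2)) auto
      qed
      show "(\<lambda>n. e n / \<eta>) \<longlonglongrightarrow> 0" using tendsto_divide[OF e tendsto_const, of \<eta>] eta by simp
    qed
    then have "(R \<circ> r) \<longlonglongrightarrow> 0" using LIMSEQ_subseq_LIMSEQ r(1) by blast
    moreover have "(R \<circ> r) \<longlonglongrightarrow> Z x - (Z a * cos (x - a) + l * sin (x - a) + J)"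
    proof -
      have h: "(\<lambda>n. H (r n) y) \<longlonglongrightarrow> Z y" for y using LIMSEQ_subseq_LIMSEQ[OF Hlim r(1)] by (simp add: o_def)
      have i: "(\<lambda>n. I (r n)) \<longlonglongrightarrow> J" using LIMSEQ_subseq_LIMSEQ[OF IJ r(1)] by (simp add: o_def)
      have "(\<lambda>n. B (r n)) \<longlonglongrightarrow> l" using r(2) by (simp add: o_def)
      then show ?thesis unfolding R_def o_def by (intro tendsto_intros h i)
    qed
    ultimately have "Z x - (Z a * cos (x - a) + l * sin (x - a) + J) = 0" by (rule LIMSEQ_unique[symmetric])
    then show ?thesis by (simp add: J_def)
  qed
  then show ?thesis by blast
qed

text \<open>The addition theorem for \<open>sin (x - s)\<close> takes \<open>x\<close> out of the
  integrand, after which the fundamental theorem of calculus can be applied twice.\<close>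

lemma limit_deriv:
  assumes ab: "a < b" "b < a + 2 * pi" and pos: "\<And>x. x \<in> {a..b} \<Longrightarrow> Z x > 0"
  shows "\<exists>D. \<forall>x\<in>{a<..<b}. (Z has_real_derivative D x) (at x) \<and> (D has_real_derivative Z x powr (- p) - Z x) (at x)"
proof -
  obtain B where B: "\<And>x. x \<in> {a<..b} \<Longrightarrow> Z x = Z a * cos (x - a) + B * sin (x - a) + integral {a..x} (\<lambda>s. sin (x - s) * Z s powr (- p))"
    using limit_formula[OF ab pos] by blast
  have Zc: "continuous_on {a..b} (\<lambda>s. Z s powr q)" for q by (rule Zpow_cont) (use pos in auto)
  define I1 where "I1 x = integral {a..x} (\<lambda>s. cos s * Z s powr (- p))" for x
  define I2 where "I2 x = integral {a..x} (\<lambda>s. sin s * Z s powr (- p))" for x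
  define F where "F x = Z a * cos (x - a) + B * sin (x - a) + (sin x * I1 x - cos x * I2 x)" for x
  define D where "D x = - Z a * sin (x - a) + B * cos (x - a) + (cos x * I1 x + sin x * I2 x)" for x
  have ZF: "Z x = F x" if "x \<in> {a<..b}" for x
  proof -
    have c: "continuous_on {a..x} (\<lambda>s. Z s powr q)" for q using that by (intro continuous_on_subset[OF Zc]) auto
    have "integral {a..x} (\<lambda>s. sin (x - s) * Z s powr (- p)) = integral {a..x} (\<lambda>s. sin x * (cos s * Z s powr (- p)) - cos x * (sin s * Z s powr (- p)))"
      by (intro integral_ext) (simp add: sin_diff algebra_simps)
    also have "\<dots> = sin x * I1 x - cos x * I2 x" unfolding I1_def I2_def
      by (intro lin_integral continuous_intros c)
    finally show ?thesis using B[OF that] by (simp add: F_def)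
  qed
  have at: "at x within {a..b} = at x" if "x \<in> {a<..<b}" for x using that by (simp add: at_within_Icc_at)
  have d1: "(I1 has_real_derivative cos x * Z x powr (- p)) (at x)" if "x \<in> {a<..<b}" for x
    using integral_has_real_derivative[of a b "\<lambda>s. cos s * Z s powr (- p)" x, OF continuous_on_mult[OF continuous_on_cos[OF continuous_on_id] Zc]] that
    unfolding I1_def[abs_def] at[OF that] by simp
  have d2: "(I2 has_real_derivative sin x * Z x powr (- p)) (at x)" if "x \<in> {a<..<b}" for x
    using integral_has_real_derivative[of a b "\<lambda>s. sin s * Z s powr (- p)" x, OF continuous_on_mult[OF continuous_on_sin[OF continuous_on_id] Zc]] that
    unfolding I2_def[abs_def] at[OF that] by simp
  have "(Z has_real_derivative D x) (at x) \<and> (D has_real_derivative Z x powr (- p) - Z x) (at x)" if x: "x \<in> {a<..<b}" for x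
  proof
    have "(F has_real_derivative - Z a * sin (x - a) + B * cos (x - a) +
        (cos x * I1 x + sin x * (cos x * Z x powr (- p)) - (- sin x * I2 x + cos x * (sin x * Z x powr (- p))))) (at x)"
      unfolding F_def[abs_def] by (auto intro!: derivative_eq_intros d1[OF x] d2[OF x])
    then have "(F has_real_derivative D x) (at x)" by (rule DERIV_cong) (simp add: D_def algebra_simps)
    then show "(Z has_real_derivative D x) (at x)"
      by (rule has_field_derivative_transform_within_open[where S = "{a<..<b}"]) (use x ZF in auto)
    have "(D has_real_derivative - Z a * cos (x - a) - B * sin (x - a) +
        (- sin x * I1 x + cos x * (cos x * Z x powr (- p)) + (cos x * I2 x + sin x * (sin x * Z x powr (- p))))) (at x)"
      unfolding D_def[abs_def] by (auto intro!: derivative_eq_intros d1[OF x] d2[OF x])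
    moreover have "- Z a * cos (x - a) - B * sin (x - a) +
        (- sin x * I1 x + cos x * (cos x * Z x powr (- p)) + (cos x * I2 x + sin x * (sin x * Z x powr (- p)))) = Z x powr (- p) - Z x"
    proof -
      have "Z x = Z a * cos (x - a) + B * sin (x - a) + (sin x * I1 x - cos x * I2 x)" using ZF[of x] x by (simp add: F_def)
      moreover have "(cos x)\<^sup>2 + (sin x)\<^sup>2 = 1" by simp
      ultimately show ?thesis by algebra
    qed
    ultimately show "(D has_real_derivative Z x powr (- p) - Z x) (at x)" by simp
  qed
  then show ?thesis by blast
qed

lemma pos_nbhd:
  assumes "Z x > 0"
  obtains r where "r > 0" "r < 1" "\<And>y. y \<in> {x - r..x + r} \<Longrightarrow> Z y > 0"
proof -
  have "isCont Z x" using Zcont[of UNIV] by (simp add: continuous_on_eq_continuous_at)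
  then obtain d where d: "d > 0" "\<And>y. dist y x < d \<Longrightarrow> dist (Z y) (Z x) < Z x" using assms unfolding continuous_at_eps_delta by blast
  show thesis
  proof (rule that[of "min (d/2) (1/2)"])
    fix y assume "y \<in> {x - min (d/2) (1/2)..x + min (d/2) (1/2)}"
    then have "dist y x < d" using d(1) by (auto simp: dist_real_def abs_le_iff min_def split: if_splits)
    from d(2)[OF this] show "Z y > 0" by (auto simp: dist_real_def)
  qed (use d in auto)
qed

lemma deriv_at_pos:
  assumes "Z x > 0"
  shows "(Z has_real_derivative deriv Z x) (at x)" "(deriv Z has_real_derivative Z x powr (- p) - Z x) (at x)"
proof -
  obtain r where r: "r > 0" "r < 1" "\<And>y. y \<in> {x - r..x + r} \<Longrightarrow> Z y > 0" using pos_nbhd[OF assms] by blast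
  have "x - r < x + r" "x + r < x - r + 2 * pi" using r pi_gt3 by auto
  from limit_deriv[OF this r(3)] obtain D where D: "\<And>y. y \<in> {x - r<..<x + r} \<Longrightarrow> (Z has_real_derivative D y) (at y)"
    "\<And>y. y \<in> {x - r<..<x + r} \<Longrightarrow> (D has_real_derivative Z y powr (- p) - Z y) (at y)" by blast
  have dD: "deriv Z y = D y" if "y \<in> {x - r<..<x + r}" for y using D(1)[OF that] by (rule DERIV_imp_deriv)
  have xr: "x \<in> {x - r<..<x + r}" using r by auto
  show "(Z has_real_derivative deriv Z x) (at x)" using D(1)[OF xr] dD[OF xr] by simp
  show "(deriv Z has_real_derivative Z x powr (- p) - Z x) (at x)"
    by (rule has_field_derivative_transform_within_open[OF D(2)[OF xr], where S = "{x - r<..<x + r}"]) (use xr dD in auto)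
qed

text \<open>Between the last zero and a point where the limit is positive the energy
  \<open>E\<close> is conserved, but its term with \<open>Z powr (1 - p)\<close> is unbounded near a
  zero because \<open>p > 1\<close>.\<close>

lemma Z_pos: "Z x > 0"
proof (rule ccontr)
  assume "\<not> Z x > 0"
  then have x0: "Z x = 0" using Z_nonneg[of x] by simp
  obtain y where "Z y \<noteq> 0" using Znz by blast
  then have y: "Z y > 0" using Z_nonneg[of y] by simp
  \<comment> \<open>The zero is moved by whole periods into the period that ends at
    \<open>y\<close>, so that there is a last zero before \<open>y\<close>.\<close>
  define z where "z = y - 2 * pi + 2 * pi * frac ((x - (y - 2 * pi)) / (2 * pi))"
  have "Z z = Z (y - 2 * pi + 2 * pi * ((x - (y - 2 * pi)) / (2 * pi)))" unfolding z_def
  proof (rule periodic_frac[of "\<lambda>s. Z (y - 2 * pi + 2 * pi * s)"])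
    show "Z (y - 2 * pi + 2 * pi * (u + 1)) = Z (y - 2 * pi + 2 * pi * u)" for u
      using Zper[of "y - 2 * pi + 2 * pi * u"] by (simp add: algebra_simps)
  qed
  then have z0: "Z z = 0" using x0 by simp
  have "2 * pi * frac ((x - (y - 2 * pi)) / (2 * pi)) \<le> 2 * pi * 1" by (intro mult_left_mono less_imp_le[OF frac_lt_1]) auto
  then have z: "z \<in> {y - 2 * pi..y}" by (auto simp: z_def)
  have "\<exists>a\<in>{y - 2 * pi..y} \<inter> Z -` {0}. \<forall>t\<in>{y - 2 * pi..y} \<inter> Z -` {0}. t \<le> a"
  proof (rule compact_attains_sup)
    have "closed ({y - 2 * pi..y} \<inter> Z -` {0})" by (intro continuous_closed_preimage Zcont) auto
    then show "compact ({y - 2 * pi..y} \<inter> Z -` {0})" by (simp add: compact_eq_bounded_closed bounded_Int)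
  qed (use z z0 in auto)
  then obtain a where a: "y - 2 * pi \<le> a" "a \<le> y" "Z a = 0" "\<And>t. y - 2 * pi \<le> t \<Longrightarrow> t \<le> y \<Longrightarrow> Z t = 0 \<Longrightarrow> t \<le> a" by auto
  have ay: "a < y" using a y by (cases "a = y") auto
  have pos: "Z t > 0" if "a < t" "t \<le> y" for t
    using a(4)[of t] a(1) that Z_nonneg[of t] by (cases "Z t = 0") auto
  define E where "E t = (deriv Z t)\<^sup>2 + (Z t)\<^sup>2 + 2 / (p - 1) * Z t powr (1 - p)" for t
  define x1 where "x1 = (a + y) / 2"
  have x1: "x1 \<in> {a<..<y}" using ay by (auto simp: x1_def)
  have Econst: "E t = E x1" if t: "t \<in> {a<..<y}" for t
  proof (rule DERIV_isconst3[of a y t x1 E])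
    fix t assume t: "t \<in> {a<..<y}"
    have Zt: "Z t > 0" using pos t by auto
    note d = deriv_at_pos[OF Zt]
    show "(E has_real_derivative 0) (at t)"
      unfolding E_def[abs_def]
      by (rule DERIV_cong[OF DERIV_add[OF DERIV_add[OF DERIV_power[OF d(2), where n = 2] DERIV_power[OF d(1), where n = 2]]
          DERIV_cmult[OF DERIV_fun_powr[OF d(1) Zt, of "1 - p"]]]])
        (use p in \<open>simp add: field_simps\<close>)
  qed (use t x1 ay in auto)
  define K where "K = max 1 ((p - 1) / 2 * E x1) + 1"
  have K: "K > 1" by (simp add: K_def)
  have ub: "Z t powr (1 - p) < K" if t: "t \<in> {a<..<y}" for t
  proof -
    have "2 / (p - 1) * Z t powr (1 - p) \<le> E x1" unfolding Econst[OF t, symmetric] by (simp add: E_def)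
    then have "Z t powr (1 - p) \<le> (p - 1) / 2 * E x1" using p by (simp add: field_simps)
    then show ?thesis by (simp add: K_def)
  qed
  \<comment> \<open>The height at which \<open>m powr (1 - p) = K\<close>; smaller positive values
    contradict \<open>ub\<close>.\<close>
  define m where "m = K powr (- (1 / (p - 1)))"
  have m0: "m > 0" using K by (simp add: m_def)
  have "isCont Z a" using Zcont[of UNIV] by (simp add: continuous_on_eq_continuous_at)
  then obtain d where d: "d > 0" "\<And>t. dist t a < d \<Longrightarrow> dist (Z t) (Z a) < m" using m0 unfolding continuous_at_eps_delta by blast
  define t where "t = a + min (d/2) ((y - a) / 2)"
  have t: "t \<in> {a<..<y}" "dist t a < d" using d(1) ay by (auto simp: t_def dist_real_def min_def field_simps)
  have "Z t < m" using d(2)[OF t(2)] a(3) by (auto simp: dist_real_def)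
  then have "m powr (1 - p) < Z t powr (1 - p)" using pos[of t] t p by (intro powr_less_mono2_neg) auto
  moreover have "- (1 / (p - 1)) * (1 - p) = 1" using p by (simp add: field_simps)
  then have "m powr (1 - p) = K" unfolding m_def powr_powr using K by simp
  ultimately show False using ub[OF t(1)] by simp
qed

lemma Z_eq_1: "Z x = 1"
proof -
  obtain m where mm: "\<And>y. Z m \<le> Z y" using periodic_attains_inf[OF Zcont Zper] by blast
  have "soliton_ode p (Z m) Z (deriv Z)"
    by unfold_locales (use p Z_pos mm deriv_at_pos in auto)
  from soliton_ode.periodic_eq_one[OF this Zper] show ?thesis .
qed

end

text \<open>By Arzela-Ascoli a subsequence converges uniformly. The bound \<open>big\<close> keeps
  the limit from being identically 0, so it is a periodic soliton, which is 1.\<close>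

lemma support_functions_near_one:
  fixes H :: "nat \<Rightarrow> real \<Rightarrow> real"
  assumes p: "1 < p" "p < 2" and c: "c > 0" and eps: "\<epsilon> > 0"
    and per: "\<And>n x. H n (x + 2 * pi) = H n x" and bnd: "\<And>n x. 0 < H n x" "\<And>n x. H n x \<le> C"
    and lip: "\<And>n x y. \<bar>H n x - H n y\<bar> \<le> C * \<bar>x - y\<bar>" and big: "\<And>n. \<exists>x. H n x \<ge> c" and e: "e \<longlonglongrightarrow> 0"
    and form: "\<And>n. almost_soliton p C (H n) (e n)"
  shows "\<exists>n. \<forall>x. \<bar>H n x - 1\<bar> < \<epsilon>"
proof -
  have C: "C > 0" using bnd[of 0 0] by simp
  have Hc: "continuous_on S (H n)" for S n
    by (rule lipschitz_on_continuous_on[of C], rule lipschitz_onI) (use lip C in \<open>auto simp: dist_real_def\<close>)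
  obtain G k where G: "continuous_on {0..2*pi} G" "strict_mono (k :: nat \<Rightarrow> nat)"
    "\<And>d. 0 < d \<Longrightarrow> \<exists>N. \<forall>n x. n \<ge> N \<and> x \<in> {0..2*pi} \<longrightarrow> norm (H (k n) x - G x) < d"
  proof (rule Arzela_Ascoli[of "{0..2*pi}" H C])
    show "norm (H n x) \<le> C" for n x using bnd[of n x] by simp
    show "\<exists>d>0. \<forall>n y. y \<in> {0..2 * pi} \<and> norm (x - y) < d \<longrightarrow> norm (H n x - H n y) < e'" if "e' > 0" for x e'
    proof (intro exI[of _ "e' / C"] conjI allI impI)
      fix n y assume "y \<in> {0..2 * pi} \<and> norm (x - y) < e' / C"
      then have "C * \<bar>x - y\<bar> < e'" using C by (simp add: field_simps)
      then show "norm (H n x - H n y) < e'" using lip[of n x y] by simp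
    qed (use that C in simp)
  qed auto
  \<comment> \<open>Arzela-Ascoli provides a limit on one period; reduction modulo
    \<open>2 * pi\<close> extends it to the line.\<close>
  define red where "red x = 2 * pi * frac (x / (2 * pi))" for x :: real
  define Z where "Z x = G (red x)" for x
  have red: "red x \<in> {0..2*pi}" for x
    using frac_ge_0[of "x / (2 * pi)"] frac_lt_1[of "x / (2 * pi)"] by (auto simp: red_def mult_le_cancel_left1 intro: less_imp_le)
  have Hred: "H n (red x) = H n x" for n x
    using periodic_frac[of "\<lambda>s. H n (2 * pi * s)" "x / (2 * pi)"] by (simp add: distrib_left per red_def)
  have lim: "uniform_limit UNIV (\<lambda>n. H (k n)) Z sequentially"
  proof (rule uniform_limitI)
    fix d :: real assume "d > 0"
    from G(3)[OF this] obtain N where N: "\<And>n x. n \<ge> N \<Longrightarrow> x \<in> {0..2*pi} \<Longrightarrow> norm (H (k n) x - G x) < d" by blast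
    show "\<forall>\<^sub>F n in sequentially. \<forall>x\<in>UNIV. dist (H (k n) x) (Z x) < d"
      unfolding eventually_sequentially
    proof (intro exI allI impI ballI)
      fix n x assume "N \<le> n"
      from N[OF this red[of x]] show "dist (H (k n) x) (Z x) < d" by (simp add: Hred Z_def dist_norm)
    qed
  qed
  have Zlim: "(\<lambda>n. H (k n) x) \<longlonglongrightarrow> Z x" for x using tendsto_uniform_limitI[OF lim] by simp
  have Zc: "continuous_on UNIV Z" by (rule uniform_limit_theorem[OF _ lim]) (auto intro!: always_eventually Hc)
  interpret s: soliton_limit p C "\<lambda>n. H (k n)" Z "\<lambda>n. e (k n)"
  proof
    show "(\<lambda>n. e (k n)) \<longlonglongrightarrow> 0" using LIMSEQ_subseq_LIMSEQ[OF e G(2)] by (simp add: o_def)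
    show "continuous_on S Z" for S using Zc continuous_on_subset by blast
    show "Z (x + 2 * pi) = Z x" for x using Zlim[of "x + 2 * pi"] Zlim[of x] unfolding per by (rule LIMSEQ_unique)
    show "\<exists>x. Z x \<noteq> 0"
    proof (rule ccontr)
      assume "\<not> (\<exists>x. Z x \<noteq> 0)"
      then have "\<forall>\<^sub>F n in sequentially. \<forall>x. \<bar>H (k n) x\<bar> < c" using uniform_limitD[OF lim c] by (simp add: dist_real_def)
      then obtain n where "\<forall>x. \<bar>H (k n) x\<bar> < c" by (auto simp: eventually_sequentially)
      moreover obtain x where "H (k n) x \<ge> c" using big by blast
      ultimately show False using abs_ge_self[of "H (k n) x"] by (meson le_less_trans less_le_not_le order_trans)
    qed
  qed (use p bnd Hc lim form in auto)
  have "\<forall>\<^sub>F n in sequentially. \<forall>x. \<bar>H (k n) x - 1\<bar> < \<epsilon>" using uniform_limitD[OF lim eps] by (simp add: dist_real_def s.Z_eq_1)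
  then show ?thesis by (auto simp: eventually_sequentially)
qed

section \<open>Nearly stationary entropy forces nearly circular curves\<close>

lemma powr_ge_linear: "1 \<le> b \<Longrightarrow> 0 \<le> k \<Longrightarrow> 1 + b * (k - 1) \<le> k powr b" for b k :: real
  using powr_le_linear[of "1 / b" "k powr b"] by (simp add: powr_powr field_simps)

text \<open>Bernoulli's inequality for the exponent \<open>(p + 1) / 2\<close> at
  \<open>y^2\<close>. Subtracting the linear term leaves \<open>(p + 1) / 2\<close> times
  \<open>(y - 1)^2\<close>.\<close>

lemma powr_gap_square:
  fixes p y :: real
  assumes "1 \<le> p" "0 \<le> y"
  shows "(y - 1)\<^sup>2 \<le> y powr (p + 1) - 1 - (p + 1) * (y - 1)"
proof -
  have "1 + ((p + 1) / 2) * (y\<^sup>2 - 1) \<le> (y\<^sup>2) powr ((p + 1) / 2)" using assms by (intro powr_ge_linear) auto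
  also have "(y\<^sup>2) powr ((p + 1) / 2) = y powr (p + 1)"
  proof -
    have "y\<^sup>2 = y powr 2" "2 * ((p + 1) / 2) = p + 1" using assms by simp_all
    then show ?thesis by (simp only: powr_powr)
  qed
  finally have "((p + 1) / 2) * (y - 1)\<^sup>2 \<le> y powr (p + 1) - 1 - (p + 1) * (y - 1)"
    by (simp add: power2_eq_square field_simps)
  moreover have "1 * (y - 1)\<^sup>2 \<le> ((p + 1) / 2) * (y - 1)\<^sup>2" using assms by (intro mult_right_mono) auto
  ultimately show ?thesis by simp
qed

lemma powr_diff_one:
  fixes p y :: real
  assumes "1 \<le> p" "p \<le> 2" "0 \<le> y"
  shows "\<bar>y powr p - 1\<bar> \<le> 2 * \<bar>y - 1\<bar> + (y - 1)\<^sup>2"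
proof (cases "y \<ge> 1")
  case True
  then have "1 \<le> y powr p" "y powr p \<le> y powr 2" using assms by (intro ge_one_powr_ge_zero powr_mono; simp)+
  moreover have "y powr 2 = y\<^sup>2" using True by simp
  ultimately show ?thesis using True by (simp add: power2_eq_square algebra_simps)
next
  case False
  then have "y powr p \<le> 1" "y powr 2 \<le> y powr p" using assms by (intro powr_le1 powr_mono'; simp)+
  moreover have "y powr 2 = y\<^sup>2" using assms by simp
  ultimately have "\<bar>y powr p - 1\<bar> \<le> 1 - y\<^sup>2" by simp
  also have "\<dots> \<le> 2 * (1 - y)" using zero_le_power2[of "y - 1"] by (simp add: power2_eq_square algebra_simps)
  finally have "\<bar>y powr p - 1\<bar> \<le> 2 * (1 - y)" .
  then have "\<bar>y powr p - 1\<bar> \<le> 2 * \<bar>y - 1\<bar>" using False by simp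
  then show ?thesis by (rule add_increasing2[OF zero_le_power2])
qed

context closed_curve
begin

text \<open>With respect to the probability measure \<open>h g du / (2 area)\<close>, the function \<open>y = v / h\<close> has mean 1 by normalisation,
  and \<open>ratio\<close> says that its moments of orders \<open>p + 1\<close> and \<open>p\<close> nearly agree, where \<open>p = 1 / \<alpha>\<close>; hence \<open>y\<close> is close to 1.\<close>

lemma normalized_estimates:
  assumes al: "1/2 < \<alpha>" "\<alpha> < 1" and h: "\<And>u. X u \<bullet> N u > 0"
    and v: "\<And>u. v u = (w u / g u) powr \<alpha>" "continuous_on UNIV v"
    and Y: "integral {0..1} (\<lambda>u. v u * g u) = 2 * area"
    and c: "c > 0" "2 * area \<ge> c * len\<^sup>2" and del: "0 < \<delta>" "\<delta> \<le> 1/4"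
    and ratio: "integral {0..1} (\<lambda>u. (X u \<bullet> N u) powr (- (1 / \<alpha>)) * v u * w u) \<le> (1 + \<delta>) * integral {0..1} (\<lambda>u. (X u \<bullet> N u) powr (1 - 1 / \<alpha>) * w u)"
  shows "integral {0..1} (\<lambda>u. \<bar>(X u \<bullet> N u) * g u - (X u \<bullet> N u) powr (1 - 1 / \<alpha>) * w u\<bar>) \<le> 13 * sqrt \<delta> * len\<^sup>2"
    "len \<le> max 1 (7 / c)" "1 \<le> len"
proof -
  define p where "p = 1 / \<alpha>"
  have p: "1 < p" "p < 2" using al by (auto simp: p_def field_simps)
  define hh where "hh u = X u \<bullet> N u" for u
  have hp: "hh u > 0" for u using h by (simp add: hh_def)
  have hne: "hh u \<noteq> 0" for u using hp[of u] by simp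
  have vc: "continuous_on S v" for S using v(2) continuous_on_subset by blast
  have hc: "continuous_on S hh" for S unfolding hh_def[abs_def] by (intro continuous_intros X_cont N_cont)
  have hpc: "continuous_on S (\<lambda>u. hh u powr q)" for S q by (intro continuous_on_powr hc continuous_on_const) (use hne in auto)
  note cts = continuous_on_mult[OF continuous_on_mult[OF hpc vc] w_cont'] continuous_on_mult[OF hpc w_cont']
     continuous_on_mult[OF hc g_cont'] continuous_on_mult[OF vc g_cont']
  define A2 where "A2 = integral {0..1} (\<lambda>u. hh u * g u)"
  define I where "I = integral {0..1} (\<lambda>u. hh u powr (1 - p) * w u)"
  define Q where "Q = integral {0..1} (\<lambda>u. hh u powr (- p) * v u * w u)"
  have A2: "A2 = 2 * area" using area_translate[of 0] by (simp add: A2_def hh_def)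
  have YA: "integral {0..1} (\<lambda>u. v u * g u) = A2" using Y A2 by simp
  have A2p: "A2 > 0"
  proof -
    have "0 < c * len\<^sup>2" using c(1) len_pos by simp
    then show ?thesis using c(2) A2 by linarith
  qed
  have QI: "Q \<le> (1 + \<delta>) * I" using ratio by (simp add: Q_def I_def hh_def p_def)
  define y where "y u = v u / hh u" for u
  have y0: "y u \<ge> 0" for u using hp[of u] by (simp add: y_def v(1))
  have yc: "continuous_on S y" for S unfolding y_def[abs_def] by (intro continuous_on_divide vc hc) (use hne in auto)
  have e1: "v u * g u = hh u * g u * y u" for u using hne[of u] by (simp add: y_def)
  have yp: "hh u * g u * y u powr p = hh u powr (1 - p) * w u" for u
  proof -
    have gp: "g u > 0" by (rule g_pos)
    have vp: "v u powr p = w u / g u" unfolding v(1) powr_powr using al w_nonneg[of u] gp by (simp add: p_def)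
    have "(v u / hh u) powr p = v u powr p / hh u powr p" by (rule powr_divide)
    then have "y u powr p = v u powr p * hh u powr (- p)" unfolding y_def by (simp add: powr_minus divide_inverse)
    moreover have "hh u * hh u powr (- p) = hh u powr (1 - p)" using powr_add[of "hh u" 1 "- p"] hp[of u] by simp
    ultimately have "hh u * g u * y u powr p = g u * (w u / g u) * hh u powr (1 - p)" using vp by (simp add: mult_ac)
    then show ?thesis using gp by simp
  qed
  have yp1: "hh u * g u * y u powr (p + 1) = hh u powr (- p) * v u * w u" for u
  proof -
    have "y u powr (p + 1) = y u powr p * y u" using y0[of u] powr_add[of "y u" p 1] by simp
    then have "hh u * g u * y u powr (p + 1) = hh u * g u * y u powr p * y u" by (simp only: mult.assoc)
    then have "hh u * g u * y u powr (p + 1) = hh u powr (1 - p) * w u * (v u / hh u)" unfolding yp by (simp add: y_def)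
    also have "hh u powr (1 - p) = hh u * hh u powr (- p)" using powr_add[of "hh u" 1 "- p"] hp[of u] by simp
    finally show ?thesis using hne[of u] by simp
  qed
  have hg: "hh u * g u > 0" for u using hp g_pos by simp
  \<comment> \<open>Young's inequality bounds \<open>y powr p\<close> by \<open>p / (p + 1)\<close>
    times \<open>y powr (p + 1)\<close> plus \<open>1 / (p + 1)\<close>; this is its
    integral.\<close>
  have IQ: "I \<le> (p * Q + A2) / (p + 1)"
  proof -
    have "I \<le> integral {0..1} (\<lambda>u. (p / (p + 1)) * (hh u powr (- p) * v u * w u) + (1 / (p + 1)) * (hh u * g u))"
      unfolding I_def
    proof (intro integral_mono_intros cts continuous_on_add continuous_on_mult_left)
      fix u
      have "(y u powr (p + 1)) powr (p / (p + 1)) \<le> 1 + (p / (p + 1)) * (y u powr (p + 1) - 1)"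
        using p by (intro powr_le_linear) auto
      also have "(y u powr (p + 1)) powr (p / (p + 1)) = y u powr p" unfolding powr_powr using p by simp
      finally have "hh u * g u * y u powr p \<le> hh u * g u * (1 + (p / (p + 1)) * (y u powr (p + 1) - 1))"
        using hg[of u] by (intro mult_left_mono) auto
      also have "\<dots> = (p / (p + 1)) * (hh u * g u * y u powr (p + 1)) + (1 / (p + 1)) * (hh u * g u)"
      proof -
        have "1 / (p + 1) = 1 - p / (p + 1)" using p by (simp add: field_simps)
        then show ?thesis by (simp only:) (simp add: right_diff_distrib distrib_left left_diff_distrib mult_ac)
      qed
      finally show "hh u powr (1 - p) * w u \<le> (p / (p + 1)) * (hh u powr (- p) * v u * w u) + (1 / (p + 1)) * (hh u * g u)"
        unfolding yp yp1 .
    qed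
    also have "\<dots> = (p / (p + 1)) * Q + (1 / (p + 1)) * A2" unfolding Q_def A2_def
      by (intro lin_integral cts)
    finally show ?thesis by (simp add: add_divide_distrib)
  qed
  \<comment> \<open>\<open>ratio\<close> bounds \<open>Q\<close> by \<open>I\<close>, and
    \<open>IQ\<close> bounds \<open>I\<close> by an average of \<open>Q\<close> and
    \<open>A2\<close>. Together they leave \<open>Q\<close> little room above
    \<open>A2\<close>.\<close>
  have QA: "Q - A2 \<le> 6 * \<delta> * A2"
  proof -
    have "Q \<le> (1 + \<delta>) * ((p * Q + A2) / (p + 1))" using QI mult_left_mono[OF IQ, of "1 + \<delta>"] del by simp
    then have "(p + 1) * Q \<le> (1 + \<delta>) * (p * Q + A2)" using p by (simp add: field_simps)
    then have q1: "(1 - p * \<delta>) * Q \<le> (1 + \<delta>) * A2" by (simp add: algebra_simps)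
    have pd: "p * \<delta> \<le> 2 * \<delta>" using p del by (intro mult_right_mono) auto
    have Q0: "Q \<ge> 0" unfolding Q_def by (intro integral_nonneg_intros cts) (simp add: v(1) w_nonneg)
    have "(1 - 2 * \<delta>) * Q \<le> (1 - p * \<delta>) * Q" using pd Q0 by (intro mult_right_mono) auto
    then have q2: "(1 - 2 * \<delta>) * Q \<le> (1 + \<delta>) * A2" using q1 by linarith
    have "(1 - 2 * \<delta>) * (Q - A2) \<le> 3 * \<delta> * A2" using q2 by (simp add: algebra_simps)
    also have "\<dots> \<le> (1 - 2 * \<delta>) * (6 * \<delta> * A2)" using del A2p mult_right_mono[of "1/2" "1 - 2 * \<delta>" "6 * \<delta> * A2"] by simp
    finally show ?thesis using del by (simp add: mult_le_cancel_left)
  qed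
  have hA: "hh u \<le> len" for u using supp_bounds(2)[OF h, of "\<theta> u"] supp_theta[OF h, of u] by (simp add: hh_def)
  have A2L: "A2 \<le> len\<^sup>2"
  proof -
    have "A2 \<le> integral {0..1} (\<lambda>u. len * g u)" unfolding A2_def
      by (intro integral_mono_intros cts continuous_on_mult_left g_cont' mult_right_mono hA less_imp_le[OF g_pos])
    then show ?thesis by (simp add: len_def power2_eq_square)
  qed
  \<comment> \<open>The second moment of \<open>y - 1\<close>. The linear term of
    \<open>powr_gap_square\<close> integrates to 0 because \<open>y\<close> has mean 1.\<close>
  define E where "E = integral {0..1} (\<lambda>u. hh u * g u * (y u - 1)\<^sup>2)"
  have Ec: "continuous_on S (\<lambda>u. hh u * g u * (y u - 1)\<^sup>2)" for S
    by (intro continuous_on_mult continuous_on_power continuous_on_diff continuous_on_const hc g_cont' yc)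
  have E: "E \<le> 6 * \<delta> * A2"
  proof -
    have "E \<le> integral {0..1} (\<lambda>u. hh u powr (- p) * v u * w u - hh u * g u - (p + 1) * (v u * g u - hh u * g u))"
      unfolding E_def
    proof (intro integral_mono_intros cts continuous_on_diff continuous_on_mult_left Ec)
      fix u
      have "hh u * g u * (y u - 1)\<^sup>2 \<le> hh u * g u * (y u powr (p + 1) - 1 - (p + 1) * (y u - 1))"
        using hg[of u] p y0 by (intro mult_left_mono powr_gap_square) auto
      also have "\<dots> = hh u * g u * y u powr (p + 1) - hh u * g u - (p + 1) * (hh u * g u * y u - hh u * g u)"
        by (simp add: algebra_simps)
      finally show "hh u * g u * (y u - 1)\<^sup>2 \<le> hh u powr (- p) * v u * w u - hh u * g u - (p + 1) * (v u * g u - hh u * g u)"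
        unfolding yp1 e1[symmetric] .
    qed
    also have "\<dots> = Q - A2 - (p + 1) * (A2 - A2)" unfolding Q_def
      by (subst (2) YA[symmetric], unfold A2_def, intro lin_integral cts)
    finally show ?thesis using QA by simp
  qed
  show "integral {0..1} (\<lambda>u. \<bar>(X u \<bullet> N u) * g u - (X u \<bullet> N u) powr (1 - 1 / \<alpha>) * w u\<bar>) \<le> 13 * sqrt \<delta> * len\<^sup>2"
    unfolding hh_def[symmetric] p_def[symmetric]
  proof -
    \<comment> \<open>The parameter of the splitting of \<open>2 * \<bar>y - 1\<bar>\<close> into
      \<open>s\<close> and \<open>(y - 1)^2 / s\<close>. As \<open>E\<close> is of order
      \<open>\<delta>\<close>, the root balances the two parts.\<close>
    define s where "s = sqrt \<delta>"
    have s: "s > 0" "s * s = \<delta>" "s \<le> 1" using del by (auto simp: s_def intro!: real_le_lsqrt)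
    have "integral {0..1} (\<lambda>u. \<bar>hh u * g u - hh u powr (1 - p) * w u\<bar>) \<le>
       integral {0..1} (\<lambda>u. s * (hh u * g u) + (1 / s + 1) * (hh u * g u * (y u - 1)\<^sup>2))"
    proof (intro integral_mono_intros cts continuous_on_add continuous_on_mult_left Ec continuous_on_rabs continuous_on_diff)
      fix u
      have "\<bar>hh u * g u - hh u powr (1 - p) * w u\<bar> = \<bar>hh u * g u * (y u powr p - 1)\<bar>" unfolding yp[symmetric] by (simp add: algebra_simps abs_minus_commute)
      also have "\<dots> = hh u * g u * \<bar>y u powr p - 1\<bar>" using hp[of u] g_pos[of u] by (simp add: abs_mult)
      also have "\<dots> \<le> hh u * g u * (s + (1 / s + 1) * (y u - 1)\<^sup>2)"
      proof (rule mult_left_mono)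
        have "0 \<le> (s - \<bar>y u - 1\<bar>)\<^sup>2" by simp
        then have "2 * \<bar>y u - 1\<bar> * s \<le> (s + (1 / s) * (y u - 1)\<^sup>2) * s" using s(1) by (simp add: power2_eq_square algebra_simps)
        then have "2 * \<bar>y u - 1\<bar> \<le> s + (1 / s) * (y u - 1)\<^sup>2" using s(1) by (simp only: mult_le_cancel_right if_True)
        moreover have "\<bar>y u powr p - 1\<bar> \<le> 2 * \<bar>y u - 1\<bar> + (y u - 1)\<^sup>2" using p y0 by (intro powr_diff_one) auto
        ultimately show "\<bar>y u powr p - 1\<bar> \<le> s + (1 / s + 1) * (y u - 1)\<^sup>2" by (simp add: distrib_right)
      qed (use hg[of u] in simp)
      finally show "\<bar>hh u * g u - hh u powr (1 - p) * w u\<bar> \<le> s * (hh u * g u) + (1 / s + 1) * (hh u * g u * (y u - 1)\<^sup>2)"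
        by (simp add: algebra_simps)
    qed
    also have "\<dots> = s * A2 + (1 / s + 1) * E" unfolding A2_def E_def
      by (intro lin_integral cts Ec)
    also have "\<dots> \<le> s * A2 + (1 / s + 1) * (6 * (s * s) * A2)"
      using E s by (intro add_left_mono mult_left_mono) auto
    also have "\<dots> = (7 * s + 6 * (s * s)) * A2" using s(1) by (simp add: field_simps)
    also have "\<dots> \<le> (13 * s) * A2" using s A2p mult_left_mono[of s 1 s] by (intro mult_right_mono) auto
    also have "\<dots> \<le> (13 * s) * len\<^sup>2" using A2L s by (intro mult_left_mono) auto
    finally show "integral {0..1} (\<lambda>u. \<bar>hh u * g u - hh u powr (1 - p) * w u\<bar>) \<le> 13 * sqrt \<delta> * len\<^sup>2" by (simp add: s_def)
  qed
  \<comment> \<open>By concavity of the power \<alpha> the integral of the speed is at most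
    \<open>(2 * pi / len) powr \<alpha> * len\<close>. For long curves this falls short of the area,
    which is of order \<open>len^2\<close>.\<close>
  show "len \<le> max 1 (7 / c)"
  proof (rule ccontr)
    assume "\<not> len \<le> max 1 (7 / c)"
    then have "len > 1" "7 / c < len" by (simp_all add: not_le)
    then have L: "len > 1" "7 < c * len" using c(1) by (simp_all add: pos_divide_less_eq mult.commute)
    define m where "m = 2 * pi / len"
    have m: "m > 0" using len_pos by (simp add: m_def)
    have "A2 \<le> integral {0..1} (\<lambda>u. m powr \<alpha> * (g u + \<alpha> * (1 / m * w u - g u)))"
      unfolding YA[symmetric]
    proof (intro integral_mono_intros cts continuous_on_add continuous_on_mult_left continuous_on_diff g_cont' w_cont')
      fix u
      define k where "k = w u / g u / m"
      have k0: "k \<ge> 0" using w_nonneg[of u] g_pos[of u] m by (simp add: k_def)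
      have "v u = (m * k) powr \<alpha>" using m by (simp add: v(1) k_def)
      also have "\<dots> = m powr \<alpha> * k powr \<alpha>" using m k0 by (simp add: powr_mult)
      also have "\<dots> \<le> m powr \<alpha> * (1 + \<alpha> * (k - 1))" using al k0 by (intro mult_left_mono powr_le_linear) auto
      finally have "v u * g u \<le> m powr \<alpha> * (1 + \<alpha> * (k - 1)) * g u" using g_pos[of u] by (intro mult_right_mono) auto
      also have "\<dots> = m powr \<alpha> * (g u + \<alpha> * (1 / m * w u - g u))" using g_pos[of u] m by (simp add: k_def field_simps)
      finally show "v u * g u \<le> m powr \<alpha> * (g u + \<alpha> * (1 / m * w u - g u))" .
    qed
    also have "\<dots> = m powr \<alpha> * (len + \<alpha> * (1 / m * integral {0..1} w - len))" unfolding len_def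
      by (intro lin_integral g_cont' w_cont')
    also have "\<dots> = m powr \<alpha> * len" using len_pos by (simp add: int_w m_def)
    also have "\<dots> \<le> (2 * pi) powr \<alpha> * len"
      using L len_pos al by (intro mult_right_mono powr_mono2) (auto simp: m_def field_simps)
    also have "\<dots> \<le> (2 * pi) powr 1 * len"
      using len_pos al pi_gt3 by (intro mult_right_mono powr_mono) auto
    also have "\<dots> \<le> 7 * len" using pi_approx len_pos by (intro mult_right_mono) auto
    finally have "A2 \<le> 7 * len" .
    then have "c * len * len \<le> 7 * len" using c(2) A2 by (simp add: power2_eq_square mult.assoc)
    then show False using L len_pos by simp
  qed
  \<comment> \<open>For length below 1 the support function is at most 1, so \<open>I\<close> is at
    least \<open>2 * pi\<close>; but \<open>I\<close> is at most \<open>5/2 * A2\<close>, which is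
    then at most 5/2.\<close>
  show "1 \<le> len"
  proof (rule ccontr)
    assume "\<not> 1 \<le> len"
    then have L: "len < 1" by simp
    have "2 * pi = integral {0..1} (\<lambda>u. 1 * w u)" by (simp add: int_w)
    also have "\<dots> \<le> I" unfolding I_def
    proof (intro integral_mono_intros cts continuous_on_mult_left w_cont' mult_right_mono w_nonneg)
      fix u
      have "hh u \<le> 1" using hA[of u] L by simp
      then have "1 powr (1 - p) \<le> hh u powr (1 - p)" using hp[of u] p by (intro powr_mono2') auto
      then show "1 \<le> hh u powr (1 - p)" by simp
    qed
    also have "\<dots> \<le> (p * Q + A2) / (p + 1)" by (rule IQ)
    also have "\<dots> \<le> (p * (5/2 * A2) + 5/2 * A2) / (p + 1)"
    proof -
      have "6 * \<delta> * A2 \<le> 3/2 * A2" using del A2p by (intro mult_right_mono) auto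
      then have "Q \<le> 5/2 * A2" using QA by linarith
      then show ?thesis using p A2p by (intro divide_right_mono add_mono mult_left_mono) auto
    qed
    also have "\<dots> = 5/2 * A2" using p by (simp add: field_simps)
    also have "\<dots> \<le> 5/2 * len\<^sup>2" using A2L by simp
    also have "\<dots> \<le> 5/2 * 1\<^sup>2" using L len_pos by (intro mult_left_mono power_mono) auto
    finally show False using pi_gt3 by simp
  qed
qed

end

text \<open>The data of the curve are explicit arguments because a compactness argument quantifies
  over all curves. The last inequality says that the derivative of the entropy with respect to
  \<open>ln area\<close> is at most \<open>\<delta> / 2\<close>; multiplied out in this form it is
  invariant under scaling.\<close>

definition near_soliton where
  "near_soliton \<alpha> c \<delta> X N g w \<theta> v \<longleftrightarrow> closed_curve X N g w \<theta> \<and> (\<forall>u. X u \<bullet> N u > 0) \<and>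
     (\<forall>u. v u = (w u / g u) powr \<alpha>) \<and> continuous_on UNIV v \<and>
     2 * closed_curve.area X N g \<ge> c * (closed_curve.len g)\<^sup>2 \<and>
     integral {0..1} (\<lambda>u. (X u \<bullet> N u) powr (- (1 / \<alpha>)) * v u * w u) * (2 * closed_curve.area X N g)
       \<le> (1 + \<delta>) * integral {0..1} (\<lambda>u. (X u \<bullet> N u) powr (1 - 1 / \<alpha>) * w u) * integral {0..1} (\<lambda>u. v u * g u)"

text \<open>Counterexamples for \<open>\<delta>\<close> tending to 0 would have uniformly bounded
  lengths and support functions with a subsequence tending to 1. Support values close to 1 bound the
  length from above and the area from below.\<close>

lemma near_soliton_normalized:
  assumes al: "1/2 < \<alpha>" "\<alpha> < (1::real)" and c: "c > 0" and e: "e > 0"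
  shows "\<exists>\<delta>>0. \<forall>X N g w \<theta> v. near_soliton \<alpha> c \<delta> X N g w \<theta> v \<longrightarrow> integral {0..1} (\<lambda>u. v u * g u) = 2 * closed_curve.area X N g \<longrightarrow>
     (closed_curve.len g)\<^sup>2 - 4 * pi * closed_curve.area X N g \<le> e * (closed_curve.len g)\<^sup>2"
proof (rule ccontr)
  assume neg: "\<not> ?thesis"
  define bad where "bad \<delta> q = (case q of (X, N, g, w, \<theta>, v) \<Rightarrow> near_soliton \<alpha> c \<delta> X N g w \<theta> v \<and>
     integral {0..1} (\<lambda>u. v u * g u) = 2 * closed_curve.area X N g \<and>
     \<not> (closed_curve.len g)\<^sup>2 - 4 * pi * closed_curve.area X N g \<le> e * (closed_curve.len g)\<^sup>2)" for \<delta> q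
  \<comment> \<open>A square, so that the error bound with \<open>sqrt (\<delta> n)\<close> is
    explicit; the shift by 4 keeps \<open>\<delta> n\<close> below 1/4.\<close>
  define \<delta> where "\<delta> n = (1 / (real n + 4))\<^sup>2" for n
  have del: "0 < \<delta> n" "\<delta> n \<le> 1/4" for n
  proof -
    show "0 < \<delta> n" by (simp add: \<delta>_def)
    have "1 / (real n + 4) \<le> 1 / 4" by (simp add: field_simps)
    then have "\<delta> n \<le> (1/4)\<^sup>2" unfolding \<delta>_def by (intro power_mono) auto
    then show "\<delta> n \<le> 1/4" by (simp add: power2_eq_square)
  qed
  have "\<forall>n. \<exists>q. bad (\<delta> n) q"
  proof
    fix n
    show "\<exists>q. bad (\<delta> n) q" using neg del(1)[of n] unfolding bad_def split_paired_Ex by auto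
  qed
  from choice[OF this] obtain q where q: "\<And>n. bad (\<delta> n) (q n)" by blast
  define X where "X n = fst (q n)" for n
  define N where "N n = fst (snd (q n))" for n
  define g where "g n = fst (snd (snd (q n)))" for n
  define w where "w n = fst (snd (snd (snd (q n))))" for n
  define \<theta> where "\<theta> n = fst (snd (snd (snd (snd (q n)))))" for n
  define v where "v n = snd (snd (snd (snd (snd (q n)))))" for n
  have b: "near_soliton \<alpha> c (\<delta> n) (X n) (N n) (g n) (w n) (\<theta> n) (v n)"
     "integral {0..1} (\<lambda>u. v n u * g n u) = 2 * closed_curve.area (X n) (N n) (g n)"
     "\<not> (closed_curve.len (g n))\<^sup>2 - 4 * pi * closed_curve.area (X n) (N n) (g n) \<le> e * (closed_curve.len (g n))\<^sup>2" for n
    using q[of n] by (auto simp: bad_def X_def N_def g_def w_def \<theta>_def v_def split_beta)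
  have cc: "closed_curve (X n) (N n) (g n) (w n) (\<theta> n)" and h: "X n u \<bullet> N n u > 0" for n u
    using b(1)[of n] by (auto simp: near_soliton_def)
  have est: "integral {0..1} (\<lambda>u. \<bar>(X n u \<bullet> N n u) * g n u - (X n u \<bullet> N n u) powr (1 - 1 / \<alpha>) * w n u\<bar>) \<le> 13 * sqrt (\<delta> n) * (closed_curve.len (g n))\<^sup>2"
    "closed_curve.len (g n) \<le> max 1 (7 / c)" "1 \<le> closed_curve.len (g n)" for n
  proof -
    interpret closed_curve "X n" "N n" "g n" "w n" "\<theta> n" by (rule cc)
    note ns = b(1)[of n, unfolded near_soliton_def]
    have A: "area > 0"
    proof -
      have "0 < c * len\<^sup>2" using c len_pos by simp
      then show ?thesis using ns by linarith
    qed
    have "integral {0..1} (\<lambda>u. (X n u \<bullet> N n u) powr (- (1 / \<alpha>)) * v n u * w n u)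
       \<le> (1 + \<delta> n) * integral {0..1} (\<lambda>u. (X n u \<bullet> N n u) powr (1 - 1 / \<alpha>) * w n u)"
      using ns A unfolding b(2) by (auto intro: mult_right_le_imp_le[of _ "2 * area"])
    with ns normalized_estimates[OF al h _ _ b(2) c _ del, of n]
    show "integral {0..1} (\<lambda>u. \<bar>(X n u \<bullet> N n u) * g n u - (X n u \<bullet> N n u) powr (1 - 1 / \<alpha>) * w n u\<bar>) \<le> 13 * sqrt (\<delta> n) * len\<^sup>2"
      "len \<le> max 1 (7 / c)" "1 \<le> len" by auto
  qed
  define C where "C = max 1 (7 / c)"
  define e' where "e' = min (e / 2) (1 / 2)"
  have e': "e' > 0" "e' \<le> 1/2" "2 * e' \<le> e" using e by (auto simp: e'_def)
  define H where "H n = closed_curve.supp (X n) (N n) (\<theta> n)" for n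
  define p where "p = 1 / \<alpha>"
  have "\<exists>n. \<forall>x. \<bar>H n x - 1\<bar> < e'"
  proof (rule support_functions_near_one[where p = p and C = C and c = "1/10" and e = "\<lambda>n. 13 * C\<^sup>2 * (1 / (real n + 4))"])
    show "1 < p" "p < 2" using al by (auto simp: p_def field_simps)
    show "(0::real) < 1 / 10" by simp
    show "e' > 0" by (rule e')
    show "(\<lambda>n. 13 * C\<^sup>2 * (1 / (real n + 4))) \<longlonglongrightarrow> 0"
      using tendsto_mult_left[OF LIMSEQ_ignore_initial_segment[OF lim_inverse_n', of 4], of "13 * C\<^sup>2"] by simp
    fix n
    interpret closed_curve "X n" "N n" "g n" "w n" "\<theta> n" by (rule cc)
    have LC: "len \<le> C" unfolding C_def by (rule est)
    show "H n (x + 2 * pi) = H n x" for x unfolding H_def by (rule supp_per[OF h])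
    show "0 < H n x" "H n x \<le> C" for x using supp_bounds[OF h, of x] LC by (auto simp: H_def)
    show "\<bar>H n x - H n y\<bar> \<le> C * \<bar>x - y\<bar>" for x y
      using supp_lip[OF h, of x y] mult_right_mono[OF LC, of "\<bar>x - y\<bar>"] unfolding H_def by simp
    \<comment> \<open>Otherwise Cauchy's formula gives a length of at most
      \<open>2 * pi / 10\<close>, below 1.\<close>
    show "\<exists>x. 1 / 10 \<le> H n x"
    proof (rule ccontr)
      assume "\<not> (\<exists>x. 1 / 10 \<le> H n x)"
      then have "\<not> 1 / 10 \<le> H n (\<theta> n u)" for u by blast
      then have "X n u \<bullet> N n u < 1 / 10" for u unfolding H_def supp_theta[OF h] by (simp add: not_le)
      then have "integral {0..1} (\<lambda>u. ((X n u - 0) \<bullet> N n u) * w n u) \<le> integral {0..1} (\<lambda>u. 1/10 * w n u)"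
        by (intro integral_mono_intros continuous_intros X_cont N_cont w_cont' mult_right_mono w_nonneg) (auto intro: less_imp_le)
      then have "len \<le> 2 * pi / 10" using int_h_w[of 0] int_w by simp
      then show False using est(3)[of n] pi_less_4 by simp
    qed
    define er where "er = integral {0..1} (\<lambda>u. \<bar>(X n u \<bullet> N n u) * g n u - (X n u \<bullet> N n u) powr (1 - p) * w n u\<bar>)"
    have "er \<le> 13 * (1 / (real n + 4)) * len\<^sup>2" using est(1)[of n] by (simp add: er_def p_def \<delta>_def real_sqrt_divide)
    also have "\<dots> \<le> 13 * (1 / (real n + 4)) * C\<^sup>2" using LC len_pos by (intro mult_left_mono power_mono) auto
    finally have er: "er \<le> 13 * C\<^sup>2 * (1 / (real n + 4))" by (simp add: mult_ac)
    show "almost_soliton p C (H n) (13 * C\<^sup>2 * (1 / (real n + 4)))"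
      unfolding H_def by (rule almost_soliton_mono[OF supp_formula[OF h] LC er[unfolded er_def]])
  qed
  then obtain n where n: "\<And>x. \<bar>H n x - 1\<bar> < e'" by blast
  interpret closed_curve "X n" "N n" "g n" "w n" "\<theta> n" by (rule cc)
  have hn: "\<bar>X n u \<bullet> N n u - 1\<bar> < e'" for u using n[of "\<theta> n u"] supp_theta[OF h, of u] by (simp add: H_def)
  have "integral {0..1} (\<lambda>u. ((X n u - 0) \<bullet> N n u) * w n u) \<le> integral {0..1} (\<lambda>u. (1 + e') * w n u)"
  proof (intro integral_mono_intros continuous_intros X_cont N_cont w_cont' mult_right_mono w_nonneg)
    show "(X n u - 0) \<bullet> N n u \<le> 1 + e'" for u using hn[of u] by (simp add: abs_less_iff)
  qed
  then have L: "len \<le> (1 + e') * (2 * pi)" using int_h_w[of 0] int_w by simp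
  have "1 - e' \<le> (X n u - 0) \<bullet> N n u" for u using hn[of u] by (simp add: abs_less_iff)
  then have A: "(1 - e') * len \<le> 2 * area" by (rule area_ge)
  have "(1 - e') * len * len \<le> (1 - e') * len * ((1 + e') * (2 * pi))" using L e' len_pos by (intro mult_left_mono) auto
  also have "\<dots> = (1 + e') * (2 * pi) * ((1 - e') * len)" by simp
  also have "\<dots> \<le> (1 + e') * (2 * pi) * (2 * area)" using A e' by (intro mult_left_mono) auto
  finally have "(1 - e') * len\<^sup>2 \<le> (1 + e') * (4 * pi * area)" by (simp add: power2_eq_square algebra_simps)
  then have "(1 + e') * (len\<^sup>2 - 4 * pi * area) \<le> 2 * e' * len\<^sup>2" by (simp add: algebra_simps)
  also have "\<dots> \<le> 1 * (e * len\<^sup>2)" using e' mult_right_mono[of "2 * e'" e "len\<^sup>2"] by simp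
  also have "1 * (e * len\<^sup>2) \<le> (1 + e') * (e * len\<^sup>2)" using e e' by (intro mult_right_mono) auto
  finally have "len\<^sup>2 - 4 * pi * area \<le> e * len\<^sup>2" using e' by simp
  then show False using b(3)[of n] by simp
qed

lemma near_soliton_near_circle:
  assumes al: "1/2 < \<alpha>" "\<alpha> < (1::real)" and c: "c > 0" and e: "e > 0"
  shows "\<exists>\<delta>>0. \<forall>X N g w \<theta> v. near_soliton \<alpha> c \<delta> X N g w \<theta> v \<longrightarrow> integral {0..1} (\<lambda>u. v u * g u) > 0 \<longrightarrow>
     (closed_curve.len g)\<^sup>2 - 4 * pi * closed_curve.area X N g \<le> e * (closed_curve.len g)\<^sup>2"
proof -
  obtain \<delta> where \<delta>: "\<delta> > 0" and norm: "\<And>X N g w \<theta> v. near_soliton \<alpha> c \<delta> X N g w \<theta> v \<Longrightarrow> integral {0..1} (\<lambda>u. v u * g u) = 2 * closed_curve.area X N g \<Longrightarrow>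
     (closed_curve.len g)\<^sup>2 - 4 * pi * closed_curve.area X N g \<le> e * (closed_curve.len g)\<^sup>2"
    using near_soliton_normalized[OF assms] by blast
  have "(closed_curve.len g)\<^sup>2 - 4 * pi * closed_curve.area X N g \<le> e * (closed_curve.len g)\<^sup>2"
    if ns: "near_soliton \<alpha> c \<delta> X N g w \<theta> v" and Y: "integral {0..1} (\<lambda>u. v u * g u) > 0" for X N g w \<theta> v
  proof -
    note n = ns[unfolded near_soliton_def]
    interpret C: closed_curve X N g w \<theta> using n by simp
    define Y where "Y = integral {0..1} (\<lambda>u. v u * g u)"
    define I where "I = integral {0..1} (\<lambda>u. (X u \<bullet> N u) powr (1 - 1 / \<alpha>) * w u)"
    define Q where "Q = integral {0..1} (\<lambda>u. (X u \<bullet> N u) powr (- (1 / \<alpha>)) * v u * w u)"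
    have h: "X u \<bullet> N u > 0" for u using n by simp
    have "0 < c * C.len\<^sup>2" using c C.len_pos by simp
    then have A: "C.area > 0" using n by linarith
    \<comment> \<open>Scaling by \<open>s\<close> multiplies the integral of the speed by
      \<open>s powr (1 - \<alpha>)\<close> and the area by \<open>s^2\<close>; this \<open>s\<close>
      makes the former equal to twice the latter.\<close>
    define s where "s = (Y / (2 * C.area)) powr (1 / (\<alpha> + 1))"
    have s: "s > 0" using Y A by (simp add: s_def Y_def)
    have s1: "s powr (\<alpha> + 1) = Y / (2 * C.area)" unfolding s_def powr_powr using al Y A by (simp add: Y_def)
    define X' where "X' u = s *\<^sub>R X u" for u
    define g' where "g' u = s * g u" for u
    define v' where "v' u = s powr (- \<alpha>) * v u" for u
    have cc: "closed_curve X' N g' w \<theta>"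
    proof
      fix u
      show "(X' has_vector_derivative g' u *\<^sub>R (\<i> * N u)) (at u)"
        unfolding X'_def[abs_def] g'_def using has_vector_derivative_scaleR[OF DERIV_const C.X_u, of s]  by simp
      show "X' (u + 1) = X' u" "g' (u + 1) = g' u" by (simp_all add: X'_def g'_def C.X_per C.g_per)
      show "0 < g' u" using s C.g_pos by (simp add: g'_def)
      show "continuous_on UNIV g'" unfolding g'_def[abs_def] by (intro continuous_intros C.g_cont)
    qed (use C.N_cis C.theta_u C.theta_per C.w_per C.w_nonneg C.w_cont in auto)
    interpret D: closed_curve X' N g' w \<theta> by (rule cc)
    have hh: "X' u \<bullet> N u = s * (X u \<bullet> N u)" for u by (simp add: X'_def)
    have L: "D.len = s * C.len" unfolding D.len_def C.len_def g'_def by simp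
    have "integral {0..1} (\<lambda>u. (X' u \<bullet> N u) * g' u) = s\<^sup>2 * integral {0..1} (\<lambda>u. (X u \<bullet> N u) * g u)"
      unfolding hh g'_def integral_mult_right[symmetric]
      by (intro integral_ext) (simp add: power2_eq_square)
    then have Ar: "D.area = s\<^sup>2 * C.area" unfolding D.area_def C.area_def by simp
    have "integral {0..1} (\<lambda>u. v' u * g' u) = integral {0..1} (\<lambda>u. (s powr (- \<alpha>) * s) * (v u * g u))"
      by (intro integral_ext) (simp add: v'_def g'_def)
    also have "\<dots> = s powr (1 - \<alpha>) * Y" unfolding integral_mult_right Y_def using powr_add[of s 1 "- \<alpha>"] s by (simp add: mult.commute)
    finally have Y': "integral {0..1} (\<lambda>u. v' u * g' u) = s powr (1 - \<alpha>) * Y" .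
    have I': "integral {0..1} (\<lambda>u. (X' u \<bullet> N u) powr (1 - 1 / \<alpha>) * w u) = s powr (1 - 1 / \<alpha>) * I"
      unfolding I_def hh integral_mult_right[symmetric]
      by (intro integral_ext) (simp add: powr_mult)
    have Q': "integral {0..1} (\<lambda>u. (X' u \<bullet> N u) powr (- (1 / \<alpha>)) * v' u * w u) = s powr (- (1 / \<alpha>)) * s powr (- \<alpha>) * Q"
      unfolding Q_def hh integral_mult_right[symmetric]
      by (intro integral_ext) (simp add: powr_mult v'_def)
    have p2: "s\<^sup>2 = s powr 2" using s by simp
    have Yeq: "s powr (1 - \<alpha>) * Y = 2 * (s\<^sup>2 * C.area)"
    proof -
      have "Y = s powr (\<alpha> + 1) * (2 * C.area)" using s1 A by simp
      then have "s powr (1 - \<alpha>) * Y = s powr (1 - \<alpha> + (\<alpha> + 1)) * (2 * C.area)" by (simp only: powr_add mult.assoc)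
      then show ?thesis by (simp only: p2) simp
    qed
    have "near_soliton \<alpha> c \<delta> X' N g' w \<theta> v'"
      unfolding near_soliton_def
    proof (intro conjI allI)
      fix u
      show "0 < X' u \<bullet> N u" using h s by (simp add: hh)
      show "v' u = (w u / g' u) powr \<alpha>" 
      proof -
        have "(w u / g' u) powr \<alpha> = ((w u / g u) / s) powr \<alpha>" by (simp add: g'_def mult.commute)
        also have "\<dots> = (w u / g u) powr \<alpha> / s powr \<alpha>" by (rule powr_divide)
        finally show ?thesis using n by (simp add: v'_def powr_minus divide_inverse mult.commute)
      qed
      show "continuous_on UNIV v'" unfolding v'_def[abs_def] using n by (intro continuous_intros) auto
      show "c * D.len\<^sup>2 \<le> 2 * D.area"
        using n mult_left_mono[of "c * C.len\<^sup>2" "2 * C.area" "s\<^sup>2"] unfolding L Ar by (simp add: power_mult_distrib mult_ac)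
      have k: "Q * (2 * C.area) \<le> (1 + \<delta>) * I * Y" using n unfolding Q_def I_def Y_def by blast
      have "s powr (- (1 / \<alpha>)) * s powr (- \<alpha>) * Q * (2 * (s\<^sup>2 * C.area)) = s powr (- (1 / \<alpha>) + (- \<alpha>) + 2) * (Q * (2 * C.area))"
        unfolding p2 powr_add by simp
      also have "\<dots> \<le> s powr (- (1 / \<alpha>) + (- \<alpha>) + 2) * ((1 + \<delta>) * I * Y)" using k by (intro mult_left_mono) auto
      also have "- (1 / \<alpha>) + (- \<alpha>) + 2 = (1 - 1 / \<alpha>) + (1 - \<alpha>)" by simp
      also have "s powr ((1 - 1 / \<alpha>) + (1 - \<alpha>)) * ((1 + \<delta>) * I * Y) = (1 + \<delta>) * (s powr (1 - 1 / \<alpha>) * I) * (s powr (1 - \<alpha>) * Y)"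
        unfolding powr_add by simp
      finally show "integral {0..1} (\<lambda>u. (X' u \<bullet> N u) powr (- (1 / \<alpha>)) * v' u * w u) * (2 * D.area)
        \<le> (1 + \<delta>) * integral {0..1} (\<lambda>u. (X' u \<bullet> N u) powr (1 - 1 / \<alpha>) * w u) * integral {0..1} (\<lambda>u. v' u * g' u)"
        unfolding Q' I' Y' Ar .
    qed (rule cc)
    from norm[OF this] have "D.len\<^sup>2 - 4 * pi * D.area \<le> e * D.len\<^sup>2" using Y' Yeq Ar by simp
    then have "s\<^sup>2 * (C.len\<^sup>2 - 4 * pi * C.area) \<le> s\<^sup>2 * (e * C.len\<^sup>2)" unfolding L Ar by (simp add: power_mult_distrib algebra_simps)
    then show ?thesis using s by simp
  qed
  then show ?thesis using \<delta> by blast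
qed

section \<open>The entropy\<close>

lemma powr_neg_ge_linear: "0 < y \<Longrightarrow> 0 \<le> b \<Longrightarrow> 1 - b * (y - 1) \<le> y powr (- b)" for y b :: real
proof -
  assume y: "0 < y" and b: "0 \<le> b"
  have "b * ln y \<le> b * (y - 1)" using ln_le_minus_one[OF y] b by (rule mult_left_mono)
  moreover have "1 + (- b * ln y) \<le> exp (- b * ln y)" by (rule exp_ge_add_one_self)
  ultimately show ?thesis using y by (simp add: powr_def)
qed

context sweeping_flow
begin

definition hz :: "complex \<Rightarrow> real \<Rightarrow> real \<Rightarrow> real" where "hz z t u = (X t u - z) \<bullet> N t u"

lemma hz_pos: "z \<in> \<Omega> T \<Longrightarrow> T < 0 \<Longrightarrow> t \<le> T \<Longrightarrow> hz z t u > 0"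
proof -
  assume "z \<in> \<Omega> T" "T < 0" "t \<le> T"
  then have "z \<in> \<Omega> t" "t < 0" using Omega_antimono[of t T] by auto
  then show ?thesis using Omega_support[of t z u] unfolding hz_def by (simp add: inner_diff_left)
qed

lemma hz_t: "t < 0 \<Longrightarrow> ((\<lambda>t. hz z t u) has_real_derivative - v t u + \<psi> t u * ((X t u - z) \<bullet> (\<i> * N t u))) (at t)"
proof -
  assume t: "t < 0"
  have Xt: "((\<lambda>s. X s u - z) has_vector_derivative (- v t u) *\<^sub>R N t u) (at t)"
    using X_t[OF t] by (auto intro!: derivative_eq_intros)
  have "((\<lambda>t. (X t u - z) \<bullet> N t u) has_real_derivative (X t u - z) \<bullet> (\<psi> t u *\<^sub>R (\<i> * N t u)) + ((- v t u) *\<^sub>R N t u) \<bullet> N t u) (at t)"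
    using bounded_bilinear.has_vector_derivative[OF bounded_bilinear_inner Xt N_t[OF t]]
    by (simp add: has_real_derivative_iff_has_vector_derivative)
  moreover have "N t u \<bullet> N t u = 1" using norm_N[OF t, of u] by (simp add: dot_square_norm)
  ultimately show ?thesis by (simp add: hz_def[abs_def])
qed

lemma hz_cont: "continuous_on ({..<0} \<times> UNIV) (\<lambda>p. hz z (fst p) (snd p))"
  unfolding hz_def by (intro continuous_intros conts)

text \<open>All terms containing the tangential derivative of the speed combine to the derivative
  along the curve of \<open>hz powr (- b) * \<psi>\<close> and integrate to 0.\<close>

lemma entropy_deriv:
  assumes z: "z \<in> \<Omega> T" "T < 0" and t: "t < T"
  shows "((\<lambda>t. integral {0..1} (\<lambda>u. hz z t u powr (- b) * w t u)) has_real_derivative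
     b * integral {0..1} (\<lambda>u. hz z t u powr (- b - 1) * v t u * w t u)) (at t)"
proof -
  have t0: "t < 0" using z t by simp
  interpret c: closed_curve "X t" "N t" "g t" "w t" "\<Theta> t" by (rule curve_at[OF t0])
  define f' where "f' t u = (- b) * hz z t u powr (- b - 1) * (- v t u + \<psi> t u * ((X t u - z) \<bullet> (\<i> * N t u))) * w t u + \<psi>u t u * hz z t u powr (- b)" for t u
  have hp: "hz z t u > 0" if "t \<le> T" for t u using hz_pos[OF z that] .
  have sub: "continuous_on ({..<T} \<times> UNIV) f" if "continuous_on ({..<0} \<times> UNIV) f" for f :: "real \<times> real \<Rightarrow> 'z::topological_space"
    by (rule continuous_on_subset[OF that]) (use z in auto)
  have hpc: "continuous_on ({..<T} \<times> UNIV) (\<lambda>p. hz z (fst p) (snd p) powr q)" for q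
    by (rule continuous_on_powr[OF sub[OF hz_cont] continuous_on_const]) (use hp in \<open>force simp: less_imp_neq[symmetric]\<close>)
  note cT = conts[THEN sub]
  have i: "((\<lambda>t. integral {0..1} (\<lambda>u. hz z t u powr (- b) * w t u)) has_real_derivative integral {0..1} (f' t)) (at t)"
  proof (rule leibniz[OF _ _ _ t])
    show "((\<lambda>t. hz z t u powr (- b) * w t u) has_real_derivative f' t u) (at t)" if "t < T" for t u
    proof -
      have t0: "t < 0" using that z by simp
      from DERIV_mult[OF DERIV_fun_powr[OF hz_t[OF t0, of z u] hp[of t u], of "- b"] w_t[OF t0, of u]] that
      show ?thesis unfolding f'_def by (auto intro: DERIV_cong)
    qed
    show "continuous_on ({..<T} \<times> UNIV) (\<lambda>(t, u). hz z t u powr - b * w t u)"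
      unfolding case_prod_unfold by (intro continuous_on_mult hpc cT)
    show "continuous_on ({..<T} \<times> UNIV) (\<lambda>(t, u). f' t u)"
      unfolding case_prod_unfold f'_def
      by (intro continuous_on_add continuous_on_mult hpc cT continuous_on_const continuous_on_minus continuous_on_inner continuous_on_diff)
  qed
  have hps: "continuous_on S (\<lambda>u. hz z t u powr q)" for q S
  proof -
    have "continuous_on S (hz z t)" unfolding hz_def[abs_def] by (intro continuous_intros csec t0)
    then show ?thesis using hp[of t] t by (intro continuous_on_powr continuous_on_const) (auto simp: less_imp_neq[symmetric])
  qed
  define ex where "ex u = (- b) * hz z t u powr (- b - 1) * (w t u * ((X t u - z) \<bullet> (\<i> * N t u))) * \<psi> t u + \<psi>u t u * hz z t u powr (- b)" for u
  have exc: "continuous_on S ex" for S unfolding ex_def[abs_def]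
    by (intro continuous_on_add continuous_on_mult hps csec t0 continuous_on_const continuous_on_inner continuous_on_diff)
  have "integral {0..1} ex = 0"
  proof (rule periodic_deriv_integral)
    fix u
    have "(hz z t has_real_derivative w t u * ((X t u - z) \<bullet> (\<i> * N t u))) (at u)"
      unfolding hz_def[abs_def] by (rule c.X_has_derivative_prod(1))
    from DERIV_mult[OF DERIV_fun_powr[OF this hp, of "- b"] psi_u[OF t0, of u]] t
    show "((\<lambda>u. hz z t u powr (- b) * \<psi> t u) has_real_derivative ex u) (at u)" unfolding ex_def by (auto intro: DERIV_cong)
    show "hz z t 1 powr - b * \<psi> t 1 = hz z t 0 powr - b * \<psi> t 0"
      using X_per[OF t0, of 0] N_per[OF t0, of 0] psi_per[OF t0, of 0] by (simp add: hz_def)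
  qed
  have "integral {0..1} (f' t) = integral {0..1} (\<lambda>u. b * (hz z t u powr (- b - 1) * v t u * w t u) + ex u)"
    by (intro integral_ext) (simp add: f'_def ex_def algebra_simps)
  also have "\<dots> = b * integral {0..1} (\<lambda>u. hz z t u powr (- b - 1) * v t u * w t u) + integral {0..1} ex"
    by (intro lin_integral exc continuous_on_mult hps csec t0)
  finally show ?thesis using i \<open>integral {0..1} ex = 0\<close> by simp
qed

lemma speed_integral_pos: "t < 0 \<Longrightarrow> integral {0..1} (\<lambda>u. v t u * g t u) > 0"
proof (rule ccontr)
  assume t: "t < 0" and n: "\<not> integral {0..1} (\<lambda>u. v t u * g t u) > 0"
  have "integral {0..1} (\<lambda>u. v t u * g t u) \<ge> 0"
    by (intro integral_nonneg_intros continuous_intros csec t) (use v_nonneg[OF t] g_pos[OF t] in \<open>simp add: less_imp_le\<close>)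
  then have "integral {0..1} (\<lambda>u. v t u * g t u) = 0" using n by simp
  then have "\<forall>u\<in>{0..1}. v t u * g t u = 0"
    by (subst (asm) integral_eq_0_iff) (use v_nonneg[OF t] g_pos[OF t] in \<open>auto intro!: continuous_intros csec t simp: less_imp_le\<close>)
  then have "w t u = 0" if "u \<in> {0..1}" for u
  proof -
    have "v t u = 0" using that \<open>\<forall>u\<in>{0..1}. v t u * g t u = 0\<close> g_pos[OF t, of u] by fastforce
    then show ?thesis using g_pos[OF t, of u] v_eq[OF t, of u] by simp
  qed
  then have "integral {0..1} (w t) = integral {0..1} (\<lambda>_::real. 0)" by (intro Henstock_Kurzweil_Integration.integral_cong) auto
  then show False using int_w[OF t] by simp
qed

text \<open>If the inequality failed at all early times, \<open>G\<close> would be nonincreasing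
  there, hence bounded below by \<open>G S'\<close> in the past. But Jensen bounds the entropy term
  by \<open>ln L\<close>, and non-collapsing bounds that by \<open>ln A / 2\<close>, up to
  constants. The extra \<open>\<delta>\<close> then drives \<open>G\<close> to minus infinity as the
  area grows.\<close>

lemma entropy_times:
  assumes al: "\<alpha> < 1" and z: "z \<in> \<Omega> T" "T < 0" and d: "\<delta> > 0"
  shows "\<exists>t\<le>S. t < T \<and> integral {0..1} (\<lambda>u. hz z t u powr (- (1 / \<alpha>)) * v t u * w t u) * (2 * A t)
     \<le> (1 + \<delta>) * integral {0..1} (\<lambda>u. hz z t u powr (1 - 1 / \<alpha>) * w t u) * integral {0..1} (\<lambda>u. v t u * g t u)"
proof (rule ccontr)
  define b where "b = 1 / \<alpha> - 1"
  have b: "b > 0" using al alpha by (simp add: b_def field_simps)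
  have be: "1 - 1 / \<alpha> = - b" "- (1 / \<alpha>) = - b - 1" by (simp_all add: b_def)
  define I where "I t = integral {0..1} (\<lambda>u. hz z t u powr (- b) * w t u)" for t
  define Q where "Q t = integral {0..1} (\<lambda>u. hz z t u powr (- b - 1) * v t u * w t u)" for t
  define Y where "Y t = integral {0..1} (\<lambda>u. v t u * g t u)" for t
  assume "\<not> ?thesis"
  then have neg: "Q t * (2 * A t) > (1 + \<delta>) * I t * Y t" if "t \<le> S" "t < T" for t
    using that unfolding be I_def Q_def Y_def by force
  obtain c where c: "c > 0" "\<And>t. t < 0 \<Longrightarrow> 2 * A t \<ge> c * (L t)\<^sup>2" using area_ge_length by blast
  \<comment> \<open>Jensen's inequality for the convex power \<open>- b\<close>, by way of its
    tangent at \<open>L t / (2 * pi)\<close>, which is the mean of the support function by Cauchy's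
    formula.\<close>
  have Ilow: "2 * pi * (L t / (2 * pi)) powr (- b) \<le> I t" if t: "t \<le> T" for t
  proof -
    have t0: "t < 0" using z t by simp
    interpret c: closed_curve "X t" "N t" "g t" "w t" "\<Theta> t" by (rule curve_at[OF t0])
    define a where "a = L t / (2 * pi)"
    have a: "a > 0" using L_pos[OF t0] by (simp add: a_def)
    have hp: "hz z t u > 0" for u using hz_pos[OF z t] .
    have hc: "continuous_on S (hz z t)" for S unfolding hz_def[abs_def] by (intro continuous_intros csec t0)
    have hps: "continuous_on S (\<lambda>u. hz z t u powr q)" for q S
      using hp by (intro continuous_on_powr continuous_on_const hc) (auto simp: less_imp_neq[symmetric])
    have "integral {0..1} (\<lambda>u. a powr (- b) * ((1 + b) * w t u - (b / a) * (hz z t u * w t u))) \<le> I t"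
      unfolding I_def
    proof (intro integral_mono_intros continuous_on_mult continuous_on_diff continuous_on_const hps hc csec t0)
      fix u
      have "1 - b * (hz z t u / a - 1) \<le> (hz z t u / a) powr (- b)" using hp a b by (intro powr_neg_ge_linear) auto
      then have "a powr (- b) * (1 - b * (hz z t u / a - 1)) \<le> a powr (- b) * (hz z t u / a) powr (- b)" by (intro mult_left_mono) auto
      also have "\<dots> = hz z t u powr (- b)" using a by (simp add: powr_mult[symmetric])
      finally have "a powr (- b) * (1 - b * (hz z t u / a - 1)) * w t u \<le> hz z t u powr (- b) * w t u"
        using w_nonneg[OF t0] by (intro mult_right_mono)
      then show "a powr (- b) * ((1 + b) * w t u - (b / a) * (hz z t u * w t u)) \<le> hz z t u powr (- b) * w t u"
        by (simp add: algebra_simps)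
    qed
    moreover have "integral {0..1} (\<lambda>u. a powr (- b) * ((1 + b) * w t u - (b / a) * (hz z t u * w t u)))
      = a powr (- b) * ((1 + b) * integral {0..1} (w t) - (b / a) * integral {0..1} (\<lambda>u. hz z t u * w t u))"
      by (intro lin_integral continuous_on_mult hc csec t0)
    moreover have "(1 + b) * integral {0..1} (w t) - (b / a) * integral {0..1} (\<lambda>u. hz z t u * w t u) = 2 * pi"
      using c.int_h_w[of z] len_area(1)[OF t0] L_pos[OF t0] int_w[OF t0] by (simp add: hz_def a_def algebra_simps)
    ultimately show ?thesis by (simp only: a_def mult.commute)
  qed
  have Ipos: "I t > 0" if "t \<le> T" for t
    using Ilow[OF that] L_pos[of t] that z by (intro less_le_trans[OF _ Ilow[OF that]]) simp
  define G where "G t = - (1 / b) * ln (I t) - ((1 + \<delta>) / 2) * ln (A t)" for t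
  define S' where "S' = min S (T - 1)"
  have mono: "G S' \<le> G s" if s: "s \<le> S'" for s
  proof (rule DERIV_nonpos_imp_nonincreasing[where f = G, OF s])
    fix x assume x: "s \<le> x" "x \<le> S'"
    then have xT: "x < T" "x \<le> S" and x0: "x < 0" using z by (auto simp: S'_def)
    have Ip: "I x > 0" and Ap: "A x > 0" using Ipos[of x] A_pos[OF x0] xT by auto
    have dI: "(I has_real_derivative b * Q x) (at x)"
      unfolding I_def[abs_def] Q_def by (rule entropy_deriv[OF z xT(1)])
    have dA: "(A has_real_derivative - Y x) (at x)" unfolding Y_def by (rule A_deriv[OF x0])
    have "(G has_real_derivative - (1 / b) * (b * Q x / I x) - ((1 + \<delta>) / 2) * (- Y x / A x)) (at x)"
      unfolding G_def[abs_def]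
      by (intro DERIV_diff DERIV_cmult) (use Ip Ap in \<open>auto intro!: derivative_eq_intros dI dA\<close>)
    moreover have "- (1 / b) * (b * Q x / I x) - ((1 + \<delta>) / 2) * (- Y x / A x) \<le> 0"
      using neg[OF xT(2,1)] Ip Ap b by (simp add: field_simps)
    ultimately show "\<exists>y. (G has_real_derivative y) (at x) \<and> y \<le> 0" by blast
  qed
  define K where "K = - ln (2 * pi) / b - ln (2 * pi) + ln (2 / c) / 2"
  have ub: "G s \<le> K - (\<delta> / 2) * ln (A s)" if s: "s \<le> S'" for s
  proof -
    have sT: "s \<le> T" and s0: "s < 0" using s z by (auto simp: S'_def)
    have Ls: "L s > 0" and As: "A s > 0" using L_pos[OF s0] A_pos[OF s0] by auto
    have "ln (2 * pi * (L s / (2 * pi)) powr (- b)) \<le> ln (I s)"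
      using Ilow[OF sT] Ls by (subst ln_le_cancel_iff) (auto intro: Ipos[OF sT])
    moreover have "ln (2 * pi * (L s / (2 * pi)) powr (- b)) = ln (2 * pi) + (- b) * (ln (L s) - ln (2 * pi))"
      using Ls by (simp add: ln_mult ln_div ln_powr)
    ultimately have "- ln (I s) / b \<le> (- ln (2 * pi) + b * (ln (L s) - ln (2 * pi))) / b"
      using b by (intro divide_right_mono) auto
    then have 1: "- (1 / b) * ln (I s) \<le> - ln (2 * pi) / b + ln (L s) - ln (2 * pi)"
      using b by (simp add: add_divide_distrib diff_divide_distrib)
    have "(L s)\<^sup>2 \<le> 2 / c * A s" using c(1) c(2)[OF s0] by (simp add: field_simps)
    then have "ln ((L s)\<^sup>2) \<le> ln (2 / c * A s)" using Ls c(1) As by (subst ln_le_cancel_iff) auto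
    moreover have "ln ((L s)\<^sup>2) = 2 * ln (L s)" using Ls by (simp add: ln_realpow)
    moreover have "ln (2 / c * A s) = ln (2 / c) + ln (A s)" using c(1) As by (intro ln_mult_pos) auto
    ultimately have 2: "ln (L s) \<le> ln (2 / c) / 2 + ln (A s) / 2" by simp
    have e: "((1 + \<delta>) / 2) * ln (A s) = ln (A s) / 2 + (\<delta> / 2) * ln (A s)" by (simp add: field_simps)
    show ?thesis unfolding G_def K_def e using 1 2 by linarith
  qed
  have "filterlim (\<lambda>s. ln (A s)) at_top at_bot" by (rule filterlim_compose[OF ln_at_top A_at_bot])
  then have "\<forall>\<^sub>F s in at_bot. ln (A s) \<ge> (K - G S' + 1) * 2 / \<delta>" by (simp add: filterlim_at_top)
  then have "\<forall>\<^sub>F s in at_bot. s \<le> S' \<and> ln (A s) \<ge> (K - G S' + 1) * 2 / \<delta>" by (simp add: eventually_conj_iff)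
  then obtain s where s: "s \<le> S'" "ln (A s) \<ge> (K - G S' + 1) * 2 / \<delta>" 
    using eventually_happens'[OF trivial_limit_at_bot_linorder] by blast
  have "K - G S' + 1 \<le> (\<delta> / 2) * ln (A s)" using s(2) d by (simp add: field_simps)
  then show False using mono[OF s(1)] ub[OF s(1)] by simp
qed

lemma deficit_zero_lt1:
  assumes al: "\<alpha> < 1" and t: "t < 0"
  shows "P t = 0"
proof (rule deficit_zero_of_near[OF _ _ t])
  fix e S :: real assume e: "e > 0" and S: "S < 0"
  \<comment> \<open>A point inside at time -1 is inside at all earlier times, so it can be the
    origin of every support function used here.\<close>
  obtain z where z: "z \<in> \<Omega> (- 1)" using Omega_ne[of "- 1"] by auto
  obtain c where c: "c > 0" "\<And>t. t < 0 \<Longrightarrow> 2 * A t \<ge> c * (L t)\<^sup>2" using area_ge_length by blast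
  obtain \<delta> where \<delta>: "\<delta> > 0" and near: "\<And>X N g w \<theta> v. near_soliton \<alpha> c \<delta> X N g w \<theta> v \<Longrightarrow> integral {0..1} (\<lambda>u. v u * g u) > 0 \<Longrightarrow>
     (closed_curve.len g)\<^sup>2 - 4 * pi * closed_curve.area X N g \<le> e * (closed_curve.len g)\<^sup>2"
    using near_soliton_near_circle[OF alpha al c(1) e] by blast
  obtain s where s: "s \<le> S" "s < - 1" and r: "integral {0..1} (\<lambda>u. hz z s u powr (- (1 / \<alpha>)) * v s u * w s u) * (2 * A s)
     \<le> (1 + \<delta>) * integral {0..1} (\<lambda>u. hz z s u powr (1 - 1 / \<alpha>) * w s u) * integral {0..1} (\<lambda>u. v s u * g s u)"
    using entropy_times[OF al z _ \<delta>, of S] by auto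
  have s0: "s < 0" using s by simp
  interpret c: closed_curve "X s" "N s" "g s" "w s" "\<Theta> s" by (rule curve_at[OF s0])
  interpret d: closed_curve "\<lambda>u. X s u - z" "N s" "g s" "w s" "\<Theta> s"
    using convex_flow.curve_at[OF translate s0] unfolding convex_flow.\<Theta>_def[OF translate] \<Theta>_def .
  have Ad: "d.area = A s" using c.area_translate[of z] len_area(2)[OF s0] by (simp add: d.area_def)
  have "near_soliton \<alpha> c \<delta> (\<lambda>u. X s u - z) (N s) (g s) (w s) (\<Theta> s) (v s)"
    unfolding near_soliton_def Ad len_area(1)[OF s0]
  proof (intro conjI allI)
    show "0 < (X s u - z) \<bullet> N s u" for u using hz_pos[OF z, of s u] s by (simp add: hz_def)
    show "v s u = (w s u / g s u) powr \<alpha>" for u by (rule v_eq[OF s0])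
    show "continuous_on UNIV (v s)" by (intro csec s0)
  qed (use r[unfolded hz_def] c(2)[OF s0] d.closed_curve_axioms in blast)+
  from near[OF this speed_integral_pos[OF s0]] have "P s \<le> e * (L s)\<^sup>2" by (simp add: Ad P_def len_area(1)[OF s0])
  then show "\<exists>t\<le>S. P t \<le> e * (L t)\<^sup>2" using s by blast
qed (use al in simp)

lemma deficit_zero: "t < 0 \<Longrightarrow> P t = 0"
  using deficit_zero_ge1 deficit_zero_lt1 by (cases "\<alpha> \<ge> 1") auto

end

section \<open>Vanishing deficit\<close>

context sweeping_flow
begin

lemma curvature_constant:
  assumes t: "t < 0"
  shows "w t u = (2 * pi / L t) * g t u"
proof -
  define m where "m = 2 * pi / L t"
  have m: "m > 0" using L_pos[OF t] by (simp add: m_def)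
  define f where "f u = (w t u - m * g t u) * (v t u - m powr \<alpha>)" for u
  have "(P has_real_derivative 0) (at t)"
    by (rule has_field_derivative_transform_within_open[of "\<lambda>_. 0" _ _ "{..<0}"]) (use t deficit_zero in auto)
  with P_deriv[OF t] have "- 2 * L t * integral {0..1} f = 0" unfolding f_def m_def by (rule DERIV_unique)
  then have "integral {0..1} f = 0" using L_pos[OF t] by simp
  then have z: "\<forall>u\<in>{0..1}. f u = 0"
    by (subst (asm) integral_eq_0_iff) (use weighted_cheb(2)[OF t less_imp_le[OF m]] t in \<open>auto simp: f_def intro!: continuous_intros csec\<close>)
  have fper: "f (u + 1) = f u" for u by (simp add: f_def w_per[OF t] g_per[OF t] v_per[OF t])
  have "f u = f (frac u)" using periodic_frac[of f u] fper by simp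
  also have "\<dots> = 0" using z frac_ge_0[of u] frac_lt_1[of u] by (auto simp: less_imp_le)
  finally have "w t u = m * g t u \<or> v t u = m powr \<alpha>" by (simp add: f_def)
  moreover have "w t u = m * g t u" if "v t u = m powr \<alpha>"
  proof -
    have k: "w t u / g t u \<ge> 0" using w_nonneg[OF t, of u] g_pos[OF t, of u] by simp
    have "(w t u / g t u) powr \<alpha> = m powr \<alpha>" using that v_eq[OF t, of u] by simp
    then have "((w t u / g t u) powr \<alpha>) powr (1 / \<alpha>) = (m powr \<alpha>) powr (1 / \<alpha>)" by simp
    then have "w t u / g t u = m" using k m alpha by (simp add: powr_powr)
    then show ?thesis using g_pos[OF t, of u] by (simp add: field_simps)
  qed
  ultimately show ?thesis by (auto simp: m_def)
qed

lemma curves_are_circles: "\<exists>q. \<forall>t<0. \<exists>r>0. range (X t) = sphere q r"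
proof -
  define r where "r t = L t / (2 * pi)" for t
  define q where "q t = X t 0 - r t *\<^sub>R N t 0" for t
  have rp: "r t > 0" if "t < 0" for t using L_pos[OF that] by (simp add: r_def)
  have qu: "X t u - r t *\<^sub>R N t u = q t" if t: "t < 0" for t u
  proof -
    have "((\<lambda>u. X t u - r t *\<^sub>R N t u) has_vector_derivative 0) (at x within UNIV)" for x
    proof -
      have "((\<lambda>u. X t u - r t *\<^sub>R N t u) has_vector_derivative g t x *\<^sub>R (\<i> * N t x) - r t *\<^sub>R (w t x *\<^sub>R (\<i> * N t x))) (at x)"
        by (intro has_vector_derivative_diff X_u[OF t] bounded_linear.has_vector_derivative[OF bounded_linear_scaleR_right N_u[OF t]])
      moreover have "r t * w t x = g t x" using L_pos[OF t] by (simp add: curvature_constant[OF t] r_def)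
      ultimately show ?thesis by simp
    qed
    from has_vector_derivative_zero_constant[OF convex_UNIV this] obtain c where "\<And>u. X t u - r t *\<^sub>R N t u = c" by auto
    then show ?thesis by (simp add: q_def)
  qed
  have vc: "v t u = (1 / r t) powr \<alpha>" if t: "t < 0" for t u
    using v_eq[OF t, of u] g_pos[OF t, of u] by (simp add: curvature_constant[OF t] r_def)
  have psi0: "\<psi> t u = 0" if t: "t < 0" for t u
  proof -
    have "(v t has_real_derivative 0) (at u)" unfolding vc[OF t, abs_def] by simp
    from DERIV_unique[OF this v_u[OF t]] show ?thesis using g_pos[OF t, of u] by simp
  qed
  have q': "(q has_vector_derivative 0) (at t)" if t: "t < 0" for t
  proof -
    define V where "V = integral {0..1} (\<lambda>u. v t u * w t u)"
    define k where "k = - ((1 / r t) powr \<alpha>) - (- V / (2 * pi))"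
    \<comment> \<open>The derivative of the centre can be computed through every \<open>u\<close>
      and is then the multiple \<open>k\<close> of \<open>N t u\<close>, with \<open>k\<close>
      independent of \<open>u\<close>. Opposite normals force \<open>k = 0\<close>.\<close>
    have qd: "(q has_vector_derivative k *\<^sub>R N t u) (at t)" for u
    proof -
      have dr: "(r has_real_derivative - V / (2 * pi)) (at t)"
        unfolding r_def[abs_def] V_def by (intro DERIV_cdivide L_deriv[OF t])
      have "((\<lambda>t. X t u - r t *\<^sub>R N t u) has_vector_derivative (- v t u) *\<^sub>R N t u
           - (r t *\<^sub>R (\<psi> t u *\<^sub>R (\<i> * N t u)) + (- V / (2 * pi)) *\<^sub>R N t u)) (at t)"
        by (intro has_vector_derivative_diff X_t[OF t] has_vector_derivative_scaleR[OF dr N_t[OF t]])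
      then have "((\<lambda>t. X t u - r t *\<^sub>R N t u) has_vector_derivative k *\<^sub>R N t u) (at t)"
        by (simp add: psi0[OF t] vc[OF t] k_def scaleR_diff_left[symmetric])
      then show ?thesis
        by (rule has_vector_derivative_transform_within_open[where S = "{..<0}"]) (use t qu in auto)
    qed
    obtain u1 where u1: "N t u1 = 1" using N_surj[OF t, of 1] by auto
    obtain u2 where u2: "N t u2 = - 1" using N_surj[OF t, of "- 1"] by auto
    have "k *\<^sub>R N t u1 = k *\<^sub>R N t u2" by (rule vector_derivative_unique_at[OF qd qd])
    then have "k = 0" using u1 u2 by simp
    then show ?thesis using qd[of 0] by simp
  qed
  have "\<exists>c. \<forall>t\<in>{..<0}. q t = c"
    by (rule has_vector_derivative_zero_constant[of "{..<0}" q]) (use q' in \<open>auto intro: has_vector_derivative_at_within\<close>)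
  then obtain c where c: "\<And>t. t < 0 \<Longrightarrow> q t = c" by auto
  have "range (X t) = sphere c (r t)" if t: "t < 0" for t
  proof -
    have X: "X t u = c + r t *\<^sub>R N t u" for u using qu[OF t, of u] c[OF t] by (simp add: algebra_simps)
    show ?thesis
    proof (intro set_eqI iffI)
      fix x assume "x \<in> range (X t)"
      then show "x \<in> sphere c (r t)" using rp[OF t] norm_N[OF t] by (auto simp: X dist_norm)
    next
      fix x assume x: "x \<in> sphere c (r t)"
      define e where "e = (1 / r t) *\<^sub>R (x - c)"
      have "norm e = 1" using x rp[OF t] by (simp add: e_def dist_norm norm_minus_commute)
      then obtain u where "N t u = e" using N_surj[OF t] by blast
      then have "X t u = x" using rp[OF t] by (simp add: X e_def)
      then show "x \<in> range (X t)" by blast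
    qed
  qed
  then show ?thesis using rp by blast
qed

end

section \<open>From the plane to the complex numbers\<close>

lemma smooth_onD:
  assumes "smooth_on S f"
  shows "x \<in> S \<Longrightarrow> f differentiable (at x)" "continuous_on S f" "smooth_on S (\<lambda>x. frechet_derivative f (at x) v)"
proof -
  have h: "higher_differentiable_on S f n" for n using assms by (simp add: smooth_on_def)
  show "x \<in> S \<Longrightarrow> f differentiable (at x)" using h[of "Suc 0"] by simp
  show "continuous_on S f" using h[of 0] by simp
  show "smooth_on S (\<lambda>x. frechet_derivative f (at x) v)" unfolding smooth_on_def
  proof
    show "higher_differentiable_on S (\<lambda>x. frechet_derivative f (at x) v) n" for n using h[of "Suc n"] by simp
  qed
qed

abbreviation "past \<equiv> ({..<0::real} \<times> (UNIV::real set))"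

definition du where "du f p = frechet_derivative f (at p) (0, 1)" for f :: "real \<times> real \<Rightarrow> 'a::real_normed_vector"
definition dt where "dt f p = frechet_derivative f (at p) (1, 0)" for f :: "real \<times> real \<Rightarrow> 'a::real_normed_vector"

lemma smooth_partials:
  assumes "smooth_on past f"
  shows "smooth_on past (du f)" "smooth_on past (dt f)"
  using smooth_onD(3)[OF assms] by (simp_all add: du_def[abs_def] dt_def[abs_def])

lemma has_partial_derivatives:
  fixes f :: "real \<times> real \<Rightarrow> 'a::real_normed_vector"
  assumes "smooth_on past f" "t < 0"
  shows "((\<lambda>u. f (t, u)) has_vector_derivative du f (t, u)) (at u)"
    "((\<lambda>t. f (t, u)) has_vector_derivative dt f (t, u)) (at t)"
proof -
  have "f differentiable (at (t, u))" using smooth_onD(1)[OF assms(1)] assms(2) by simp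
  then have d: "(f has_derivative frechet_derivative f (at (t, u))) (at (t, u))" by (simp add: frechet_derivative_works)
  then have lin: "linear (frechet_derivative f (at (t, u)))" using has_derivative_linear by blast
  have "((\<lambda>u. f (t, u)) has_derivative (\<lambda>h. frechet_derivative f (at (t, u)) (0, h))) (at u)"
    by (rule has_derivative_compose[of "\<lambda>u. (t, u)" "\<lambda>h. (0, h)" u UNIV f, OF _ d]) (auto intro!: derivative_eq_intros)
  moreover have "frechet_derivative f (at (t, u)) (0, h) = h *\<^sub>R du f (t, u)" for h
    using linear_scale[OF lin, of h "(0, 1)"] by (simp add: du_def)
  ultimately show "((\<lambda>u. f (t, u)) has_vector_derivative du f (t, u)) (at u)" by (simp add: has_vector_derivative_def)
  have "((\<lambda>t. f (t, u)) has_derivative (\<lambda>h. frechet_derivative f (at (t, u)) (h, 0))) (at t)"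
    by (rule has_derivative_compose[of "\<lambda>t. (t, u)" "\<lambda>h. (h, 0)" t UNIV f, OF _ d]) (auto intro!: derivative_eq_intros)
  moreover have "frechet_derivative f (at (t, u)) (h, 0) = h *\<^sub>R dt f (t, u)" for h
    using linear_scale[OF lin, of h "(1, 0)"] by (simp add: dt_def)
  ultimately show "((\<lambda>t. f (t, u)) has_vector_derivative dt f (t, u)) (at t)" by (simp add: has_vector_derivative_def)
qed

text \<open>The increment of \<open>f\<close> in \<open>u\<close> is the integral of
  \<open>du f\<close>. Differentiating it in \<open>t\<close> under the integral sign and then in
  its upper limit gives the symmetry.\<close>

lemma mixed_partials:
  fixes f :: "real \<times> real \<Rightarrow> 'a::banach"
  assumes f: "smooth_on past f" and t: "t < 0"
  shows "dt (du f) (t, u) = du (dt f) (t, u)"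
proof -
  define a where "a = u - 1"
  define b where "b = u + 1"
  have sc: "continuous_on S (\<lambda>s. h (t, s))" if "smooth_on past h" "t < 0" for h :: "real \<times> real \<Rightarrow> 'a" and t S
    by (rule continuous_on_compose2[OF smooth_onD(2)[OF that(1)]]) (use that(2) in \<open>auto intro!: continuous_intros\<close>)
  note fu = smooth_partials(1)[OF f] and ft = smooth_partials(2)[OF f]
  have ftc: "integral {a..x} (\<lambda>s. du f (t, s)) = f (t, x) - f (t, a)" if "t < 0" "a \<le> x" for t x
    by (rule integral_unique, rule fundamental_theorem_of_calculus[OF that(2)])
      (rule has_vector_derivative_at_within[OF has_partial_derivatives(1)[OF f that(1)]])
  have key: "integral {a..x} (\<lambda>s. dt (du f) (t, s)) = dt f (t, x) - dt f (t, a)" if x: "a \<le> x" for x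
  proof -
    have "((\<lambda>t. integral (cbox a x) (\<lambda>s. du f (t, s))) has_vector_derivative integral (cbox a x) (\<lambda>s. dt (du f) (t, s))) (at t within {..<0})"
    proof (rule leibniz_rule_vector_derivative)
      show "((\<lambda>x. du f (x, s)) has_vector_derivative dt (du f) (t', s)) (at t' within {..<0})" if "t' \<in> {..<0}" for t' s
        using has_partial_derivatives(2)[OF fu] that by (auto intro: has_vector_derivative_at_within)
      show "(\<lambda>s. du f (t', s)) integrable_on cbox a x" if "t' \<in> {..<0}" for t'
        using that by (intro integrable_continuous sc[OF fu]) auto
      show "continuous_on ({..<0} \<times> cbox a x) (\<lambda>(t, s). dt (du f) (t, s))"
        using continuous_on_subset[OF smooth_onD(2)[OF smooth_partials(2)[OF fu]], of "{..<0} \<times> cbox a x"] by (auto simp: case_prod_unfold)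
    qed (use t in auto)
    then have "((\<lambda>t. integral {a..x} (\<lambda>s. du f (t, s))) has_vector_derivative integral {a..x} (\<lambda>s. dt (du f) (t, s))) (at t)"
      using at_within_open[of t "{..<0}"] t by simp
    then have "((\<lambda>t. f (t, x) - f (t, a)) has_vector_derivative integral {a..x} (\<lambda>s. dt (du f) (t, s))) (at t)"
      by (rule has_vector_derivative_transform_within_open[where S = "{..<0}"]) (use t ftc x in auto)
    moreover have "((\<lambda>t. f (t, x) - f (t, a)) has_vector_derivative dt f (t, x) - dt f (t, a)) (at t)"
      by (intro has_vector_derivative_diff has_partial_derivatives(2)[OF f t])
    ultimately show ?thesis by (rule vector_derivative_unique_at)
  qed
  have uab: "u \<in> {a<..<b}" by (simp add: a_def b_def)
  have "((\<lambda>x. integral {a..x} (\<lambda>s. dt (du f) (t, s))) has_vector_derivative dt (du f) (t, u)) (at u within {a..b})"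
    by (rule integral_has_vector_derivative[OF sc[OF smooth_partials(2)[OF fu] t]]) (use uab in auto)
  then have "((\<lambda>x. integral {a..x} (\<lambda>s. dt (du f) (t, s))) has_vector_derivative dt (du f) (t, u)) (at u)"
    using uab by (simp add: at_within_Icc_at)
  then have "((\<lambda>x. dt f (t, x) - dt f (t, a)) has_vector_derivative dt (du f) (t, u)) (at u)"
    by (rule has_vector_derivative_transform_within_open[where S = "{a<..<b}"]) (use uab key in auto)
  moreover have "((\<lambda>x. dt f (t, x) - dt f (t, a)) has_vector_derivative du (dt f) (t, u) - 0) (at u)"
    by (intro has_vector_derivative_diff has_partial_derivatives(1)[OF ft t] has_vector_derivative_const)
  ultimately show ?thesis using vector_derivative_unique_at by fastforce
qed

section \<open>The identification of the real plane with the complex numbers\<close>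

definition to_c :: "real^2 \<Rightarrow> complex" where "to_c x = Complex (x $ 1) (x $ 2)"
definition of_c :: "complex \<Rightarrow> real^2" where "of_c z = vector [Re z, Im z]"

lemma of_c_to_c [simp]: "of_c (to_c x) = x" and to_c_of_c [simp]: "to_c (of_c z) = z"
  by (simp_all add: of_c_def to_c_def vec_eq_iff forall_2 complex_eq_iff)

lemma inner_to_c: "to_c x \<bullet> to_c y = x \<bullet> y"
  by (simp add: to_c_def inner_complex_def inner_vec_def sum_2)

lemma norm_to_c [simp]: "norm (to_c x) = norm x"
  by (simp add: norm_eq_sqrt_inner inner_to_c)

lemma linear_to_c: "linear to_c"
  by (rule linearI) (simp_all add: to_c_def complex_eq_iff)

lemma bounded_linear_to_c: "bounded_linear to_c"
  using linear_to_c linear_conv_bounded_linear by blast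

lemma linear_of_c: "linear of_c"
  by (rule linearI) (simp_all add: of_c_def vec_eq_iff forall_2)

lemma connected_component_image:
  assumes "continuous_on UNIV f" "connected_component S x y"
  shows "connected_component (f ` S) (f x) (f y)"
proof -
  obtain T where "connected T" "T \<subseteq> S" "x \<in> T" "y \<in> T" using assms(2) by (auto simp: connected_component_def)
  then show ?thesis unfolding connected_component_def
    using connected_continuous_image[OF continuous_on_subset[OF assms(1) subset_UNIV]] by (intro exI[of _ "f ` T"]) auto
qed

text \<open>The identification is a norm-preserving homeomorphism, so it carries components to
  components and keeps boundedness, which is all that \<open>inside\<close> and
  \<open>outside\<close> depend on.\<close>

lemma component_bounded_iff:
  "bounded (connected_component_set (- to_c ` S) (to_c x)) \<longleftrightarrow> bounded (connected_component_set (- S) x)"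
proof -
  have c: "continuous_on UNIV to_c" "continuous_on UNIV of_c"
    by (simp_all add: linear_continuous_on linear_conv_bounded_linear[symmetric] linear_to_c linear_of_c)
  have im: "- to_c ` S = to_c ` (- S)" 
    by (rule bij_image_Compl_eq[symmetric], rule bijI') (metis of_c_to_c, metis to_c_of_c)
  have im': "of_c ` (- to_c ` S) = - S" unfolding im by (force simp: image_image)
  have "connected_component_set (- to_c ` S) (to_c x) = to_c ` connected_component_set (- S) x"
  proof (intro set_eqI iffI)
    fix z assume "z \<in> connected_component_set (- to_c ` S) (to_c x)"
    then have "connected_component (- S) x (of_c z)" using connected_component_image[OF c(2), of "- to_c ` S" "to_c x" z] by (simp add: im')
    then show "z \<in> to_c ` connected_component_set (- S) x" by (intro image_eqI[of _ _ "of_c z"]) auto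
  qed (use connected_component_image[OF c(1), of "- S" x] in \<open>auto simp: im\<close>)
  moreover have "bounded (to_c ` T) \<longleftrightarrow> bounded T" for T by (simp add: bounded_iff)
  ultimately show ?thesis by simp
qed

lemma to_c_mem_image [simp]: "to_c x \<in> to_c ` S \<longleftrightarrow> x \<in> S"
  by (metis image_iff of_c_to_c)

lemma to_c_inside: "to_c x \<in> inside (to_c ` S) \<longleftrightarrow> x \<in> inside S"
  by (simp add: inside_def component_bounded_iff)

lemma to_c_outside: "to_c x \<in> outside (to_c ` S) \<longleftrightarrow> x \<in> outside S"
  by (simp add: outside_def component_bounded_iff)

lemma inside_to_c: "inside (to_c ` S) = to_c ` inside S"
proof (rule set_eqI)
  fix z
  show "z \<in> inside (to_c ` S) \<longleftrightarrow> z \<in> to_c ` inside S"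
    using to_c_inside[of "of_c z" S] to_c_mem_image[of "of_c z" "inside S"] by simp
qed

section \<open>Outward normals of convex curves\<close>

locale outward_curve =
  fixes \<gamma> \<gamma>1 :: "real \<Rightarrow> complex"
  assumes d1: "\<And>u. (\<gamma> has_vector_derivative \<gamma>1 u) (at u)"
    and c1: "continuous_on UNIV \<gamma>1"
    and ne: "\<And>u. \<gamma>1 u \<noteq> 0"
    and per: "\<And>u. \<gamma> (u + 1) = \<gamma> u"
    and simple: "simple_path \<gamma>"
    and conv: "convex (inside (range \<gamma>))"
    and out: "\<And>u. \<exists>\<nu>. norm \<nu> = 1 \<and> \<nu> \<bullet> \<gamma>1 u = 0 \<and> (\<forall>\<^sub>F s in at_right 0. \<gamma> u + s *\<^sub>R \<nu> \<in> outside (range \<gamma>))"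
begin

definition outw :: "real \<Rightarrow> complex \<Rightarrow> bool" where
  "outw u \<nu> \<longleftrightarrow> norm \<nu> = 1 \<and> \<nu> \<bullet> \<gamma>1 u = 0 \<and> (\<forall>\<^sub>F s in at_right 0. \<gamma> u + s *\<^sub>R \<nu> \<in> outside (range \<gamma>))"

abbreviation "R \<equiv> inside (range \<gamma>)"

lemma trace: "path_image \<gamma> = range \<gamma>"
proof -
  have "\<gamma> u \<in> \<gamma> ` {0..1}" for u
    using periodic_frac[of \<gamma> u] per frac_ge_0[of u] frac_lt_1[of u] by (metis atLeastAtMost_iff image_eqI less_imp_le)
  then show ?thesis by (auto simp: path_image_def)
qed

lemma region: "R \<noteq> {}" "open R" "bounded R" "closure R = R \<union> range \<gamma>" "closure R \<inter> outside (range \<gamma>) = {}"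
proof -
  have "pathfinish \<gamma> = pathstart \<gamma>" using per[of 0] by (simp add: pathfinish_def pathstart_def)
  note J = Jordan_inside_outside[OF simple this, unfolded trace]
  show "R \<noteq> {}" "open R" "bounded R" using J by auto
  show "closure R = R \<union> range \<gamma>" using J closure_Un_frontier[of R] by simp
  then show "closure R \<inter> outside (range \<gamma>) = {}" by (auto simp: inside_def outside_def)
qed

lemma inj: "\<gamma> u = \<gamma> u' \<Longrightarrow> u' - u \<in> \<int>"
proof -
  assume eq: "\<gamma> u = \<gamma> u'"
  have e: "\<gamma> (frac u) = \<gamma> (frac u')" using periodic_frac[of \<gamma>] per eq by simp
  have r: "frac u \<in> {0..1}" "frac u' \<in> {0..1}" "frac u < 1" "frac u' < 1"
    using frac_ge_0 frac_lt_1 less_imp_le[OF frac_lt_1] by auto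
  have "\<forall>x\<in>{0..1}. \<forall>y\<in>{0..1}. \<gamma> x = \<gamma> y \<longrightarrow> x = y \<or> x = 0 \<and> y = 1 \<or> x = 1 \<and> y = 0"
    using simple unfolding simple_path_def loop_free_def by blast
  from bspec[OF bspec[OF this r(1)] r(2)] have "frac u = frac u'" using e r(3,4) by auto
  then have "u' - u = of_int (\<lfloor>u'\<rfloor> - \<lfloor>u\<rfloor>)" by (simp add: frac_def)
  then show ?thesis by (metis Ints_of_int)
qed

definition T :: "real \<Rightarrow> complex" where "T u = sgn (\<gamma>1 u)"

lemma gT: "\<gamma>1 u = norm (\<gamma>1 u) *\<^sub>R T u" "norm (T u) = 1"
  using ne[of u] by (simp_all add: T_def norm_sgn sgn_div_norm)

lemma frame_outw: "outw u \<nu> \<Longrightarrow> frame (T u) \<nu>"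
  using ne[of u] by (auto simp: frame_def outw_def gT(2)) (simp add: T_def sgn_div_norm inner_commute)

lemma inner_deriv: "((\<lambda>u. \<gamma> u \<bullet> a) has_real_derivative \<gamma>1 u \<bullet> a) (at u)"
  by (rule has_real_derivative_inner[OF d1])

text \<open>The alternative to the claim is that the region lies on the side of \<open>\<nu>\<close>. Then convexity puts points \<open>\<gamma> u + s \<nu>\<close> with small \<open>s > 0\<close>
  into its closure: combine an interior point with a point of the curve on the other side of the normal line.\<close>

lemma support:
  assumes \<nu>: "outw u \<nu>" and z: "z \<in> R"
  shows "(z - \<gamma> u) \<bullet> \<nu> < 0"
proof -
  have "\<gamma> u \<in> closure R" by (simp add: region(4))
  moreover have "\<gamma> u \<notin> rel_interior R" using region(2) by (auto simp: rel_interior_open inside_def)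
  ultimately obtain a where a: "a \<noteq> 0" "\<And>y. y \<in> closure R \<Longrightarrow> a \<bullet> \<gamma> u \<le> a \<bullet> y" "\<And>y. y \<in> rel_interior R \<Longrightarrow> a \<bullet> \<gamma> u < a \<bullet> y"
    using supporting_hyperplane_relative_frontier[OF conv] by metis
  have fr: "frame (T u) \<nu>" by (rule frame_outw[OF \<nu>])
  have "\<gamma>1 u \<bullet> a = 0"
  proof (rule DERIV_local_min[OF inner_deriv, of 1])
    have "a \<bullet> \<gamma> u \<le> a \<bullet> \<gamma> y" for y by (rule a(2)) (simp add: region(4))
    then show "\<forall>y. \<bar>u - y\<bar> < 1 \<longrightarrow> \<gamma> u \<bullet> a \<le> \<gamma> y \<bullet> a" by (simp add: inner_commute[of _ a])
  qed simp
  then have "T u \<bullet> a = 0" using ne[of u] by (simp add: T_def sgn_div_norm)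
  then have a': "a = (a \<bullet> \<nu>) *\<^sub>R \<nu>" using frame_expand[OF fr, of a] by (simp add: inner_commute)
  define c where "c = a \<bullet> \<nu>"
  have ac: "a \<bullet> y = c * (y \<bullet> \<nu>)" for y by (subst a') (simp add: c_def inner_commute)
  have strict: "0 < c * ((y - \<gamma> u) \<bullet> \<nu>)" if "y \<in> R" for y
    using a(3)[of y] that region(2) by (simp add: rel_interior_open ac inner_diff_left right_diff_distrib)
  have "c \<le> 0"
  proof (rule ccontr)
    assume "\<not> c \<le> 0"
    then have c: "c > 0" by simp
    obtain z0 where z0: "z0 \<in> R" using region(1) by blast
    define d where "d = z0 - \<gamma> u"
    have b: "d \<bullet> \<nu> > 0" using strict[OF z0] c by (simp add: d_def zero_less_mult_iff)
    have pos: "\<gamma>1 u \<bullet> T u > 0" using ne[of u] by (simp add: T_def inner_sgn)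
    obtain u' where u': "(d \<bullet> T u) * ((\<gamma> u' - \<gamma> u) \<bullet> T u) \<le> 0" "(\<gamma> u' - \<gamma> u) \<bullet> T u \<noteq> 0"
    proof (cases "d \<bullet> T u \<ge> 0")
      case True
      from DERIV_pos_inc_left[OF inner_deriv pos] obtain e where "e > 0" "\<And>h. 0 < h \<Longrightarrow> h < e \<Longrightarrow> \<gamma> (u - h) \<bullet> T u < \<gamma> u \<bullet> T u" by blast
      then have "\<gamma> (u - e/2) \<bullet> T u < \<gamma> u \<bullet> T u" by simp
      then show ?thesis using True by (intro that[of "u - e/2"]) (auto simp: inner_diff_left mult_nonneg_nonpos)
    next
      case False
      from DERIV_pos_inc_right[OF inner_deriv pos] obtain e where "e > 0" "\<And>h. 0 < h \<Longrightarrow> h < e \<Longrightarrow> \<gamma> u \<bullet> T u < \<gamma> (u + h) \<bullet> T u" by blast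
      then have "\<gamma> u \<bullet> T u < \<gamma> (u + e/2) \<bullet> T u" by simp
      then show ?thesis using False by (intro that[of "u + e/2"]) (auto simp: inner_diff_left mult_nonpos_nonneg)
    qed
    define p where "p = \<gamma> u' - \<gamma> u"
    have p2: "p \<bullet> \<nu> \<ge> 0"
    proof -
      have "a \<bullet> \<gamma> u \<le> a \<bullet> \<gamma> u'" by (rule a(2)) (simp add: region(4))
      then have "c * (p \<bullet> \<nu>) \<ge> 0" by (simp add: ac p_def inner_diff_left right_diff_distrib)
      then show ?thesis using c by (simp add: zero_le_mult_iff)
    qed
    define S where "S = \<bar>p \<bullet> T u\<bar> + \<bar>d \<bullet> T u\<bar>"
    have S: "S > 0" using u'(2) by (simp add: S_def p_def)
    define l where "l = \<bar>p \<bullet> T u\<bar> / S"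
    define m where "m = \<bar>d \<bullet> T u\<bar> / S"
    have lm: "l > 0" "m \<ge> 0" "l + m = 1" using S u'(2) by (auto simp: l_def m_def p_def S_def add_divide_distrib[symmetric])
    have "\<bar>p \<bullet> T u\<bar> * (d \<bullet> T u) + \<bar>d \<bullet> T u\<bar> * (p \<bullet> T u) = 0"
      using u'(1) unfolding p_def[symmetric] by (auto simp: abs_if mult_le_0_iff not_less)
    then have "l * (d \<bullet> T u) + m * (p \<bullet> T u) = 0" unfolding l_def m_def using S by (simp add: field_simps)
    define q where "q = l *\<^sub>R z0 + m *\<^sub>R \<gamma> u'"
    define s0 where "s0 = l * (d \<bullet> \<nu>) + m * (p \<bullet> \<nu>)"
    have s0: "s0 > 0" using lm b p2 by (simp add: s0_def add_pos_nonneg)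
    have qd: "q - \<gamma> u = l *\<^sub>R d + m *\<^sub>R p"
    proof -
      have "\<gamma> u = l *\<^sub>R \<gamma> u + m *\<^sub>R \<gamma> u" using lm(3) by (metis scaleR_add_left scaleR_one)
      then show ?thesis by (simp add: q_def d_def p_def algebra_simps)
    qed
    have "(q - \<gamma> u) \<bullet> T u = 0" unfolding qd using \<open>l * (d \<bullet> T u) + m * (p \<bullet> T u) = 0\<close> by (simp add: inner_add_left)
    moreover have "(q - \<gamma> u) \<bullet> \<nu> = s0" unfolding qd by (simp add: inner_add_left s0_def)
    ultimately have qs: "q = \<gamma> u + s0 *\<^sub>R \<nu>" using frame_expand[OF fr, of "q - \<gamma> u"] by (simp add: algebra_simps)
    have K: "convex (closure R)" by (rule convex_closure[OF conv])
    have qK: "q \<in> closure R" unfolding q_def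
      by (rule convexD[OF K]) (use z0 closure_subset[of R] lm region(4) in auto)
    obtain e where e: "e > 0" "\<And>s. 0 < s \<Longrightarrow> s < e \<Longrightarrow> \<gamma> u + s *\<^sub>R \<nu> \<in> outside (range \<gamma>)"
      using \<nu> unfolding outw_def eventually_at_right_field by auto
    define s where "s = min s0 (e/2)"
    have s: "0 < s" "s \<le> s0" "s < e" using s0 e(1) by (auto simp: s_def)
    have "\<gamma> u + s *\<^sub>R \<nu> = (1 - s / s0) *\<^sub>R \<gamma> u + (s / s0) *\<^sub>R q" using s0 by (simp add: qs algebra_simps)
    moreover have "(1 - s / s0) *\<^sub>R \<gamma> u + (s / s0) *\<^sub>R q \<in> closure R"
      by (rule convexD[OF K]) (use qK region(4) s s0 in auto)
    ultimately show False using e(2)[OF s(1,3)] region(5) by auto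
  qed
  then show ?thesis using strict[OF z] by (auto simp: zero_less_mult_iff not_less)
qed

lemma T_cont: "continuous_on S T"
  unfolding T_def[abs_def] sgn_div_norm using ne continuous_on_subset[OF c1, of S] by (intro continuous_intros) auto

lemma curve_cont: "continuous_on S \<gamma>"
  by (meson d1 continuous_at_imp_continuous_on has_vector_derivative_continuous)

text \<open>An outward normal is \<open>- \<i> * T u\<close> up to sign. By \<open>support\<close>
  the vector from the curve to an interior point is never tangent, so connectedness makes the sign
  independent of \<open>u\<close>. The integral is twice the signed area; tying the sign to it
  allows a comparison of different times.\<close>

lemma orientation:
  "\<exists>\<sigma>\<in>{1, - 1::real}. (\<forall>u \<nu>. outw u \<nu> \<longrightarrow> \<nu> = \<sigma> *\<^sub>R (- \<i> * T u)) \<and>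
    0 < \<sigma> * integral {0..1} (\<lambda>u. \<gamma> u \<bullet> (- \<i> * \<gamma>1 u))"
proof -
  obtain z0 where z0: "z0 \<in> R" using region(1) by blast
  define n where "n u = - \<i> * T u" for u
  have nT: "frame (T u) (n u)" for u using gT(2)[of u] by (simp add: frame_def n_def norm_mult inner_complex_def)
  have pm: "\<nu> = n u \<or> \<nu> = - n u" if "outw u \<nu>" for u \<nu>
  proof -
    have "\<nu> \<bullet> T u = 0" using frame_outw[OF that] by (simp add: frame_def inner_commute)
    then have e: "\<nu> = (\<nu> \<bullet> n u) *\<^sub>R n u" using frame_expand[OF nT, of \<nu> u] by simp
    moreover have "norm \<nu> = 1" "norm (n u) = 1" using that nT by (auto simp: outw_def frame_def)
    ultimately have "\<bar>\<nu> \<bullet> n u\<bar> = 1" by (metis norm_scaleR mult.right_neutral)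
    then show ?thesis using e by (auto simp: abs_if split: if_splits)
  qed
  define f where "f u = (z0 - \<gamma> u) \<bullet> n u" for u
  have fne: "f u \<noteq> 0" for u
  proof -
    obtain \<nu> where \<nu>: "outw u \<nu>" using out[of u] by (auto simp: outw_def)
    show ?thesis using support[OF \<nu> z0] pm[OF \<nu>] by (auto simp: f_def)
  qed
  have fc: "continuous_on S f" for S unfolding f_def[abs_def] n_def by (intro continuous_intros curve_cont T_cont)
  have cn: "connected (f ` UNIV)" by (rule connected_continuous_image[OF fc]) simp
  have same: "f u > 0 \<longleftrightarrow> f 0 > 0" for u
  proof (rule ccontr)
    assume "\<not> ?thesis"
    then have "f u \<le> 0 \<and> 0 \<le> f 0 \<or> f 0 \<le> 0 \<and> 0 \<le> f u" by auto
    then have "0 \<in> f ` UNIV" using connected_contains_Icc[OF cn, of "f u" "f 0"] connected_contains_Icc[OF cn, of "f 0" "f u"] by (meson atLeastAtMost_iff rangeI subsetD)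
    then show False using fne by auto
  qed
  define \<sigma> where "\<sigma> = (if f 0 > 0 then - 1 else 1 :: real)"
  have sf: "\<sigma> * f u < 0" for u using same[of u] fne[of u] by (auto simp: \<sigma>_def not_less less_le)
  show ?thesis
  proof (intro bexI[of _ \<sigma>] conjI allI impI)
    show "\<sigma> \<in> {1, - 1}" by (simp add: \<sigma>_def)
    fix u \<nu> assume \<nu>: "outw u \<nu>"
    have "\<nu> = n u \<and> \<sigma> = 1 \<or> \<nu> = - n u \<and> \<sigma> = - 1"
      using pm[OF \<nu>] support[OF \<nu> z0] sf[of u] by (auto simp: f_def \<sigma>_def split: if_splits)
    then show "\<nu> = \<sigma> *\<^sub>R (- \<i> * T u)" by (auto simp: n_def)
  next
    have c: "continuous_on S (\<lambda>u. \<gamma> u \<bullet> (- \<i> * \<gamma>1 u))" "continuous_on S (\<lambda>u. z0 \<bullet> (- \<i> * \<gamma>1 u))" for S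
      using continuous_on_subset[OF c1, of S] by (intro continuous_intros curve_cont; simp)+
    have z: "integral {0..1} (\<lambda>u. z0 \<bullet> (- \<i> * \<gamma>1 u)) = 0"
    proof (rule periodic_deriv_integral)
      fix u
      have "((\<lambda>u. (- \<i> * \<gamma> u) \<bullet> z0) has_real_derivative (- \<i> * \<gamma>1 u) \<bullet> z0) (at u)"
        by (intro has_real_derivative_inner bounded_linear.has_vector_derivative[OF bounded_linear_mult_right d1])
      then show "((\<lambda>u. (- \<i> * \<gamma> u) \<bullet> z0) has_real_derivative z0 \<bullet> (- \<i> * \<gamma>1 u)) (at u)" by (simp add: inner_commute)
      show "(- \<i> * \<gamma> 1) \<bullet> z0 = (- \<i> * \<gamma> 0) \<bullet> z0" using per[of 0] by simp
    qed
    have "0 < integral {0..1} (\<lambda>u. - (\<sigma> * f u) * norm (\<gamma>1 u))"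
    proof -
      define G where "G u = - (\<sigma> * f u) * norm (\<gamma>1 u)" for u
      have G: "G u > 0" for u using sf[of u] ne[of u] by (simp add: G_def mult_neg_pos)
      have Gc: "continuous_on {0..1} G" unfolding G_def[abs_def] using continuous_on_subset[OF c1, of "{0..1}"] by (intro continuous_intros fc) auto
      have "integral {0..1} G \<ge> 0" by (intro integral_nonneg_intros Gc less_imp_le[OF G])
      moreover have "integral {0..1} G \<noteq> 0"
        using integral_eq_0_iff[of 0 1 G] Gc G less_imp_le[OF G] by (auto simp: less_imp_neq[symmetric])
      ultimately show ?thesis by (simp add: G_def[abs_def])
    qed
    also have "(\<lambda>u. - (\<sigma> * f u) * norm (\<gamma>1 u)) = (\<lambda>u. \<sigma> * (\<gamma> u \<bullet> (- \<i> * \<gamma>1 u) - z0 \<bullet> (- \<i> * \<gamma>1 u)))"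
    proof
      fix u
      have "norm (\<gamma>1 u) *\<^sub>R n u = - \<i> * \<gamma>1 u" by (subst (2) gT(1)) (simp add: n_def)
      then have "f u * norm (\<gamma>1 u) = (z0 - \<gamma> u) \<bullet> (- \<i> * \<gamma>1 u)" by (metis f_def inner_scaleR_right mult.commute)
      then have "- (\<sigma> * f u) * norm (\<gamma>1 u) = - \<sigma> * ((z0 - \<gamma> u) \<bullet> (- \<i> * \<gamma>1 u))"
        by (metis mult.assoc mult_minus_left)
      then show "- (\<sigma> * f u) * norm (\<gamma>1 u) = \<sigma> * (\<gamma> u \<bullet> (- \<i> * \<gamma>1 u) - z0 \<bullet> (- \<i> * \<gamma>1 u))"
        by (simp add: inner_diff_left right_diff_distrib)
    qed
    also have "integral {0..1} \<dots> = \<sigma> * (integral {0..1} (\<lambda>u. \<gamma> u \<bullet> (- \<i> * \<gamma>1 u)) - integral {0..1} (\<lambda>u. z0 \<bullet> (- \<i> * \<gamma>1 u)))"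
      by (intro lin_integral c)
    finally show "0 < \<sigma> * integral {0..1} (\<lambda>u. \<gamma> u \<bullet> (- \<i> * \<gamma>1 u))" unfolding z diff_0_right .
  qed
qed

end

text \<open>The farthest point of the curve from the origin is the only point of the curve on its tangent line,
  so its normal direction is attained only once per period.\<close>

lemma turning_number_one:
  fixes X N :: "real \<Rightarrow> complex"
  assumes X: "\<And>u. (X has_vector_derivative g u *\<^sub>R (\<i> * N u)) (at u)"
    and N: "\<And>u. (N has_vector_derivative w u *\<^sub>R (\<i> * N u)) (at u)"
    and nN: "\<And>u. norm (N u) = 1" and g: "\<And>u. g u > 0" and w: "\<And>u. w u \<ge> 0" "continuous_on UNIV w"
    and per: "\<And>u. X (u + 1) = X u" "\<And>u. N (u + 1) = N u" "\<And>u. w (u + 1) = w u"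
    and inj: "\<And>u u'. X u = X u' \<Longrightarrow> u' - u \<in> \<int>"
    and supp: "\<And>u u'. (X u' - X u) \<bullet> N u \<le> 0"
  shows "\<exists>\<theta>. (\<forall>u. N u = cis (\<theta> u)) \<and> (\<forall>u. (\<theta> has_real_derivative w u) (at u)) \<and> (\<forall>u. \<theta> (u + 1) = \<theta> u + 2 * pi)"
proof -
  have wc: "continuous_on S w" for S using w(2) continuous_on_subset by blast
  obtain \<theta>0 where th0: "\<And>u. (\<theta>0 has_real_derivative w u) (at u)"
  proof -
    define I where "I u = (if u \<ge> 0 then integral {0..u} w else - integral {u..0} w)" for u
    have "(I has_real_derivative w u) (at u)" for u
    proof -
      define a where "a = - \<bar>u\<bar> - 1"
      define b where "b = \<bar>u\<bar> + 1"
      have ub: "u \<in> {a<..<b}" "a \<le> 0" "0 \<le> b" by (auto simp: a_def b_def)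
      have "((\<lambda>x. integral {a..x} w - integral {a..0} w) has_real_derivative w u - 0) (at u within {a..b})"
        by (intro DERIV_diff integral_has_real_derivative[OF wc] DERIV_const) (use ub in auto)
      then have "((\<lambda>x. integral {a..x} w - integral {a..0} w) has_real_derivative w u) (at u)"
        using ub by (simp add: at_within_Icc_at)
      then show ?thesis
      proof (rule has_field_derivative_transform_within_open[where S = "{a<..<b}"])
        fix x assume x: "x \<in> {a<..<b}"
        have i: "w integrable_on {c..d}" for c d by (rule integrable_continuous_real[OF wc])
        show "integral {a..x} w - integral {a..0} w = I x"
          using Henstock_Kurzweil_Integration.integral_combine[of a 0 x w, OF _ _ i] Henstock_Kurzweil_Integration.integral_combine[of a x 0 w, OF _ _ i] x ub
          by (auto simp: I_def)
      qed (use ub in auto)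
    qed
    then show thesis by (rule that)
  qed
  define c where "c = Arg (N 0) - \<theta>0 0"
  define \<theta> where "\<theta> u = \<theta>0 u + c" for u
  have th: "(\<theta> has_real_derivative w u) (at u)" for u unfolding \<theta>_def[abs_def] using th0 by (auto intro!: derivative_eq_intros)
  have ccis: "((\<lambda>u. cis (- \<theta> u)) has_vector_derivative (- w u) *\<^sub>R (\<i> * cis (- \<theta> u))) (at u)" for u
    using has_derivative_cis[OF has_vector_derivative_def[THEN iffD1, OF DERIV_minus[OF th, unfolded has_real_derivative_iff_has_vector_derivative]]]
    unfolding has_vector_derivative_def by (simp add: scaleR_conv_of_real mult_ac)
  have "((\<lambda>u. N u * cis (- \<theta> u)) has_vector_derivative 0) (at u within UNIV)" for u
    using has_vector_derivative_mult[OF N[of u] ccis[of u]] by (simp add: scaleR_conv_of_real)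
  from has_vector_derivative_zero_constant[OF convex_UNIV this] obtain k where k: "\<And>u. N u * cis (- \<theta> u) = k" by auto
  have "cis (Arg (N 0)) = N 0" using cis_Arg[of "N 0"] nN[of 0] norm_eq_zero[of "N 0"] by (simp add: sgn_eq)
  then have "k = 1" using k[of 0] nN[of 0] by (simp add: \<theta>_def c_def cis_mult flip: cis_inverse) (metis cis_inverse cis_mult cis_zero add.right_inverse)
  have Nc: "N u = cis (\<theta> u)" for u
  proof -
    have "N u * cis (- \<theta> u) * cis (\<theta> u) = cis (\<theta> u)" using k[of u] \<open>k = 1\<close> by simp
    then show ?thesis by (simp add: mult.assoc cis_mult)
  qed
  define D where "D = \<theta> 1 - \<theta> 0"
  have D: "\<theta> (u + 1) = \<theta> u + D" for u
  proof -
    have "((\<lambda>u. \<theta> (u + 1) - \<theta> u) has_real_derivative 0) (at u)" for u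
    proof -
      have "((\<lambda>u. \<theta> (u + 1)) has_real_derivative w (u + 1) * 1) (at u)"
        by (rule DERIV_chain2[OF th]) (auto intro!: derivative_eq_intros)
      from DERIV_diff[OF this th[of u]] show ?thesis by (simp add: per)
    qed
    then have "\<theta> (u + 1) - \<theta> u = \<theta> (0 + 1) - \<theta> 0" by (intro DERIV_isconst_all) blast
    then show ?thesis by (simp add: D_def)
  qed
  have mono: "\<theta> a \<le> \<theta> b" if "a \<le> b" for a b
    by (rule DERIV_nonneg_imp_nondecreasing[OF that]) (use th w in blast)
  have tc: "continuous_on S \<theta>" for S by (intro continuous_at_imp_continuous_on ballI DERIV_isCont[OF th])
  have "cis D = 1" using per(2)[of 0] Nc[of 0] Nc[of 1] cis_mult[of "\<theta> 0" D] cis_neq_zero[of "\<theta> 0"] D[of 0] by simp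
  then obtain m :: int where m: "D = 2 * pi * m"
    unfolding cis_conv_exp exp_eq_1 by (auto simp: mult.commute)
  have "D \<ge> 0" using mono[of 0 1] by (simp add: D_def)
  then have m0: "m \<ge> 0" using m pi_gt_zero not_le[of pi 0] by (auto simp: zero_le_mult_iff)
  \<comment> \<open>Without any turning the curve would advance steadily in one direction and could
    not close up.\<close>
  have "D \<noteq> 0"
  proof
    assume D0: "D = 0"
    have "\<theta> u = \<theta> 0" if "u \<in> {0..1}" for u using mono[of 0 u] mono[of u 1] that D0 by (simp add: D_def)
    then have Nu: "N u = N 0" if "u \<in> {0..1}" for u using that unfolding Nc by (intro arg_cong[where f = cis]) blast
    have "X 0 \<bullet> (\<i> * N 0) < X 1 \<bullet> (\<i> * N 0)"
    proof (rule DERIV_pos_imp_increasing[where f = "\<lambda>u. X u \<bullet> (\<i> * N 0)"])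
      fix x :: real assume x: "0 \<le> x" "x \<le> 1"
      have "((\<lambda>u. X u \<bullet> (\<i> * N 0)) has_real_derivative (g x *\<^sub>R (\<i> * N x)) \<bullet> (\<i> * N 0)) (at x)"
        by (rule has_real_derivative_inner[OF X])
      moreover have "(g x *\<^sub>R (\<i> * N x)) \<bullet> (\<i> * N 0) = g x" using Nu[of x] x nN[of 0] by (simp add: dot_square_norm norm_mult)
      ultimately show "\<exists>y. ((\<lambda>u. X u \<bullet> (\<i> * N 0)) has_real_derivative y) (at x) \<and> 0 < y" using g[of x] by auto
    qed simp
    then show False using per(1)[of 0] by simp
  qed
  then have m1: "m \<ge> 1" using m m0 by (cases "m = 0") auto
  have "m < 2"
  proof (rule ccontr)
    assume "\<not> m < 2"
    then have D4: "D \<ge> 2 * pi * 2" unfolding m by (intro mult_left_mono) auto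
    have Xc: "continuous_on S X" for S by (meson X continuous_at_imp_continuous_on has_vector_derivative_continuous)
    have "\<exists>a\<in>{0..1}. \<forall>y\<in>{0..1}. norm (X y) \<le> norm (X a)" by (rule continuous_attains_sup) (auto intro!: continuous_intros Xc)
    then obtain a where a: "\<And>y. y \<in> {0..1} \<Longrightarrow> norm (X y) \<le> norm (X a)" by blast
    have aa: "norm (X y) \<le> norm (X a)" for y
      using a[of "frac y"] periodic_frac[of X y] per(1) frac_ge_0[of y] frac_lt_1[of y] by (simp add: less_imp_le)
    have "((\<lambda>u. X u \<bullet> X u) has_real_derivative X a \<bullet> (g a *\<^sub>R (\<i> * N a)) + (g a *\<^sub>R (\<i> * N a)) \<bullet> X a) (at a)"
      using bounded_bilinear.has_vector_derivative[OF bounded_bilinear_inner X[of a] X[of a]]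
      by (simp add: has_real_derivative_iff_has_vector_derivative)
    moreover have "\<forall>y. \<bar>a - y\<bar> < 1 \<longrightarrow> X y \<bullet> X y \<le> X a \<bullet> X a"
      using aa by (auto simp: dot_square_norm power_mono)
    ultimately have "X a \<bullet> (g a *\<^sub>R (\<i> * N a)) + (g a *\<^sub>R (\<i> * N a)) \<bullet> X a = 0"
      using DERIV_local_max[of "\<lambda>u. X u \<bullet> X u" _ a 1] by auto
    then have perp: "X a \<bullet> (\<i> * N a) = 0" using g[of a] by (simp add: inner_commute)
    have fr: "frame (\<i> * N a) (N a)" using nN[of a] by (simp add: frame_def norm_mult inner_i_mult)
    have "2 * pi < D" using D4 pi_gt_zero by linarith
    then have "\<exists>b\<ge>a. b \<le> a + 1 \<and> \<theta> b = \<theta> a + 2 * pi" using D[of a] by (intro IVT' tc) auto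
    then obtain b where b: "a \<le> b" "b \<le> a + 1" "\<theta> b = \<theta> a + 2 * pi" by blast
    have ab: "a \<noteq> b" "b \<noteq> a + 1" using b D[of a] \<open>2 * pi < D\<close> by auto
    have Nb: "N b = N a" using b(3) by (simp add: Nc flip: cis_mult)
    have "X b \<bullet> N a = X a \<bullet> N a" using supp[of b a] supp[of a b] by (simp add: Nb inner_diff_left)
    moreover have "(X b \<bullet> (\<i> * N a))\<^sup>2 + (X b \<bullet> N a)\<^sup>2 \<le> (X a \<bullet> (\<i> * N a))\<^sup>2 + (X a \<bullet> N a)\<^sup>2"
      using aa[of b] unfolding frame_norm[OF fr, symmetric] by (intro power_mono) auto
    ultimately have "X b \<bullet> (\<i> * N a) = 0" using perp by simp
    then have "X a = X b" using frame_expand[OF fr, of "X a"] frame_expand[OF fr, of "X b"] perp \<open>X b \<bullet> N a = X a \<bullet> N a\<close> by simp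
    then have "b - a \<in> \<int>" by (rule inj)
    then obtain k :: int where "b - a = k" by (rule Ints_cases)
    moreover have "0 < b - a" "b - a < 1" using b ab by auto
    ultimately have "0 < real_of_int k" "real_of_int k < 1" by simp_all
    then show False by simp
  qed
  then have "D = 2 * pi" using m m1 by simp
  then show ?thesis using Nc th D by blast
qed

section \<open>From the parametrised flow to the geometric quantities\<close>

lemma norm_sgn_deriv:
  fixes f :: "real \<Rightarrow> complex"
  assumes f: "(f has_vector_derivative f') (at x)" and ne: "f x \<noteq> 0"
  shows "((\<lambda>x. norm (f x)) has_real_derivative f' \<bullet> sgn (f x)) (at x)"
    "((\<lambda>x. sgn (f x)) has_vector_derivative ((f' \<bullet> (\<i> * sgn (f x))) / norm (f x)) *\<^sub>R (\<i> * sgn (f x))) (at x)"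
proof -
  define n where "n = norm (f x)"
  define T where "T = sgn (f x)"
  have n: "n > 0" and fT: "f x = n *\<^sub>R T" using ne by (simp_all add: n_def T_def sgn_div_norm)
  have i: "((\<lambda>x. f x \<bullet> f x) has_real_derivative f x \<bullet> f' + f' \<bullet> f x) (at x)"
    using bounded_bilinear.has_vector_derivative[OF bounded_bilinear_inner f f]
    by (simp add: has_real_derivative_iff_has_vector_derivative)
  have "f x \<bullet> f x > 0" using ne by simp
  from DERIV_chain2[OF DERIV_real_sqrt[OF this] i]
  have "((\<lambda>x. norm (f x)) has_real_derivative inverse n / 2 * (f x \<bullet> f' + f' \<bullet> f x)) (at x)"
    by (simp add: norm_eq_sqrt_inner n_def)
  then show d: "((\<lambda>x. norm (f x)) has_real_derivative f' \<bullet> sgn (f x)) (at x)"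
    by (rule DERIV_cong) (use n in \<open>simp add: sgn_div_norm n_def[symmetric] inner_commute[of "f x"] field_simps\<close>)
  have "((\<lambda>x. inverse (norm (f x)) *\<^sub>R f x) has_vector_derivative inverse n *\<^sub>R f' + (- (inverse n * (f' \<bullet> T) * inverse n)) *\<^sub>R f x) (at x)"
    unfolding n_def T_def by (rule has_vector_derivative_scaleR[OF DERIV_inverse'[OF d] f]) (use ne in simp)
  moreover have "inverse n *\<^sub>R f' + (- (inverse n * (f' \<bullet> T) * inverse n)) *\<^sub>R f x = ((f' \<bullet> (\<i> * T)) / n) *\<^sub>R (\<i> * T)"
  proof -
    have fr: "frame T (\<i> * T)" using ne by (simp add: frame_def T_def norm_sgn norm_mult inner_i_mult)
    have "inverse n *\<^sub>R f' + (- (inverse n * (f' \<bullet> T) * inverse n)) *\<^sub>R f x = inverse n *\<^sub>R (f' - (f' \<bullet> T) *\<^sub>R T)"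
      using n by (simp add: fT scaleR_diff_right)
    also have "f' - (f' \<bullet> T) *\<^sub>R T = (f' \<bullet> (\<i> * T)) *\<^sub>R (\<i> * T)" using frame_expand[OF fr, of f'] by (simp add: algebra_simps)
    finally show ?thesis by (simp add: divide_inverse mult.commute)
  qed
  ultimately show "((\<lambda>x. sgn (f x)) has_vector_derivative ((f' \<bullet> (\<i> * sgn (f x))) / norm (f x)) *\<^sub>R (\<i> * sgn (f x))) (at x)"
    by (simp add: sgn_div_norm[abs_def] n_def T_def)
qed

lemma periodic_vector_derivative:
  assumes "\<And>u. (f has_vector_derivative f' u) (at u)" "\<And>u. f (u + 1) = f u"
  shows "f' (u + 1) = f' (u::real)"
proof -
  have "((\<lambda>u. u + 1) has_real_derivative 1) (at u)" by (auto intro!: derivative_eq_intros)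
  then have "((f \<circ> (\<lambda>u. u + 1)) has_vector_derivative 1 *\<^sub>R f' (u + 1)) (at u)"
    using vector_diff_chain_at[of "\<lambda>u. u + 1" 1 u f "f' (u + 1)"] assms(1)
    by (simp add: has_real_derivative_iff_has_vector_derivative)
  then have "(f has_vector_derivative f' (u + 1)) (at u)" using assms(2) by (simp add: o_def)
  then show ?thesis using assms(1) by (rule vector_derivative_unique_at)
qed

text \<open>The curves run counterclockwise: \<open>- \<i> * sgn (Xu t u)\<close> is the outward
  normal. Equality of mixed derivatives is built in, since \<open>Xtu\<close> and
  \<open>Xtuu\<close> serve for both orders of differentiation.\<close>

locale oriented_flow =
  fixes \<alpha> :: real and X Xu Xuu Xt Xtu Xtuu :: "real \<Rightarrow> real \<Rightarrow> complex" and \<Omega> :: "real \<Rightarrow> complex set"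
  assumes alpha: "\<alpha> > 1/2"
    and X_u: "\<And>t u. t < 0 \<Longrightarrow> (X t has_vector_derivative Xu t u) (at u)"
    and Xu_u: "\<And>t u. t < 0 \<Longrightarrow> (Xu t has_vector_derivative Xuu t u) (at u)"
    and Xt_u: "\<And>t u. t < 0 \<Longrightarrow> (Xt t has_vector_derivative Xtu t u) (at u)"
    and Xtu_u: "\<And>t u. t < 0 \<Longrightarrow> (Xtu t has_vector_derivative Xtuu t u) (at u)"
    and X_t: "\<And>t u. t < 0 \<Longrightarrow> ((\<lambda>s. X s u) has_vector_derivative Xt t u) (at t)"
    and Xu_t: "\<And>t u. t < 0 \<Longrightarrow> ((\<lambda>s. Xu s u) has_vector_derivative Xtu t u) (at t)"
    and Xuu_t: "\<And>t u. t < 0 \<Longrightarrow> ((\<lambda>s. Xuu s u) has_vector_derivative Xtuu t u) (at t)"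
    and conts: "continuous_on past (\<lambda>p. X (fst p) (snd p))" "continuous_on past (\<lambda>p. Xu (fst p) (snd p))"
      "continuous_on past (\<lambda>p. Xuu (fst p) (snd p))" "continuous_on past (\<lambda>p. Xt (fst p) (snd p))"
      "continuous_on past (\<lambda>p. Xtu (fst p) (snd p))" "continuous_on past (\<lambda>p. Xtuu (fst p) (snd p))"
    and Xu_ne: "\<And>t u. t < 0 \<Longrightarrow> Xu t u \<noteq> 0"
    and X_per: "\<And>t u. t < 0 \<Longrightarrow> X t (u + 1) = X t u"
    and flow: "\<And>t u. t < 0 \<Longrightarrow> Xt t u = - ((- (Xuu t u \<bullet> (- \<i> * sgn (Xu t u))) / (norm (Xu t u))\<^sup>2) powr \<alpha>) *\<^sub>R (- \<i> * sgn (Xu t u))"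
    and open_Omega: "\<And>t. t < 0 \<Longrightarrow> open (\<Omega> t)"
    and convex_Omega: "\<And>t. t < 0 \<Longrightarrow> convex (\<Omega> t)"
    and bounded_Omega: "\<And>t. t < 0 \<Longrightarrow> bounded (\<Omega> t)"
    and Omega_ne: "\<And>t. t < 0 \<Longrightarrow> \<Omega> t \<noteq> {}"
    and closure_Omega: "\<And>t. t < 0 \<Longrightarrow> closure (\<Omega> t) = \<Omega> t \<union> range (X t)"
    and Omega_support: "\<And>t u z. t < 0 \<Longrightarrow> z \<in> \<Omega> t \<Longrightarrow> (z - X t u) \<bullet> (- \<i> * sgn (Xu t u)) < 0"
    and inj: "\<And>t u u'. t < 0 \<Longrightarrow> X t u = X t u' \<Longrightarrow> u' - u \<in> \<int>"
begin

definition N where "N t u = - \<i> * sgn (Xu t u)"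
definition g where "g t u = norm (Xu t u)"
definition gu where "gu t u = Xuu t u \<bullet> (\<i> * N t u)"
definition w where "w t u = - (Xuu t u \<bullet> N t u) / g t u"
definition v where "v t u = - (Xt t u \<bullet> N t u)"
definition \<psi> where "\<psi> t u = - (Xtu t u \<bullet> N t u) / g t u"
definition \<psi>u where "\<psi>u t u = - ((Xtuu t u \<bullet> N t u + w t u * (Xtu t u \<bullet> (\<i> * N t u))) * g t u - (Xtu t u \<bullet> N t u) * gu t u) / (g t u)\<^sup>2"

lemma iN: "\<i> * N t u = sgn (Xu t u)"
  by (simp add: N_def flip: mult.assoc)

lemma g_pos: "t < 0 \<Longrightarrow> g t u > 0"
  by (simp add: g_def Xu_ne)

lemma Xu_eq: "t < 0 \<Longrightarrow> Xu t u = g t u *\<^sub>R (\<i> * N t u)"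
  using Xu_ne[of t u] unfolding iN g_def by (simp add: sgn_div_norm)

lemma norm_N: "t < 0 \<Longrightarrow> norm (N t u) = 1"
  using Xu_ne[of t u] by (simp add: N_def norm_mult norm_sgn)

lemma NN: "t < 0 \<Longrightarrow> N t u \<bullet> N t u = 1" "t < 0 \<Longrightarrow> (\<i> * N t u) \<bullet> (\<i> * N t u) = 1"
  using norm_N[of t u] by (simp_all add: dot_square_norm norm_mult)

lemma isgn: "\<i> * sgn (Xu t u) = - N t u" "sgn (Xu t u) = \<i> * N t u"
  by (simp_all add: N_def flip: mult.assoc)

lemma N_u: "t < 0 \<Longrightarrow> (N t has_vector_derivative w t u *\<^sub>R (\<i> * N t u)) (at u)"
proof -
  assume t: "t < 0"
  have "((\<lambda>u. - \<i> * sgn (Xu t u)) has_vector_derivative - \<i> * (((Xuu t u \<bullet> (\<i> * sgn (Xu t u))) / norm (Xu t u)) *\<^sub>R (\<i> * sgn (Xu t u)))) (at u)"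
    by (rule bounded_linear.has_vector_derivative[OF bounded_linear_mult_right norm_sgn_deriv(2)[OF Xu_u[OF t] Xu_ne[OF t]]])
  then show ?thesis unfolding N_def[abs_def, symmetric] g_def[symmetric] isgn(1) by (simp add: w_def N_def[abs_def])
qed

lemma N_t: "t < 0 \<Longrightarrow> ((\<lambda>s. N s u) has_vector_derivative \<psi> t u *\<^sub>R (\<i> * N t u)) (at t)"
proof -
  assume t: "t < 0"
  have "((\<lambda>t. - \<i> * sgn (Xu t u)) has_vector_derivative - \<i> * (((Xtu t u \<bullet> (\<i> * sgn (Xu t u))) / norm (Xu t u)) *\<^sub>R (\<i> * sgn (Xu t u)))) (at t)"
    by (rule bounded_linear.has_vector_derivative[OF bounded_linear_mult_right norm_sgn_deriv(2)[OF Xu_t[OF t] Xu_ne[OF t]]])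
  then show ?thesis unfolding g_def[symmetric] isgn(1) by (simp add: \<psi>_def N_def[abs_def] g_def)
qed

lemma g_u: "t < 0 \<Longrightarrow> (g t has_real_derivative gu t u) (at u)"
  using norm_sgn_deriv(1)[OF Xu_u Xu_ne] by (simp add: g_def[abs_def] gu_def iN)

lemma v_eq: "t < 0 \<Longrightarrow> v t u = (w t u / g t u) powr \<alpha>"
  using flow[of t u] NN(1)[of t u] unfolding N_def[symmetric] g_def[symmetric] by (simp add: v_def w_def power2_eq_square)

lemma Xt_eq: "t < 0 \<Longrightarrow> Xt t u = (- v t u) *\<^sub>R N t u"
  using flow[of t u] NN(1)[of t u] unfolding N_def[symmetric] v_def by (metis inner_scaleR_left minus_minus mult.right_neutral)

lemma inner_u:
  assumes f: "(f has_vector_derivative f') (at u)" and t: "t < 0"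
  shows "((\<lambda>u. f u \<bullet> N t u) has_real_derivative f' \<bullet> N t u + w t u * (f u \<bullet> (\<i> * N t u))) (at u)"
  using bounded_bilinear.has_vector_derivative[OF bounded_bilinear_inner f N_u[OF t]]
  by (simp add: has_real_derivative_iff_has_vector_derivative add.commute)

lemma v_u: "t < 0 \<Longrightarrow> (v t has_real_derivative g t u * \<psi> t u) (at u)"
proof -
  assume t: "t < 0"
  have "((\<lambda>u. - (Xt t u \<bullet> N t u)) has_real_derivative - (Xtu t u \<bullet> N t u + w t u * (Xt t u \<bullet> (\<i> * N t u)))) (at u)"
    by (intro DERIV_minus inner_u Xt_u t)
  moreover have "Xt t u \<bullet> (\<i> * N t u) = 0" by (simp add: Xt_eq[OF t] inner_i_mult)
  ultimately show ?thesis using g_pos[OF t, of u] by (simp add: v_def[abs_def] \<psi>_def)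
qed

text \<open>Differentiating \<open>Xt = - v N\<close> along the curve produces a tangential
  component only from the rotation of the normal.\<close>

lemma Xtu_T: "t < 0 \<Longrightarrow> Xtu t u \<bullet> (\<i> * N t u) = - v t u * w t u"
proof -
  assume t: "t < 0"
  have "((\<lambda>u. (- v t u) *\<^sub>R N t u) has_vector_derivative (- v t u) *\<^sub>R (w t u *\<^sub>R (\<i> * N t u)) + (- (g t u * \<psi> t u)) *\<^sub>R N t u) (at u)"
    by (intro has_vector_derivative_scaleR DERIV_minus v_u[OF t] N_u[OF t])
  then have "(Xt t has_vector_derivative (- v t u) *\<^sub>R (w t u *\<^sub>R (\<i> * N t u)) + (- (g t u * \<psi> t u)) *\<^sub>R N t u) (at u)"
    by (simp only: Xt_eq[OF t, abs_def])
  from vector_derivative_unique_at[OF Xt_u[OF t] this]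
  show ?thesis by (simp add: inner_diff_left inner_i_mult NN[OF t])
qed

lemma psi_u: "t < 0 \<Longrightarrow> (\<psi> t has_real_derivative \<psi>u t u) (at u)"
proof -
  assume t: "t < 0"
  have "((\<lambda>u. - (Xtu t u \<bullet> N t u) / g t u) has_real_derivative
     (- (Xtuu t u \<bullet> N t u + w t u * (Xtu t u \<bullet> (\<i> * N t u))) * g t u - - (Xtu t u \<bullet> N t u) * gu t u) / (g t u * g t u)) (at u)"
    by (intro DERIV_divide DERIV_minus inner_u Xtu_u g_u t) (use g_pos[OF t, of u] in simp)
  then show ?thesis unfolding \<psi>_def[abs_def] by (rule DERIV_cong) (simp add: \<psi>u_def power2_eq_square algebra_simps)
qed

lemma g_t: "t < 0 \<Longrightarrow> ((\<lambda>s. g s u) has_real_derivative - (v t u * w t u)) (at t)"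
  using norm_sgn_deriv(1)[OF Xu_t Xu_ne, of t u] Xtu_T[of t u] by (simp add: g_def[abs_def] iN)

text \<open>With \<open>w\<close> and \<open>\<psi>\<close> the derivatives of the normal angle in
  \<open>u\<close> and in \<open>t\<close>, this is the symmetry of its mixed derivatives. It
  becomes visible once \<open>Xtu_T\<close> is substituted.\<close>

lemma w_t: "t < 0 \<Longrightarrow> ((\<lambda>s. w s u) has_real_derivative \<psi>u t u) (at t)"
proof -
  assume t: "t < 0"
  have gp: "g t u > 0" by (rule g_pos[OF t])
  have i: "((\<lambda>t. Xuu t u \<bullet> N t u) has_real_derivative Xtuu t u \<bullet> N t u + \<psi> t u * (Xuu t u \<bullet> (\<i> * N t u))) (at t)"
    using bounded_bilinear.has_vector_derivative[OF bounded_bilinear_inner Xuu_t[OF t] N_t[OF t]]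
    by (simp add: has_real_derivative_iff_has_vector_derivative add.commute)
  have d: "((\<lambda>t. - (Xuu t u \<bullet> N t u) / g t u) has_real_derivative
     (- (Xtuu t u \<bullet> N t u + \<psi> t u * (Xuu t u \<bullet> (\<i> * N t u))) * g t u - - (Xuu t u \<bullet> N t u) * (- (v t u * w t u))) / (g t u * g t u)) (at t)"
    by (intro DERIV_divide DERIV_minus i g_t t) (use gp in simp)
  have "Xuu t u \<bullet> N t u = - (g t u * w t u)" "Xtu t u \<bullet> N t u = - (g t u * \<psi> t u)" using gp by (simp_all add: w_def \<psi>_def)
  then have "(- (Xtuu t u \<bullet> N t u + \<psi> t u * (Xuu t u \<bullet> (\<i> * N t u))) * g t u - - (Xuu t u \<bullet> N t u) * (- (v t u * w t u))) / (g t u * g t u) = \<psi>u t u"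
    unfolding \<psi>u_def Xtu_T[OF t] gu_def[symmetric] by (simp add: power2_eq_square algebra_simps)
  then show ?thesis using d unfolding w_def[abs_def] by simp
qed

lemma pers:
  assumes t: "t < 0"
  shows "Xu t (u + 1) = Xu t u" "Xuu t (u + 1) = Xuu t u" "Xt t (u + 1) = Xt t u" "Xtu t (u + 1) = Xtu t u"
proof -
  show 1: "Xu t (u + 1) = Xu t u" for u by (rule periodic_vector_derivative[OF X_u[OF t] X_per[OF t]])
  show "Xuu t (u + 1) = Xuu t u" by (rule periodic_vector_derivative[OF Xu_u[OF t] 1])
  show 2: "Xt t (u + 1) = Xt t u" for u
  proof -
    have "((\<lambda>s. X s u) has_vector_derivative Xt t (u + 1)) (at t)"
      by (rule has_vector_derivative_transform_within_open[OF X_t[OF t, of "u + 1"], of "{..<0}"]) (use t X_per in auto)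
    then show ?thesis using X_t[OF t] by (rule vector_derivative_unique_at)
  qed
  show "Xtu t (u + 1) = Xtu t u" by (rule periodic_vector_derivative[OF Xt_u[OF t] 2])
qed

lemma support_closed: "t < 0 \<Longrightarrow> (X t u' - X t u) \<bullet> N t u \<le> 0"
proof -
  assume t: "t < 0"
  have "closure (\<Omega> t) \<subseteq> {z. (z - X t u) \<bullet> N t u \<le> 0}"
  proof (rule closure_minimal)
    show "\<Omega> t \<subseteq> {z. (z - X t u) \<bullet> N t u \<le> 0}" using Omega_support[OF t] by (auto simp: N_def intro: less_imp_le)
    show "closed {z. (z - X t u) \<bullet> N t u \<le> 0}" by (intro closed_Collect_le continuous_intros)
  qed
  then show ?thesis using closure_Omega[OF t] by auto
qed

text \<open>The curve stays on one side of each tangent line, so its component along a fixed normal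
  is maximal at the point of contact.\<close>

lemma w_nonneg: "t < 0 \<Longrightarrow> w t u \<ge> 0"
proof -
  assume t: "t < 0"
  have "- (Xuu t u \<bullet> N t u) \<ge> 0"
  proof (rule local_min_second_deriv(2)[where f = "\<lambda>x. - (X t x \<bullet> N t u)" and f' = "\<lambda>x. - (Xu t x \<bullet> N t u)"])
    show "((\<lambda>x. - (X t x \<bullet> N t u)) has_real_derivative - (Xu t x \<bullet> N t u)) (at x)" for x
      by (intro DERIV_minus has_real_derivative_inner X_u t)
    show "((\<lambda>x. - (Xu t x \<bullet> N t u)) has_real_derivative - (Xuu t u \<bullet> N t u)) (at u)"
      by (intro DERIV_minus has_real_derivative_inner Xu_u t)
    show "\<forall>\<^sub>F x in nhds u. - (X t u \<bullet> N t u) \<le> - (X t x \<bullet> N t u)"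
      using support_closed[OF t] by (intro always_eventually) (simp add: inner_diff_left)
  qed
  then show ?thesis using g_pos[OF t, of u] by (simp add: w_def divide_nonpos_pos)
qed

lemma N_cont: "continuous_on past (\<lambda>p. N (fst p) (snd p))"
  unfolding N_def sgn_div_norm by (intro continuous_intros conts) (use Xu_ne in auto)

lemma g_cont: "continuous_on past (\<lambda>p. g (fst p) (snd p))"
  unfolding g_def by (intro continuous_intros conts)

lemma w_cont: "continuous_on past (\<lambda>p. w (fst p) (snd p))"
  unfolding w_def by (intro continuous_intros conts N_cont g_cont) (use g_pos in \<open>force simp: less_imp_neq[symmetric]\<close>)

lemma flow_is_convex: "convex_flow \<alpha> X N g gu w v \<psi> \<psi>u \<Omega>"
proof
  have gne: "g (fst p) (snd p) \<noteq> 0" if "p \<in> past" for p using g_pos[of "fst p" "snd p"] that by auto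
  show "continuous_on past (\<lambda>(t, u). X t u)" "continuous_on past (\<lambda>(t, u). N t u)" "continuous_on past (\<lambda>(t, u). g t u)"
    "continuous_on past (\<lambda>(t, u). w t u)" unfolding case_prod_unfold by (rule conts N_cont g_cont w_cont)+
  show "continuous_on past (\<lambda>(t, u). v t u)" unfolding case_prod_unfold v_def by (intro continuous_intros conts N_cont)
  show "continuous_on past (\<lambda>(t, u). \<psi> t u)" unfolding case_prod_unfold \<psi>_def
    by (intro continuous_intros conts N_cont g_cont) (use gne in auto)
  show "continuous_on past (\<lambda>(t, u). \<psi>u t u)" unfolding case_prod_unfold \<psi>u_def gu_def
    by (intro continuous_intros conts N_cont g_cont w_cont) (use gne in auto)
  fix t u :: real assume t: "t < 0"
  show "(X t has_vector_derivative g t u *\<^sub>R (\<i> * N t u)) (at u)" using X_u[OF t, of u] by (simp add: Xu_eq[OF t])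
  show "((\<lambda>s. X s u) has_vector_derivative - v t u *\<^sub>R N t u) (at t)" using X_t[OF t, of u] by (simp add: Xt_eq[OF t])
  show "N t (u + 1) = N t u" "g t (u + 1) = g t u" "w t (u + 1) = w t u" "\<psi> t (u + 1) = \<psi> t u"
    by (simp_all add: N_def g_def w_def \<psi>_def pers[OF t])
  show "(z - X t u) \<bullet> N t u < 0" if "z \<in> \<Omega> t" for z using Omega_support[OF t that] by (simp add: N_def)
  have sec: "continuous_on UNIV (w t)"
  proof -
    have "continuous_on UNIV (\<lambda>u. (t, u))" by (intro continuous_intros)
    from continuous_on_compose2[OF w_cont this] t show ?thesis by auto
  qed
  have Xe: "(X t has_vector_derivative g t u *\<^sub>R (\<i> * N t u)) (at u)" for u using X_u[OF t, of u] by (simp add: Xu_eq[OF t])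
  have wp: "w t (u + 1) = w t u" "N t (u + 1) = N t u" for u by (simp_all add: N_def g_def w_def pers[OF t])
  show "\<exists>\<theta>. (\<forall>u. N t u = cis (\<theta> u)) \<and> (\<forall>u. (\<theta> has_real_derivative w t u) (at u)) \<and> (\<forall>u. \<theta> (u + 1) = \<theta> u + 2 * pi)"
    by (rule turning_number_one[OF Xe N_u[OF t] norm_N[OF t] g_pos[OF t] w_nonneg[OF t] sec X_per[OF t] wp(2) wp(1) inj[OF t] support_closed[OF t]])
qed (use alpha N_u g_u v_u psi_u N_t g_t w_t norm_N g_pos w_nonneg v_eq X_per open_Omega convex_Omega bounded_Omega Omega_ne closure_Omega in auto)

end

section \<open>The given solution as a flow of complex curves\<close>

locale ancient_solution =
  fixes \<alpha> :: real and F :: "real \<Rightarrow> real \<Rightarrow> real^2"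
  assumes alpha: "\<alpha> > 1/2" and sol: "convex_compact_ancient_solution \<alpha> F" and sweeps: "sweeps_plane F"
begin

definition FF :: "real \<times> real \<Rightarrow> real^2" where "FF = (\<lambda>(t, u). F t u)"

lemma FF_simp [simp]: "FF (t, u) = F t u"
  by (simp add: FF_def)

lemma smooth: "smooth_on past FF" "smooth_on past (du FF)" "smooth_on past (du (du FF))" "smooth_on past (dt FF)"
    "smooth_on past (du (dt FF))" "smooth_on past (du (du (dt FF)))"
proof -
  show "smooth_on past FF" using sol by (simp add: convex_compact_ancient_solution_def generalized_curve_shortening_flow_def FF_def)
  then show "smooth_on past (du FF)" "smooth_on past (du (du FF))" "smooth_on past (dt FF)"
    "smooth_on past (du (dt FF))" "smooth_on past (du (du (dt FF)))" by (simp_all add: smooth_partials)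
qed

lemma curve: "t < 0 \<Longrightarrow> F t (u + 1) = F t u" "t < 0 \<Longrightarrow> simple_path (F t)"
    "t < 0 \<Longrightarrow> vector_derivative (F t) (at u) \<noteq> 0" "t < 0 \<Longrightarrow> convex (inside (path_image (F t)))"
  using sol by (auto simp: convex_compact_ancient_solution_def closed_convex_embedded_curve_def closed_embedded_curve_def)

lemma velocity: "t < 0 \<Longrightarrow> vector_derivative (F t) (at u) = du FF (t, u)"
  using has_partial_derivatives(1)[OF smooth(1)] by (intro vector_derivative_at) simp

lemma acceleration: "t < 0 \<Longrightarrow> vector_derivative (\<lambda>w. du FF (t, w)) (at u) = du (du FF) (t, u)"
  by (rule vector_derivative_at[OF has_partial_derivatives(1)[OF smooth(2)]])

lemma trace: "t < 0 \<Longrightarrow> path_image (F t) = range (F t)"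
proof -
  assume t: "t < 0"
  have "F t u \<in> F t ` {0..1}" for u
    using periodic_frac[of "F t" u] curve(1)[OF t] frac_ge_0[of u] frac_lt_1[of u] by (metis atLeastAtMost_iff image_eqI less_imp_le)
  then show ?thesis by (auto simp: path_image_def)
qed

lemma range_to_c: "range (\<lambda>u. to_c (F t u)) = to_c ` range (F t)"
  by (simp add: image_image)

lemma to_c_deriv: "(f has_vector_derivative f') (at x) \<Longrightarrow> ((\<lambda>x. to_c (f x)) has_vector_derivative to_c f') (at x)"
  by (rule bounded_linear.has_vector_derivative[OF bounded_linear_to_c])

lemma to_c_scaleR: "to_c (r *\<^sub>R x) = r *\<^sub>R to_c x"
  using linear_scale[OF linear_to_c] .

lemma to_c_add: "to_c (x + y) = to_c x + to_c y"
  using linear_add[OF linear_to_c] .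

lemma to_c_cont: "continuous_on S f \<Longrightarrow> continuous_on S (\<lambda>x. to_c (f x))"
  by (rule bounded_linear.continuous_on[OF bounded_linear_to_c])

lemma cont_section: "continuous_on S (\<lambda>u. f (t, u))" if "smooth_on past f" "t < 0" for f :: "real \<times> real \<Rightarrow> real^2"
proof -
  have "continuous_on S (\<lambda>u. (t, u))" by (intro continuous_intros)
  from continuous_on_compose2[OF smooth_onD(2)[OF that(1)] this] that(2) show ?thesis by auto
qed

lemma normal_exists:
  assumes t: "t < 0"
  obtains \<nu> where "outward_unit_normal (F t) u \<nu>" 
    "dt FF (t, u) = - (curvature (F t) u \<nu> powr \<alpha>) *\<^sub>R \<nu>"
proof -
  obtain \<nu> where \<nu>: "outward_unit_normal (F t) u \<nu>" "((\<lambda>\<tau>. F \<tau> u) has_vector_derivative - (curvature (F t) u \<nu> powr \<alpha>) *\<^sub>R \<nu>) (at t)"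
    using sol t unfolding convex_compact_ancient_solution_def generalized_curve_shortening_flow_def by blast
  have "((\<lambda>\<tau>. F \<tau> u) has_vector_derivative dt FF (t, u)) (at t)" using has_partial_derivatives(2)[OF smooth(1) t] by simp
  from vector_derivative_unique_at[OF this \<nu>(2)] \<nu>(1) that show thesis by blast
qed

lemma outward_to_c:
  assumes t: "t < 0" and \<nu>: "outward_unit_normal (F t) u \<nu>"
  shows "norm (to_c \<nu>) = 1" "to_c \<nu> \<bullet> to_c (du FF (t, u)) = 0"
    "\<forall>\<^sub>F s in at_right 0. to_c (F t u) + s *\<^sub>R to_c \<nu> \<in> outside (range (\<lambda>u. to_c (F t u)))"
proof -
  note n = \<nu>[unfolded outward_unit_normal_def velocity[OF t] trace[OF t]]
  show "norm (to_c \<nu>) = 1" "to_c \<nu> \<bullet> to_c (du FF (t, u)) = 0" using n by (simp_all add: inner_to_c)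
  have "to_c (F t u) + s *\<^sub>R to_c \<nu> \<in> outside (range (\<lambda>u. to_c (F t u))) \<longleftrightarrow> F t u + s *\<^sub>R \<nu> \<in> outside (range (F t))" for s
    unfolding range_to_c to_c_scaleR[symmetric] to_c_add[symmetric] by (rule to_c_outside)
  then show "\<forall>\<^sub>F s in at_right 0. to_c (F t u) + s *\<^sub>R to_c \<nu> \<in> outside (range (\<lambda>u. to_c (F t u)))" using n by simp
qed

lemma outward: "t < 0 \<Longrightarrow> outward_curve (\<lambda>u. to_c (F t u)) (\<lambda>u. to_c (du FF (t, u)))"
proof
  assume t: "t < 0"
  fix u
  show "((\<lambda>u. to_c (F t u)) has_vector_derivative to_c (du FF (t, u))) (at u)"
    using has_partial_derivatives(1)[OF smooth(1) t] by (intro to_c_deriv) simp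
  show "continuous_on UNIV (\<lambda>u. to_c (du FF (t, u)))" by (intro to_c_cont cont_section smooth t)
  show "to_c (du FF (t, u)) \<noteq> 0" using curve(3)[OF t, of u] velocity[OF t, of u] norm_to_c[of "du FF (t, u)"] by force
  show "to_c (F t (u + 1)) = to_c (F t u)" by (simp add: curve(1)[OF t])
  have "inj to_c" by (rule inj_on_inverseI[of _ of_c]) simp
  then show "simple_path (\<lambda>u. to_c (F t u))"
    using simple_path_linear_image_eq[OF linear_to_c, of "F t"] curve(2)[OF t] by (simp add: o_def)
  show "convex (inside (range (\<lambda>u. to_c (F t u))))"
    unfolding range_to_c inside_to_c using convex_linear_image[OF linear_to_c curve(4)[OF t]] trace[OF t] by simp
  obtain \<nu> where "outward_unit_normal (F t) u \<nu>" using normal_exists[OF t] by blast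
  from outward_to_c[OF t this]
  show "\<exists>\<nu>. norm \<nu> = 1 \<and> \<nu> \<bullet> to_c (du FF (t, u)) = 0 \<and> (\<forall>\<^sub>F s in at_right 0. to_c (F t u) + s *\<^sub>R \<nu> \<in> outside (range (\<lambda>u. to_c (F t u))))" by blast
qed

text \<open>At each time the sign is that of the integral \<open>S t\<close>, which depends
  continuously on time and never vanishes.\<close>

lemma orientation_sign:
  "\<exists>\<sigma>\<in>{1, - 1::real}. \<forall>t u \<nu>. t < 0 \<longrightarrow> outward_unit_normal (F t) u \<nu> \<longrightarrow> to_c \<nu> = \<sigma> *\<^sub>R (- \<i> * sgn (to_c (du FF (t, u))))"
proof -
  define S where "S t = integral {0..1} (\<lambda>u. to_c (F t u) \<bullet> (- \<i> * to_c (du FF (t, u))))" for t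
  have "continuous_on ({..<0} \<times> cbox 0 1) (\<lambda>(t, u). to_c (FF (t, u)) \<bullet> (- \<i> * to_c (du FF (t, u))))"
    unfolding case_prod_unfold
    unfolding prod.collapse by (intro continuous_on_inner continuous_on_mult continuous_on_const to_c_cont
      continuous_on_subset[OF smooth_onD(2)[OF smooth(1)]] continuous_on_subset[OF smooth_onD(2)[OF smooth(2)]] Sigma_mono) auto
  from integral_continuous_on_param[OF this] have Sc: "continuous_on {..<0} S" by (simp add: S_def[abs_def])
  have cn: "connected (S ` {..<0})" by (rule connected_continuous_image[OF Sc]) (simp add: convex_connected)
  have ex: "\<exists>\<sigma>\<in>{1, - 1::real}. (\<forall>u \<nu>. outward_unit_normal (F t) u \<nu> \<longrightarrow> to_c \<nu> = \<sigma> *\<^sub>R (- \<i> * sgn (to_c (du FF (t, u))))) \<and> 0 < \<sigma> * S t" if t: "t < 0" for t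
  proof -
    interpret outward_curve "\<lambda>u. to_c (F t u)" "\<lambda>u. to_c (du FF (t, u))" by (rule outward[OF t])
    obtain \<sigma> where s: "\<sigma> \<in> {1, - 1::real}" "\<forall>u \<nu>. outw u \<nu> \<longrightarrow> \<nu> = \<sigma> *\<^sub>R (- \<i> * T u)" "0 < \<sigma> * S t"
      using orientation unfolding S_def by blast
    have "outw u (to_c \<nu>)" if "outward_unit_normal (F t) u \<nu>" for u \<nu>
      using outward_to_c[OF t that] by (simp add: outw_def)
    then show ?thesis using s unfolding T_def by blast
  qed
  define \<sigma> where "\<sigma> = sgn (S (- 1))"
  have sg: "sgn (S t) = \<sigma> \<and> S t \<noteq> 0" if t: "t < 0" for t
  proof -
    have nz: "S t' \<noteq> 0" if "t' < 0" for t' using ex[OF that] by auto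
    show ?thesis
    proof (rule ccontr)
      assume "\<not> ?thesis"
      then have "S t \<le> 0 \<and> 0 \<le> S (- 1) \<or> S (- 1) \<le> 0 \<and> 0 \<le> S t" using nz[OF t] by (auto simp: \<sigma>_def sgn_if split: if_splits)
      moreover have "S t \<in> S ` {..<0}" "S (- 1) \<in> S ` {..<0}" using t by auto
      ultimately have "0 \<in> S ` {..<0}"
        using connected_contains_Icc[OF cn, of "S t" "S (- 1)"] connected_contains_Icc[OF cn, of "S (- 1)" "S t"] by (meson atLeastAtMost_iff subsetD)
      then show False using nz by auto
    qed
  qed
  show ?thesis
  proof (intro bexI[of _ \<sigma>] allI impI)
    show "\<sigma> \<in> {1, - 1}" using sg[of "- 1"] by (auto simp: \<sigma>_def sgn_if)
    fix t u \<nu> assume t: "t < (0::real)" and \<nu>: "outward_unit_normal (F t) u \<nu>"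
    obtain s where s: "s \<in> {1, - 1::real}" "to_c \<nu> = s *\<^sub>R (- \<i> * sgn (to_c (du FF (t, u))))" "0 < s * S t" using ex[OF t] \<nu> by blast
    then have "s = \<sigma>" using sg[OF t] by (auto simp: sgn_if zero_less_mult_iff split: if_splits)
    then show "to_c \<nu> = \<sigma> *\<^sub>R (- \<i> * sgn (to_c (du FF (t, u))))" using s by simp
  qed
qed

lemma circles: "\<exists>p. \<forall>t<0. \<exists>r>0. path_image (F t) = sphere p r"
proof -
  obtain \<sigma> where s: "\<sigma> \<in> {1, - 1::real}"
    and sn: "\<And>t u \<nu>. t < 0 \<Longrightarrow> outward_unit_normal (F t) u \<nu> \<Longrightarrow> to_c \<nu> = \<sigma> *\<^sub>R (- \<i> * sgn (to_c (du FF (t, u))))"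
    using orientation_sign by blast
  have ss: "\<sigma> * \<sigma> = 1" "\<bar>\<sigma>\<bar> = 1" "\<sigma> \<noteq> 0" using s by auto
  \<comment> \<open>For \<open>\<sigma> = - 1\<close> the curves run clockwise and are traversed
    backwards. This changes the sign of the derivatives of odd order in \<open>u\<close> only, hence
    the factor \<open>\<sigma>\<close> in \<open>Xu\<close> and \<open>Xtu\<close>.\<close>
  define X where "X t u = to_c (F t (\<sigma> * u))" for t u
  define Xu where "Xu t u = \<sigma> *\<^sub>R to_c (du FF (t, \<sigma> * u))" for t u
  define Xuu where "Xuu t u = to_c (du (du FF) (t, \<sigma> * u))" for t u
  define Xt where "Xt t u = to_c (dt FF (t, \<sigma> * u))" for t u
  define Xtu where "Xtu t u = \<sigma> *\<^sub>R to_c (du (dt FF) (t, \<sigma> * u))" for t u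
  define Xtuu where "Xtuu t u = to_c (du (du (dt FF)) (t, \<sigma> * u))" for t u
  define \<Omega> where "\<Omega> t = inside (range (\<lambda>u. to_c (F t u)))" for t
  have ud: "((\<lambda>u. to_c (f (t, \<sigma> * u))) has_vector_derivative \<sigma> *\<^sub>R to_c (du f (t, \<sigma> * u))) (at u)"
    if "smooth_on past f" "t < 0" for f t u
  proof -
    have "((\<lambda>u. \<sigma> * u) has_vector_derivative \<sigma>) (at u)" by (auto intro!: derivative_eq_intros)
    from vector_diff_chain_at[OF this to_c_deriv[OF has_partial_derivatives(1)[OF that, of "\<sigma> * u"]]]
    show ?thesis by (simp add: o_def)
  qed
  have uds: "((\<lambda>u. \<sigma> *\<^sub>R to_c (f (t, \<sigma> * u))) has_vector_derivative to_c (du f (t, \<sigma> * u))) (at u)"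
    if "smooth_on past f" "t < 0" for f t u
    using bounded_linear.has_vector_derivative[OF bounded_linear_scaleR_right[of \<sigma>] ud[OF that, of u]] by (simp add: ss)
  have td: "((\<lambda>t. to_c (f (t, \<sigma> * u))) has_vector_derivative to_c (dt f (t, \<sigma> * u))) (at t)"
    if "smooth_on past f" "t < 0" for f t u
    by (rule to_c_deriv[OF has_partial_derivatives(2)[OF that]])
  have mixed2: "dt (du (du FF)) (t, u) = du (du (dt FF)) (t, u)" if t: "t < 0" for t u
  proof -
    have "((\<lambda>u. dt (du FF) (t, u)) has_vector_derivative du (du (dt FF)) (t, u)) (at u)"
      unfolding mixed_partials[OF smooth(1) t] by (rule has_partial_derivatives(1)[OF smooth(5) t])
    moreover have "((\<lambda>u. dt (du FF) (t, u)) has_vector_derivative du (dt (du FF)) (t, u)) (at u)"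
      by (rule has_partial_derivatives(1)[OF smooth_partials(2)[OF smooth(2)] t])
    ultimately have "du (dt (du FF)) (t, u) = du (du (dt FF)) (t, u)" using vector_derivative_unique_at by blast
    then show ?thesis using mixed_partials[OF smooth(2) t] by simp
  qed
  have sc: "continuous_on past (\<lambda>p. to_c (f (fst p, \<sigma> * snd p)))" if "smooth_on past f" for f
  proof (rule to_c_cont, rule continuous_on_compose2[OF smooth_onD(2)[OF that]])
    show "continuous_on past (\<lambda>p. (fst p, \<sigma> * snd p))" by (intro continuous_intros)
  qed auto
  have sgnXu: "- \<i> * sgn (Xu t u) = \<sigma> *\<^sub>R (- \<i> * sgn (to_c (du FF (t, \<sigma> * u))))" for t u
    using ss by (simp add: Xu_def sgn_scaleR) (simp add: sgn_if scaleR_conv_of_real split: if_splits, use s in auto)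
  have normal: "- \<i> * sgn (Xu t u) = to_c \<nu>" if "t < 0" "outward_unit_normal (F t) (\<sigma> * u) \<nu>" for t u \<nu>
    unfolding sgnXu by (rule sn[OF that, symmetric])
  have rX: "range (X t) = range (\<lambda>u. to_c (F t u))" for t
  proof -
    have "range ((*) \<sigma>) = UNIV" using ss by (metis surjI mult.assoc mult_1)
    then show ?thesis unfolding X_def[abs_def] using image_image[of "\<lambda>u. to_c (F t u)" "(*) \<sigma>" UNIV] by simp
  qed
  interpret o: oriented_flow \<alpha> X Xu Xuu Xt Xtu Xtuu \<Omega>
  proof
    show "continuous_on past (\<lambda>p. X (fst p) (snd p))" using sc[OF smooth(1)] by (simp add: X_def)
    show "continuous_on past (\<lambda>p. Xu (fst p) (snd p))" unfolding Xu_def by (intro continuous_intros sc smooth)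
    show "continuous_on past (\<lambda>p. Xuu (fst p) (snd p))" unfolding Xuu_def by (intro sc smooth)
    show "continuous_on past (\<lambda>p. Xt (fst p) (snd p))" unfolding Xt_def by (intro sc smooth)
    show "continuous_on past (\<lambda>p. Xtu (fst p) (snd p))" unfolding Xtu_def by (intro continuous_intros sc smooth)
    show "continuous_on past (\<lambda>p. Xtuu (fst p) (snd p))" unfolding Xtuu_def by (intro sc smooth)
    fix t u :: real assume t: "t < 0"
    interpret outward_curve "\<lambda>u. to_c (F t u)" "\<lambda>u. to_c (du FF (t, u))" by (rule outward[OF t])
    show "(X t has_vector_derivative Xu t u) (at u)" using ud[OF smooth(1) t, of u] by (simp add: X_def[abs_def] Xu_def)
    show "(Xu t has_vector_derivative Xuu t u) (at u)" unfolding Xu_def[abs_def] Xuu_def by (rule uds[OF smooth(2) t])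
    show "(Xt t has_vector_derivative Xtu t u) (at u)" unfolding Xt_def[abs_def] Xtu_def by (rule ud[OF smooth(4) t])
    show "(Xtu t has_vector_derivative Xtuu t u) (at u)" unfolding Xtu_def[abs_def] Xtuu_def by (rule uds[OF smooth(5) t])
    show "((\<lambda>s. X s u) has_vector_derivative Xt t u) (at t)" using td[OF smooth(1) t, of u] by (simp add: X_def[abs_def] Xt_def)
    show "((\<lambda>s. Xu s u) has_vector_derivative Xtu t u) (at t)"
      unfolding Xu_def[abs_def] Xtu_def mixed_partials[OF smooth(1) t, symmetric]
      by (rule bounded_linear.has_vector_derivative[OF bounded_linear_scaleR_right td[OF smooth(2) t]])
    show "((\<lambda>s. Xuu s u) has_vector_derivative Xtuu t u) (at t)"
      unfolding Xuu_def[abs_def] Xtuu_def mixed2[OF t, symmetric] by (rule td[OF smooth(3) t])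
    show "Xu t u \<noteq> 0" using ne ss by (simp add: Xu_def)
    show "X t (u + 1) = X t u"
    proof -
      have "X t (u + 1) = to_c (F t (\<sigma> * u + \<sigma>))" by (simp add: X_def distrib_left)
      then show ?thesis using s curve(1)[OF t, of "\<sigma> * u"] curve(1)[OF t, of "\<sigma> * u - 1"] by (auto simp: X_def)
    qed
    obtain \<nu> where \<nu>: "outward_unit_normal (F t) (\<sigma> * u) \<nu>" "dt FF (t, \<sigma> * u) = - (curvature (F t) (\<sigma> * u) \<nu> powr \<alpha>) *\<^sub>R \<nu>"
      using normal_exists[OF t] by blast
    note nrm = normal[OF t \<nu>(1)]
    have "norm (Xu t u) = norm (du FF (t, \<sigma> * u))" using ss by (simp add: Xu_def)
    then show "Xt t u = - ((- (Xuu t u \<bullet> (- \<i> * sgn (Xu t u))) / (norm (Xu t u))\<^sup>2) powr \<alpha>) *\<^sub>R (- \<i> * sgn (Xu t u))"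
      unfolding nrm Xt_def \<nu>(2) curvature_def acceleration[OF t] velocity[OF t] Xuu_def inner_to_c to_c_scaleR by simp
    have ow: "outw (\<sigma> * u) (to_c \<nu>)" using outward_to_c[OF t \<nu>(1)] by (simp add: outw_def)
    show "(z - X t u) \<bullet> (- \<i> * sgn (Xu t u)) < 0" if "z \<in> \<Omega> t" for z
      unfolding nrm X_def using support[OF ow] that by (simp add: \<Omega>_def)
    show "open (\<Omega> t)" "convex (\<Omega> t)" "bounded (\<Omega> t)" "\<Omega> t \<noteq> {}" unfolding \<Omega>_def using region conv by auto
    show "closure (\<Omega> t) = \<Omega> t \<union> range (X t)" unfolding \<Omega>_def rX by (rule region(4))
    show "u' - u \<in> \<int>" if "X t u = X t u'" for u'
    proof -
      have "\<sigma> * u' - \<sigma> * u \<in> \<int>" using inj[of "\<sigma> * u" "\<sigma> * u'"] that by (simp add: X_def)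
      then have "\<sigma> * (u' - u) \<in> \<int>" by (simp add: right_diff_distrib)
      then show ?thesis using s Ints_minus[of "- (u' - u)"] by auto
    qed
  qed (rule alpha)
  interpret cf: convex_flow \<alpha> X o.N o.g o.gu o.w o.v o.\<psi> o.\<psi>u \<Omega> by (rule o.flow_is_convex)
  interpret sf: sweeping_flow \<alpha> X o.N o.g o.gu o.w o.v o.\<psi> o.\<psi>u \<Omega>
  proof
    fix z
    have "\<forall>\<^sub>F t in at_bot. of_c z \<in> inside (path_image (F t))" using sweeps by (simp add: sweeps_plane_def)
    moreover have "\<forall>\<^sub>F t in at_bot. t < (0::real)" by (rule eventually_gt_at_bot)
    ultimately show "\<forall>\<^sub>F t in at_bot. z \<in> \<Omega> t"
    proof eventually_elim
      fix t :: real assume "of_c z \<in> inside (path_image (F t))" "t < 0"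
      then show "z \<in> \<Omega> t" using to_c_inside[of "of_c z" "range (F t)"] by (simp add: \<Omega>_def range_to_c trace)
    qed
  next
    obtain p where p: "\<And>e. e > 0 \<Longrightarrow> \<forall>\<^sub>F t in at_left 0. path_image (F t) \<subseteq> ball p e"
      using sol by (auto simp: convex_compact_ancient_solution_def shrinks_to_point_def)
    have "\<forall>\<^sub>F t in at_left 0. \<forall>u. norm (X t u - to_c p) < e" if "e > 0" for e
    proof -
      have "\<forall>\<^sub>F t in at_left 0. t < (0::real)" by (simp add: eventually_at_filter)
      with p[OF that] show ?thesis
      proof eventually_elim
        fix t :: real assume a: "path_image (F t) \<subseteq> ball p e" "t < 0"
        show "\<forall>u. norm (X t u - to_c p) < e"
        proof
          fix u
          have "F t (\<sigma> * u) \<in> ball p e" using a(1) unfolding trace[OF a(2)] by blast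
          moreover have "X t u - to_c p = to_c (F t (\<sigma> * u) - p)" by (simp add: X_def linear_diff[OF linear_to_c])
          ultimately show "norm (X t u - to_c p) < e" by (simp add: dist_norm norm_minus_commute)
        qed
      qed
    qed
    then show "\<exists>p. \<forall>e>0. \<forall>\<^sub>F t in at_left 0. \<forall>u. norm (X t u - p) < e" by blast
  qed
  obtain q where q: "\<And>t. t < 0 \<Longrightarrow> \<exists>r>0. range (X t) = sphere q r" using sf.curves_are_circles by blast
  have "\<exists>r>0. path_image (F t) = sphere (of_c q) r" if t: "t < 0" for t
  proof -
    obtain r where r: "r > 0" "range (X t) = sphere q r" using q[OF t] by blast
    have "x \<in> path_image (F t) \<longleftrightarrow> x \<in> sphere (of_c q) r" for x
    proof -
      have "x \<in> path_image (F t) \<longleftrightarrow> to_c x \<in> range (X t)" unfolding rX range_to_c trace[OF t] by simp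
      also have "\<dots> \<longleftrightarrow> norm (to_c (of_c q) - to_c x) = r" unfolding r(2) by (simp add: dist_norm)
      also have "\<dots> \<longleftrightarrow> x \<in> sphere (of_c q) r" unfolding linear_diff[OF linear_to_c, symmetric] by (simp add: dist_norm)
      finally show ?thesis .
    qed
    then show ?thesis using r(1) by blast
  qed
  then show ?thesis by blast
qed

end

theorem corollary1:
  fixes \<alpha> :: real and F :: "real \<Rightarrow> real \<Rightarrow> real^2"
  assumes "\<alpha> > 1/2"
    and "convex_compact_ancient_solution \<alpha> F"
    and "sweeps_plane F"
  shows "shrinking_circle \<alpha> F"
proof -
  interpret ancient_solution \<alpha> F using assms by unfold_locales
  show ?thesis using circles assms(2) by (simp add: shrinking_circle_def convex_compact_ancient_solution_def)
qed

end
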